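(* Let $A$ be a commutative associative algebra over $\mathbb{C}$ and $U$ an $A$-module, equipped with a bilinear form on $A$, a bilinear form on $U$, and a bilinear map $\circ:U\times U\to A$ satisfying the compatibility conditions (1)–(3) of the context. Assume that $A$ has an identity, written as $\frac12\omega$, with $\langle\omega,\omega\rangle=\frac12$. Let $\ell$ be a nonzero complex number and assume that the given ($\mathbb{C}$-valued) bilinear forms on $A$ and $U$ are both non-degenerate. Then $L_{\mathcal{L}(A,U)}(\ell,0)$ is a simple conformal vertex superalgebra with $$L_{\mathcal{L}(A,U)}(\ell,0)_{(2)}=A,\qquad L_{\mathcal{L}(A,U)}(\ell,0)_{(\frac32)}=U$$ (under the canonical identification), such that $L_{\mathcal{L}(A,U)}(\ell,0)$ is strongly generated by $A+U$. Furthermore, if both $A$ and $U$ are finite-dimensional, then $L_{\mathcal{L}(A,U)}(\ell,0)$ is a vertex operator superalgebra (with finite-dimensional homogeneous subspaces).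
   Context: Compatibility conditions: (1) the form $\langle\cdot,\cdot\rangle$ on $A$ is symmetric and associative ($\langle ab,c\rangle=\langle a,bc\rangle$); (2) the form $\langle\cdot,\cdot\rangle$ on $U$ and the map $\circ$ are symmetric; (3) for $a\in A$, $u,v,w\in U$: $\langle v,au\rangle=\langle u,av\rangle=\frac43\langle a,u\circ v\rangle$, $a(u\circ v)=v\circ au=u\circ av$, $(u\circ v)w=(v\circ w)u=(w\circ u)v$. Since $A$ is unital, the $A$-module $U$ is understood to be unital. Lie superalgebra: $\mathcal{L}(A,U)=A\otimes\mathbb{C}[t,t^{-1}]\oplus U\otimes\mathbb{C}[t,t^{-1}]\oplus\mathbb{C}K$, even part $A\otimes\mathbb{C}[t,t^{-1}]+\mathbb{C}K$, odd part $U\otimes\mathbb{C}[t,t^{-1}]$, $K$ central, writing $x(n)=x\otimes t^n$, with $[a(m),b(n)]=\frac12(m-n)(ab)(m+n-1)+\binom m3\langle a,b\rangle\delta_{m+n-2,0}K$, $[a(m),u(n)]=\frac14(m-2n)(au)(m+n-1)$, $[u(m),v(n)]_+=(u\circ v)(m+n)+\frac12m(m-1)\langle u,v\rangle\delta_{m+n-1,0}K$ for $a,b\in A$, $u,v\in U$. It is $\frac12\mathbb{Z}$-graded by $\deg K=0$, $\deg a(n)=1-n$, $\deg u(n)=\frac12-n$. For $\ell\in\mathbb{C}$ let $\mathbb{C}_\ell=\mathbb{C}$ be the module for the subalgebra $\mathcal{L}(A,U)^+=(A\oplus U)\otimes\mathbb{C}[t]\oplus\mathbb{C}K$ on which $K$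 acts as $\ell$ and $(A\oplus U)\otimes\mathbb{C}[t]$ acts as $0$, and let $V_{\mathcal{L}(A,U)}(\ell,0)=U(\mathcal{L}(A,U))\otimes_{U(\mathcal{L}(A,U)^+)}\mathbb{C}_\ell$ (here $U(\cdot)$ is the universal enveloping algebra), $\mathbf 1=1\otimes1$, $\frac12\mathbb{Z}$-graded by $\deg\mathbf 1=0$. $A\oplus U$ is identified with a subspace via $x\mapsto x(-1)\mathbf 1$, so that the degree-$2$ subspace is $A$ and the degree-$\frac32$ subspace is $U$. $V_{\mathcal{L}(A,U)}(\ell,0)$ carries the unique vertex superalgebra structure with vacuum $\mathbf 1$ and $Y(x,z)=\sum_{n\in\mathbb{Z}}x(n)z^{-n-1}$ for $x\in A\oplus U$; $\omega\in A$ is its conformal vector. It has a unique maximal graded ideal $J$, and $L_{\mathcal{L}(A,U)}(\ell,0)=V_{\mathcal{L}(A,U)}(\ell,0)/J$. The identifications $L_{\mathcal{L}(A,U)}(\ell,0)_{(2)}=A$, $L_{\mathcal{L}(A,U)}(\ell,0)_{(3/2)}=U$ are via the quotient map. A conformal vertex superalgebra is $(V,Y,\mathbf 1,\omega)$ with $V=\oplus_{q\in\frac12\mathbb{Z}}V_{(q)}$ a complex vector space with parity decomposition $V^{\bar0}=\oplus_{n\in\mathbb{Z}}V_{(n)}$, $V^{\bar1}=\oplus_{n\in\mathbb{Z}}V_{(n+\frac12)}$, a linear map $Y(v,z)=\sum_n v_nz^{-n-1}\in(\mathrm{End}\,V)[[z,z^{-1}]]$, and even vectors $\mathbf 1,\omega$,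 such that: $u_nv\in V^{\alpha+\beta}$ for $u\in V^\alpha,v\in V^\beta$ and $u_nv=0$ for $n$ large; the (super) Jacobi identity holds: for parity-homogeneous $u,v$ and $m,n,k\in\mathbb{Z}$, $\sum_{i\ge0}(-1)^i\binom mi(u_{m+k-i}v_{n+i}-(-1)^{|u||v|}(-1)^mv_{m+n-i}u_{k+i})=\sum_{i\ge0}\binom ki(u_{m+i}v)_{n+k-i}$; $\mathbf 1_mv=\delta_{m,-1}v$, $v_{-1}\mathbf 1=v$, $v_n\mathbf 1=0$ for $n\ge0$; $L(n)=\omega_{n+1}$ satisfy the Virasoro relations $[L(m),L(n)]=(m-n)L(m+n)+\frac{m^3-m}{12}\delta_{m+n,0}c_V$ for some $c_V\in\mathbb{C}$; $Y(L(-1)v,z)=\frac{d}{dz}Y(v,z)$; and $V_{(q)}=\{v: L(0)v=qv\}$. It is a vertex operator superalgebra if moreover $\dim V_{(q)}<\infty$ for all $q$ and $V_{(q)}=0$ for $q$ sufficiently negative. A vertex superalgebra is defined by the same axioms with only a $\mathbb{Z}_2$-grading and without $\omega$ and its axioms. $V$ is strongly generated by a subset $T$ if $V$ is spanned by $\mathbf 1$ and the vectors $a^{(1)}_{-n_1}\cdots a^{(r)}_{-n_r}\mathbf 1$ with $r\ge1$, $a^{(i)}\in T$, $n_i\in\mathbb{Z}_{+}$ (positive integers). *)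

theory Defs
  imports
    Complex_Main
    "HOL-Library.Poly_Mapping"
    "HOL-Library.Product_Plus"
    "HOL-Algebra.Module"
    "HOL-Algebra.QuotRing"
begin

section \<open>Complex vector spaces with carrier sets\<close>

text \<open>
  The input data \<open>A\<close> and \<open>U\<close> live on whole types.  The spaces constructed from them are quotients
  that depend on the data, so they are HOL-Algebra modules over \<open>\<complex>\<close> whose elements are cosets.
\<close>

definition CC :: "(complex, complex) module" where
  "CC = \<lparr>carrier = UNIV, mult = (*), one = 1, zero = 0, add = (+), smult = (*)\<rparr>"

definition vspan :: "(complex, 'v) module \<Rightarrow> 'v set \<Rightarrow> 'v set" where
  "vspan V S = \<Inter>{H. submodule H CC V \<and> S \<subseteq> H}"

definition fin_dim :: "(complex, 'v) module \<Rightarrow> 'v set \<Rightarrow> bool" where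
  "fin_dim V W \<longleftrightarrow> (\<exists>B. finite B \<and> B \<subseteq> carrier V \<and> W = vspan V B)"

definition direct_sum :: "(complex, 'v) module \<Rightarrow> 'i set \<Rightarrow> ('i \<Rightarrow> 'v set) \<Rightarrow> bool" where
  "direct_sum V I W \<longleftrightarrow>
    (\<forall>i\<in>I. submodule (W i) CC V) \<and>
    (\<forall>v\<in>carrier V. \<exists>!f. (\<forall>i\<in>I. f i \<in> W i) \<and> (\<forall>i. i \<notin> I \<longrightarrow> f i = \<zero>\<^bsub>V\<^esub>) \<and>
       finite {i. f i \<noteq> \<zero>\<^bsub>V\<^esub>} \<and> v = finsum V f {i. f i \<noteq> \<zero>\<^bsub>V\<^esub>})"

text \<open>
  Quotient by a subspace \<open>N\<close> (or, for an algebra, by a two-sided ideal): \<^const>\<open>FactRing\<close> together with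
  the induced scalar multiplication.
\<close>

definition quot_mod :: "(complex, 'v) module \<Rightarrow> 'v set \<Rightarrow> (complex, 'v set) module" where
  "quot_mod M N =
    \<lparr>carrier = a_rcosets\<^bsub>M\<^esub> N, mult = rcoset_mult M N, one = N +>\<^bsub>M\<^esub> \<one>\<^bsub>M\<^esub>, zero = N,
     add = set_add M, smult = (\<lambda>c X. \<Union>x\<in>X. N +>\<^bsub>M\<^esub> (c \<odot>\<^bsub>M\<^esub> x))\<rparr>"


section \<open>Universal enveloping algebra of a Lie superalgebra\<close>

text \<open>
  A (sub) Lie superalgebra: addition comes from the type class, \<open>lpart False\<close> and \<open>lpart True\<close>
  are the even and the odd part of the ambient space, and \<open>lbracket\<close> is the super bracket.
\<close>

record 'l lie_superalgebra =
  lcarrier :: "'l set"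
  lscale :: "complex \<Rightarrow> 'l \<Rightarrow> 'l"
  lbracket :: "'l \<Rightarrow> 'l \<Rightarrow> 'l"
  lpart :: "bool \<Rightarrow> 'l set"

text \<open>
  The free monoid, written additively (addition is concatenation), so that the convolution product of
  \<^theory>\<open>HOL-Library.Poly_Mapping\<close> makes \<open>'l word \<Rightarrow>\<^sub>0 complex\<close> the free associative algebra on the
  set \<open>'l\<close>.
\<close>

datatype 'l word = Word (letters: "'l list")

instantiation word :: (type) monoid_add
begin

definition zero_word :: "'a word" where "0 = Word []"

definition plus_word :: "'a word \<Rightarrow> 'a word \<Rightarrow> 'a word" where
  "v + w = Word (letters v @ letters w)"

instance
  by standard (simp_all add: zero_word_def plus_word_def)

end

definition pm_scale :: "complex \<Rightarrow> ('k \<Rightarrow>\<^sub>0 complex) \<Rightarrow> ('k \<Rightarrow>\<^sub>0 complex)" where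
  "pm_scale c f = Poly_Mapping.map ((*) c) f"

definition free_alg :: "'l set \<Rightarrow> (complex, 'l word \<Rightarrow>\<^sub>0 complex) module" where
  "free_alg S =
    \<lparr>carrier = {f. \<forall>w\<in>Poly_Mapping.keys f. set (letters w) \<subseteq> S},
     mult = (*), one = 1, zero = 0, add = (+), smult = pm_scale\<rparr>"

definition gen :: "'l \<Rightarrow> ('l word \<Rightarrow>\<^sub>0 complex)" where
  "gen x = Poly_Mapping.single (Word [x]) 1"

text \<open>The first two families turn the free algebra on the set \<open>lcarrier L\<close> into its tensor algebra.\<close>

definition uea_rels :: "('l::ab_group_add) lie_superalgebra \<Rightarrow> ('l word \<Rightarrow>\<^sub>0 complex) set" where
  "uea_rels L =
    {gen (x + y) - gen x - gen y | x y. x \<in> lcarrier L \<and> y \<in> lcarrier L} \<union>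
    {gen (lscale L c x) - pm_scale c (gen x) | c x. x \<in> lcarrier L} \<union>
    {gen x * gen y - pm_scale (if p \<and> q then -1 else 1) (gen y * gen x) - gen (lbracket L x y)
       | x y p q. x \<in> lcarrier L \<inter> lpart L p \<and> y \<in> lcarrier L \<inter> lpart L q}"

definition uea_ideal :: "('l::ab_group_add) lie_superalgebra \<Rightarrow> ('l word \<Rightarrow>\<^sub>0 complex) set" where
  "uea_ideal L = genideal (free_alg (lcarrier L)) (uea_rels L)"

definition uea :: "('l::ab_group_add) lie_superalgebra \<Rightarrow>
    (complex, ('l word \<Rightarrow>\<^sub>0 complex) set) module" where
  "uea L = quot_mod (free_alg (lcarrier L)) (uea_ideal L)"

definition uea_class :: "('l::ab_group_add) lie_superalgebra \<Rightarrow> ('l word \<Rightarrow>\<^sub>0 complex) \<Rightarrow>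
    ('l word \<Rightarrow>\<^sub>0 complex) set" where
  "uea_class L f = uea_ideal L +>\<^bsub>free_alg (lcarrier L)\<^esub> f"

text \<open>For a subalgebra \<open>S\<close> of \<open>L\<close>, the map \<open>U(S) \<rightarrow> U(L)\<close> induced by the inclusion; its argument is
  a coset \<open>X\<close>.\<close>

definition uea_incl :: "('l::ab_group_add) lie_superalgebra \<Rightarrow> ('l word \<Rightarrow>\<^sub>0 complex) set \<Rightarrow>
    ('l word \<Rightarrow>\<^sub>0 complex) set" where
  "uea_incl L X = (\<Union>f\<in>X. uea_class L f)"

text \<open>
  The action of the enveloping algebra on a one-dimensional module \<open>\<complex>\<close> on which the Lie superalgebra
  acts by \<open>\<rho>\<close>; all representatives of a coset act in the same way.
\<close>

definition free_act :: "('l \<Rightarrow> complex \<Rightarrow> complex) \<Rightarrow> ('l word \<Rightarrow>\<^sub>0 complex) \<Rightarrow> complex \<Rightarrow> complex" where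
  "free_act \<rho> f z = (\<Sum>w\<in>Poly_Mapping.keys f. Poly_Mapping.lookup f w * foldr \<rho> (letters w) z)"

definition uea_act :: "('l \<Rightarrow> complex \<Rightarrow> complex) \<Rightarrow> ('l word \<Rightarrow>\<^sub>0 complex) set \<Rightarrow> complex \<Rightarrow> complex" where
  "uea_act \<rho> X z = the_elem ((\<lambda>f. free_act \<rho> f z) ` X)"


section \<open>Tensor product over a non-commutative algebra\<close>

definition tens :: "'p \<Rightarrow> 'n \<Rightarrow> ('p \<times> 'n \<Rightarrow>\<^sub>0 complex)" where
  "tens p x = Poly_Mapping.single (p, x) 1"

definition tensor_free :: "(complex, 'p) module \<Rightarrow> (complex, 'n) module \<Rightarrow>
    (complex, 'p \<times> 'n \<Rightarrow>\<^sub>0 complex) module" where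
  "tensor_free P N =
    \<lparr>carrier = {f. Poly_Mapping.keys f \<subseteq> carrier P \<times> carrier N},
     mult = undefined, one = undefined, zero = 0, add = (+), smult = pm_scale\<rparr>"

text \<open>
  \<open>P\<close> is a right and \<open>N\<close> a left module over a complex algebra with carrier \<open>S\<close>, the actions being
  \<open>ra\<close> and \<open>la\<close>.
\<close>

definition tensor_rels :: "(complex, 'p) module \<Rightarrow> 's set \<Rightarrow> ('p \<Rightarrow> 's \<Rightarrow> 'p) \<Rightarrow>
    (complex, 'n) module \<Rightarrow> ('s \<Rightarrow> 'n \<Rightarrow> 'n) \<Rightarrow> ('p \<times> 'n \<Rightarrow>\<^sub>0 complex) set" where
  "tensor_rels P S ra N la =
    {tens (p \<oplus>\<^bsub>P\<^esub> p') x - tens p x - tens p' x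
       | p p' x. p \<in> carrier P \<and> p' \<in> carrier P \<and> x \<in> carrier N} \<union>
    {tens p (x \<oplus>\<^bsub>N\<^esub> x') - tens p x - tens p x'
       | p x x'. p \<in> carrier P \<and> x \<in> carrier N \<and> x' \<in> carrier N} \<union>
    {tens (c \<odot>\<^bsub>P\<^esub> p) x - pm_scale c (tens p x) | c p x. p \<in> carrier P \<and> x \<in> carrier N} \<union>
    {tens p (c \<odot>\<^bsub>N\<^esub> x) - pm_scale c (tens p x) | c p x. p \<in> carrier P \<and> x \<in> carrier N} \<union>
    {tens (ra p s) x - tens p (la s x) | p s x. p \<in> carrier P \<and> s \<in> S \<and> x \<in> carrier N}"

definition tensor_null :: "(complex, 'p) module \<Rightarrow> 's set \<Rightarrow> ('p \<Rightarrow> 's \<Rightarrow> 'p) \<Rightarrow>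
    (complex, 'n) module \<Rightarrow> ('s \<Rightarrow> 'n \<Rightarrow> 'n) \<Rightarrow> ('p \<times> 'n \<Rightarrow>\<^sub>0 complex) set" where
  "tensor_null P S ra N la = vspan (tensor_free P N) (tensor_rels P S ra N la)"

definition tensor_product :: "(complex, 'p) module \<Rightarrow> 's set \<Rightarrow> ('p \<Rightarrow> 's \<Rightarrow> 'p) \<Rightarrow>
    (complex, 'n) module \<Rightarrow> ('s \<Rightarrow> 'n \<Rightarrow> 'n) \<Rightarrow> (complex, ('p \<times> 'n \<Rightarrow>\<^sub>0 complex) set) module" where
  "tensor_product P S ra N la = quot_mod (tensor_free P N) (tensor_null P S ra N la)"


section \<open>Vertex superalgebras\<close>

text \<open>
  \<open>Y v n\<close> is the mode \<open>v\<^sub>n\<close>; only its values on the carrier of \<open>V\<close> are relevant.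
  \<open>par False\<close> and \<open>par True\<close> are the even and the odd part.
\<close>

text \<open>A sum over all \<open>i \<ge> 0\<close> with only finitely many nonzero terms.\<close>

definition fsum :: "(complex, 'v) module \<Rightarrow> (nat \<Rightarrow> 'v) \<Rightarrow> 'v" where
  "fsum V f = finsum V f {i. f i \<noteq> \<zero>\<^bsub>V\<^esub>}"

definition super_sign :: "bool \<Rightarrow> bool \<Rightarrow> complex" where
  "super_sign p q = (if p \<and> q then -1 else 1)"

locale vertex_superalgebra =
  fixes V :: "(complex, 'v) module"
    and par :: "bool \<Rightarrow> 'v set"
    and Y :: "'v \<Rightarrow> int \<Rightarrow> 'v \<Rightarrow> 'v"
    and vac :: 'v
  assumes vector_space: "module CC V"
    and parity: "direct_sum V UNIV par"
    and vac_even: "vac \<in> par False"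
    and Y_closed: "\<And>v n w. v \<in> carrier V \<Longrightarrow> w \<in> carrier V \<Longrightarrow> Y v n w \<in> carrier V"
    and Y_add_left: "\<And>u v n w. u \<in> carrier V \<Longrightarrow> v \<in> carrier V \<Longrightarrow> w \<in> carrier V \<Longrightarrow>
        Y (u \<oplus>\<^bsub>V\<^esub> v) n w = Y u n w \<oplus>\<^bsub>V\<^esub> Y v n w"
    and Y_smult_left: "\<And>c v n w. v \<in> carrier V \<Longrightarrow> w \<in> carrier V \<Longrightarrow>
        Y (c \<odot>\<^bsub>V\<^esub> v) n w = c \<odot>\<^bsub>V\<^esub> Y v n w"
    and Y_add_right: "\<And>v n w x. v \<in> carrier V \<Longrightarrow> w \<in> carrier V \<Longrightarrow> x \<in> carrier V \<Longrightarrow>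
        Y v n (w \<oplus>\<^bsub>V\<^esub> x) = Y v n w \<oplus>\<^bsub>V\<^esub> Y v n x"
    and Y_smult_right: "\<And>c v n w. v \<in> carrier V \<Longrightarrow> w \<in> carrier V \<Longrightarrow>
        Y v n (c \<odot>\<^bsub>V\<^esub> w) = c \<odot>\<^bsub>V\<^esub> Y v n w"
    and Y_parity: "\<And>p q u v n. u \<in> par p \<Longrightarrow> v \<in> par q \<Longrightarrow> Y u n v \<in> par (p \<noteq> q)"
    and truncation: "\<And>u v. u \<in> carrier V \<Longrightarrow> v \<in> carrier V \<Longrightarrow> \<exists>N. \<forall>n\<ge>N. Y u n v = \<zero>\<^bsub>V\<^esub>"
    and jacobi: "\<And>p q u v w m n k. u \<in> par p \<Longrightarrow> v \<in> par q \<Longrightarrow> w \<in> carrier V \<Longrightarrow>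
        fsum V (\<lambda>i. ((-1) ^ i * (of_int m gchoose i)) \<odot>\<^bsub>V\<^esub>
            (Y u (m + k - int i) (Y v (n + int i) w) \<ominus>\<^bsub>V\<^esub>
             (super_sign p q * (-1) powi m) \<odot>\<^bsub>V\<^esub> Y v (m + n - int i) (Y u (k + int i) w)))
        = fsum V (\<lambda>i. (of_int k gchoose i) \<odot>\<^bsub>V\<^esub> Y (Y u (m + int i) v) (n + k - int i) w)"
    and vac_left: "\<And>v m. v \<in> carrier V \<Longrightarrow> Y vac m v = (if m = -1 then v else \<zero>\<^bsub>V\<^esub>)"
    and creation: "\<And>v. v \<in> carrier V \<Longrightarrow> Y v (-1) vac = v"
    and annihilation: "\<And>v n. v \<in> carrier V \<Longrightarrow> n \<ge> 0 \<Longrightarrow> Y v n vac = \<zero>\<^bsub>V\<^esub>"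

definition va_ideal :: "(complex, 'v) module \<Rightarrow> ('v \<Rightarrow> int \<Rightarrow> 'v \<Rightarrow> 'v) \<Rightarrow> 'v set \<Rightarrow> bool" where
  "va_ideal V Y I \<longleftrightarrow> submodule I CC V \<and>
    (\<forall>v\<in>carrier V. \<forall>w\<in>I. \<forall>n. Y v n w \<in> I \<and> Y w n v \<in> I)"

definition va_simple :: "(complex, 'v) module \<Rightarrow> ('v \<Rightarrow> int \<Rightarrow> 'v \<Rightarrow> 'v) \<Rightarrow> bool" where
  "va_simple V Y \<longleftrightarrow> carrier V \<noteq> {\<zero>\<^bsub>V\<^esub>} \<and>
    (\<forall>I. va_ideal V Y I \<longrightarrow> I = {\<zero>\<^bsub>V\<^esub>} \<or> I = carrier V)"

text \<open>Gradings are functions on \<^typ>\<open>rat\<close>, of which only the values on \<open>\<half>\<int>\<close> are relevant.\<close>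

definition half_ints :: "rat set" where
  "half_ints = {q. 2 * q \<in> \<int>}"

definition gr_parity :: "(complex, 'v) module \<Rightarrow> (rat \<Rightarrow> 'v set) \<Rightarrow> bool \<Rightarrow> 'v set" where
  "gr_parity V gr p = vspan V (\<Union>n::int. gr (of_int n + (if p then 1/2 else 0)))"

definition graded_ideal :: "(complex, 'v) module \<Rightarrow> (rat \<Rightarrow> 'v set) \<Rightarrow> ('v \<Rightarrow> int \<Rightarrow> 'v \<Rightarrow> 'v) \<Rightarrow>
    'v set \<Rightarrow> bool" where
  "graded_ideal V gr Y I \<longleftrightarrow> va_ideal V Y I \<and> I = vspan V (\<Union>q\<in>half_ints. I \<inter> gr q)"

definition maximal_graded_ideal :: "(complex, 'v) module \<Rightarrow> (rat \<Rightarrow> 'v set) \<Rightarrow>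
    ('v \<Rightarrow> int \<Rightarrow> 'v \<Rightarrow> 'v) \<Rightarrow> 'v set \<Rightarrow> bool" where
  "maximal_graded_ideal V gr Y I \<longleftrightarrow> graded_ideal V gr Y I \<and> I \<noteq> carrier V \<and>
    (\<forall>I'. graded_ideal V gr Y I' \<and> I' \<noteq> carrier V \<and> I \<subseteq> I' \<longrightarrow> I' = I)"

text \<open>The parity decomposition of a conformal vertex superalgebra is the one given by its grading.\<close>

locale conformal_vertex_superalgebra = vertex_superalgebra V "gr_parity V gr" Y vac
  for V :: "(complex, 'v) module"
    and gr :: "rat \<Rightarrow> 'v set"
    and Y :: "'v \<Rightarrow> int \<Rightarrow> 'v \<Rightarrow> 'v"
    and vac :: 'v
    and \<omega> :: 'v +
  assumes grading: "direct_sum V half_ints gr"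
    and omega_even: "\<omega> \<in> gr_parity V gr False"
    and virasoro: "\<exists>c. \<forall>m n. \<forall>v\<in>carrier V.
        Y \<omega> (m + 1) (Y \<omega> (n + 1) v) \<ominus>\<^bsub>V\<^esub> Y \<omega> (n + 1) (Y \<omega> (m + 1) v) =
        of_int (m - n) \<odot>\<^bsub>V\<^esub> Y \<omega> (m + n + 1) v \<oplus>\<^bsub>V\<^esub>
        (if m + n = 0 then of_int (m ^ 3 - m) / 12 * c else 0) \<odot>\<^bsub>V\<^esub> v"
    and translation: "\<And>v n w. v \<in> carrier V \<Longrightarrow> w \<in> carrier V \<Longrightarrow>
        Y (Y \<omega> 0 v) n w = (- of_int n) \<odot>\<^bsub>V\<^esub> Y v (n - 1) w"
    and gr_eigenspace: "\<And>q. q \<in> half_ints \<Longrightarrow>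
        gr q = {v \<in> carrier V. Y \<omega> 1 v = of_rat q \<odot>\<^bsub>V\<^esub> v}"

locale vertex_operator_superalgebra = conformal_vertex_superalgebra +
  assumes gr_fin_dim: "\<And>q. q \<in> half_ints \<Longrightarrow> fin_dim V (gr q)"
    and gr_bounded_below: "\<exists>N. \<forall>q\<in>half_ints. q < N \<longrightarrow> gr q = {\<zero>\<^bsub>V\<^esub>}"

text \<open>The empty list contributes the vacuum.\<close>

definition strongly_generated :: "(complex, 'v) module \<Rightarrow> ('v \<Rightarrow> int \<Rightarrow> 'v \<Rightarrow> 'v) \<Rightarrow> 'v \<Rightarrow>
    'v set \<Rightarrow> bool" where
  "strongly_generated V Y vac T \<longleftrightarrow>
    carrier V = vspan V {foldr (\<lambda>(a, n) v. Y a (- n) v) xs vac | xs :: ('v \<times> int) list.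
                           \<forall>(a, n)\<in>set xs. a \<in> T \<and> n > 0}"


section \<open>The pair \<open>(A, U)\<close>\<close>

record ('a, 'u) pair_data =
  scA :: "complex \<Rightarrow> 'a \<Rightarrow> 'a"
  scU :: "complex \<Rightarrow> 'u \<Rightarrow> 'u"
  act :: "'a \<Rightarrow> 'u \<Rightarrow> 'u"
  formA :: "'a \<Rightarrow> 'a \<Rightarrow> complex"
  formU :: "'u \<Rightarrow> 'u \<Rightarrow> complex"
  circ :: "'u \<Rightarrow> 'u \<Rightarrow> 'a"

definition cbilinear :: "(complex \<Rightarrow> 'x \<Rightarrow> 'x) \<Rightarrow> (complex \<Rightarrow> 'y \<Rightarrow> 'y) \<Rightarrow> (complex \<Rightarrow> 'z \<Rightarrow> 'z) \<Rightarrow>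
    ('x::ab_group_add \<Rightarrow> 'y::ab_group_add \<Rightarrow> 'z::ab_group_add) \<Rightarrow> bool" where
  "cbilinear s1 s2 s3 f \<longleftrightarrow>
    (\<forall>x. Vector_Spaces.linear s2 s3 (f x)) \<and> (\<forall>y. Vector_Spaces.linear s1 s3 (\<lambda>x. f x y))"

definition nondegenerate :: "('x::zero \<Rightarrow> 'x \<Rightarrow> complex) \<Rightarrow> bool" where
  "nondegenerate f \<longleftrightarrow> (\<forall>x. (\<forall>y. f x y = 0) \<longrightarrow> x = 0)"

definition fin_dim_type :: "(complex \<Rightarrow> 'x \<Rightarrow> 'x::ab_group_add) \<Rightarrow> bool" where
  "fin_dim_type s \<longleftrightarrow> (\<exists>B. finite B \<and> Modules.module.span s B = UNIV)"

text \<open>The (commutative, associative) product of \<open>A\<close> is that of the type class; \<open>\<omega>\<close> is twice the identity.\<close>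

locale compatible_pair =
  fixes D :: "('a::comm_ring, 'u::ab_group_add) pair_data" and \<omega> :: 'a
  assumes vsA: "Vector_Spaces.vector_space (scA D)"
    and vsU: "Vector_Spaces.vector_space (scU D)"
    and mult_bilinear: "cbilinear (scA D) (scA D) (scA D) (*)"
    and act_bilinear: "cbilinear (scA D) (scU D) (scU D) (act D)"
    and formA_bilinear: "cbilinear (scA D) (scA D) (*) (formA D)"
    and formU_bilinear: "cbilinear (scU D) (scU D) (*) (formU D)"
    and circ_bilinear: "cbilinear (scU D) (scU D) (scA D) (circ D)"
    and act_assoc: "act D (a * b) u = act D a (act D b u)"
    and identity: "scA D (1/2) \<omega> * a = a"
    and act_identity: "act D (scA D (1/2) \<omega>) u = u"
    and formA_sym: "formA D a b = formA D b a"
    and formA_assoc: "formA D (a * b) c = formA D a (b * c)"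
    and formU_sym: "formU D u v = formU D v u"
    and circ_sym: "circ D u v = circ D v u"
    and formU_act: "formU D v (act D a u) = formU D u (act D a v)"
    and formU_circ: "formU D u (act D a v) = 4/3 * formA D a (circ D u v)"
    and mult_circ1: "a * circ D u v = circ D v (act D a u)"
    and mult_circ2: "circ D v (act D a u) = circ D u (act D a v)"
    and circ_act1: "act D (circ D u v) w = act D (circ D v w) u"
    and circ_act2: "act D (circ D v w) u = act D (circ D w u) v"


section \<open>The Lie superalgebra \<open>\<L>(A, U)\<close>\<close>

text \<open>
  \<open>(f, g, c)\<close> stands for the sum of all \<open>a(n)\<close> with \<open>a = f n\<close>, of all \<open>u(n)\<close> with \<open>u = g n\<close>,
  and of \<open>c K\<close>.
\<close>

type_synonym ('a, 'u) loop = "(int \<Rightarrow>\<^sub>0 'a) \<times> (int \<Rightarrow>\<^sub>0 'u) \<times> complex"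

text \<open>The element \<open>a(n) + u(n)\<close>.\<close>

definition mode :: "'a::zero \<times> 'u::zero \<Rightarrow> int \<Rightarrow> ('a, 'u) loop" where
  "mode x n = (Poly_Mapping.single n (fst x), Poly_Mapping.single n (snd x), 0)"

definition loop_scale :: "('a::comm_ring, 'u::ab_group_add) pair_data \<Rightarrow> complex \<Rightarrow>
    ('a, 'u) loop \<Rightarrow> ('a, 'u) loop" where
  "loop_scale D c = (\<lambda>(f, g, k). (Poly_Mapping.map (scA D c) f, Poly_Mapping.map (scU D c) g, c * k))"

text \<open>\<open>[a(m), u(n)]\<close>; the opposite bracket \<open>[u(n), a(m)]\<close> is its negative.\<close>

definition bracket_AU :: "('a::comm_ring, 'u::ab_group_add) pair_data \<Rightarrow>
    (int \<Rightarrow>\<^sub>0 'a) \<Rightarrow> (int \<Rightarrow>\<^sub>0 'u) \<Rightarrow> (int \<Rightarrow>\<^sub>0 'u)" where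
  "bracket_AU D f g = (\<Sum>m\<in>Poly_Mapping.keys f. \<Sum>n\<in>Poly_Mapping.keys g.
     Poly_Mapping.single (m + n - 1)
       (scU D (of_int (m - 2 * n) / 4) (act D (Poly_Mapping.lookup f m) (Poly_Mapping.lookup g n))))"

definition loop_bracket :: "('a::comm_ring, 'u::ab_group_add) pair_data \<Rightarrow>
    ('a, 'u) loop \<Rightarrow> ('a, 'u) loop \<Rightarrow> ('a, 'u) loop" where
  "loop_bracket D = (\<lambda>(f, g, k) (f', g', k').
    ((\<Sum>m\<in>Poly_Mapping.keys f. \<Sum>n\<in>Poly_Mapping.keys f'.
        Poly_Mapping.single (m + n - 1)
          (scA D (of_int (m - n) / 2) (Poly_Mapping.lookup f m * Poly_Mapping.lookup f' n))) +
     (\<Sum>m\<in>Poly_Mapping.keys g. \<Sum>n\<in>Poly_Mapping.keys g'.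
        Poly_Mapping.single (m + n)
          (circ D (Poly_Mapping.lookup g m) (Poly_Mapping.lookup g' n))),
     bracket_AU D f g' - bracket_AU D f' g,
     (\<Sum>m\<in>Poly_Mapping.keys f. \<Sum>n\<in>Poly_Mapping.keys f'.
        if m + n - 2 = 0
        then (of_int m gchoose 3) * formA D (Poly_Mapping.lookup f m) (Poly_Mapping.lookup f' n)
        else 0) +
     (\<Sum>m\<in>Poly_Mapping.keys g. \<Sum>n\<in>Poly_Mapping.keys g'.
        if m + n - 1 = 0
        then of_int (m * (m - 1)) / 2 * formU D (Poly_Mapping.lookup g m) (Poly_Mapping.lookup g' n)
        else 0)))"

definition LAU :: "('a::comm_ring, 'u::ab_group_add) pair_data \<Rightarrow> ('a, 'u) loop lie_superalgebra" where
  "LAU D = \<lparr>lcarrier = UNIV, lscale = loop_scale D, lbracket = loop_bracket D,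
     lpart = (\<lambda>p. if p then {(f, g, k). f = 0 \<and> k = 0} else {(f, g, k). g = 0})\<rparr>"

definition LAU_plus :: "('a::comm_ring, 'u::ab_group_add) pair_data \<Rightarrow> ('a, 'u) loop lie_superalgebra" where
  "LAU_plus D = (LAU D)\<lparr>lcarrier :=
     {(f, g, k). Poly_Mapping.keys f \<subseteq> {0..} \<and> Poly_Mapping.keys g \<subseteq> {0..}}\<rparr>"

text \<open>The subspace of degree \<open>q\<close>.\<close>

definition LAU_gr :: "rat \<Rightarrow> ('a::comm_ring, 'u::ab_group_add) loop set" where
  "LAU_gr q = {(f, g, k). (\<forall>n\<in>Poly_Mapping.keys f. 1 - of_int n = q) \<and>
     (\<forall>n\<in>Poly_Mapping.keys g. 1/2 - of_int n = q) \<and> (k \<noteq> 0 \<longrightarrow> q = 0)}"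


section \<open>The vertex superalgebras \<open>V(\<ell>, 0)\<close> and \<open>L(\<ell>, 0)\<close>\<close>

type_synonym ('a, 'u) U_elem = "(('a, 'u) loop word \<Rightarrow>\<^sub>0 complex) set"
type_synonym ('a, 'u) V_elem = "(('a, 'u) U_elem \<times> complex \<Rightarrow>\<^sub>0 complex) set"

text \<open>The module \<open>\<complex>\<^sub>\<ell>\<close> of \<open>\<L>(A, U)\<^sup>+\<close>.\<close>

definition C_ell :: "complex \<Rightarrow> ('a, 'u) loop \<Rightarrow> complex \<Rightarrow> complex" where
  "C_ell l = (\<lambda>(f, g, k) z. l * k * z)"

definition V_free :: "('a::comm_ring, 'u::ab_group_add) pair_data \<Rightarrow>
    (complex, ('a, 'u) U_elem \<times> complex \<Rightarrow>\<^sub>0 complex) module" where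
  "V_free D = tensor_free (uea (LAU D)) CC"

definition V_null :: "('a::comm_ring, 'u::ab_group_add) pair_data \<Rightarrow> complex \<Rightarrow>
    (('a, 'u) U_elem \<times> complex \<Rightarrow>\<^sub>0 complex) set" where
  "V_null D l = tensor_null (uea (LAU D)) (carrier (uea (LAU_plus D)))
     (\<lambda>p s. p \<otimes>\<^bsub>uea (LAU D)\<^esub> uea_incl (LAU D) s) CC (uea_act (C_ell l))"

definition V_mod :: "('a::comm_ring, 'u::ab_group_add) pair_data \<Rightarrow> complex \<Rightarrow>
    (complex, ('a, 'u) V_elem) module" where
  "V_mod D l = tensor_product (uea (LAU D)) (carrier (uea (LAU_plus D)))
     (\<lambda>p s. p \<otimes>\<^bsub>uea (LAU D)\<^esub> uea_incl (LAU D) s) CC (uea_act (C_ell l))"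

definition V_vac :: "('a::comm_ring, 'u::ab_group_add) pair_data \<Rightarrow> complex \<Rightarrow> ('a, 'u) V_elem" where
  "V_vac D l = V_null D l +>\<^bsub>V_free D\<^esub> tens \<one>\<^bsub>uea (LAU D)\<^esub> 1"

text \<open>The action \<open>x (p \<otimes> z) = x p \<otimes> z\<close> of \<open>x \<in> \<L>(A, U)\<close> on \<open>V(\<ell>, 0)\<close>.\<close>

definition V_act :: "('a::comm_ring, 'u::ab_group_add) pair_data \<Rightarrow> complex \<Rightarrow>
    ('a, 'u) loop \<Rightarrow> ('a, 'u) V_elem \<Rightarrow> ('a, 'u) V_elem" where
  "V_act D l x X = (\<Union>f\<in>X. V_null D l +>\<^bsub>V_free D\<^esub>
     (\<Sum>(p, z)\<in>Poly_Mapping.keys f. pm_scale (Poly_Mapping.lookup f (p, z))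
        (tens (uea_class (LAU D) (gen x) \<otimes>\<^bsub>uea (LAU D)\<^esub> p) z)))"

definition V_gr :: "('a::comm_ring, 'u::ab_group_add) pair_data \<Rightarrow> complex \<Rightarrow> rat \<Rightarrow>
    ('a, 'u) V_elem set" where
  "V_gr D l q = vspan (V_mod D l)
     {foldr (V_act D l) xs (V_vac D l) | xs. \<exists>ds. list_all2 (\<lambda>x d. x \<in> LAU_gr d) xs ds \<and> sum_list ds = q}"

definition V_emb :: "('a::comm_ring, 'u::ab_group_add) pair_data \<Rightarrow> complex \<Rightarrow> 'a \<times> 'u \<Rightarrow>
    ('a, 'u) V_elem" where
  "V_emb D l x = V_act D l (mode x (-1)) (V_vac D l)"

text \<open>The values of \<open>Y\<close> outside of the carrier are fixed in order to make the description unique.\<close>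

definition V_Y :: "('a::comm_ring, 'u::ab_group_add) pair_data \<Rightarrow> complex \<Rightarrow>
    ('a, 'u) V_elem \<Rightarrow> int \<Rightarrow> ('a, 'u) V_elem \<Rightarrow> ('a, 'u) V_elem" where
  "V_Y D l = (THE Y.
     vertex_superalgebra (V_mod D l) (gr_parity (V_mod D l) (V_gr D l)) Y (V_vac D l) \<and>
     (\<forall>x n. \<forall>w\<in>carrier (V_mod D l). Y (V_emb D l x) n w = V_act D l (mode x n) w) \<and>
     (\<forall>v n w. v \<notin> carrier (V_mod D l) \<or> w \<notin> carrier (V_mod D l) \<longrightarrow> Y v n w = undefined))"

definition V_max_ideal :: "('a::comm_ring, 'u::ab_group_add) pair_data \<Rightarrow> complex \<Rightarrow>
    ('a, 'u) V_elem set" where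
  "V_max_ideal D l = (THE J. maximal_graded_ideal (V_mod D l) (V_gr D l) (V_Y D l) J)"

definition L_mod :: "('a::comm_ring, 'u::ab_group_add) pair_data \<Rightarrow> complex \<Rightarrow>
    (complex, ('a, 'u) V_elem set) module" where
  "L_mod D l = quot_mod (V_mod D l) (V_max_ideal D l)"

definition L_proj :: "('a::comm_ring, 'u::ab_group_add) pair_data \<Rightarrow> complex \<Rightarrow>
    ('a, 'u) V_elem \<Rightarrow> ('a, 'u) V_elem set" where
  "L_proj D l v = V_max_ideal D l +>\<^bsub>V_mod D l\<^esub> v"

definition L_Y :: "('a::comm_ring, 'u::ab_group_add) pair_data \<Rightarrow> complex \<Rightarrow>
    ('a, 'u) V_elem set \<Rightarrow> int \<Rightarrow> ('a, 'u) V_elem set \<Rightarrow> ('a, 'u) V_elem set" where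
  "L_Y D l X n Z = (\<Union>v\<in>X. \<Union>w\<in>Z. L_proj D l (V_Y D l v n w))"

definition L_vac :: "('a::comm_ring, 'u::ab_group_add) pair_data \<Rightarrow> complex \<Rightarrow>
    ('a, 'u) V_elem set" where
  "L_vac D l = L_proj D l (V_vac D l)"

definition L_gr :: "('a::comm_ring, 'u::ab_group_add) pair_data \<Rightarrow> complex \<Rightarrow> rat \<Rightarrow>
    ('a, 'u) V_elem set set" where
  "L_gr D l q = L_proj D l ` V_gr D l q"

text \<open>The canonical map \<open>A \<oplus> U \<rightarrow> L(\<ell>, 0)\<close>.\<close>

definition L_emb :: "('a::comm_ring, 'u::ab_group_add) pair_data \<Rightarrow> complex \<Rightarrow> 'a \<times> 'u \<Rightarrow>
    ('a, 'u) V_elem set" where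
  "L_emb D l x = L_proj D l (V_emb D l x)"

definition linear_iso_onto :: "(complex \<Rightarrow> 'x \<Rightarrow> 'x::ab_group_add) \<Rightarrow> (complex, 'v) module \<Rightarrow> 'v set \<Rightarrow>
    ('x \<Rightarrow> 'v) \<Rightarrow> bool" where
  "linear_iso_onto s V W \<phi> \<longleftrightarrow> bij_betw \<phi> UNIV W \<and>
    (\<forall>x y. \<phi> (x + y) = \<phi> x \<oplus>\<^bsub>V\<^esub> \<phi> y) \<and> (\<forall>c x. \<phi> (s c x) = c \<odot>\<^bsub>V\<^esub> \<phi> x)"

end

theory Submission
  imports Defs
begin

text \<open>The induced module \<open>V = V(\<ell>, 0)\<close> is spanned by words in the modes \<open>a(n)\<close>, \<open>u(n)\<close> applied to the
vacuum, and everything is derived from the commutators of these modes.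

\<^bold>\<open>Vertex operators.\<close>  The commutators of the modes of two generating fields are polynomials of degree at
most three in the first index, once the sum of the indices is fixed, so the fields are mutually local
(\<open>cubic_local\<close>, \<open>f_local\<close>).  Dong's lemma (\<open>mut_local_nprod\<close>) shows that locality is inherited by all products
of fields; hence every state is created from the vacuum by a field that is local with all the others
(\<open>good'_exists_pair\<close>), and by Goddard's theorem (\<open>goddard_uniqueness\<close>) there is only one such field.  This gives
the state-field correspondence \<open>Y\<close> and the equation \<open>Y(u\<^sub>m v) = Y(u)\<^sub>m Y(v)\<close>, which turns the Borcherds
identity for two local fields (\<open>borcherds_identity\<close>) into the Jacobi identity (\<open>Y_jacobi\<close>).

\<^bold>\<open>Nonvanishing.\<close>  That the vacuum is nonzero and that the forms on \<open>A\<close> and \<open>U\<close> can be recovered from \<open>V\<close>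
would usually be read off from a Poincare-Birkhoff-Witt basis.  It suffices to have the linear functional that
takes the coefficient of the vacuum, and this functional can be written down: on words in the letters of the
Lie superalgebra, a letter of negative index in front gives zero, and a letter of nonnegative index acts on
the remaining word as a derivation, plus its scalar on \<open>\<complex>\<^sub>\<ell>\<close>.  The Jacobi identity shows that this
functional \<open>sigma\<close> respects the relations of the enveloping algebra (\<open>sigma_commutator\<close>) and of the tensor
product (\<open>sigma_right\<close>), so it descends to \<open>V\<close> (\<open>Psi_null\<close>).

\<^bold>\<open>The simple quotient.\<close>  The degree zero part of \<open>V\<close> is spanned by the vacuum.  A submodule that does not
contain the vacuum is therefore annihilated by the functional, together with all its translates under the
enveloping algebra; so the radical \<open>J0\<close> of the functional is the largest proper submodule
(\<open>proper_mode_submodule\<close>).  Submodules for the modes and ideals of the vertex superalgebra are the same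
(\<open>mode_submodule_Y_left\<close>, \<open>mode_submodule_Y_right\<close>, \<open>ideal_preimage\<close>), so \<open>J0\<close> is the maximal ideal and its
quotient is simple.

\<^bold>\<open>Low degrees.\<close>  Reordering of modes shows that the eigenspaces of \<open>L(0)\<close> are spanned by monomials in modes of
negative index (\<open>NW_gr0\<close>).  This is strong generation; it also shows that degree two consists of the vectors
\<open>a(-1)1\<close> and degree three halves of the vectors \<open>u(-1)1\<close>, and that the homogeneous subspaces are
finite-dimensional if \<open>A\<close> and \<open>U\<close> are.  As \<open>b(3)a(-1)1 = \<ell>\<langle>b, a\<rangle>1\<close> and \<open>v(2)u(-1)1 = \<ell>\<langle>v, u\<rangle>1\<close>, no
nonzero vector of \<open>A\<close> or \<open>U\<close> lies in the radical when \<open>\<ell> \<noteq> 0\<close> and the forms are non-degenerate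
(\<open>J0_A\<close>, \<open>J0_U\<close>).

\<^bold>\<open>Where the computations take place.\<close>  The elements of \<open>V\<close> and of its quotient are cosets.  To keep them out of
the arguments, states are represented by elements of the free associative algebra on the Lie superalgebra,
and \<open>V\<close> is its quotient by a subspace \<open>N0\<close>.  A linear projection \<open>PP\<close> with kernel \<open>N0\<close> plays the role of the
identity operator; all fields are normalised to commute with it, so that equations in \<open>V\<close> become equations in
the free algebra.  The locale \<open>vsa_quotient\<close> transports the results to a quotient, and is used once
for \<open>V\<close> and once for the simple quotient.\<close>

section \<open>Calculus of fields in terms of their modes\<close>

text \<open>Truncation makes statements about modes true for large indices; this rule carries them down.\<close>

lemma int_downward_induct [case_names bound step]:
  assumes "\<And>c. c \<ge> B \<Longrightarrow> Q c" and "\<And>c. (\<And>c'. c' > c \<Longrightarrow> Q c') \<Longrightarrow> Q c"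
  shows "Q (c::int)"
proof (induction "nat (B - c)" arbitrary: c rule: less_induct)
  case less
  show ?case
  proof (cases "c \<ge> B")
    case True then show ?thesis using assms(1) by blast
  next
    case False
    show ?thesis
    proof (rule assms(2))
      fix c' assume "c' > c"
      then show "Q c'" using less[of c'] assms(1)[of c'] False by fastforce
    qed
  qed
qed

lemma Sum_any_eq_sum:
  fixes f :: "nat \<Rightarrow> 'b::comm_monoid_add"
  assumes "\<And>i. i \<ge> N \<Longrightarrow> f i = 0"
  shows "Sum_any f = sum f {..<N}"
  by (rule Sum_any.expand_superset) (use assms in \<open>auto simp: not_le[symmetric]\<close>)

lemma gbinomial_pascal: "((of_int (m + 1) :: complex) gchoose Suc i) = (of_int m gchoose Suc i) + (of_int m gchoose i)"
  using gbinomial_Suc_Suc[of "of_int m :: complex" i] by (simp add: add.commute)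

lemma gbinomial_absorb: "(of_int m - of_nat i) * ((of_int m :: complex) gchoose i) = of_nat (Suc i) * (of_int m gchoose Suc i)"
  using gbinomial_mult_1[of "of_int m :: complex" i] by (simp add: algebra_simps)

text \<open>The coefficients of a formal distribution in three variables form a function of three integers.  On these
coefficients the three operators are multiplication by \<open>z\<^sub>1 - z\<^sub>2\<close>, \<open>z\<^sub>1 - z\<^sub>3\<close> and \<open>z\<^sub>2 - z\<^sub>3\<close>.\<close>

definition diff12 :: "(int \<Rightarrow> int \<Rightarrow> int \<Rightarrow> 'v::ab_group_add) \<Rightarrow> int \<Rightarrow> int \<Rightarrow> int \<Rightarrow> 'v" where
  "diff12 F = (\<lambda>k q r. F (k + 1) q r - F k (q + 1) r)"

definition diff13 :: "(int \<Rightarrow> int \<Rightarrow> int \<Rightarrow> 'v::ab_group_add) \<Rightarrow> int \<Rightarrow> int \<Rightarrow> int \<Rightarrow> 'v" where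
  "diff13 F = (\<lambda>k q r. F (k + 1) q r - F k q (r + 1))"

definition diff23 :: "(int \<Rightarrow> int \<Rightarrow> int \<Rightarrow> 'v::ab_group_add) \<Rightarrow> int \<Rightarrow> int \<Rightarrow> int \<Rightarrow> 'v" where
  "diff23 F = (\<lambda>k q r. F k (q + 1) r - F k q (r + 1))"

definition null3 :: "int \<Rightarrow> int \<Rightarrow> int \<Rightarrow> 'v::ab_group_add" where
  "null3 = (\<lambda>k q r. 0)"

lemma diff_null3 [simp]: "diff12 null3 = null3" "diff13 null3 = null3" "diff23 null3 = null3"
  by (simp_all add: diff12_def diff13_def diff23_def null3_def)

lemma diffpow_null3 [simp]: "(diff13 ^^ n) null3 = null3" "(diff23 ^^ n) null3 = null3"
  by (induction n) auto

text \<open>In terms of the variables, \<open>z\<^sub>2 - z\<^sub>3 = (z\<^sub>1 - z\<^sub>3) - (z\<^sub>1 - z\<^sub>2)\<close>: this relation drives the descent below.\<close>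

lemma diff23_eq: "diff23 F = (\<lambda>k q r. diff13 F k q r - diff12 F k q r)"
  by (simp add: diff12_def diff13_def diff23_def fun_eq_iff)

lemma diff13_23_commute: "diff13 (diff23 F) = diff23 (diff13 F)"
  by (simp add: diff13_def diff23_def fun_eq_iff algebra_simps)

lemma diff12_23_commute: "diff12 (diff23 F) = diff23 (diff12 F)"
  by (simp add: diff12_def diff23_def fun_eq_iff algebra_simps)

lemma diff13_23pow_commute: "diff13 ((diff23 ^^ n) F) = (diff23 ^^ n) (diff13 F)"
  by (induction n arbitrary: F) (auto simp: diff13_23_commute funpow_swap1)

lemma diff12_23pow_commute: "diff12 ((diff23 ^^ n) F) = (diff23 ^^ n) (diff12 F)"
  by (induction n arbitrary: F) (auto simp: diff12_23_commute funpow_swap1)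

lemma diff13pow_23pow_commute: "(diff13 ^^ m) ((diff23 ^^ n) F) = (diff23 ^^ n) ((diff13 ^^ m) F)"
  by (induction m arbitrary: F) (auto simp: diff13_23pow_commute)

lemma diff_add:
  "diff13 (\<lambda>k q r. F k q r + G k q r) = (\<lambda>k q r. diff13 F k q r + diff13 G k q r)"
  "diff23 (\<lambda>k q r. F k q r + G k q r) = (\<lambda>k q r. diff23 F k q r + diff23 G k q r)"
  by (simp_all add: diff13_def diff23_def fun_eq_iff algebra_simps)

lemma diffpow_add:
  "(diff13 ^^ n) (\<lambda>k q r. F k q r + G k q r) = (\<lambda>k q r. (diff13 ^^ n) F k q r + (diff13 ^^ n) G k q r)"
  "(diff23 ^^ n) (\<lambda>k q r. F k q r + G k q r) = (\<lambda>k q r. (diff23 ^^ n) F k q r + (diff23 ^^ n) G k q r)"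
  by (induction n) (simp_all add: diff_add)

lemma diff_eventually:
  assumes "\<And>k q r. eventually (\<lambda>I. F I k q r = R k q r) sequentially"
  shows "eventually (\<lambda>I. diff13 (F I) k q r = diff13 R k q r) sequentially"
    and "eventually (\<lambda>I. diff23 (F I) k q r = diff23 R k q r) sequentially"
   unfolding diff13_def diff23_def
   using eventually_conj[OF assms[of "k+1" q r] assms[of k q "r+1"]]
     eventually_conj[OF assms[of k "q+1" r] assms[of k q "r+1"]]
   by (auto elim: eventually_mono)

lemma diffpow_eventually:
  assumes "\<And>k q r. eventually (\<lambda>I. F I k q r = R k q r) sequentially"
  shows "eventually (\<lambda>I. (diff13 ^^ n) (F I) k q r = (diff13 ^^ n) R k q r) sequentially"
    and "eventually (\<lambda>I. (diff23 ^^ n) (F I) k q r = (diff23 ^^ n) R k q r) sequentially"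
proof -
  have "\<forall>k q r. eventually (\<lambda>I. (diff13 ^^ n) (F I) k q r = (diff13 ^^ n) R k q r) sequentially"
    by (induction n) (use assms in \<open>auto intro!: diff_eventually\<close>)
  then show "eventually (\<lambda>I. (diff13 ^^ n) (F I) k q r = (diff13 ^^ n) R k q r) sequentially" by blast
  have "\<forall>k q r. eventually (\<lambda>I. (diff23 ^^ n) (F I) k q r = (diff23 ^^ n) R k q r) sequentially"
    by (induction n) (use assms in \<open>auto intro!: diff_eventually\<close>)
  then show "eventually (\<lambda>I. (diff23 ^^ n) (F I) k q r = (diff23 ^^ n) R k q r) sequentially" by blast
qed

text \<open>Infinite binomial sums of modes are coefficientwise limits of finite ones, and the difference operators only
look at finitely many coefficients; so it is enough to annihilate the partial sums.\<close>

lemma diffpow_limit_null: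
  assumes "\<And>k q r. eventually (\<lambda>I. F I k q r = R k q r) sequentially"
    and "\<And>I. (diff13 ^^ n) ((diff23 ^^ n) (F I)) = null3"
  shows "(diff13 ^^ n) ((diff23 ^^ n) R) = null3"
proof (intro ext)
  fix k q r
  have "eventually (\<lambda>I. (diff13 ^^ n) ((diff23 ^^ n) (F I)) k q r = (diff13 ^^ n) ((diff23 ^^ n) R) k q r) sequentially"
    by (intro diffpow_eventually assms(1))
  then obtain I where "(diff13 ^^ n) ((diff23 ^^ n) (F I)) k q r = (diff13 ^^ n) ((diff23 ^^ n) R) k q r"
    using eventually_happens' sequentially_bot by blast
  then show "(diff13 ^^ n) ((diff23 ^^ n) R) k q r = null3 k q r"
    using assms(2) by metis
qed

lemma diff_shift:
  "diff13 (\<lambda>k q r. F (k + a) (q + b) r) = (\<lambda>k q r. diff13 F (k + a) (q + b) r)"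
  "diff23 (\<lambda>k q r. F (k + a) (q + b) r) = (\<lambda>k q r. diff23 F (k + a) (q + b) r)"
  by (simp_all add: diff13_def diff23_def fun_eq_iff algebra_simps)

lemma diffpow_shift:
  "(diff13 ^^ n) (\<lambda>k q r. F (k + a) (q + b) r) = (\<lambda>k q r. (diff13 ^^ n) F (k + a) (q + b) r)"
  "(diff23 ^^ n) (\<lambda>k q r. F (k + a) (q + b) r) = (\<lambda>k q r. (diff23 ^^ n) F (k + a) (q + b) r)"
proof -
  show "(diff13 ^^ n) (\<lambda>k q r. F (k + a) (q + b) r) = (\<lambda>k q r. (diff13 ^^ n) F (k + a) (q + b) r)"
    by (induction n) (auto simp: diff_shift(1))
  show "(diff23 ^^ n) (\<lambda>k q r. F (k + a) (q + b) r) = (\<lambda>k q r. (diff23 ^^ n) F (k + a) (q + b) r)"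
    by (induction n) (auto simp: diff_shift(2))
qed

text \<open>The inductive core of Dong's lemma.  One goes down from large \<open>n\<close>.  Modulo what is already annihilated by a power
of \<open>z\<^sub>2 - z\<^sub>3\<close>, the factor \<open>z\<^sub>1 - z\<^sub>2\<close> raises \<open>n\<close> and therefore acts as zero, so that \<open>z\<^sub>2 - z\<^sub>3\<close> and
\<open>z\<^sub>1 - z\<^sub>3\<close> act in the same way; further factors \<open>z\<^sub>2 - z\<^sub>3\<close> can be traded for the factors \<open>z\<^sub>1 - z\<^sub>3\<close> that are
needed to apply the third assumption.\<close>

lemma diff23pow_descent:
  fixes R :: "'w \<Rightarrow> int \<Rightarrow> int \<Rightarrow> int \<Rightarrow> int \<Rightarrow> 'a::ab_group_add"
  assumes step: "\<And>w n. diff12 (R w n) = R w (n + 1)"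
    and top: "\<And>w n. n \<ge> int N \<Longrightarrow> R w n = null3"
    and kill: "\<And>w n. (diff13 ^^ N) ((diff23 ^^ N) (R w n)) = null3"
  shows "\<exists>M\<ge>N. \<forall>w. (diff23 ^^ M) (R w n) = null3"
proof (induction n rule: int_downward_induct[where B = "int N"])
  case (bound c)
  then show ?case using top by (intro exI[of _ N]) auto
next
  case (step c)
  then obtain M where M: "M \<ge> N" "\<And>w. (diff23 ^^ M) (R w (c + 1)) = null3"
    by (meson zless_add1_eq)
  have "(diff23 ^^ (N + M)) (R w c) = null3" for w
  proof -
    have descent: "(diff23 ^^ (j + M)) (R w c) = (diff13 ^^ j) ((diff23 ^^ M) (R w c))" for j
    proof (induction j)
      case (Suc j)
      have "(diff23 ^^ (Suc j + M)) (R w c) = diff23 ((diff13 ^^ j) ((diff23 ^^ M) (R w c)))"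
        using Suc by simp
      also have "\<dots> = (diff13 ^^ j) (diff23 ((diff23 ^^ M) (R w c)))"
        using diff13pow_23pow_commute[of j 1 "(diff23 ^^ M) (R w c)"] by simp
      also have "diff23 ((diff23 ^^ M) (R w c)) = diff13 ((diff23 ^^ M) (R w c))"
        using M(2) by (subst diff23_eq)
          (simp add: diff12_23pow_commute assms(1) null3_def)
      finally show ?case by (simp add: funpow_swap1)
    qed simp
    have split: "(diff23 ^^ M) x = (diff23 ^^ (M - N)) ((diff23 ^^ N) x)" for x :: "int \<Rightarrow> int \<Rightarrow> int \<Rightarrow> 'a"
      using fun_cong[OF funpow_add[of "M - N" N diff23], of x] M(1) by simp
    from descent[of N] have "(diff23 ^^ (N + M)) (R w c) = (diff23 ^^ (M - N)) ((diff13 ^^ N) ((diff23 ^^ N) (R w c)))"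
      unfolding diff13pow_23pow_commute split[of "(diff13 ^^ N) (R w c)"] .
    then show ?thesis by (simp add: kill)
  qed
  then show ?case by (intro exI[of _ "N + M"]) simp
qed

definition mode_bounded :: "(int \<Rightarrow> int \<Rightarrow> 'v::zero) \<Rightarrow> bool" where
  "mode_bounded Z \<longleftrightarrow> (\<exists>B. \<forall>a b. b \<ge> B \<longrightarrow> Z a b = 0)"

text \<open>Fields act on a space of representatives: \<open>P\<close> is a projection whose kernel is divided out, and it stands for
the identity operator of the quotient.\<close>

locale field_space = vector_space sc for sc :: "complex \<Rightarrow> 'f::ab_group_add \<Rightarrow> 'f" +
  fixes P :: "'f \<Rightarrow> 'f"
  assumes P_linear: "Vector_Spaces.linear sc sc P"
    and P_idem: "P (P v) = P v"
begin

abbreviation "lin \<equiv> Vector_Spaces.linear sc sc"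

lemma lin_simps:
  assumes "lin f"
  shows "f (x + y) = f x + f y" "f (x - y) = f x - f y" "f (sc c x) = sc c (f x)" "f 0 = 0" "f (- x) = - f x"
    "f (sum g A) = (\<Sum>a\<in>A. f (g a))"
proof -
  interpret f: Vector_Spaces.linear sc sc f by fact
  show "f (x + y) = f x + f y" "f (x - y) = f x - f y" "f (sc c x) = sc c (f x)" "f 0 = 0" "f (- x) = - f x"
    "f (sum g A) = (\<Sum>a\<in>A. f (g a))"
    by (simp_all add: f.add f.scale f.diff f.zero f.neg f.sum)
qed

lemmas P_simps = lin_simps[OF P_linear]

lemma linI: "(\<And>x y. f (x + y) = f x + f y) \<Longrightarrow> (\<And>c x. f (sc c x) = sc c (f x)) \<Longrightarrow> lin f"
  by unfold_locales (auto simp: algebra_simps)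

subsection \<open>Binomial sums\<close>

text \<open>The coefficients of \<open>(z - w)\<^sup>m Z(z, w)\<close>, where the power is expanded for \<open>|z| > |w|\<close>.\<close>

definition hsum :: "(int \<Rightarrow> int \<Rightarrow> 'f) \<Rightarrow> int \<Rightarrow> int \<Rightarrow> int \<Rightarrow> 'f" where
  "hsum Z m k q = Sum_any (\<lambda>i. sc ((-1) ^ i * (of_int m gchoose i)) (Z (m + k - int i) (q + int i)))"

lemma hsum_eq:
  assumes "\<And>a b. b \<ge> B \<Longrightarrow> Z a b = 0" "B \<le> q + int N"
  shows "hsum Z m k q = (\<Sum>i<N. sc ((-1) ^ i * (of_int m gchoose i)) (Z (m + k - int i) (q + int i)))"
  unfolding hsum_def by (rule Sum_any_eq_sum) (use assms in auto)

lemma hsum_eventually: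
  assumes "mode_bounded Z"
  shows "eventually (\<lambda>N. hsum Z m k q = (\<Sum>i<N. sc ((-1) ^ i * (of_int m gchoose i)) (Z (m + k - int i) (q + int i)))) sequentially"
proof -
  obtain B where "\<And>a b. b \<ge> B \<Longrightarrow> Z a b = 0" using assms unfolding mode_bounded_def by blast
  then show ?thesis
    unfolding eventually_sequentially
    by (intro exI[of _ "nat (B - q)"] allI impI hsum_eq[where B = B]) auto
qed

text \<open>Multiplication by one more factor \<open>z - w\<close>; on coefficients this is Pascal's rule.\<close>

lemma hsum_recurrence:
  assumes "mode_bounded Z"
  shows "hsum Z m (k + 1) q - hsum Z m k (q + 1) = hsum Z (m + 1) k q"
proof -
  obtain B where B: "\<And>a b. b \<ge> B \<Longrightarrow> Z a b = 0" using assms unfolding mode_bounded_def by blast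
  define N where "N = nat (B - q)"
  let ?b = "\<lambda>i. (-1) ^ i * ((of_int m :: complex) gchoose i)"
  let ?Z = "\<lambda>i::nat. Z (m + 1 + k - int i) (q + int i)"
  have pascal: "sc ((-1) ^ Suc i * ((of_int m gchoose Suc i) + (of_int m gchoose i))) z = sc (?b (Suc i)) z - sc (?b i) z" for i z
    unfolding scale_left_diff_distrib[symmetric] by (rule arg_cong[of _ _ "\<lambda>c. sc c z"]) (simp add: algebra_simps)
  have 1: "hsum Z m (k + 1) q = (\<Sum>i<Suc N. sc (?b i) (?Z i))"
    by (subst hsum_eq[where B = B and N = "Suc N"]) (auto simp: B N_def algebra_simps)
  have 2: "hsum Z m k (q + 1) = (\<Sum>i<N. sc (?b i) (?Z (Suc i)))"
    by (subst hsum_eq[where B = B and N = N]) (auto simp: B N_def algebra_simps)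
  have 3: "hsum Z (m + 1) k q = (\<Sum>i<Suc N. sc ((-1) ^ i * (of_int (m + 1) gchoose i)) (?Z i))"
    by (subst hsum_eq[where B = B and N = "Suc N"]) (auto simp: B N_def algebra_simps)
  show ?thesis
    unfolding 1 2 3 sum.lessThan_Suc_shift gbinomial_pascal
    by (simp only: pascal sum_subtractf) simp
qed

lemma hsum_0: "hsum Z 0 k q = Z k q"
  unfolding hsum_def by (subst Sum_any_eq_sum[where N = 1]) (auto simp: gbinomial_0_left)

lemma hsum_lin:
  assumes "lin f" "mode_bounded Z"
  shows "f (hsum Z m k q) = hsum (\<lambda>a b. f (Z a b)) m k q"
proof -
  obtain B where B: "\<And>a b. b \<ge> B \<Longrightarrow> Z a b = 0" using assms unfolding mode_bounded_def by blast
  show ?thesis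
    by (subst (1 2) hsum_eq[where B = B and N = "nat (B - q)"])
      (auto simp: B lin_simps[OF assms(1)])
qed

lemma hsum_add:
  assumes "mode_bounded Z" "mode_bounded Z'"
  shows "hsum (\<lambda>a b. Z a b + Z' a b) m k q = hsum Z m k q + hsum Z' m k q"
proof -
  obtain B where B: "\<And>a b. b \<ge> B \<Longrightarrow> Z a b = 0" using assms unfolding mode_bounded_def by blast
  obtain B' where B': "\<And>a b. b \<ge> B' \<Longrightarrow> Z' a b = 0" using assms unfolding mode_bounded_def by blast
  show ?thesis
    by (subst (1 2 3) hsum_eq[where B = "max B B'" and N = "nat (max B B' - q)"])
      (auto simp: B B' scale_right_distrib sum.distrib)
qed

lemma hsum_scale:
  assumes "mode_bounded Z"
  shows "hsum (\<lambda>a b. sc c (Z a b)) m k q = sc c (hsum Z m k q)"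
proof -
  have "lin (sc c)" by (rule linI) (auto simp: algebra_simps)
  from hsum_lin[OF this assms] show ?thesis by simp
qed

lemma hsum_null [simp]: "hsum (\<lambda>a b. 0) m k q = 0"
  by (simp add: hsum_def)

text \<open>How a derivation that acts on modes like \<open>\<partial>\<close> passes through a binomial sum: the binomial
  expansion of \<open>(z - w)\<^sup>m\<close> is annihilated by \<open>\<partial>\<^sub>z + \<partial>\<^sub>w\<close>.\<close>

lemma hsum_derivation:
  assumes "mode_bounded Z"
  shows "hsum (\<lambda>a b. sc (of_int a) (Z (a - 1) b) + sc (of_int b) (Z a (b - 1))) m k q
    = sc (of_int k) (hsum Z m (k - 1) q) + sc (of_int q) (hsum Z m k (q - 1))"
proof -
  obtain B where B: "\<And>a b. b \<ge> B \<Longrightarrow> Z a b = 0" using assms unfolding mode_bounded_def by blast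
  define N where "N = nat (B + 1 - q)"
  let ?b = "\<lambda>i. (-1) ^ i * ((of_int m :: complex) gchoose i)"
  let ?Y = "\<lambda>i::nat. Z (m + k - 1 - int i) (q + int i)"
  let ?X = "\<lambda>i::nat. Z (m + k - int i) (q - 1 + int i)"
  have YX: "?Y i = ?X (Suc i)" for i by (simp add: algebra_simps)
  have XN: "?X N = 0" "?Y N = 0" using B by (auto simp: N_def)
  have absorb: "?b (Suc i) * of_nat (Suc i) = - (?b i * (of_int m - of_nat i))" for i
    using arg_cong[OF gbinomial_absorb[of m i], of "\<lambda>x. - ((-1) ^ i * x)"] by (simp add: ac_simps)
  have coefY: "sc (?b i) (sc (of_int (m + k - int i)) y) = sc (of_int k) (sc (?b i) y) + sc (?b i * (of_int m - of_nat i)) y" for i y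
    unfolding scale_scale scale_left_distrib[symmetric] by (rule arg_cong[of _ _ "\<lambda>c. sc c y"]) (simp add: algebra_simps)
  have coefX: "sc (?b i) (sc (of_int (q + int i)) y) = sc (of_int q) (sc (?b i) y) + sc (?b i * of_nat i) y" for i y
    unfolding scale_scale scale_left_distrib[symmetric] by (rule arg_cong[of _ _ "\<lambda>c. sc c y"]) (simp add: algebra_simps)
  have tele: "(\<Sum>i<n. sc (?b i * (of_int m - of_nat i)) (?Y i)) + (\<Sum>i<Suc n. sc (?b i * of_nat i) (?X i)) = 0" for n
  proof -
    have "(\<Sum>i<Suc n. sc (?b i * of_nat i) (?X i)) = (\<Sum>i<n. sc (?b (Suc i) * of_nat (Suc i)) (?X (Suc i)))"
      by (subst sum.lessThan_Suc_shift) simp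
    also have "\<dots> = - (\<Sum>i<n. sc (?b i * (of_int m - of_nat i)) (?Y i))"
      unfolding absorb YX by (simp add: sum_negf)
    finally show ?thesis by simp
  qed
  have "hsum (\<lambda>a b. sc (of_int a) (Z (a - 1) b) + sc (of_int b) (Z a (b - 1))) m k q
      = (\<Sum>i<N. sc (?b i) (sc (of_int (m + k - int i)) (?Y i) + sc (of_int (q + int i)) (?X i)))"
    by (subst hsum_eq[where B = "B + 1" and N = N]) (auto simp: B N_def algebra_simps)
  also have "\<dots> = (\<Sum>i<N. sc (of_int k) (sc (?b i) (?Y i))) + (\<Sum>i<N. sc (of_int q) (sc (?b i) (?X i)))
     + ((\<Sum>i<N. sc (?b i * (of_int m - of_nat i)) (?Y i)) + (\<Sum>i<N. sc (?b i * of_nat i) (?X i)))"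
    unfolding scale_right_distrib coefY coefX sum.distrib by (simp only: ac_simps)
  also have "(\<Sum>i<N. sc (?b i * of_nat i) (?X i)) = (\<Sum>i<Suc N. sc (?b i * of_nat i) (?X i))"
    using XN by simp
  also have "(\<Sum>i<N. sc (?b i * (of_int m - of_nat i)) (?Y i)) + (\<Sum>i<Suc N. sc (?b i * of_nat i) (?X i)) = 0"
    by (rule tele)
  finally show ?thesis
    using hsum_eq[where B = B and N = N and m = m and k = "k - 1" and q = q, OF B]
      hsum_eq[where B = B and N = N and m = m and k = k and q = "q - 1", OF B]
    by (simp add: N_def scale_sum_right add_diff_eq)
qed

end

context field_space
begin

subsection \<open>Fields, products of fields and locality\<close>

text \<open>The last two conditions say that a field is an operation on the quotient by the kernel of \<open>P\<close>, lifted back to the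
representatives.\<close>

definition field :: "(int \<Rightarrow> 'f \<Rightarrow> 'f) \<Rightarrow> bool" where
  "field \<phi> \<longleftrightarrow> (\<forall>n. lin (\<phi> n)) \<and> (\<forall>w. \<exists>N. \<forall>n\<ge>N. \<phi> n w = 0) \<and>
    (\<forall>n w. P (\<phi> n w) = \<phi> n w \<and> \<phi> n (P w) = \<phi> n w)"

lemma fieldD:
  assumes "field \<phi>"
  shows "lin (\<phi> n)" "\<exists>N. \<forall>n\<ge>N. \<phi> n w = 0" "P (\<phi> n w) = \<phi> n w" "\<phi> n (P w) = \<phi> n w"
  using assms unfolding field_def by auto

lemma field_comp_bounded: "field \<phi> \<Longrightarrow> field \<psi> \<Longrightarrow> mode_bounded (\<lambda>a b. \<phi> a (\<psi> b w))"
  unfolding mode_bounded_def using fieldD(2)[of \<psi> w] lin_simps(4)[OF fieldD(1)] by metis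

text \<open>The coefficients of \<open>(z - w)\<^sup>m \<phi>(z)\<psi>(w) - s (-w + z)\<^sup>m \<psi>(w)\<phi>(z)\<close>, each power being expanded in the domain that fits
the order of the two fields; this is one side of the Borcherds identity.  For \<open>k = 0\<close> they are the modes
of the \<open>m\<close>-th product of the fields, for \<open>m = 0\<close> they are the commutators of the modes, and locality says that they
vanish for large \<open>m\<close>.\<close>

definition bor :: "complex \<Rightarrow> (int \<Rightarrow> 'f \<Rightarrow> 'f) \<Rightarrow> (int \<Rightarrow> 'f \<Rightarrow> 'f) \<Rightarrow> int \<Rightarrow> int \<Rightarrow> int \<Rightarrow> 'f \<Rightarrow> 'f" where
  "bor s \<phi> \<psi> m k q w = hsum (\<lambda>a b. \<phi> a (\<psi> b w)) m k q - sc (s * (-1) powi m) (hsum (\<lambda>a b. \<psi> a (\<phi> b w)) m q k)"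

definition nprod :: "complex \<Rightarrow> (int \<Rightarrow> 'f \<Rightarrow> 'f) \<Rightarrow> int \<Rightarrow> (int \<Rightarrow> 'f \<Rightarrow> 'f) \<Rightarrow> int \<Rightarrow> 'f \<Rightarrow> 'f" where
  "nprod s \<phi> m \<psi> = (\<lambda>n w. bor s \<phi> \<psi> m 0 n w)"

definition mut_local :: "complex \<Rightarrow> (int \<Rightarrow> 'f \<Rightarrow> 'f) \<Rightarrow> (int \<Rightarrow> 'f \<Rightarrow> 'f) \<Rightarrow> bool" where
  "mut_local s \<phi> \<psi> \<longleftrightarrow> (\<exists>N. \<forall>m\<ge>N. \<forall>k q w. bor s \<phi> \<psi> m k q w = 0)"

lemma powi_minus_Suc: "(-1::complex) powi (m + 1) = - ((-1) powi m)"
  by (simp add: power_int_add)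

lemma powi_minus_square: "(-1::complex) powi m * (-1) powi m = 1"
  by (simp flip: power_int_mult_distrib)

lemma bor_recurrence:
  assumes "field \<phi>" "field \<psi>"
  shows "bor s \<phi> \<psi> m (k + 1) q w - bor s \<phi> \<psi> m k (q + 1) w = bor s \<phi> \<psi> (m + 1) k q w"
proof -
  note r1 = hsum_recurrence[OF field_comp_bounded[OF assms, of w], of m k q]
  note r2 = hsum_recurrence[OF field_comp_bounded[OF assms(2,1), of w], of m q k]
  show ?thesis
    unfolding bor_def powi_minus_Suc r1[symmetric] r2[symmetric] by (simp add: algebra_simps)
qed

lemma bor_0: "bor s \<phi> \<psi> 0 k q w = \<phi> k (\<psi> q w) - sc s (\<psi> q (\<phi> k w))"
  by (simp add: bor_def hsum_0)

lemma bor_swap: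
  assumes "s * s = 1"
  shows "bor s \<psi> \<phi> m k q w = - sc (s * (-1) powi m) (bor s \<phi> \<psi> m q k w)"
proof -
  have "s * (-1) powi m * (s * (-1) powi m) = 1"
    using assms powi_minus_square[of m] by (metis (no_types, opaque_lifting) mult.assoc mult.left_commute mult.right_neutral)
  then show ?thesis
    unfolding bor_def scale_right_diff_distrib scale_scale by simp
qed

lemma mut_local_sym: "mut_local s \<phi> \<psi> \<Longrightarrow> s * s = 1 \<Longrightarrow> mut_local s \<psi> \<phi>"
  unfolding mut_local_def using bor_swap[of s \<psi> \<phi>] by simp metis

text \<open>By the recurrence, the vanishing for one exponent implies it for all larger ones.\<close>

lemma mut_localI:
  assumes "field \<phi>" "field \<psi>" "\<And>k q w. bor s \<phi> \<psi> N k q w = 0"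
  shows "mut_local s \<phi> \<psi>"
proof -
  have "\<forall>k q w. bor s \<phi> \<psi> m k q w = 0" if "m \<ge> N" for m
    using that
  proof (induction m rule: int_ge_induct)
    case (step i)
    then show ?case using bor_recurrence[OF assms(1,2), of s i] by (metis diff_self)
  qed (use assms in auto)
  then show ?thesis unfolding mut_local_def by blast
qed

lemma hsum_linear_family:
  assumes "\<And>a b. lin (Z a b)" "\<And>w. mode_bounded (\<lambda>a b. Z a b w)"
  shows "lin (\<lambda>w. hsum (\<lambda>a b. Z a b w) m k q)"
proof (rule linI)
  show "hsum (\<lambda>a b. Z a b (x + y)) m k q = hsum (\<lambda>a b. Z a b x) m k q + hsum (\<lambda>a b. Z a b y) m k q" for x y
    unfolding lin_simps(1)[OF assms(1)] by (rule hsum_add[OF assms(2) assms(2)])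
  show "hsum (\<lambda>a b. Z a b (sc c x)) m k q = sc c (hsum (\<lambda>a b. Z a b x) m k q)" for c x
    unfolding lin_simps(3)[OF assms(1)] by (rule hsum_scale[OF assms(2)])
qed

lemma bor_linear:
  assumes "field \<phi>" "field \<psi>"
  shows "lin (bor s \<phi> \<psi> m k q)"
proof -
  have c: "lin (\<lambda>w. \<phi> a (\<psi> b w))" if "field \<phi>" "field \<psi>" for \<phi> \<psi> a b
    by (rule linI) (simp_all add: lin_simps[OF fieldD(1)[OF that(1)]] lin_simps[OF fieldD(1)[OF that(2)]])
  note l1 = hsum_linear_family[OF c[OF assms] field_comp_bounded[OF assms], of m k q]
  note l2 = hsum_linear_family[OF c[OF assms(2,1)] field_comp_bounded[OF assms(2,1)], of m q k]
  show ?thesis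
    by (rule linI) (simp_all add: bor_def lin_simps[OF l1] lin_simps[OF l2] algebra_simps)
qed

lemma bor_apply_lin:
  assumes "field \<phi>" "field \<psi>" "lin f"
  shows "f (bor s \<phi> \<psi> m k q w) = hsum (\<lambda>a b. f (\<phi> a (\<psi> b w))) m k q - sc (s * (-1) powi m) (hsum (\<lambda>a b. f (\<psi> a (\<phi> b w))) m q k)"
  by (simp add: bor_def lin_simps[OF assms(3)] hsum_lin[OF assms(3) field_comp_bounded] assms(1,2))

lemma bor_truncation:
  assumes "field \<phi>" "field \<psi>"
  shows "\<exists>N. \<forall>n\<ge>N. bor s \<phi> \<psi> m k n w = 0"
proof -
  obtain B where B: "\<And>b. b \<ge> B \<Longrightarrow> \<psi> b w = 0" using fieldD(2)[OF assms(2)] by blast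
  obtain B' where B': "\<And>b. b \<ge> B' \<Longrightarrow> \<phi> b w = 0" using fieldD(2)[OF assms(1)] by blast
  define K where "K = nat (B' - k)"
  have "eventually (\<lambda>n. \<forall>i\<in>{..<K}. \<psi> (m + n - int i) (\<phi> (k + int i) w) = 0) at_top"
  proof (rule eventually_ball_finite; safe?)
    fix i
    obtain C where C: "\<And>b. b \<ge> C \<Longrightarrow> \<psi> b (\<phi> (k + int i) w) = 0" using fieldD(2)[OF assms(2)] by blast
    show "eventually (\<lambda>n. \<psi> (m + n - int i) (\<phi> (k + int i) w) = 0) at_top"
      unfolding eventually_at_top_linorder by (rule exI[of _ "C - m + int i"]) (auto intro!: C)
  qed
  then obtain N where N: "\<And>n i. n \<ge> N \<Longrightarrow> i < K \<Longrightarrow> \<psi> (m + n - int i) (\<phi> (k + int i) w) = 0"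
    unfolding eventually_at_top_linorder by blast
  have "bor s \<phi> \<psi> m k n w = 0" if "n \<ge> max N B" for n
  proof -
    have "hsum (\<lambda>a b. \<phi> a (\<psi> b w)) m k n = 0"
      by (subst hsum_eq[where B = B and N = 0]) (use that in \<open>auto simp: B lin_simps[OF fieldD(1)[OF assms(1)]]\<close>)
    moreover have "hsum (\<lambda>a b. \<psi> a (\<phi> b w)) m n k = 0"
      by (subst hsum_eq[where B = B' and N = K])
        (use that in \<open>auto simp: B' N K_def lin_simps[OF fieldD(1)[OF assms(2)]]\<close>)
    ultimately show ?thesis by (simp add: bor_def)
  qed
  then show ?thesis by blast
qed

lemma field_nprod:
  assumes "field \<phi>" "field \<psi>"
  shows "field (nprod s \<phi> m \<psi>)"
  unfolding field_def nprod_def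
proof (intro conjI allI)
  show "lin (bor s \<phi> \<psi> m 0 n)" for n by (rule bor_linear[OF assms])
  show "\<exists>N. \<forall>n\<ge>N. bor s \<phi> \<psi> m 0 n w = 0" for w by (rule bor_truncation[OF assms])
  show "P (bor s \<phi> \<psi> m 0 n w) = bor s \<phi> \<psi> m 0 n w" for n w
    by (rule trans[OF bor_apply_lin[OF assms P_linear]]) (simp add: fieldD(3)[OF assms(1)] fieldD(3)[OF assms(2)] bor_def)
  show "bor s \<phi> \<psi> m 0 n (P w) = bor s \<phi> \<psi> m 0 n w" for n w
    by (simp add: bor_def fieldD(4)[OF assms(1)] fieldD(4)[OF assms(2)])
qed

subsection \<open>Products preserve locality\<close>

lemma diff_scale:
  "(diff13 ^^ n) (\<lambda>k q r. sc c (F k q r)) = (\<lambda>k q r. sc c ((diff13 ^^ n) F k q r))"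
  "(diff23 ^^ n) (\<lambda>k q r. sc c (F k q r)) = (\<lambda>k q r. sc c ((diff23 ^^ n) F k q r))"
  by (induction n) (simp_all add: diff13_def diff23_def scale_right_diff_distrib)

text \<open>Annihilation by \<open>(z\<^sub>1 - z\<^sub>3)\<^sup>N (z\<^sub>2 - z\<^sub>3)\<^sup>N\<close>.\<close>

definition killed :: "nat \<Rightarrow> (int \<Rightarrow> int \<Rightarrow> int \<Rightarrow> 'f) \<Rightarrow> bool" where
  "killed N F \<longleftrightarrow> (diff13 ^^ N) ((diff23 ^^ N) F) = null3"

lemma killed_add: "killed N F \<Longrightarrow> killed N G \<Longrightarrow> killed N (\<lambda>k q r. F k q r + G k q r)"
  by (simp add: killed_def diffpow_add null3_def)

lemma killed_scale: "killed N F \<Longrightarrow> killed N (\<lambda>k q r. sc c (F k q r))"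
  by (simp add: killed_def diff_scale null3_def)

lemma killed_zero: "killed N (\<lambda>k q r. 0)"
  using diffpow_null3 by (simp add: killed_def flip: null3_def)

lemma killed_sum: "(\<And>i. i < (I::nat) \<Longrightarrow> killed N (F i)) \<Longrightarrow> killed N (\<lambda>k q r. \<Sum>i<I. F i k q r)"
  by (induction I) (auto intro: killed_add killed_zero)

lemma killed_shift: "killed N F \<Longrightarrow> killed N (\<lambda>k q r. F (k + a) (q + b) r)"
  by (simp add: killed_def diffpow_shift null3_def)

lemma killed_23: "(diff23 ^^ N) F = null3 \<Longrightarrow> killed N F"
  by (simp add: killed_def)

lemma killed_13: "(diff13 ^^ N) F = null3 \<Longrightarrow> killed N F"
  by (simp add: killed_def diff13pow_23pow_commute)

lemma diff23pow_bor:
  assumes "field b" "field c"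
  shows "(diff23 ^^ j) (\<lambda>k q r. bor s b c 0 q r (w k)) = (\<lambda>k q r. bor s b c (int j) q r (w k))"
  by (induction j) (simp_all add: diff23_def fun_eq_iff bor_recurrence[OF assms] algebra_simps)

lemma diff23pow_lin_bor:
  assumes "field b" "field c" "\<And>k. lin (a k)"
  shows "(diff23 ^^ j) (\<lambda>k q r. a k (bor s b c 0 q r w)) = (\<lambda>k q r. a k (bor s b c (int j) q r w))"
  by (induction j) (simp_all add: diff23_def fun_eq_iff bor_recurrence[OF assms(1,2)] add.commute[of 1] flip: lin_simps(2)[OF assms(3)])

lemma diff13pow_bor:
  assumes "field b" "field c"
  shows "(diff13 ^^ j) (\<lambda>k q r. bor s b c 0 k r (w q)) = (\<lambda>k q r. bor s b c (int j) k r (w q))"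
  by (induction j) (simp_all add: diff13_def fun_eq_iff bor_recurrence[OF assms] algebra_simps)

lemma diff13pow_lin_bor:
  assumes "field b" "field c" "\<And>k. lin (a k)"
  shows "(diff13 ^^ j) (\<lambda>k q r. a q (bor s b c 0 k r w)) = (\<lambda>k q r. a q (bor s b c (int j) k r w))"
  by (induction j) (simp_all add: diff13_def fun_eq_iff bor_recurrence[OF assms(1,2)] add.commute[of 1] flip: lin_simps(2)[OF assms(3)])

lemma diff23pow_cong:
  assumes "\<And>q r. F k q r = G k q r"
  shows "(diff23 ^^ j) F k q r = (diff23 ^^ j) G k q r"
  by (induction j arbitrary: q r) (auto simp: diff23_def assms)

text \<open>Dong's lemma.  The commutator of the \<open>n\<close>-th product of \<open>a\<close> and \<open>b\<close> with \<open>c\<close> is a limit of sums of triple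
commutators, each of which is annihilated by a power of \<open>(z\<^sub>1 - z\<^sub>3)(z\<^sub>2 - z\<^sub>3)\<close> since \<open>c\<close> is local with \<open>a\<close> and \<open>b\<close>.
The locality of \<open>a\<close> and \<open>b\<close> makes the products vanish for large \<open>n\<close>, which starts the descent that removes the
variable \<open>z\<^sub>1\<close>.\<close>

lemma mut_local_nprod:
  assumes f: "field a" "field b" "field c"
    and ab: "mut_local s a b" and ac: "mut_local u a c" and bc: "mut_local v b c"
    and t: "t = u * v"
  shows "mut_local t (nprod s a n b) c"
proof -
  obtain N1 where N1: "\<And>m k q w. m \<ge> N1 \<Longrightarrow> bor s a b m k q w = 0"
    using ab unfolding mut_local_def by blast
  obtain N2 where N2: "\<And>m k q w. m \<ge> N2 \<Longrightarrow> bor u a c m k q w = 0"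
    using ac unfolding mut_local_def by blast
  obtain N3 where N3: "\<And>m k q w. m \<ge> N3 \<Longrightarrow> bor v b c m k q w = 0"
    using bc unfolding mut_local_def by blast
  define N where "N = nat (max N1 (max N2 N3))"
  have NN: "N1 \<le> int N" "N2 \<le> int N" "N3 \<le> int N" unfolding N_def by linarith+
  have N: "\<And>m k q w. m \<ge> int N \<Longrightarrow> bor s a b m k q w = 0" "\<And>k q w. bor u a c (int N) k q w = 0"
    "\<And>k q w. bor v b c (int N) k q w = 0"
    using NN by (auto intro!: N1 N2 N3)
  note la = lin_simps[OF fieldD(1)[OF f(1)]] and lb = lin_simps[OF fieldD(1)[OF f(2)]] and lc = lin_simps[OF fieldD(1)[OF f(3)]]
  (* R w n: the commutator of the n-th product of a and b with c; the n-th product is the coefficient k = 0. *)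
  define R where "R w n k q r = bor s a b n k q (c r w) - sc t (c r (bor s a b n k q w))" for w n k q r
  (* W and V: the commutators of the two orders of a and b with c, of which R is a binomial sum. *)
  define W where "W w k q r = a k (b q (c r w)) - sc t (c r (a k (b q w)))" for w k q r
  define V where "V w k q r = b q (a k (c r w)) - sc t (c r (b q (a k w)))" for w k q r
  have W: "killed N (W w)" for w
  proof -
    have "W w = (\<lambda>k q r. a k (bor v b c 0 q r w) + sc v (bor u a c 0 k r (b q w)))"
      by (simp add: W_def fun_eq_iff bor_0 la t algebra_simps)
    moreover have "killed N (\<lambda>k q r. a k (bor v b c 0 q r w))"
      by (rule killed_23) (simp add: diff23pow_lin_bor[OF f(2,3) fieldD(1)[OF f(1)]] N la null3_def)
    moreover have "killed N (\<lambda>k q r. bor u a c 0 k r (b q w))"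
      by (rule killed_13) (simp add: diff13pow_bor[OF f(1,3)] N null3_def)
    ultimately show ?thesis by (auto intro!: killed_add killed_scale)
  qed
  have V: "killed N (V w)" for w
  proof -
    have "V w = (\<lambda>k q r. b q (bor u a c 0 k r w) + sc u (bor v b c 0 q r (a k w)))"
      by (simp add: V_def fun_eq_iff bor_0 lb t algebra_simps)
    moreover have "killed N (\<lambda>k q r. b q (bor u a c 0 k r w))"
      by (rule killed_13) (simp add: diff13pow_lin_bor[OF f(1,3) fieldD(1)[OF f(2)]] N lb null3_def)
    moreover have "killed N (\<lambda>k q r. bor v b c 0 q r (a k w))"
      by (rule killed_23) (simp add: diff23pow_bor[OF f(2,3)] N null3_def)
    ultimately show ?thesis by (auto intro!: killed_add killed_scale)
  qed
  have kill: "(diff13 ^^ N) ((diff23 ^^ N) (R w n)) = null3" for w n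
  proof -
    let ?b = "\<lambda>i. (-1) ^ i * ((of_int n :: complex) gchoose i)"
    define F where "F I k q r = (\<Sum>i<I. sc (?b i) (W w (k + (n - int i)) (q + int i) r))
        + sc (- (s * (-1) powi n)) (\<Sum>i<I. sc (?b i) (V w (k + int i) (q + (n - int i)) r))" for I k q r
    have "killed N (F I)" for I
      unfolding F_def by (intro killed_add killed_scale killed_sum killed_shift[OF W] killed_shift[OF V])
    moreover have "eventually (\<lambda>I. F I k q r = R w n k q r) sequentially" for k q r
    proof -
      note e1 = hsum_eventually[OF field_comp_bounded[OF f(1,2), of "c r w"], of n k q]
      note e2 = hsum_eventually[OF field_comp_bounded[OF f(2,1), of "c r w"], of n q k]
      note e3 = hsum_eventually[OF field_comp_bounded[OF f(1,2), of w], of n k q]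
      note e4 = hsum_eventually[OF field_comp_bounded[OF f(2,1), of w], of n q k]
      show ?thesis using e1 e2 e3 e4
      proof eventually_elim
        case (elim I)
        show ?case
          unfolding F_def R_def W_def V_def bor_def elim
          by (simp add: lc scale_right_diff_distrib sum_subtractf sum_negf scale_sum_right add_diff_eq diff_add_eq add.commute mult.commute mult.left_commute)
      qed
    qed
    ultimately show ?thesis unfolding killed_def by (rule diffpow_limit_null[rotated])
  qed
  have "\<exists>M\<ge>N. \<forall>w. (diff23 ^^ M) (R w n) = null3"
  proof (rule diff23pow_descent)
    show "diff12 (R w n) = R w (n + 1)" for w n
      unfolding R_def diff12_def fun_eq_iff bor_recurrence[OF f(1,2), symmetric] lc by (simp add: algebra_simps)
    show "R w n = null3" if "n \<ge> int N" for w n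
      using that by (simp add: R_def null3_def fun_eq_iff N lc)
  qed (rule kill)
  then obtain M where M: "\<And>w. (diff23 ^^ M) (R w n) = null3" by blast
  show ?thesis
  proof (rule mut_localI)
    show "field (nprod s a n b)" by (rule field_nprod[OF f(1,2)])
    show "field c" by fact
    fix k q w
    have "bor t (nprod s a n b) c (int M) k q w = (diff23 ^^ M) (\<lambda>j k q. bor t (nprod s a n b) c 0 k q w) 0 k q"
      by (subst diff23pow_bor[OF field_nprod[OF f(1,2)] f(3)]) simp
    also have "\<dots> = (diff23 ^^ M) (R w n) 0 k q"
      by (rule diff23pow_cong) (simp add: R_def bor_0 nprod_def)
    finally show "bor t (nprod s a n b) c (int M) k q w = 0" by (simp add: M null3_def)
  qed
qed

subsection \<open>The Borcherds identity for mutually local fields\<close>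

text \<open>Both sides obey the same recurrence in \<open>k\<close>, and they agree for \<open>k = 0\<close> by the definition of the products.  For
negative \<open>k\<close> the recurrence is solved for the term with the smaller \<open>k\<close>, at the cost of a larger \<open>m\<close>;
locality supplies the start, as both sides vanish for large \<open>m\<close>.\<close>

lemma borcherds_identity:
  assumes f: "field \<phi>" "field \<psi>" and "mut_local s \<phi> \<psi>"
  shows "Sum_any (\<lambda>i. sc (of_int k gchoose i) (nprod s \<phi> (m + int i) \<psi> (n + k - int i) w)) = bor s \<phi> \<psi> m k n w"
proof -
  obtain N where N: "\<And>m k q w. m \<ge> N \<Longrightarrow> bor s \<phi> \<psi> m k q w = 0"
    using assms unfolding mut_local_def by blast
  define X where "X m n = nprod s \<phi> m \<psi> n w" for m n
  define L where "L m k n = Sum_any (\<lambda>i. sc (of_int k gchoose i) (X (m + int i) (n + k - int i)))" for m k n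
  have X: "X m n = 0" if "m \<ge> N" for m n using N that by (simp add: X_def nprod_def)
  have L: "L m k n = (\<Sum>i<K. sc (of_int k gchoose i) (X (m + int i) (n + k - int i)))" if "m + int K \<ge> N" for m k n K
    unfolding L_def by (rule Sum_any_eq_sum) (use that in \<open>auto simp: X\<close>)
  have L_rec: "L m (k + 1) n = L (m + 1) k n + L m k (n + 1)" for m k n
  proof -
    define K where "K = nat (N - m)"
    have K: "m + int K \<ge> N" by (simp add: K_def)
    have 1: "L m (k + 1) n = (\<Sum>i<Suc K. sc (of_int (k + 1) gchoose i) (X (m + int i) (n + (k + 1) - int i)))"
      by (rule L) (use K in simp)
    have 2: "L m k (n + 1) = (\<Sum>i<Suc K. sc (of_int k gchoose i) (X (m + int i) (n + (k + 1) - int i)))"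
      using L[of m "Suc K" k "n + 1"] K by (simp add: ac_simps)
    have 3: "L (m + 1) k n = (\<Sum>i<K. sc (of_int k gchoose i) (X (m + int (Suc i)) (n + (k + 1) - int (Suc i))))"
      using L[of "m + 1" K k n] K by (simp add: ac_simps)
    show ?thesis
      unfolding 1 2 3 sum.lessThan_Suc_shift gbinomial_pascal scale_left_distrib sum.distrib by simp
  qed
  have "\<forall>m n. L m k n = bor s \<phi> \<psi> m k n w"
  proof (induction k rule: int_induct[where k = 0])
    case base
    have "L m 0 n = X m n" for m n
      unfolding L_def by (subst Sum_any_eq_sum[where N = 1]) (auto simp: gbinomial_0_left)
    then show ?case by (simp add: X_def nprod_def)
  next
    case (step1 i)
    then show ?case
      using bor_recurrence[OF f, of s _ i] by (simp add: L_rec) (metis diff_add_cancel)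
  next
    case (step2 i)
    have "\<forall>n. L m (i - 1) n = bor s \<phi> \<psi> m (i - 1) n w" for m
    proof (induction m rule: int_downward_induct[where B = N])
      case (bound m)
      then show ?case by (subst L[where K = 0]) (auto simp: N)
    next
      case (step m)
      show ?case
      proof
        fix n
        have "L m (i - 1) n = L m i (n - 1) - L (m + 1) (i - 1) (n - 1)"
          using L_rec[of m "i - 1" "n - 1"] by simp
        also have "\<dots> = bor s \<phi> \<psi> m i (n - 1) w - bor s \<phi> \<psi> (m + 1) (i - 1) (n - 1) w"
          using step[of "m + 1"] step2 by simp
        also have "\<dots> = bor s \<phi> \<psi> m (i - 1) n w"
          using bor_recurrence[OF f, of s m "i - 1" "n - 1" w] by (simp add: algebra_simps)
        finally show "L m (i - 1) n = bor s \<phi> \<psi> m (i - 1) n w" .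
      qed
    qed
    then show ?case by blast
  qed
  then show ?thesis unfolding L_def X_def by blast
qed

end

section \<open>Vertex superalgebras generated by mutually local fields\<close>

lemma super_sign_simps:
  "super_sign p q * super_sign p q = 1" "super_sign p q = super_sign q p" "super_sign False q = 1" "super_sign p False = 1"
  "super_sign (p \<noteq> q) r = super_sign p r * super_sign q r" "super_sign r (p \<noteq> q) = super_sign r p * super_sign r q"
  by (auto simp: super_sign_def)

text \<open>The setting of the reconstruction theorem: mutually local fields \<open>Gen\<close> that generate the space from the vacuum, with a
translation operator \<open>T\<close>.  \<open>Sp p\<close> are the vectors of parity \<open>p\<close>; both contain the kernel of \<open>P\<close>, which is
why they meet in that kernel and not in zero.\<close>

locale generating_fields = field_space sc P
  for sc :: "complex \<Rightarrow> 'f::ab_group_add \<Rightarrow> 'f" and P :: "'f \<Rightarrow> 'f" +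
  fixes Gen :: "bool \<Rightarrow> (int \<Rightarrow> 'f \<Rightarrow> 'f) set" and vac :: 'f and T :: "'f \<Rightarrow> 'f" and Sp :: "bool \<Rightarrow> 'f set"
  assumes Sp_subspace: "subspace (Sp p)"
    and Sp_null: "P v = 0 \<Longrightarrow> v \<in> Sp p"
    and Sp_disjoint: "v \<in> Sp False \<Longrightarrow> v \<in> Sp True \<Longrightarrow> P v = 0"
    and vac_P: "P vac = vac" and vac_Sp: "vac \<in> Sp False"
    and T_linear: "Vector_Spaces.linear sc sc T" and T_P: "P (T v) = T v" "T (P v) = T v" and T_vac: "T vac = 0"
    and Gen_field: "x \<in> Gen p \<Longrightarrow> field x"
    and Gen_local: "x \<in> Gen p \<Longrightarrow> y \<in> Gen q \<Longrightarrow> mut_local (super_sign p q) x y"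
    and Gen_T: "x \<in> Gen p \<Longrightarrow> T (x n w) - x n (T w) = sc (- of_int n) (x (n - 1) w)"
    and Gen_vac: "x \<in> Gen p \<Longrightarrow> n \<ge> 0 \<Longrightarrow> x n vac = 0"
    and Gen_parity: "x \<in> Gen p \<Longrightarrow> w \<in> Sp q \<Longrightarrow> x n w \<in> Sp (p \<noteq> q)"
    and generation: "subspace H \<Longrightarrow> (\<And>v. P v = 0 \<Longrightarrow> v \<in> H) \<Longrightarrow> vac \<in> H \<Longrightarrow>
        (\<And>p x n v. x \<in> Gen p \<Longrightarrow> v \<in> H \<Longrightarrow> x n v \<in> H) \<Longrightarrow> H = UNIV"
begin

text \<open>The properties that the vertex operator of a state of parity \<open>p\<close> must have, locality being required with the
generating fields only.\<close>

definition good :: "bool \<Rightarrow> (int \<Rightarrow> 'f \<Rightarrow> 'f) \<Rightarrow> bool" where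
  "good p \<chi> \<longleftrightarrow> field \<chi> \<and> (\<forall>n w. T (\<chi> n w) - \<chi> n (T w) = sc (- of_int n) (\<chi> (n - 1) w)) \<and>
     (\<forall>n\<ge>0. \<chi> n vac = 0) \<and> (\<forall>q n w. w \<in> Sp q \<longrightarrow> \<chi> n w \<in> Sp (p \<noteq> q)) \<and>
     (\<forall>q. \<forall>x\<in>Gen q. mut_local (super_sign p q) \<chi> x)"

lemma goodD:
  assumes "good p \<chi>"
  shows "field \<chi>" "T (\<chi> n w) - \<chi> n (T w) = sc (- of_int n) (\<chi> (n - 1) w)" "n \<ge> 0 \<Longrightarrow> \<chi> n vac = 0"
    "w \<in> Sp q \<Longrightarrow> \<chi> n w \<in> Sp (p \<noteq> q)" "x \<in> Gen q \<Longrightarrow> mut_local (super_sign p q) \<chi> x"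
    "lin (\<chi> n)" "P (\<chi> n w) = \<chi> n w" "\<chi> n (P w) = \<chi> n w"
  using assms fieldD[of \<chi>] unfolding good_def by auto

lemma good_Gen: "x \<in> Gen p \<Longrightarrow> good p x"
  unfolding good_def using Gen_field Gen_T Gen_vac Gen_parity Gen_local by blast

lemma Sp_zero: "0 \<in> Sp p" using Sp_null[of 0] P_simps by simp

lemma Sp_closed: "x \<in> Sp p \<Longrightarrow> y \<in> Sp p \<Longrightarrow> x + y \<in> Sp p" "x \<in> Sp p \<Longrightarrow> sc c x \<in> Sp p" "x \<in> Sp p \<Longrightarrow> y \<in> Sp p \<Longrightarrow> x - y \<in> Sp p"
  using Sp_subspace subspace_add subspace_scale subspace_diff by blast+

lemma Sp_P: "P v \<in> Sp p \<longleftrightarrow> v \<in> Sp p"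
proof -
  have "v - P v \<in> Sp p" by (rule Sp_null) (simp add: P_simps P_idem)
  then show ?thesis using Sp_closed(1)[of "P v" p "v - P v"] Sp_closed(3)[of v p "v - P v"] by auto
qed

lemma bor_add_left:
  assumes "field \<phi>" "field \<phi>'" "field \<psi>"
  shows "bor s (\<lambda>n w. \<phi> n w + \<phi>' n w) \<psi> m k q w = bor s \<phi> \<psi> m k q w + bor s \<phi>' \<psi> m k q w"
  unfolding bor_def lin_simps[OF fieldD(1)[OF assms(3)]]
  by (simp add: hsum_add field_comp_bounded assms algebra_simps)

lemma bor_scale_left:
  assumes "field \<phi>" "field \<psi>"
  shows "bor s (\<lambda>n w. sc c (\<phi> n w)) \<psi> m k q w = sc c (bor s \<phi> \<psi> m k q w)"
  unfolding bor_def lin_simps[OF fieldD(1)[OF assms(2)]]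
  by (simp add: hsum_scale field_comp_bounded assms algebra_simps)

lemma mut_local_add_left:
  assumes "field \<phi>" "field \<phi>'" "field \<psi>" "mut_local s \<phi> \<psi>" "mut_local s \<phi>' \<psi>"
  shows "mut_local s (\<lambda>n w. \<phi> n w + \<phi>' n w) \<psi>"
proof -
  obtain N N' where "\<forall>m\<ge>N. \<forall>k q w. bor s \<phi> \<psi> m k q w = 0" "\<forall>m\<ge>N'. \<forall>k q w. bor s \<phi>' \<psi> m k q w = 0"
    using assms unfolding mut_local_def by blast
  then show ?thesis
    unfolding mut_local_def bor_add_left[OF assms(1-3)] by (intro exI[of _ "max N N'"]) simp
qed

lemma mut_local_scale_left:
  assumes "field \<phi>" "field \<psi>" "mut_local s \<phi> \<psi>"
  shows "mut_local s (\<lambda>n w. sc c (\<phi> n w)) \<psi>"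
  using assms(3) unfolding mut_local_def bor_scale_left[OF assms(1-2)] by (metis scale_zero_right)

lemma field_add: 
  assumes "field \<phi>" "field \<phi>'"
  shows "field (\<lambda>n w. \<phi> n w + \<phi>' n w)"
  unfolding field_def
proof (intro conjI allI)
  note l = lin_simps[OF fieldD(1)[OF assms(1)]] lin_simps[OF fieldD(1)[OF assms(2)]]
  show "lin (\<lambda>w. \<phi> n w + \<phi>' n w)" for n by (rule linI) (simp_all add: l algebra_simps)
  show "\<exists>N. \<forall>n\<ge>N. \<phi> n w + \<phi>' n w = 0" for w
  proof -
    obtain N N' where "\<forall>n\<ge>N. \<phi> n w = 0" "\<forall>n\<ge>N'. \<phi>' n w = 0"
      using fieldD(2)[OF assms(1)] fieldD(2)[OF assms(2)] by meson
    then show ?thesis by (intro exI[of _ "max N N'"]) simp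
  qed
qed (simp_all add: P_simps fieldD(3,4)[OF assms(1)] fieldD(3,4)[OF assms(2)])

lemma field_scale: 
  assumes "field \<phi>"
  shows "field (\<lambda>n w. sc c (\<phi> n w))"
  unfolding field_def
proof (intro conjI allI)
  show "lin (\<lambda>w. sc c (\<phi> n w))" for n
    by (rule linI) (simp_all add: lin_simps[OF fieldD(1)[OF assms(1)]] algebra_simps)
  show "\<exists>N. \<forall>n\<ge>N. sc c (\<phi> n w) = 0" for w using fieldD(2)[OF assms(1), of w] by force
qed (simp_all add: P_simps fieldD(3,4)[OF assms(1)])

lemma good_add:
  assumes "good p \<phi>" "good p \<phi>'"
  shows "good p (\<lambda>n w. \<phi> n w + \<phi>' n w)"
  unfolding good_def
proof (intro conjI allI ballI impI)
  note g = goodD[OF assms(1)] goodD[OF assms(2)]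
  show "field (\<lambda>n w. \<phi> n w + \<phi>' n w)" by (intro field_add g)
  show "T (\<phi> n w + \<phi>' n w) - (\<phi> n (T w) + \<phi>' n (T w)) = sc (- of_int n) (\<phi> (n - 1) w + \<phi>' (n - 1) w)" for n w
    using g(2)[of n w] g(10)[of n w] by (simp add: lin_simps[OF T_linear] algebra_simps)
  show "\<phi> n vac + \<phi>' n vac = 0" if "0 \<le> n" for n using that g(3,11) by simp
  show "\<phi> n w + \<phi>' n w \<in> Sp (p \<noteq> q)" if "w \<in> Sp q" for q n w by (intro Sp_closed g that)
  show "mut_local (super_sign p q) (\<lambda>n w. \<phi> n w + \<phi>' n w) x" if "x \<in> Gen q" for q x
    by (intro mut_local_add_left g that Gen_field[OF that])
qed

lemma good_scale:
  assumes "good p \<phi>"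
  shows "good p (\<lambda>n w. sc c (\<phi> n w))"
  unfolding good_def
proof (intro conjI allI ballI impI)
  note g = goodD[OF assms(1)]
  show "field (\<lambda>n w. sc c (\<phi> n w))" by (intro field_scale g)
  show "T (sc c (\<phi> n w)) - sc c (\<phi> n (T w)) = sc (- of_int n) (sc c (\<phi> (n - 1) w))" for n w
    using arg_cong[OF g(2)[of n w], of "sc c"] by (simp add: lin_simps[OF T_linear] algebra_simps)
  show "sc c (\<phi> n vac) = 0" if "0 \<le> n" for n using that g(3) by simp
  show "sc c (\<phi> n w) \<in> Sp (p \<noteq> q)" if "w \<in> Sp q" for q n w by (intro Sp_closed g that)
  show "mut_local (super_sign p q) (\<lambda>n w. sc c (\<phi> n w)) x" if "x \<in> Gen q" for q x
    by (intro mut_local_scale_left g that Gen_field[OF that])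
qed

definition idf :: "int \<Rightarrow> 'f \<Rightarrow> 'f" where "idf n w = (if n = -1 then P w else 0)"

lemma field_idf: "field idf"
  unfolding field_def
proof (intro conjI allI)
  show "lin (idf n)" for n by (rule linI) (simp_all add: idf_def P_simps)
  show "\<exists>N. \<forall>n\<ge>N. idf n w = 0" for w by (intro exI[of _ 0]) (auto simp: idf_def)
qed (simp_all add: idf_def P_simps P_idem)

lemma idf_local: "field \<psi> \<Longrightarrow> mut_local 1 idf \<psi>"
  by (rule mut_localI[where N = 0])
    (auto simp: field_idf bor_0 idf_def fieldD lin_simps[OF fieldD(1)])

lemma good_idf: "good False idf"
  unfolding good_def
proof (intro conjI allI ballI impI)
  show "mut_local (super_sign False q) idf x" if "x \<in> Gen q" for q x
    using idf_local[OF Gen_field[OF that]] by (simp add: super_sign_simps)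
  show "idf n w \<in> Sp (False \<noteq> q)" if "w \<in> Sp q" for q n w using that by (simp add: idf_def Sp_P Sp_zero)
qed (auto simp: field_idf idf_def T_P lin_simps[OF T_linear])

text \<open>Commuting with \<open>T\<close> is differentiation of fields, and the Leibniz rule holds for the products of fields because
\<open>(z - w)\<^sup>m\<close> is annihilated by the sum of both partial derivatives.\<close>

lemma bor_derivation:
  assumes f: "field \<phi>" "field \<psi>"
    and T: "\<And>n w. T (\<phi> n w) - \<phi> n (T w) = sc (- of_int n) (\<phi> (n - 1) w)"
      "\<And>n w. T (\<psi> n w) - \<psi> n (T w) = sc (- of_int n) (\<psi> (n - 1) w)"
  shows "T (bor s \<phi> \<psi> m k q w) - bor s \<phi> \<psi> m k q (T w)
    = - sc (of_int k) (bor s \<phi> \<psi> m (k - 1) q w) - sc (of_int q) (bor s \<phi> \<psi> m k (q - 1) w)"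
proof -
  have *: "hsum (\<lambda>a b. T (\<phi> a (\<psi> b w))) m k q = hsum (\<lambda>a b. \<phi> a (\<psi> b (T w))) m k q
      - sc (of_int k) (hsum (\<lambda>a b. \<phi> a (\<psi> b w)) m (k - 1) q) - sc (of_int q) (hsum (\<lambda>a b. \<phi> a (\<psi> b w)) m k (q - 1))"
    if f: "field \<phi>" "field \<psi>"
    and T: "\<And>n w. T (\<phi> n w) - \<phi> n (T w) = sc (- of_int n) (\<phi> (n - 1) w)"
      "\<And>n w. T (\<psi> n w) - \<psi> n (T w) = sc (- of_int n) (\<psi> (n - 1) w)" for \<phi> \<psi> k q
  proof -
    let ?D = "\<lambda>a b. sc (of_int a) (\<phi> (a - 1) (\<psi> b w)) + sc (of_int b) (\<phi> a (\<psi> (b - 1) w))"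
    have Z: "T (\<phi> a (\<psi> b w)) = \<phi> a (\<psi> b (T w)) + sc (-1) (?D a b)" for a b
    proof -
      have "T (\<phi> a (\<psi> b w)) = \<phi> a (T (\<psi> b w)) - sc (of_int a) (\<phi> (a - 1) (\<psi> b w))"
        using T(1)[of a "\<psi> b w"] by (simp add: algebra_simps)
      also have "T (\<psi> b w) = \<psi> b (T w) - sc (of_int b) (\<psi> (b - 1) w)"
        using T(2)[of b w] by (simp add: algebra_simps)
      finally show ?thesis by (simp add: lin_simps[OF fieldD(1)[OF f(1)]] algebra_simps)
    qed
    have bD: "mode_bounded ?D"
    proof -
      obtain B where B: "\<And>b. b \<ge> B \<Longrightarrow> \<psi> b w = 0" using fieldD(2)[OF f(2)] by blast
      show ?thesis unfolding mode_bounded_def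
        by (intro exI[of _ "B + 1"]) (auto simp: B lin_simps[OF fieldD(1)[OF f(1)]])
    qed
    have bD': "mode_bounded (\<lambda>a b. sc (-1) (?D a b))"
      using bD unfolding mode_bounded_def by (metis scale_zero_right)
    have "hsum (\<lambda>a b. T (\<phi> a (\<psi> b w))) m k q = hsum (\<lambda>a b. \<phi> a (\<psi> b (T w))) m k q + sc (-1) (hsum ?D m k q)"
      unfolding Z hsum_add[OF field_comp_bounded[OF f] bD'] hsum_scale[OF bD] ..
    also have "hsum ?D m k q = sc (of_int k) (hsum (\<lambda>a b. \<phi> a (\<psi> b w)) m (k - 1) q) + sc (of_int q) (hsum (\<lambda>a b. \<phi> a (\<psi> b w)) m k (q - 1))"
      by (rule hsum_derivation[OF field_comp_bounded[OF f]])
    finally show ?thesis by (simp add: algebra_simps)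
  qed
  show ?thesis
    unfolding bor_apply_lin[OF f T_linear] *[OF f T] *[OF f(2,1) T(2,1)]
    by (simp add: bor_def algebra_simps)
qed

lemma good_nprod:
  assumes "good p \<phi>" "good q \<psi>" "mut_local (super_sign p q) \<phi> \<psi>"
  shows "good (p \<noteq> q) (nprod (super_sign p q) \<phi> m \<psi>)"
  unfolding good_def
proof (intro conjI allI ballI impI)
  note g = goodD[OF assms(1)] and h = goodD[OF assms(2)]
  let ?s = "super_sign p q"
  show "field (nprod ?s \<phi> m \<psi>)" by (intro field_nprod g h)
  show "T (nprod ?s \<phi> m \<psi> n w) - nprod ?s \<phi> m \<psi> n (T w) = sc (- of_int n) (nprod ?s \<phi> m \<psi> (n - 1) w)" for n w
    unfolding nprod_def by (subst bor_derivation) (use g h in auto)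
  show "nprod ?s \<phi> m \<psi> n vac = 0" if "0 \<le> n" for n
  proof -
    have "hsum (\<lambda>a b. \<phi> a (\<psi> b vac)) m 0 n = 0"
      by (subst hsum_eq[where B = 0 and N = 0]) (use that h(3) in \<open>auto simp: lin_simps[OF g(6)]\<close>)
    moreover have "hsum (\<lambda>a b. \<psi> a (\<phi> b vac)) m n 0 = 0"
      by (subst hsum_eq[where B = 0 and N = 0]) (use that g(3) in \<open>auto simp: lin_simps[OF h(6)]\<close>)
    ultimately show ?thesis by (simp add: nprod_def bor_def)
  qed
  show "nprod ?s \<phi> m \<psi> n w \<in> Sp ((p \<noteq> q) \<noteq> r)" if w: "w \<in> Sp r" for r n w
  proof -
    have *: "hsum Z m k n \<in> Sp e" if Z: "\<And>a b. Z a b \<in> Sp e" "mode_bounded Z" for Z k n e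
    proof -
      obtain B where B: "\<And>a b. b \<ge> B \<Longrightarrow> Z a b = 0" using Z(2) unfolding mode_bounded_def by blast
      show ?thesis
        by (subst hsum_eq[where B = B and N = "nat (B - n)"])
          (auto simp: B intro!: subspace_sum[OF Sp_subspace] Sp_closed Z)
    qed
    have "\<phi> a (\<psi> b w) \<in> Sp ((p \<noteq> q) \<noteq> r)" "\<psi> a (\<phi> b w) \<in> Sp ((p \<noteq> q) \<noteq> r)" for a b
      using g(4)[OF h(4)[OF w], of a b] h(4)[OF g(4)[OF w], of a b] by (cases p; cases q; cases r; simp)+
    then show ?thesis unfolding nprod_def bor_def
      by (intro Sp_closed *) (auto intro!: field_comp_bounded g h)
  qed
  show "mut_local (super_sign (p \<noteq> q) r) (nprod ?s \<phi> m \<psi>) x" if "x \<in> Gen r" for r x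
    by (rule mut_local_nprod[OF g(1) h(1) Gen_field[OF that] assms(3) g(5)[OF that] h(5)[OF that]]) (rule super_sign_simps)
qed

lemma nprod_vac:
  assumes "good p \<phi>" "good q \<psi>"
  shows "nprod s \<phi> m \<psi> (-1) vac = \<phi> m (\<psi> (-1) vac)"
proof -
  note g = goodD[OF assms(1)] and h = goodD[OF assms(2)]
  have "hsum (\<lambda>a b. \<phi> a (\<psi> b vac)) m 0 (-1) = \<phi> m (\<psi> (-1) vac)"
    by (subst hsum_eq[where B = 0 and N = 1]) (use h(3) in \<open>auto simp: lin_simps[OF g(6)]\<close>)
  moreover have "hsum (\<lambda>a b. \<psi> a (\<phi> b vac)) m (-1) 0 = 0"
    by (subst hsum_eq[where B = 0 and N = 0]) (use g(3) in \<open>auto simp: lin_simps[OF h(6)]\<close>)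
  ultimately show ?thesis by (simp add: nprod_def bor_def)
qed

text \<open>Goddard's uniqueness theorem.  Translation covariance turns the vanishing of the last mode on the vacuum into the
vanishing of all modes; locality with the generating fields allows to move the field through a word of
modes to the vacuum.\<close>

lemma goddard_uniqueness:
  assumes "good p \<chi>" "\<chi> (-1) vac = 0"
  shows "\<chi> n w = 0"
proof -
  note g = goodD[OF assms(1)]
  have vac: "\<chi> n vac = 0" for n
  proof (induction n rule: int_downward_induct[where B = "-1"])
    case (bound c)
    then show ?case using g(3)[of c] assms(2) by (cases "c = -1") auto
  next
    case (step c)
    show ?case
    proof (cases "c \<ge> -1")
      case True
      then show ?thesis using g(3)[of c] assms(2) by (cases "c = -1") auto
    next
      case False
      have "sc (- of_int (c + 1)) (\<chi> c vac) = 0"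
        using g(2)[of "c + 1" vac] step[of "c + 1"] by (simp add: T_vac lin_simps[OF T_linear] lin_simps[OF g(6)])
      moreover have "c + 1 \<noteq> 0" using False by linarith
      then have "- complex_of_int (c + 1) \<noteq> 0" by (simp only: neg_equal_0_iff_equal of_int_eq_0_iff not_False_eq_True)
      ultimately show ?thesis by (simp only: scale_eq_0_iff simp_thms)
    qed
  qed
  let ?H = "{w. \<forall>n. \<chi> n w = 0}"
  have "?H = UNIV"
  proof (rule generation)
    show "subspace ?H" by (rule subspaceI) (auto simp: lin_simps[OF g(6)])
    show "v \<in> ?H" if "P v = 0" for v using g(8)[of _ v] that lin_simps[OF g(6)] by auto
    show "vac \<in> ?H" using vac by blast
    fix q x k b assume x: "x \<in> Gen q" and b: "b \<in> ?H"
    obtain N where N: "\<And>m k q' w. m \<ge> N \<Longrightarrow> bor (super_sign p q) \<chi> x m k q' w = 0"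
      using g(5)[OF x] unfolding mut_local_def by blast
    obtain B where B: "\<And>n. n \<ge> B \<Longrightarrow> x n b = 0" using fieldD(2)[OF Gen_field[OF x]] by blast
    have "\<forall>a. \<chi> a (x k b) = 0"
    proof (induction k rule: int_downward_induct[where B = B])
      case (bound c)
      then show ?case by (simp add: B lin_simps[OF g(6)])
    next
      case (step c)
      show ?case
      proof
        fix a
        (* By locality the mode with the smallest index of x is a combination of those with larger ones. *)
        have "0 = bor (super_sign p q) \<chi> x N (a - N) c b" using N by simp
        also have "\<dots> = hsum (\<lambda>a c. \<chi> a (x c b)) N (a - N) c"
          using b by (simp add: bor_def lin_simps[OF fieldD(1)[OF Gen_field[OF x]]])
        also have "\<dots> = (\<Sum>i<Suc (nat (B - c)). sc ((-1) ^ i * (of_int N gchoose i)) (\<chi> (N + (a - N) - int i) (x (c + int i) b)))"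
          by (rule hsum_eq[where B = B]) (auto simp: B lin_simps[OF g(6)])
        also have "\<dots> = \<chi> a (x c b)"
          unfolding sum.lessThan_Suc_shift using step by simp
        finally show "\<chi> a (x c b) = 0" by simp
      qed
    qed
    then show "x k b \<in> ?H" by blast
  qed
  then show ?thesis by blast
qed

lemma good_unique:
  assumes "good p \<chi>" "good p \<chi>'" "\<chi> (-1) vac = \<chi>' (-1) vac"
  shows "\<chi> = \<chi>'"
proof (intro ext)
  fix n w
  have "good p (\<lambda>n w. \<chi> n w + sc (-1) (\<chi>' n w))" by (intro good_add good_scale assms)
  from goddard_uniqueness[OF this, of n w] assms(3) show "\<chi> n w = \<chi>' n w" by simp
qed

text \<open>Locality with every good field is what makes this class closed under products with generating fields, by Dong's
lemma: the third field in that lemma has to be an arbitrary member of the class.\<close>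

definition good' :: "bool \<Rightarrow> (int \<Rightarrow> 'f \<Rightarrow> 'f) \<Rightarrow> bool" where
  "good' p \<chi> \<longleftrightarrow> good p \<chi> \<and> (\<forall>q \<psi>. good q \<psi> \<longrightarrow> mut_local (super_sign p q) \<chi> \<psi>)"

lemma good'D: "good' p \<chi> \<Longrightarrow> good p \<chi>" "good' p \<chi> \<Longrightarrow> good q \<psi> \<Longrightarrow> mut_local (super_sign p q) \<chi> \<psi>"
  unfolding good'_def by auto

lemma good'I: "good p \<chi> \<Longrightarrow> (\<And>q \<psi>. good q \<psi> \<Longrightarrow> mut_local (super_sign p q) \<chi> \<psi>) \<Longrightarrow> good' p \<chi>"
  unfolding good'_def by auto

lemma good'_add: "good' p \<phi> \<Longrightarrow> good' p \<psi> \<Longrightarrow> good' p (\<lambda>n w. \<phi> n w + \<psi> n w)"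
  by (rule good'I[OF good_add[OF good'D(1) good'D(1)] mut_local_add_left[OF goodD(1)[OF good'D(1)] goodD(1)[OF good'D(1)]
    goodD(1) good'D(2) good'D(2)]])

lemma good'_scale: "good' p \<phi> \<Longrightarrow> good' p (\<lambda>n w. sc c (\<phi> n w))"
  by (rule good'I[OF good_scale[OF good'D(1)] mut_local_scale_left[OF goodD(1)[OF good'D(1)] goodD(1) good'D(2)]])

lemma good'_idf: "good' False idf"
proof (rule good'I[OF good_idf])
  fix q \<psi> assume "good q \<psi>"
  then show "mut_local (super_sign False q) idf \<psi>" using idf_local[OF goodD(1)] by (simp add: super_sign_simps)
qed

lemma good'_zero: "good' p (\<lambda>n w. 0)"
proof -
  have "mut_local s (\<lambda>n w. 0) \<psi>" if "field \<psi>" for s \<psi>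
    unfolding mut_local_def bor_def using lin_simps(4)[OF fieldD(1)[OF that]] by simp
  moreover have "field (\<lambda>n w. 0)" unfolding field_def by (auto intro!: linI simp: P_simps)
  moreover have "good p (\<lambda>n w. 0)"
    unfolding good_def using calculation Gen_field by (auto simp: lin_simps[OF T_linear] Sp_zero)
  ultimately show ?thesis by (intro good'I) (auto dest: goodD(1))
qed

lemma good'_nprod:
  assumes x: "x \<in> Gen p" and "good' q \<psi>"
  shows "good' (p \<noteq> q) (nprod (super_sign p q) x m \<psi>)"
proof -
  have \<psi>: "good q \<psi>" and l: "\<And>r \<chi>. good r \<chi> \<Longrightarrow> mut_local (super_sign q r) \<psi> \<chi>"
    using assms by (auto dest: good'D)
  note gx = good_Gen[OF x]
  have x\<psi>: "mut_local (super_sign p q) x \<psi>"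
    using mut_local_sym[OF l[OF gx]] super_sign_simps(1,2) by simp
  show ?thesis
  proof (rule good'I)
    show "good (p \<noteq> q) (nprod (super_sign p q) x m \<psi>)" by (rule good_nprod[OF gx \<psi> x\<psi>])
    fix r \<chi> assume \<chi>: "good r \<chi>"
    have "mut_local (super_sign p r) x \<chi>"
      using mut_local_sym[OF goodD(5)[OF \<chi> x]] super_sign_simps(1,2) by simp
    then show "mut_local (super_sign (p \<noteq> q) r) (nprod (super_sign p q) x m \<psi>) \<chi>"
      by (rule mut_local_nprod[OF goodD(1)[OF gx] goodD(1)[OF \<psi>] goodD(1)[OF \<chi>] x\<psi> _ l[OF \<chi>]]) (rule super_sign_simps)
  qed
qed

text \<open>A vector has no parity in general, so its field is kept as a pair of an even and an odd field.\<close>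

definition pair_state :: "'f \<Rightarrow> (int \<Rightarrow> 'f \<Rightarrow> 'f) \<Rightarrow> (int \<Rightarrow> 'f \<Rightarrow> 'f) \<Rightarrow> bool" where
  "pair_state v \<chi>0 \<chi>1 \<longleftrightarrow> good' False \<chi>0 \<and> good' True \<chi>1 \<and> P v = \<chi>0 (-1) vac + \<chi>1 (-1) vac"

lemma pair_stateI: "good' False \<chi>0 \<Longrightarrow> good' True \<chi>1 \<Longrightarrow> P v = \<chi>0 (-1) vac + \<chi>1 (-1) vac \<Longrightarrow> \<exists>\<chi>0 \<chi>1. pair_state v \<chi>0 \<chi>1"
  unfolding pair_state_def by blast

lemma pair_stateD:
  assumes "pair_state v \<chi>0 \<chi>1"
  shows "good' False \<chi>0" "good' True \<chi>1" "P v = \<chi>0 (-1) vac + \<chi>1 (-1) vac"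
  using assms unfolding pair_state_def by auto

text \<open>The vectors that are created by fields form a subspace that contains the vacuum (created by the identity field) and,
by products with the generators, is closed under their modes.\<close>

lemma good'_exists_pair: "\<exists>\<chi>0 \<chi>1. pair_state v \<chi>0 \<chi>1"
proof -
  let ?H = "{v. \<exists>\<chi>0 \<chi>1. pair_state v \<chi>0 \<chi>1}"
  have "?H = UNIV"
  proof (rule generation)
    show "subspace ?H"
    proof (rule subspaceI; unfold mem_Collect_eq)
      show "\<exists>\<chi>0 \<chi>1. pair_state 0 \<chi>0 \<chi>1" by (rule pair_stateI[OF good'_zero good'_zero]) (simp add: P_simps)
      fix x y assume "\<exists>\<chi>0 \<chi>1. pair_state x \<chi>0 \<chi>1" "\<exists>\<chi>0 \<chi>1. pair_state y \<chi>0 \<chi>1"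
      then obtain a b a' b' where ab: "pair_state x a b" "pair_state y a' b'" by (elim exE)
      note ab = pair_stateD[OF ab(1)] pair_stateD[OF ab(2)]
      show "\<exists>\<chi>0 \<chi>1. pair_state (x + y) \<chi>0 \<chi>1"
        by (rule pair_stateI[OF good'_add[OF ab(1,4)] good'_add[OF ab(2,5)]]) (simp add: P_simps(1) ab)
    next
      fix c x assume "\<exists>\<chi>0 \<chi>1. pair_state x \<chi>0 \<chi>1"
      then obtain a b where ab: "pair_state x a b" by (elim exE)
      note ab = pair_stateD[OF ab]
      show "\<exists>\<chi>0 \<chi>1. pair_state (sc c x) \<chi>0 \<chi>1"
        by (rule pair_stateI[OF good'_scale[OF ab(1), of c] good'_scale[OF ab(2), of c]]) (simp add: P_simps(3) ab scale_right_distrib)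
    qed
    show "v \<in> ?H" if "P v = 0" for v
      unfolding mem_Collect_eq by (rule pair_stateI[OF good'_zero good'_zero]) (simp add: that)
    show "vac \<in> ?H"
      unfolding mem_Collect_eq by (rule pair_stateI[OF good'_idf good'_zero]) (simp add: idf_def)
    fix p x n v assume x: "x \<in> Gen p" and "v \<in> ?H"
    then obtain a b where ab: "pair_state v a b" by (elim CollectE exE)
    note ab = pair_stateD[OF ab]
    note gx = good_Gen[OF x]
    let ?a = "nprod (super_sign p False) x n a" and ?b = "nprod (super_sign p True) x n b"
    have a: "?a (-1) vac = x n (a (-1) vac)" "?b (-1) vac = x n (b (-1) vac)"
      by (rule nprod_vac[OF gx good'D(1)[OF ab(1)]], rule nprod_vac[OF gx good'D(1)[OF ab(2)]])
    have e: "P (x n v) = ?a (-1) vac + ?b (-1) vac"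
      unfolding a using goodD(7,8)[OF gx, of n v] ab(3) by (simp add: lin_simps(1)[OF goodD(6)[OF gx]])
    have g: "good' p ?a" "good' (\<not> p) ?b" using good'_nprod[OF x ab(1)] good'_nprod[OF x ab(2)] by auto
    show "x n v \<in> ?H" unfolding mem_Collect_eq
    proof (cases p)
      case True
      show "\<exists>\<chi>0 \<chi>1. pair_state (x n v) \<chi>0 \<chi>1"
        by (rule pair_stateI[of ?b ?a _, OF _ _ trans[OF e add.commute]]) (use g True in simp_all)
    next
      case False
      show "\<exists>\<chi>0 \<chi>1. pair_state (x n v) \<chi>0 \<chi>1"
        by (rule pair_stateI[of ?a ?b _, OF _ _ e]) (use g False in simp_all)
    qed
  qed
  then show ?thesis by (simp add: set_eq_iff)
qed

lemma good_state_Sp: "good p \<chi> \<Longrightarrow> \<chi> n vac \<in> Sp p"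
  using goodD(4)[OF _ vac_Sp] by force

text \<open>For a homogeneous vector the field of the other parity creates a vector in the kernel of \<open>P\<close>, and can be dropped.\<close>

lemma good'_exists: assumes "v \<in> Sp p" shows "\<exists>\<chi>. good' p \<chi> \<and> \<chi> (-1) vac = P v"
proof -
  obtain a b where "pair_state v a b"
    using good'_exists_pair by blast
  note ab = pair_stateD[OF this]
  let ?a = "a (-1) vac" and ?b = "b (-1) vac"
  have S: "?a \<in> Sp False" "?b \<in> Sp True" "P ?a = ?a" "P ?b = ?b"
    using good_state_Sp[OF good'D(1)] goodD(7)[OF good'D(1)] ab(1,2) by blast+
  show ?thesis
  proof (cases p)
    case True
    then have "P v - ?b \<in> Sp True" by (intro Sp_closed(3) S(2)) (use assms Sp_P in auto)
    then have "?a = 0" using Sp_disjoint[OF S(1)] S(3) ab(3) by simp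
    then show ?thesis using ab True by (intro exI[of _ b]) simp
  next
    case False
    then have "P v - ?a \<in> Sp False" by (intro Sp_closed(3) S(1)) (use assms Sp_P in auto)
    then have "?b = 0" using Sp_disjoint[OF _ S(2)] S(4) ab(3) by simp
    then show ?thesis using ab False by (intro exI[of _ a]) simp
  qed
qed

definition Yh :: "bool \<Rightarrow> 'f \<Rightarrow> int \<Rightarrow> 'f \<Rightarrow> 'f" where
  "Yh p v = (SOME \<chi>. good' p \<chi> \<and> \<chi> (-1) vac = P v)"

lemma Yh: assumes "v \<in> Sp p" shows "good' p (Yh p v)" "good p (Yh p v)" "Yh p v (-1) vac = P v"
proof -
  note * = someI_ex[OF good'_exists[OF assms], folded Yh_def]
  show "good' p (Yh p v)" "Yh p v (-1) vac = P v"
    by (rule conjunct1[OF *], rule conjunct2[OF *])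
  show "good p (Yh p v)" by (rule good'D(1)[OF conjunct1[OF *]])
qed

lemma Yh_eqI: "v \<in> Sp p \<Longrightarrow> good p \<chi> \<Longrightarrow> \<chi> (-1) vac = P v \<Longrightarrow> Yh p v = \<chi>"
  by (rule good_unique[OF Yh(2)]) (simp_all add: Yh(3))

lemma Yh_null: "P v = 0 \<Longrightarrow> Yh p v n w = 0"
  by (rule goddard_uniqueness[OF Yh(2)[OF Sp_null]]) (simp_all add: Yh(3) Sp_null)

lemma Yh_add: "u \<in> Sp p \<Longrightarrow> v \<in> Sp p \<Longrightarrow> Yh p (u + v) n w = Yh p u n w + Yh p v n w"
  using Yh_eqI[OF Sp_closed(1) good_add[OF Yh(2) Yh(2)], of u p v u v] Yh(3) by (simp add: P_simps)

lemma Yh_scale: "v \<in> Sp p \<Longrightarrow> Yh p (sc c v) n w = sc c (Yh p v n w)"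
  by (subst Yh_eqI[OF Sp_closed(2) good_scale[OF Yh(2)]]) (simp_all add: Yh(3) P_simps)

lemma parity_decomposition: "\<exists>a b. a \<in> Sp False \<and> b \<in> Sp True \<and> v = a + b"
proof -
  obtain a b where "pair_state v a b"
    using good'_exists_pair by blast
  note ab = pair_stateD[OF this]
  have "v - P v \<in> Sp False" by (rule Sp_null) (simp add: P_simps P_idem)
  moreover have "a (-1) vac \<in> Sp False" "b (-1) vac \<in> Sp True" using good_state_Sp[OF good'D(1)] ab(1,2) by blast+
  moreover have "v = (v - P v + a (-1) vac) + b (-1) vac" using ab(3) by simp
  ultimately show ?thesis using Sp_closed(1)[of "v - P v" False "a (-1) vac"] by blast
qed

definition part :: "'f \<Rightarrow> 'f \<times> 'f" where
  "part v = (SOME (a, b). a \<in> Sp False \<and> b \<in> Sp True \<and> v = a + b)"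

lemma part: "fst (part v) \<in> Sp False" "snd (part v) \<in> Sp True" "v = fst (part v) + snd (part v)"
proof -
  have "\<exists>ab. case ab of (a, b) \<Rightarrow> a \<in> Sp False \<and> b \<in> Sp True \<and> v = a + b" using parity_decomposition by force
  from someI_ex[OF this] show "fst (part v) \<in> Sp False" "snd (part v) \<in> Sp True" "v = fst (part v) + snd (part v)"
    unfolding part_def by (auto split: prod.splits)
qed

definition Y :: "'f \<Rightarrow> int \<Rightarrow> 'f \<Rightarrow> 'f" where
  "Y v n w = Yh False (fst (part v)) n w + Yh True (snd (part v)) n w"

lemma Y_eq:
  assumes "a \<in> Sp False" "b \<in> Sp True"
  shows "Y (a + b) n w = Yh False a n w + Yh True b n w"
proof -
  let ?a = "fst (part (a + b))" and ?b = "snd (part (a + b))"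
  note p = part[of "a + b"]
  have e: "?a - a = b - ?b" using p(3) by (simp add: algebra_simps)
  have Sa: "?a - a \<in> Sp False" "?b - b \<in> Sp True" using Sp_closed(3)[OF p(1) assms(1)] Sp_closed(3)[OF p(2) assms(2)] .
  have "P (?a - a) = 0" using e Sa Sp_disjoint Sp_closed(3)[OF assms(2) p(2)] by simp
  moreover have "P (?b - b) = 0"
  proof -
    have "?b - b = - (?a - a)" using e by simp
    then show ?thesis using calculation by (simp add: P_simps)
  qed
  moreover have "Yh False (a + (?a - a)) n w = Yh False a n w + Yh False (?a - a) n w"
    by (rule Yh_add[OF assms(1) Sa(1)])
  moreover have "Yh True (b + (?b - b)) n w = Yh True b n w + Yh True (?b - b) n w"
    by (rule Yh_add[OF assms(2) Sa(2)])
  ultimately show ?thesis unfolding Y_def by (simp add: Yh_null)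
qed

lemma Y_homogeneous: "v \<in> Sp p \<Longrightarrow> Y v = Yh p v"
  using Y_eq[of v 0] Y_eq[of 0 v] Sp_zero Yh_null[of 0] by (cases p) (auto simp: P_simps fun_eq_iff)

lemma Y_add_left: "Y (u + v) n w = Y u n w + Y v n w"
proof -
  note u = part[of u] and v = part[of v]
  have e: "u + v = (fst (part u) + fst (part v)) + (snd (part u) + snd (part v))"
    by (rule trans[OF arg_cong2[where f = "(+)", OF u(3) v(3)]]) (simp only: ac_simps)
  have "Y (u + v) n w = Yh False (fst (part u) + fst (part v)) n w + Yh True (snd (part u) + snd (part v)) n w"
    by (subst e, rule Y_eq) (intro Sp_closed u(1,2) v(1,2))+
  then show ?thesis by (simp add: Y_def Yh_add u(1,2) v(1,2))
qed

lemma Y_scale_left: "Y (sc c v) n w = sc c (Y v n w)"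
proof -
  note v = part[of v]
  have e: "sc c v = sc c (fst (part v)) + sc c (snd (part v))"
    by (rule trans[OF arg_cong[where f = "sc c", OF v(3)] scale_right_distrib])
  have "Y (sc c v) n w = Yh False (sc c (fst (part v))) n w + Yh True (sc c (snd (part v))) n w"
    by (subst e, rule Y_eq) (intro Sp_closed v(1,2))+
  then show ?thesis by (simp add: Y_def Yh_scale v(1,2) scale_right_distrib)
qed

lemma Y_linear_right: "lin (Y v n)"
  unfolding Y_def
  by (intro linI) (simp_all add: lin_simps[OF goodD(6)[OF Yh(2)[OF part(1)]]] lin_simps[OF goodD(6)[OF Yh(2)[OF part(2)]]] algebra_simps)

lemma Y_P: "P (Y v n w) = Y v n w" "Y v n (P w) = Y v n w"
  unfolding Y_def using goodD(7,8)[OF Yh(2)[OF part(1)]] goodD(7,8)[OF Yh(2)[OF part(2)]]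
  by (simp_all add: P_simps)

lemma Y_null: "P v = 0 \<Longrightarrow> Y v n w = 0"
  by (simp add: Y_homogeneous[OF Sp_null[of v False]] Yh_null)

lemma Y_truncation: "\<exists>N. \<forall>n\<ge>N. Y u n v = 0"
  using fieldD(2)[OF field_add[OF goodD(1)[OF Yh(2)[OF part(1)]] goodD(1)[OF Yh(2)[OF part(2)]]]]
  unfolding Y_def .

lemma Y_parity: "u \<in> Sp p \<Longrightarrow> v \<in> Sp q \<Longrightarrow> Y u n v \<in> Sp (p \<noteq> q)"
  using goodD(4)[OF Yh(2)] by (simp add: Y_homogeneous)

lemma Y_vac_left: "Y vac n w = (if n = -1 then P w else 0)"
proof -
  have "Yh False vac = idf" by (rule Yh_eqI[OF vac_Sp good_idf]) (simp add: idf_def)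
  then show ?thesis by (simp add: Y_homogeneous[OF vac_Sp] idf_def)
qed

lemma Y_creation: "Y v (-1) vac = P v"
  unfolding Y_def Yh(3)[OF part(1)] Yh(3)[OF part(2)] P_simps(1)[symmetric] part(3)[symmetric] ..

lemma Y_annihilation: "n \<ge> 0 \<Longrightarrow> Y v n vac = 0"
  unfolding Y_def using goodD(3)[OF Yh(2)[OF part(1)]] goodD(3)[OF Yh(2)[OF part(2)]] by simp

lemma Y_T: "T (Y v n w) - Y v n (T w) = sc (- of_int n) (Y v (n - 1) w)"
  unfolding Y_def using goodD(2)[OF Yh(2)[OF part(1)], of v n w] goodD(2)[OF Yh(2)[OF part(2)], of v n w]
  by (simp add: lin_simps[OF T_linear] algebra_simps)

lemma Y_generator: "x \<in> Gen p \<Longrightarrow> Y (x (-1) vac) = x"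
  using Y_homogeneous[OF good_state_Sp[OF good_Gen]] Yh_eqI[OF good_state_Sp[OF good_Gen] good_Gen] goodD(7)[OF good_Gen]
  by simp

text \<open>Both sides are fields that create the vector \<open>u\<^sub>m v\<close>.\<close>

lemma Y_nprod:
  assumes "u \<in> Sp p" "v \<in> Sp q"
  shows "Y (Y u m v) = nprod (super_sign p q) (Y u) m (Y v)"
proof -
  note gu = Yh[OF assms(1)] and gv = Yh[OF assms(2)]
  have l: "mut_local (super_sign p q) (Yh p u) (Yh q v)" using gu(1) gv(2) by (blast dest: good'D)
  have "Yh (p \<noteq> q) (Y u m v) = nprod (super_sign p q) (Yh p u) m (Yh q v)"
  proof (rule Yh_eqI[OF Y_parity[OF assms] good_nprod[OF gu(2) gv(2) l]])
    show "nprod (super_sign p q) (Yh p u) m (Yh q v) (- 1) vac = P (Y u m v)"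
      unfolding nprod_vac[OF gu(2) gv(2)] gv(3) Y_P Y_homogeneous[OF assms(1)] goodD(7,8)[OF gu(2)] ..
  qed
  then show ?thesis
    using Y_homogeneous[OF Y_parity[OF assms], of m] by (simp add: Y_homogeneous[OF assms(1)] Y_homogeneous[OF assms(2)])
qed

text \<open>The Borcherds identity for the fields of \<open>u\<close> and \<open>v\<close>, with products of fields rewritten as fields of products.\<close>

lemma Y_jacobi:
  assumes "u \<in> Sp p" "v \<in> Sp q"
  shows "Sum_any (\<lambda>i. sc ((-1) ^ i * (of_int m gchoose i)) (Y u (m + k - int i) (Y v (n + int i) w)
       - sc (super_sign p q * (-1) powi m) (Y v (m + n - int i) (Y u (k + int i) w))))
     = Sum_any (\<lambda>i. sc (of_int k gchoose i) (Y (Y u (m + int i) v) (n + k - int i) w))"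
proof -
  note gu = Yh[OF assms(1), folded Y_homogeneous[OF assms(1)]] and gv = Yh[OF assms(2), folded Y_homogeneous[OF assms(2)]]
  let ?s = "super_sign p q"
  have l: "mut_local ?s (Y u) (Y v)" using gu(1) gv(2) by (blast dest: good'D)
  obtain B where B: "\<And>b. b \<ge> B \<Longrightarrow> Y v b w = 0" using Y_truncation by blast
  obtain B' where B': "\<And>b. b \<ge> B' \<Longrightarrow> Y u b w = 0" using Y_truncation by blast
  note z = lin_simps(4)[OF Y_linear_right]
  define N where "N = nat (max (B - n) (B' - k))"
  have N: "n + int i \<ge> B" "k + int i \<ge> B'" if "i \<ge> N" for i using that unfolding N_def by linarith+
  have "Sum_any (\<lambda>i. sc (of_int k gchoose i) (Y (Y u (m + int i) v) (n + k - int i) w)) = bor ?s (Y u) (Y v) m k n w"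
    unfolding Y_nprod[OF assms] by (rule borcherds_identity[OF goodD(1)[OF gu(2)] goodD(1)[OF gv(2)] l])
  also have "\<dots> = (\<Sum>i<N. sc ((-1) ^ i * (of_int m gchoose i)) (Y u (m + k - int i) (Y v (n + int i) w)
       - sc (super_sign p q * (-1) powi m) (Y v (m + n - int i) (Y u (k + int i) w))))"
    unfolding bor_def
    by (subst hsum_eq[where B = B and N = N], simp add: B z, use N in blast,
        subst hsum_eq[where B = B' and N = N], simp add: B' z, use N in blast)
      (simp add: scale_right_diff_distrib sum_subtractf scale_sum_right ac_simps)
  also have "\<dots> = Sum_any (\<lambda>i. sc ((-1) ^ i * (of_int m gchoose i)) (Y u (m + k - int i) (Y v (n + int i) w)
       - sc (super_sign p q * (-1) powi m) (Y v (m + n - int i) (Y u (k + int i) w))))"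
    by (rule Sum_any_eq_sum[symmetric]) (simp add: B B' N z)
  finally show ?thesis by simp
qed

end

section \<open>A functional on the tensor algebra of a split Lie superalgebra\<close>

text \<open>A Lie superalgebra with a decomposition, given by the projection \<open>pos\<close>, into the subalgebras that are the
image and the kernel of \<open>pos\<close>, and a character \<open>chi\<close> of the first.  Words over it represent vectors of the module
induced from \<open>chi\<close>.\<close>

locale split_lie_superalgebra =
  fixes scl :: "complex \<Rightarrow> 'l::ab_group_add \<Rightarrow> 'l" and br :: "'l \<Rightarrow> 'l \<Rightarrow> 'l" and hom :: "bool \<Rightarrow> 'l set"
    and ev od pos :: "'l \<Rightarrow> 'l" and chi :: "'l \<Rightarrow> complex"
  assumes br_add: "br (x + y) z = br x z + br y z" "br x (y + z) = br x y + br x z"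
    and br_scale: "br (scl c x) y = scl c (br x y)" "br x (scl c y) = scl c (br x y)"
    and ev_lin: "ev (x + y) = ev x + ev y" "ev (scl c x) = scl c (ev x)"
    and od_lin: "od (x + y) = od x + od y" "od (scl c x) = scl c (od x)"
    and pos_lin: "pos (x + y) = pos x + pos y" "pos (scl c x) = scl c (pos x)"
    and chi_lin: "chi (x + y) = chi x + chi y" "chi (scl c x) = c * chi x"
    and scl_minus: "scl (-1) x = - x" and scl_one: "scl 1 x = x"
    and scl_diff: "scl c (x - y) = scl c x - scl c y"
    and ev_hom: "ev x \<in> hom False" and od_hom: "od x \<in> hom True"
    and ev_od: "x = ev x + od x"
    and hom_even: "x \<in> hom False \<Longrightarrow> ev x = x \<and> od x = 0"
    and hom_odd: "x \<in> hom True \<Longrightarrow> ev x = 0 \<and> od x = x"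
    and hom_diff: "x \<in> hom p \<Longrightarrow> y \<in> hom p \<Longrightarrow> x - y \<in> hom p"
    and br_hom: "x \<in> hom p \<Longrightarrow> y \<in> hom q \<Longrightarrow> br x y \<in> hom (p \<noteq> q)"
    and skew: "x \<in> hom p \<Longrightarrow> y \<in> hom q \<Longrightarrow> br x y = scl (- super_sign p q) (br y x)"
    and jacobi: "x \<in> hom p \<Longrightarrow> y \<in> hom q \<Longrightarrow> br x (br y z) = br (br x y) z + scl (super_sign p q) (br y (br x z))"
    and pos_pos: "pos (pos x) = pos x"
    and pos_hom: "x \<in> hom p \<Longrightarrow> pos x \<in> hom p"
    and pos_br: "pos x = x \<Longrightarrow> pos y = y \<Longrightarrow> pos (br x y) = br x y"
    and neg_br: "pos x = 0 \<Longrightarrow> pos y = 0 \<Longrightarrow> pos (br x y) = 0"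
    and chi_br: "pos x = x \<Longrightarrow> pos y = y \<Longrightarrow> chi (br x y) = 0"
    and chi_odd: "x \<in> hom True \<Longrightarrow> chi x = 0"
begin

lemma br_zero: "br x 0 = 0" "br 0 x = 0" using br_add(2)[of x 0 0] br_add(1)[of 0 0 x] by auto
lemma br_minus: "br x (- y) = - br x y" using br_add(2)[of x y "- y"] by (simp add: br_zero eq_neg_iff_add_eq_0 add.commute)
lemma ev_zero: "ev 0 = 0" using ev_lin(1)[of 0 0] by simp
lemma od_zero: "od 0 = 0" using od_lin(1)[of 0 0] by simp
lemma chi_zero: "chi 0 = 0" using chi_lin(1)[of 0 0] by simp
lemma pos_minus: "pos (x - y) = pos x - pos y" using pos_lin(1)[of "x - y" y] by (simp add: algebra_simps)

text \<open>The sign rule is encoded by the parity automorphism, so that it makes sense for letters that are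
  not homogeneous.\<close>

definition th :: "bool \<Rightarrow> 'l \<Rightarrow> 'l" where
  "th p x = (if p then ev x - od x else x)"

lemma th_lin: "th p (x + y) = th p x + th p y" "th p (scl c x) = scl c (th p x)"
  by (simp_all add: th_def ev_lin od_lin scl_diff algebra_simps)

lemma th_hom: "y \<in> hom q \<Longrightarrow> th p y = scl (super_sign p q) y"
  using hom_even[of y] hom_odd[of y] by (cases p; cases q) (auto simp: th_def super_sign_def scl_one scl_minus)

lemma pos_hom_ev: "pos x = 0 \<Longrightarrow> pos (ev x) = 0" and pos_hom_od: "pos x = 0 \<Longrightarrow> pos (od x) = 0"
proof -
  have *: "pos (ev x) = ev (pos x) \<and> pos (od x) = od (pos x)"
  proof -
    have "pos x = pos (ev x) + pos (od x)" by (simp flip: pos_lin(1) ev_od)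
    then show ?thesis
      using hom_even[OF pos_hom[OF ev_hom[of x]]] hom_odd[OF pos_hom[OF od_hom[of x]]] ev_lin(1) od_lin(1) by simp
  qed
  show "pos x = 0 \<Longrightarrow> pos (ev x) = 0" "pos x = 0 \<Longrightarrow> pos (od x) = 0" using * ev_zero od_zero by auto
qed

lemma pos_th: "pos x = 0 \<Longrightarrow> pos (th p x) = 0"
  by (simp add: th_def pos_minus pos_hom_ev pos_hom_od)

text \<open>The value of \<open>f\<close> on the word that the derivation \<open>[x, -]\<close> of parity \<open>p\<close> produces; \<open>x\<close> passes the letters in front of
the one that it hits, which produces the signs \<open>th p\<close>.\<close>

primrec dsum :: "bool \<Rightarrow> 'l \<Rightarrow> ('l list \<Rightarrow> complex) \<Rightarrow> 'l list \<Rightarrow> complex" where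
  "dsum p x f [] = 0"
| "dsum p x f (y # w) = f (br x y # w) + dsum p x (\<lambda>v. f (th p y # v)) w"

lemma dsum_cong: "(\<And>v. length v = length w \<Longrightarrow> f v = g v) \<Longrightarrow> dsum p x f w = dsum p x g w"
proof (induction w arbitrary: f g)
  case (Cons y w)
  have "dsum p x (\<lambda>v. f (th p y # v)) w = dsum p x (\<lambda>v. g (th p y # v)) w"
    by (rule Cons.IH) (simp add: Cons.prems)
  then show ?case using Cons.prems by simp
qed simp

lemma dsum_fun_add: "dsum p x (\<lambda>v. f v + g v) w = dsum p x f w + dsum p x g w"
  by (induction w arbitrary: f g) (simp_all add: algebra_simps)

lemma dsum_fun_scale: "dsum p x (\<lambda>v. c * f v) w = c * dsum p x f w"
  by (induction w arbitrary: f) (simp_all add: algebra_simps)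

lemma dsum_fun_zero: "dsum p x (\<lambda>v. 0) w = 0"
  by (induction w) simp_all

lemma dsum_append: "dsum p x f (u @ w) = dsum p x (\<lambda>v. f (v @ w)) u + dsum p x (\<lambda>v. f (map (th p) u @ v)) w"
  by (induction u arbitrary: f) simp_all

text \<open>Multilinearity on words of length at most \<open>n\<close>; the bound is needed for the recursion that defines the functional.\<close>

definition ml :: "nat \<Rightarrow> ('l list \<Rightarrow> complex) \<Rightarrow> bool" where
  "ml n f \<longleftrightarrow> (\<forall>u v x y c. length u + length v < n \<longrightarrow>
     f (u @ (x + y) # v) = f (u @ x # v) + f (u @ y # v) \<and> f (u @ scl c x # v) = c * f (u @ x # v))"

lemma mlD:
  assumes "ml n f" "length u + length v < n"
  shows "f (u @ (x + y) # v) = f (u @ x # v) + f (u @ y # v)" "f (u @ scl c x # v) = c * f (u @ x # v)"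
  using assms unfolding ml_def by blast+

lemma mlD_Cons:
  assumes "ml n f" "length v < n"
  shows "f ((x + y) # v) = f (x # v) + f (y # v)" "f (scl c x # v) = c * f (x # v)"
  using mlD[OF assms(1), of "[]" v] assms(2) by auto

lemma ml_Cons: "ml (Suc n) f \<Longrightarrow> ml n (\<lambda>v. f (y # v))"
  unfolding ml_def by (metis append_Cons length_Cons add_Suc Suc_less_eq)

lemma dsum_linear:
  assumes "ml n f" "length w \<le> n"
  shows "dsum p (x + y) f w = dsum p x f w + dsum p y f w \<and> dsum p (scl c x) f w = c * dsum p x f w"
  using assms
proof (induction w arbitrary: f n)
  case (Cons z w)
  then obtain m where m: "n = Suc m" by (cases n) auto
  have "ml m (\<lambda>v. f (th p z # v))" using Cons.prems(1) m ml_Cons by blast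
  from Cons.IH[OF this] Cons.prems m show ?case
    by (simp add: br_add br_scale mlD_Cons[OF Cons.prems(1)] algebra_simps)
qed simp

lemma ml_dsum:
  assumes "ml n f"
  shows "ml n (dsum p x f)"
proof -
  have "dsum p x f (u @ (a + b) # v) = dsum p x f (u @ a # v) + dsum p x f (u @ b # v) \<and> dsum p x f (u @ scl c a # v) = c * dsum p x f (u @ a # v)"
    if "length u + length v < n" for u v a b c
    using assms that
  proof (induction u arbitrary: f n)
    case Nil
    have 1: "dsum p x (\<lambda>v'. f (th p (a + b) # v')) v = dsum p x (\<lambda>v'. f (th p a # v') + f (th p b # v')) v"
      by (rule dsum_cong) (use Nil in \<open>simp add: th_lin mlD_Cons\<close>)
    have 2: "dsum p x (\<lambda>v'. f (th p (scl c a) # v')) v = dsum p x (\<lambda>v'. c * f (th p a # v')) v"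
      by (rule dsum_cong) (use Nil in \<open>simp add: th_lin mlD_Cons\<close>)
    show ?case using Nil
      by (simp add: 1 2 dsum_fun_add dsum_fun_scale br_add br_scale mlD_Cons algebra_simps)
  next
    case (Cons z u)
    then obtain m where m: "n = Suc m" by (cases n) auto
    have "ml m (\<lambda>v. f (th p z # v))" using Cons.prems(1) m ml_Cons by blast
    from Cons.IH[OF this] Cons.prems m
    show ?case using mlD[OF Cons.prems(1), of "br x z # u" v] by (simp add: algebra_simps)
  qed
  then show ?thesis unfolding ml_def by blast
qed

text \<open>The recursion runs over the length because the derivation changes the letters of the remaining word, so that
structural recursion on the word is not available.\<close>

primrec sg :: "nat \<Rightarrow> 'l list \<Rightarrow> complex" where
  "sg 0 w = 1"
| "sg (Suc n) w = (case w of [] \<Rightarrow> 0 | x # v \<Rightarrow>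
     dsum False (ev (pos x)) (sg n) v + dsum True (od (pos x)) (sg n) v + chi (pos x) * sg n v)"

text \<open>The coefficient of the vacuum in the vector \<open>x\<^sub>1 \<dots> x\<^sub>n 1\<close>: the leading letter is split into its component in the
kernel of \<open>pos\<close>, which contributes nothing, and its component in the subalgebra, which is commuted to the right where
it acts on the vacuum by \<open>chi\<close>.\<close>

definition sigma :: "'l list \<Rightarrow> complex" where
  "sigma w = sg (length w) w"

lemma sigma_Nil: "sigma [] = 1" by (simp add: sigma_def)

lemma sigma_Cons: "sigma (x # v) = dsum False (ev (pos x)) sigma v + dsum True (od (pos x)) sigma v + chi (pos x) * sigma v"
proof -
  have "dsum p y (sg (length v)) v = dsum p y sigma v" for p y by (rule dsum_cong) (simp add: sigma_def)
  then show ?thesis by (simp add: sigma_def)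
qed

lemma ml_sigma: "ml n sigma"
proof (induction n)
  case 0
  then show ?case by (simp add: ml_def)
next
  case (Suc n)
  have "sigma (u @ (a + b) # v) = sigma (u @ a # v) + sigma (u @ b # v) \<and> sigma (u @ scl c a # v) = c * sigma (u @ a # v)"
    if "length u + length v < Suc n" for u v a b c
  proof (cases u)
    case Nil
    then show ?thesis using that dsum_linear[OF Suc, of v]
      by (simp add: sigma_Cons pos_lin ev_lin od_lin chi_lin algebra_simps)
  next
    case (Cons z u')
    then have l: "length u' + length v < n" using that by simp
    show ?thesis
      unfolding Cons append_Cons sigma_Cons mlD[OF Suc l] mlD[OF ml_dsum[OF Suc] l] by (simp add: algebra_simps)
  qed
  then show ?case unfolding ml_def by blast
qed

definition multilinear :: "('l list \<Rightarrow> complex) \<Rightarrow> bool" where "multilinear f \<longleftrightarrow> (\<forall>n. ml n f)"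

lemma multilinear_sigma: "multilinear sigma" by (simp add: multilinear_def ml_sigma)
lemma multilinear_Cons: "multilinear f \<Longrightarrow> multilinear (\<lambda>v. f (y # v))" using ml_Cons by (auto simp: multilinear_def)

lemma multilinearD:
  assumes "multilinear f"
  shows "f (u @ (x + y) # v) = f (u @ x # v) + f (u @ y # v)" "f (u @ scl c x # v) = c * f (u @ x # v)"
    "f ((x + y) # v) = f (x # v) + f (y # v)" "f (scl c x # v) = c * f (x # v)"
    "f (u @ z # (x + y) # v) = f (u @ z # x # v) + f (u @ z # y # v)" "f (u @ z # scl c x # v) = c * f (u @ z # x # v)"
  using mlD[of "Suc (length u + length v)" f u v] mlD_Cons[of "Suc (length v)" f v] assms
    mlD[of "Suc (length (u @ [z]) + length v)" f "u @ [z]" v]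
  by (simp_all add: multilinear_def)

lemma dsum_lin:
  assumes "multilinear f"
  shows "dsum p (x + y) f w = dsum p x f w + dsum p y f w" "dsum p (scl c x) f w = c * dsum p x f w" "dsum p 0 f w = 0"
proof -
  show a: "dsum p (x + y) f w = dsum p x f w + dsum p y f w" "dsum p (scl c x) f w = c * dsum p x f w" for x y
    using dsum_linear[of "length w" f w] assms by (auto simp: multilinear_def)
  show "dsum p 0 f w = 0" using a(1)[of 0 0] by simp
qed

text \<open>The defect of the commutator relation for \<open>x\<close> and \<open>y\<close>, between the words \<open>l\<close> and \<open>r\<close>.\<close>

definition rel :: "bool \<Rightarrow> bool \<Rightarrow> ('l list \<Rightarrow> complex) \<Rightarrow> 'l list \<Rightarrow> 'l \<Rightarrow> 'l \<Rightarrow> 'l list \<Rightarrow> complex" where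
  "rel p q f l x y r = f (l @ x # y # r) - super_sign p q * f (l @ y # x # r) - f (l @ br x y # r)"

definition Rel :: "nat \<Rightarrow> ('l list \<Rightarrow> complex) \<Rightarrow> bool" where
  "Rel m f \<longleftrightarrow> (\<forall>l x y r p q. length l + length r = m \<longrightarrow> x \<in> hom p \<longrightarrow> y \<in> hom q \<longrightarrow> rel p q f l x y r = 0)"

lemma RelD:
  assumes "Rel m f" "length l + length r = m" "x \<in> hom p" "y \<in> hom q"
  shows "f (l @ x # y # r) = super_sign p q * f (l @ y # x # r) + f (l @ br x y # r)"
proof -
  have "rel p q f l x y r = 0" using assms unfolding Rel_def by blast
  then show ?thesis by (simp add: rel_def algebra_simps)
qed

text \<open>A derivation maps the relation for \<open>x\<close> and \<open>y\<close> to the sum of the relations for \<open>[z, x]\<close>, \<open>y\<close> and for \<open>x\<close>, \<open>[z, y]\<close>, by the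
Jacobi identity, up to the relation for \<open>x\<close> and \<open>y\<close> between changed words.\<close>

lemma Rel_dsum:
  assumes f: "multilinear f" "Rel m f" and z: "z \<in> hom e"
  shows "Rel m (dsum e z f)"
  unfolding Rel_def
proof (intro allI impI)
  fix l r :: "'l list" and x y p q
  assume len: "length l + length r = m" and x: "x \<in> hom p" and y: "y \<in> hom q"
  let ?l = "map (th e) l" and ?s = super_sign
  have exp: "dsum e z f (l @ a # b # r) = dsum e z (\<lambda>v. f (v @ a # b # r)) l + (f (?l @ br z a # b # r)
      + (f (?l @ th e a # br z b # r) + dsum e z (\<lambda>v. f (?l @ th e a # th e b # v)) r))" for a b
    by (simp add: dsum_append)
  have exp1: "dsum e z f (l @ a # r) = dsum e z (\<lambda>v. f (v @ a # r)) l + (f (?l @ br z a # r)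
      + dsum e z (\<lambda>v. f (?l @ th e a # v)) r)" for a
    by (simp add: dsum_append)
  have A: "dsum e z (\<lambda>v. f (v @ x # y # r)) l = ?s p q * dsum e z (\<lambda>v. f (v @ y # x # r)) l + dsum e z (\<lambda>v. f (v @ br x y # r)) l"
    unfolding dsum_fun_scale[symmetric] dsum_fun_add[symmetric]
    by (rule dsum_cong) (simp add: RelD[OF f(2) _ x y] len)
  note thx = th_hom[OF x, of e] and thy = th_hom[OF y, of e]
  have B: "f (?l @ br z x # y # r) = ?s (e \<noteq> p) q * f (?l @ y # br z x # r) + f (?l @ br (br z x) y # r)"
    by (rule RelD[OF f(2) _ br_hom[OF z x] y]) (simp add: len)
  have C: "f (?l @ x # br z y # r) = ?s p (e \<noteq> q) * f (?l @ br z y # x # r) + f (?l @ br x (br z y) # r)"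
    by (rule RelD[OF f(2) _ x br_hom[OF z y]]) (simp add: len)
  have D: "dsum e z (\<lambda>v. f (?l @ x # y # v)) r = ?s p q * dsum e z (\<lambda>v. f (?l @ y # x # v)) r + dsum e z (\<lambda>v. f (?l @ br x y # v)) r"
    unfolding dsum_fun_scale[symmetric] dsum_fun_add[symmetric]
    by (rule dsum_cong) (simp add: RelD[OF f(2) _ x y] len)
  have D1: "dsum e z (\<lambda>v. f (?l @ th e a # th e b # v)) r = ?s e p' * ?s e q' * dsum e z (\<lambda>v. f (?l @ a # b # v)) r"
    if "a \<in> hom p'" "b \<in> hom q'" for a b p' q'
    unfolding th_hom[OF that(1)] th_hom[OF that(2)] multilinearD(2,6)[OF f(1)] by (simp add: dsum_fun_scale)
  have D2: "dsum e z (\<lambda>v. f (?l @ th e (br x y) # v)) r = ?s e p * ?s e q * dsum e z (\<lambda>v. f (?l @ br x y # v)) r"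
    unfolding th_hom[OF br_hom[OF x y]] multilinearD(2)[OF f(1)] dsum_fun_scale super_sign_simps(6) ..
  have J: "f (?l @ br z (br x y) # r) = f (?l @ br (br z x) y # r) + ?s e p * f (?l @ br x (br z y) # r)"
    unfolding jacobi[OF z x] multilinearD(1,2)[OF f(1)] ..
  have ss: "?s e q * ?s e q = 1" "?s e p * ?s e p = 1" "?s (e \<noteq> p) q = ?s e q * ?s p q" "?s p (e \<noteq> q) = ?s e p * ?s p q"
    by (auto simp: super_sign_def)
  have sst: "?s e q * (?s e q * t) = t" "?s e p * (?s e p * t) = t" for t
    using ss(1,2) by (simp_all flip: mult.assoc)
  show "rel p q (dsum e z f) l x y r = 0"
    unfolding rel_def exp exp1 A D1[OF x y] D1[OF y x] D2 D J B
    unfolding thx thy multilinearD(2)[OF f(1)] C ss(3,4)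
    by (simp add: algebra_simps sst)
qed

lemma sigma_neg: "pos x = 0 \<Longrightarrow> sigma (x # w) = 0"
  by (simp add: sigma_Cons ev_zero od_zero chi_zero dsum_lin[OF multilinear_sigma])

lemma sigma_pos: "x \<in> hom p \<Longrightarrow> pos x = x \<Longrightarrow> sigma (x # w) = dsum p x sigma w + chi x * sigma w"
  using hom_even[of x] hom_odd[of x] by (cases p) (simp_all add: sigma_Cons dsum_lin[OF multilinear_sigma])

text \<open>The derivations represent the Lie superalgebra: this is the Jacobi identity on the letter that both derivations hit,
while different letters give terms that agree up to the sign.\<close>

lemma dsum_commutator:
  assumes x: "x \<in> hom p" and y: "y \<in> hom q" and f: "multilinear f"
  shows "dsum q y (dsum p x f) w = super_sign p q * dsum p x (dsum q y f) w + dsum (p \<noteq> q) (br x y) f w"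
  using f
proof (induction w arbitrary: f)
  case (Cons z w)
  let ?s = "super_sign p q"
  have xy: "th p (br y z) = scl ?s (br y (th p z))" "th q (br x z) = scl ?s (br x (th q z))" for z
  proof -
    have *: "th e (br u z) = scl (super_sign e r) (br u (th e z))" if u: "u \<in> hom r" for e r u
    proof -
      have "br u z = br u (ev z) + br u (od z)" by (simp flip: br_add(2) ev_od)
      then have "th e (br u z) = scl (super_sign e r) (br u (scl (super_sign e False) (ev z))) + scl (super_sign e r) (br u (scl (super_sign e True) (od z)))"
        using th_hom[OF br_hom[OF u ev_hom], of e z] th_hom[OF br_hom[OF u od_hom], of e z]
        by (cases e; cases r) (auto simp: th_lin super_sign_def scl_one scl_minus br_scale br_minus)
      also have "\<dots> = scl (super_sign e r) (br u (th e (ev z) + th e (od z)))"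
        unfolding th_hom[OF ev_hom] th_hom[OF od_hom] br_add(2)
        using scl_diff[of "super_sign e r" a "- b" for a b]
        by (cases e; cases r) (simp_all add: super_sign_def scl_one scl_minus)
      finally show ?thesis by (simp flip: th_lin(1) ev_od)
    qed
    show "th p (br y z) = scl ?s (br y (th p z))" "th q (br x z) = scl ?s (br x (th q z))"
      using *[OF y, of p] *[OF x, of q] by (simp_all add: super_sign_simps(2)[of q p])
  qed
  have thth: "th p (th q z) = th q (th p z)" "th (p \<noteq> q) z = th p (th q z)"
  proof -
    have "ev (ev z) = ev z" "od (ev z) = 0" "ev (od z) = 0" "od (od z) = od z"
      using hom_even[OF ev_hom] hom_odd[OF od_hom] by auto
    moreover have "ev (a - b) = ev a - ev b" "od (a - b) = od a - od b" for a b
      using ev_lin(1)[of "a - b" b] od_lin(1)[of "a - b" b] by (auto simp: algebra_simps)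
    ultimately show "th p (th q z) = th q (th p z)" "th (p \<noteq> q) z = th p (th q z)"
      using ev_od[of z] by (cases p; cases q; simp add: th_def)+
  qed
  have IH: "dsum q y (dsum p x (\<lambda>v. f (th p (th q z) # v))) w
      = ?s * dsum p x (dsum q y (\<lambda>v. f (th p (th q z) # v))) w + dsum (p \<noteq> q) (br x y) (\<lambda>v. f (th p (th q z) # v)) w"
    by (rule Cons.IH[OF multilinear_Cons[OF Cons.prems]])
  note m = multilinearD(4)[OF Cons.prems]
  have e1: "dsum q y (dsum p x f) (z # w) = f (br x (br y z) # w) + ?s * dsum p x (\<lambda>v. f (br y (th p z) # v)) w
     + (dsum q y (\<lambda>v. f (br x (th q z) # v)) w + dsum q y (dsum p x (\<lambda>v. f (th p (th q z) # v))) w)"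
    by (simp add: xy m dsum_fun_scale dsum_fun_add)
  have e2: "dsum p x (dsum q y f) (z # w) = f (br y (br x z) # w) + ?s * dsum q y (\<lambda>v. f (br x (th q z) # v)) w
     + (dsum p x (\<lambda>v. f (br y (th p z) # v)) w + dsum p x (dsum q y (\<lambda>v. f (th p (th q z) # v))) w)"
    by (simp add: xy m dsum_fun_scale dsum_fun_add thth(1))
  have e3: "f (br x (br y z) # w) = f (br (br x y) z # w) + ?s * f (br y (br x z) # w)"
    unfolding jacobi[OF x y] multilinearD(3)[OF Cons.prems] m ..
  have e4: "dsum (p \<noteq> q) (br x y) f (z # w) = f (br (br x y) z # w) + dsum (p \<noteq> q) (br x y) (\<lambda>v. f (th p (th q z) # v)) w"
    by (simp only: dsum.simps thth(2))
  have sst: "?s * (?s * t) = t" for t by (simp add: super_sign_simps(1) flip: mult.assoc)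
  show ?case unfolding e1 e2 e3 e4 IH by (simp add: algebra_simps sst)
qed simp

text \<open>At the start of a word the relation is checked on the two subalgebras separately.  If both letters lie in the image
of \<open>pos\<close>, it says that the derivations represent the Lie superalgebra and that \<open>chi\<close> is a character; in the
mixed cases it is the definition of the functional; otherwise all terms vanish.\<close>

lemma rel_sigma_Nil:
  assumes x: "x \<in> hom p" and y: "y \<in> hom q"
  shows "rel p q sigma [] x y r = 0"
proof -
  let ?s = "super_sign p q"
  have sst: "?s * (?s * t) = t" for t by (simp add: super_sign_simps(1) flip: mult.assoc)
  note sS = multilinearD[OF multilinear_sigma]
  have split: "rel p q sigma [] (a + b) (c + d) r = rel p q sigma [] a c r + rel p q sigma [] a d r + rel p q sigma [] b c r + rel p q sigma [] b d r" for a b c d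
    using sS(5)[of "[]"] by (simp add: rel_def sS br_add algebra_simps)
  have mixed: "rel p q sigma [] a b r = 0" if a: "a \<in> hom p" "pos a = a" and b: "b \<in> hom q" "pos b = 0" for a b p q
  proof -
    have "sigma (a # b # r) = sigma (br a b # r) + dsum p a (\<lambda>v. sigma (th p b # v)) r"
      by (simp add: sigma_pos[OF a] sigma_neg[OF b(2)])
    also have "dsum p a (\<lambda>v. sigma (th p b # v)) r = 0"
      using sigma_neg[OF pos_th[OF b(2)]] dsum_fun_zero by simp
    finally show ?thesis by (simp add: rel_def sigma_neg[OF b(2)])
  qed
  have pp: "rel p q sigma [] a b r = 0" if a: "a \<in> hom p" "pos a = a" and b: "b \<in> hom q" "pos b = b" for a b
  proof -
    have *: "sigma (a # b # r) = sigma (br a b # r) + super_sign p q * (dsum p a (dsum q b sigma) r + chi b * dsum p a sigma r)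
        + chi a * (dsum q b sigma r + chi b * sigma r)" 
      if a: "a \<in> hom p" "pos a = a" and b: "b \<in> hom q" "pos b = b" for a b p q
      by (simp add: sigma_pos[OF a] sigma_pos[OF b] th_hom[OF b(1)] sS(4) dsum_fun_scale dsum_fun_add)
    have sk: "sigma (br a b # r) = - ?s * sigma (br b a # r)"
      unfolding skew[OF a(1) b(1)] by (simp add: sS(4))
    have "sigma (br a b # r) = dsum (p \<noteq> q) (br a b) sigma r"
      using sigma_pos[OF br_hom[OF a(1) b(1)] pos_br[OF a(2) b(2)]] chi_br[OF a(2) b(2)] by simp
    then have c: "dsum q b (dsum p a sigma) r = ?s * dsum p a (dsum q b sigma) r + sigma (br a b # r)"
      using dsum_commutator[OF a(1) b(1) multilinear_sigma] by simp
    have z: "?s * (chi a * chi b) = chi a * chi b"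
      using chi_odd[of a] chi_odd[of b] a b by (cases p; cases q) (auto simp: super_sign_def)
    have ss: "?s * ?s = 1" by (rule super_sign_simps)
    have "rel p q sigma [] a b r = sigma (a # b # r) - ?s * sigma (b # a # r) - sigma (br a b # r)" by (simp add: rel_def)
    also have "\<dots> = 0" unfolding *[OF a b] *[OF b a] super_sign_simps(2)[of q p] c sk
    proof -
      have *: "- s * S + s * (X + cb * A) + ca * (B + cb * t) - s * (S + s * (s * X + - s * S + ca * B) + cb * (A + ca * t)) - - s * S = 0"
        if "s * s = 1" "s * (ca * cb) = ca * cb" for s S X A B t ca cb :: complex
      proof -
        have "s = 1 \<or> s = -1" using that(1) by (metis square_eq_1_iff)
        then show ?thesis using that(2) by (auto simp: algebra_simps)
      qed
      show "- ?s * sigma (br b a # r) + ?s * (dsum p a (dsum q b sigma) r + chi b * dsum p a sigma r) + chi a * (dsum q b sigma r + chi b * sigma r)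
        - ?s * (sigma (br b a # r) + ?s * (?s * dsum p a (dsum q b sigma) r + - ?s * sigma (br b a # r) + chi a * dsum q b sigma r)
        + chi b * (dsum p a sigma r + chi a * sigma r)) - - ?s * sigma (br b a # r) = 0"
        by (rule *[OF ss z])
    qed
    finally show ?thesis .
  qed
  have nn: "rel p q sigma [] a b r = 0" if "pos a = 0" "pos b = 0" for a b
    using that sigma_neg neg_br by (simp add: rel_def)
  have np: "rel p q sigma [] b a r = 0" if a: "a \<in> hom q" "pos a = a" and b: "b \<in> hom p" "pos b = 0" for a b
  proof -
    have "rel p q sigma [] b a r = - ?s * rel q p sigma [] a b r"
      unfolding rel_def skew[OF b(1) a(1)] append_Nil sS(4) super_sign_simps(2)[of q p]
      by (simp add: algebra_simps sst)
    then show ?thesis using mixed[OF a b] by simp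
  qed
  have h: "pos x \<in> hom p" "x - pos x \<in> hom p" "pos y \<in> hom q" "y - pos y \<in> hom q"
    using pos_hom hom_diff x y by blast+
  have n: "pos (x - pos x) = 0" "pos (y - pos y) = 0" by (simp_all add: pos_minus pos_pos)
  have "rel p q sigma [] (pos x + (x - pos x)) (pos y + (y - pos y)) r = 0"
    unfolding split using pp[OF h(1) pos_pos h(3) pos_pos] mixed[OF h(1) pos_pos h(4) n(2)] np[OF h(3) pos_pos h(2) n(1)] nn[OF n] by simp
  then show ?thesis by simp
qed

text \<open>A first letter that is not involved in the relation acts as a derivation, which preserves relations.\<close>

lemma Rel_sigma: "Rel m sigma"
proof (induction m)
  case 0
  then show ?case unfolding Rel_def using rel_sigma_Nil by simp
next
  case (Suc m)
  show ?case unfolding Rel_def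
  proof (intro allI impI)
    fix l r :: "'l list" and x y p q
    assume len: "length l + length r = Suc m" and xy: "x \<in> hom p" "y \<in> hom q"
    show "rel p q sigma l x y r = 0"
    proof (cases l)
      case Nil
      then show ?thesis using rel_sigma_Nil[OF xy] by simp
    next
      case (Cons z l')
      have len': "length l' + length r = m" using len Cons by simp
      have "rel p q sigma l x y r = rel p q (dsum False (ev (pos z)) sigma) l' x y r + rel p q (dsum True (od (pos z)) sigma) l' x y r
         + chi (pos z) * rel p q sigma l' x y r"
        unfolding Cons rel_def by (simp add: sigma_Cons algebra_simps)
      then show ?thesis
        using Suc Rel_dsum[OF multilinear_sigma Suc ev_hom] Rel_dsum[OF multilinear_sigma Suc od_hom] len' xy unfolding Rel_def by simp
    qed
  qed
qed

lemma sigma_commutator: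
  assumes "x \<in> hom p" "y \<in> hom q"
  shows "sigma (l @ x # y # r) = super_sign p q * sigma (l @ y # x # r) + sigma (l @ br x y # r)"
  by (rule RelD[OF Rel_sigma refl assms])

text \<open>The last letter is the one that meets the vacuum of the induced module.  In an induction on the word, the derivation by
the first letter either acts on the letters in front of \<open>x\<close>, or replaces \<open>x\<close> by a bracket of two elements of the
subalgebra, on which \<open>chi\<close> vanishes.\<close>

lemma sigma_right_hom:
  assumes "x \<in> hom e" "pos x = x"
  shows "sigma (l @ [x]) = chi x * sigma l"
  using assms
proof (induction "length l" arbitrary: l x e)
  case 0
  then show ?case using sigma_pos[OF 0(2,3), of "[]"] by (simp add: sigma_Nil)
next
  case (Suc n)
  then obtain z l' where l: "l = z # l'" "length l' = n" by (cases l) auto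
  have "dsum p w sigma (l' @ [x]) = chi x * dsum p w sigma l'" if w: "w \<in> hom p" "pos w = w" for p w
  proof -
    have "dsum p w sigma (l' @ [x]) = dsum p w (\<lambda>v. chi x * sigma v) l' + sigma (map (th p) l' @ [br w x])"
      unfolding dsum_append
      by (simp, rule dsum_cong) (use Suc(1)[OF _ Suc(3,4)] l(2) in simp)
    also have "sigma (map (th p) l' @ [br w x]) = 0"
      using Suc(1)[OF _ br_hom[OF w(1) Suc(3)] pos_br[OF w(2) Suc(4)], of "map (th p) l'"] l(2) chi_br[OF w(2) Suc(4)] by simp
    finally show ?thesis by (simp add: dsum_fun_scale)
  qed
  moreover have "pos (ev (pos z)) = ev (pos z)" "pos (od (pos z)) = od (pos z)"
  proof -
    have "pos z = pos (ev (pos z)) + pos (od (pos z))" using pos_lin(1) ev_od pos_pos by metis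
    then show "pos (ev (pos z)) = ev (pos z)" "pos (od (pos z)) = od (pos z)"
      using hom_even[OF pos_hom[OF ev_hom[of "pos z"]]] hom_odd[OF pos_hom[OF od_hom[of "pos z"]]] ev_lin(1) od_lin(1)
      by (metis add.right_neutral, metis add.left_neutral)
  qed
  moreover have "sigma (l' @ [x]) = chi x * sigma l'" using Suc(1)[OF _ Suc(3,4)] l(2) by simp
  ultimately show ?case
    unfolding l(1) by (simp add: sigma_Cons ev_hom od_hom algebra_simps)
qed

lemma sigma_right:
  assumes "pos x = x"
  shows "sigma (l @ [x]) = chi x * sigma l"
proof -
  have "pos x = pos (ev x) + pos (od x)" using pos_lin(1) ev_od by metis
  then have "pos (ev x) = ev x" "pos (od x) = od x"
    using assms hom_even[OF pos_hom[OF ev_hom[of x]]] hom_odd[OF pos_hom[OF od_hom[of x]]] ev_lin(1) od_lin(1)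
    by (metis add.right_neutral, metis add.left_neutral)
  then have "sigma (l @ [ev x + od x]) = chi (ev x + od x) * sigma l"
    using sigma_right_hom[OF ev_hom, of x l] sigma_right_hom[OF od_hom, of x l]
    by (simp add: multilinearD(1)[OF multilinear_sigma] chi_lin algebra_simps)
  then show ?thesis by (simp flip: ev_od)
qed

end

section \<open>The Lie superalgebra of a compatible pair\<close>

lemma lookup_map_zero: "h 0 = 0 \<Longrightarrow> Poly_Mapping.lookup (Poly_Mapping.map h f) n = h (Poly_Mapping.lookup f n)"
  by (simp add: Poly_Mapping.map.rep_eq when_def)

lemma pm_eq_sum_single: "finite K \<Longrightarrow> Poly_Mapping.keys f \<subseteq> K \<Longrightarrow> f = (\<Sum>n\<in>K. Poly_Mapping.single n (Poly_Mapping.lookup f n))"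
  by (rule poly_mapping_eqI) (auto simp: lookup_sum lookup_single when_def in_keys_iff)

lemma pm_additive_induct:
  assumes "\<And>f g. Q f \<Longrightarrow> Q g \<Longrightarrow> Q (f + g)" "\<And>n a. Q (Poly_Mapping.single n a)"
  shows "Q (f :: 'k \<Rightarrow>\<^sub>0 'b::ab_group_add)"
proof -
  have "Q (\<Sum>n\<in>K. Poly_Mapping.single n (Poly_Mapping.lookup f n))" if "finite K" for K
    using that
  proof (induction K)
    case empty
    then show ?case using assms(2)[of _ 0] by simp
  qed (simp add: assms)
  from this[OF finite_keys[of f]] show ?thesis
    by (simp only: pm_eq_sum_single[OF finite_keys subset_refl, of f, symmetric])
qed

text \<open>Maps that are given on pairs of modes, extended to finite sums of modes; every component of the bracket has this form.\<close>

definition bil :: "(int \<Rightarrow> int \<Rightarrow> 'x \<Rightarrow> 'y \<Rightarrow> 'z) \<Rightarrow> (int \<Rightarrow>\<^sub>0 'x::ab_group_add) \<Rightarrow> (int \<Rightarrow>\<^sub>0 'y::ab_group_add) \<Rightarrow> 'z::ab_group_add" where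
  "bil b f g = (\<Sum>m\<in>Poly_Mapping.keys f. \<Sum>n\<in>Poly_Mapping.keys g. b m n (Poly_Mapping.lookup f m) (Poly_Mapping.lookup g n))"

lemma bil_superset:
  assumes "\<And>m n y. b m n 0 y = 0" "\<And>m n x. b m n x 0 = 0"
    and "finite K" "finite K'" "Poly_Mapping.keys f \<subseteq> K" "Poly_Mapping.keys g \<subseteq> K'"
  shows "bil b f g = (\<Sum>m\<in>K. \<Sum>n\<in>K'. b m n (Poly_Mapping.lookup f m) (Poly_Mapping.lookup g n))"
proof -
  have "bil b f g = (\<Sum>m\<in>Poly_Mapping.keys f. \<Sum>n\<in>K'. b m n (Poly_Mapping.lookup f m) (Poly_Mapping.lookup g n))"
    unfolding bil_def by (intro sum.cong refl sum.mono_neutral_left assms) (auto simp: in_keys_iff assms)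
  also have "\<dots> = (\<Sum>m\<in>K. \<Sum>n\<in>K'. b m n (Poly_Mapping.lookup f m) (Poly_Mapping.lookup g n))"
    by (intro sum.mono_neutral_left assms) (auto simp: in_keys_iff assms)
  finally show ?thesis .
qed

locale biadditive =
  fixes b :: "int \<Rightarrow> int \<Rightarrow> 'x::ab_group_add \<Rightarrow> 'y::ab_group_add \<Rightarrow> 'z::ab_group_add"
  assumes add_l: "b m n (x + x') y = b m n x y + b m n x' y" and add_r: "b m n x (y + y') = b m n x y + b m n x y'"
begin

lemma zero: "b m n 0 y = 0" "b m n x 0 = 0"
  using add_l[of m n 0 0 y] add_r[of m n x 0 0] by auto

lemma bil_add: "bil b (f + f') g = bil b f g + bil b f' g" "bil b f (g + g') = bil b f g + bil b f g'"
proof -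
  let ?K = "Poly_Mapping.keys f \<union> Poly_Mapping.keys f'" and ?K' = "Poly_Mapping.keys g \<union> Poly_Mapping.keys g'"
  have s: "Poly_Mapping.keys (f + f') \<subseteq> ?K" "Poly_Mapping.keys (g + g') \<subseteq> ?K'" by (rule Poly_Mapping.keys_add)+
  note b = bil_superset[of b, OF zero(1) zero(2), of ?K ?K']
  show "bil b (f + f') g = bil b f g + bil b f' g"
    by (subst (1 2 3) b) (use s in \<open>auto simp: lookup_add add_l sum.distrib\<close>)
  show "bil b f (g + g') = bil b f g + bil b f g'"
    by (subst (1 2 3) b) (use s in \<open>auto simp: lookup_add add_r sum.distrib\<close>)
qed

lemma bil_single: "bil b (Poly_Mapping.single m x) (Poly_Mapping.single n y) = b m n x y"
  by (subst bil_superset[of b, OF zero(1) zero(2), where K = "{m}" and K' = "{n}"]) auto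

lemma bil_zero: "bil b 0 g = 0" "bil b f 0 = 0"
  using bil_add(1)[of 0 0 g] bil_add(2)[of f 0 0] by auto

end

definition am :: "'a::zero \<Rightarrow> int \<Rightarrow> ('a, 'u::zero) loop" where "am a n = (Poly_Mapping.single n a, 0, 0)"
definition um :: "'u::zero \<Rightarrow> int \<Rightarrow> ('a::zero, 'u) loop" where "um u n = (0, Poly_Mapping.single n u, 0)"
definition cen :: "complex \<Rightarrow> ('a::zero, 'u::zero) loop" where "cen k = (0, 0, k)"

lemma mode_eq: "mode (a, 0) n = am a n" "mode (0, u) n = um u n"
  by (simp_all add: mode_def am_def um_def)

lemma mode_split: "mode (a :: 'a::ab_group_add, u :: 'u::ab_group_add) n = am a n + um u n"
  by (simp add: mode_def am_def um_def plus_prod_def)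

lemma am_um_cen_add:
  fixes a a' :: "'a::ab_group_add" and u u' :: "'u::ab_group_add"
  shows "am a n + am a' n = (am (a + a') n :: ('a, 'u) loop)" "um u n + um u' n = (um (u + u') n :: ('a, 'u) loop)"
    "cen c + cen c' = (cen (c + c') :: ('a, 'u) loop)"
    "am 0 n = (0 :: ('a, 'u) loop)" "um 0 n = (0 :: ('a, 'u) loop)" "cen 0 = (0 :: ('a, 'u) loop)"
  by (simp_all add: am_def um_def cen_def plus_prod_def single_add zero_prod_def)

text \<open>Linear statements about \<open>\<L>(A, U)\<close> need to be verified on single modes only.\<close>

lemma loop_induct:
  assumes "\<And>x y. Q x \<Longrightarrow> Q y \<Longrightarrow> Q (x + y)" "\<And>a n. Q (am a n)" "\<And>u n. Q (um u n)" "\<And>k. Q (cen k)"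
  shows "Q (x :: ('a::ab_group_add, 'u::ab_group_add) loop)"
proof -
  obtain f g k where x: "x = (f, g, k)" by (cases x) auto
  have "Q (f, 0, 0)"
  proof (induction f rule: pm_additive_induct)
    case (1 f g)
    then show ?case using assms(1)[of "(f, 0, 0)" "(g, 0, 0)"] by (simp add: plus_prod_def)
  qed (use assms(2) in \<open>simp add: am_def\<close>)
  moreover have "Q (0, g, 0)"
  proof (induction g rule: pm_additive_induct)
    case (1 f g)
    then show ?case using assms(1)[of "(0, f, 0)" "(0, g, 0)"] by (simp add: plus_prod_def)
  qed (use assms(3) in \<open>simp add: um_def\<close>)
  moreover have "Q (0, 0, k)" using assms(4) by (simp add: cen_def)
  moreover have "x = (f, 0, 0) + (0, g, 0) + (0, 0, k)" by (simp add: x plus_prod_def)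
  ultimately show ?thesis using assms(1) by metis
qed

lemma loop_even_induct:
  assumes "\<And>x y. Q x \<Longrightarrow> Q y \<Longrightarrow> Q (x + y)" "\<And>a n. Q (am a n)" "\<And>k. Q (cen k)"
  shows "Q ((f, 0, k) :: ('a::ab_group_add, 'u::ab_group_add) loop)"
proof -
  have "Q (f, 0, 0)"
  proof (induction f rule: pm_additive_induct)
    case (1 f g)
    then show ?case using assms(1)[of "(f, 0, 0)" "(g, 0, 0)"] by (simp add: plus_prod_def)
  qed (use assms(2) in \<open>simp add: am_def\<close>)
  moreover have "Q (0, 0, k)" using assms(3) by (simp add: cen_def)
  moreover have "((f, 0, k) :: ('a, 'u) loop) = (f, 0, 0) + (0, 0, k)" by (simp add: plus_prod_def)
  ultimately show ?thesis using assms(1) by metis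
qed

lemma loop_odd_induct:
  assumes "\<And>x y. Q x \<Longrightarrow> Q y \<Longrightarrow> Q (x + y)" "\<And>u n. Q (um u n)"
  shows "Q ((0, g, 0) :: ('a::ab_group_add, 'u::ab_group_add) loop)"
proof (induction g rule: pm_additive_induct)
  case (1 f g)
  then show ?case using assms(1)[of "(0, f, 0)" "(0, g, 0)"] by (simp add: plus_prod_def)
qed (use assms(2) in \<open>simp add: um_def\<close>)

definition nonneg_part :: "(int \<Rightarrow>\<^sub>0 'b::zero) \<Rightarrow> (int \<Rightarrow>\<^sub>0 'b)" where
  "nonneg_part f = Abs_poly_mapping (\<lambda>n. if n \<ge> 0 then Poly_Mapping.lookup f n else 0)"

lemma lookup_nonneg_part: "Poly_Mapping.lookup (nonneg_part f) n = (if n \<ge> 0 then Poly_Mapping.lookup f n else 0)"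
proof -
  have "finite {n. (if n \<ge> 0 then Poly_Mapping.lookup f n else 0) \<noteq> 0}"
    by (rule finite_subset[OF _ finite_keys[of f]]) (auto simp: in_keys_iff)
  then show ?thesis unfolding nonneg_part_def by (subst Abs_poly_mapping_inverse) auto
qed

text \<open>The projection to \<open>\<L>(A, U)\<^sup>+\<close> along the modes of negative index.\<close>

definition loop_pos :: "('a::zero, 'u::zero) loop \<Rightarrow> ('a, 'u) loop" where
  "loop_pos = (\<lambda>(f, g, k). (nonneg_part f, nonneg_part g, k))"

lemma nonneg_part_simps: "nonneg_part (f + g) = nonneg_part f + nonneg_part (g :: int \<Rightarrow>\<^sub>0 'b::ab_group_add)"
  "nonneg_part (Poly_Mapping.single n (b::'b)) = (if n \<ge> 0 then Poly_Mapping.single n b else 0)" "nonneg_part (0 :: int \<Rightarrow>\<^sub>0 'b) = 0"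
  "nonneg_part (nonneg_part f) = nonneg_part f"
  by (rule poly_mapping_eqI; auto simp: lookup_nonneg_part lookup_add lookup_single when_def)+

lemma loop_pos_simps: "loop_pos (x + y) = loop_pos x + loop_pos (y :: ('a::ab_group_add, 'u::ab_group_add) loop)"
  "loop_pos (am a n :: ('a, 'u) loop) = (if n \<ge> 0 then am a n else 0)"
  "loop_pos (um u n :: ('a, 'u) loop) = (if n \<ge> 0 then um u n else 0)"
  "loop_pos (cen k :: ('a, 'u) loop) = cen k" "loop_pos (0 :: ('a, 'u) loop) = 0" "loop_pos (loop_pos x) = loop_pos x"
  by (auto simp: loop_pos_def am_def um_def cen_def plus_prod_def nonneg_part_simps zero_prod_def split: prod.splits)

definition hom_part :: "bool \<Rightarrow> ('a::zero, 'u::zero) loop set" where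
  "hom_part p = (if p then {(f, g, k). f = 0 \<and> k = 0} else {(f, g, k). g = 0})"

definition even_part :: "('a::zero, 'u::zero) loop \<Rightarrow> ('a, 'u) loop" where
  "even_part = (\<lambda>(f, g, k). (f, 0, k))"

definition odd_part :: "('a::zero, 'u::zero) loop \<Rightarrow> ('a, 'u) loop" where
  "odd_part = (\<lambda>(f, g, k). (0, g, 0))"

lemma hom_partD:
  "x \<in> hom_part False \<Longrightarrow> \<exists>f k. x = (f, 0, k)" "x \<in> hom_part True \<Longrightarrow> \<exists>g. x = (0, g, 0)"
  by (auto simp: hom_part_def)

lemma gbinomial_three: "(x::complex) gchoose 3 = x * (x - 1) * (x - 2) / 6"
  by (simp add: gbinomial_prod_rev numeral_3_eq_3 prod.atLeast0_lessThan_Suc fact_numeral algebra_simps)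

context compatible_pair
begin

sublocale A: vector_space "scA D" by (rule vsA)
sublocale U: vector_space "scU D" by (rule vsU)

lemma mult_scale: "scA D c a * b = scA D c (a * b)" "a * scA D c b = scA D c (a * b)"
  using mult_bilinear Vector_Spaces.linear.axioms(3) module_hom.scale unfolding cbilinear_def by (metis, metis)

lemma linear_rules:
  assumes "cbilinear s1 s2 s3 f"
  shows "f (x + x') y = f x y + f x' y" "f x (y + y') = f x y + f x y'" "f (s1 c x) y = s3 c (f x y)" "f x (s2 c y) = s3 c (f x y)"
  using assms unfolding cbilinear_def Vector_Spaces.linear_iff by blast+

lemmas act_rules = linear_rules[OF act_bilinear]
lemmas circ_rules = linear_rules[OF circ_bilinear]
lemmas formA_rules = linear_rules[OF formA_bilinear]
lemmas formU_rules = linear_rules[OF formU_bilinear]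

abbreviation "lbr \<equiv> loop_bracket D"

definition "bAA m n a b = Poly_Mapping.single (m + n - 1 :: int) (scA D (of_int (m - n) / 2) (a * b))"
definition "bUU m n u v = Poly_Mapping.single (m + n :: int) (circ D u v)"
definition "bAU m n a u = Poly_Mapping.single (m + n - 1 :: int) (scU D (of_int (m - 2 * n) / 4) (act D a u))"
definition "cAA m n a b = (if m + n - 2 = (0::int) then (of_int m gchoose 3) * formA D a b else 0)"
definition "cUU m n u v = (if m + n - 1 = (0::int) then of_int (m * (m - 1)) / 2 * formU D u v else 0)"

lemma biadditive: "biadditive bAA" "biadditive bUU" "biadditive bAU" "biadditive cAA" "biadditive cUU"
  by unfold_locales
    (auto simp: bAA_def bUU_def bAU_def cAA_def cUU_def act_rules circ_rules formA_rules formU_rules distrib_left distrib_right A.scale_right_distrib U.scale_right_distrib single_add)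

lemma lbr_eq: "lbr (f, g, k) (f', g', k') = (bil bAA f f' + bil bUU g g', bil bAU f g' - bil bAU f' g, bil cAA f f' + bil cUU g g')"
  by (simp add: loop_bracket_def bracket_AU_def bil_def bAA_def bUU_def bAU_def cAA_def cUU_def)

lemmas bil_adds = biadditive.bil_add[OF biadditive(1)] biadditive.bil_add[OF biadditive(2)] biadditive.bil_add[OF biadditive(3)]
  biadditive.bil_add[OF biadditive(4)] biadditive.bil_add[OF biadditive(5)]
lemmas bil_zeros = biadditive.bil_zero[OF biadditive(1)] biadditive.bil_zero[OF biadditive(2)] biadditive.bil_zero[OF biadditive(3)]
  biadditive.bil_zero[OF biadditive(4)] biadditive.bil_zero[OF biadditive(5)]
lemmas bil_singles = biadditive.bil_single[OF biadditive(1)] biadditive.bil_single[OF biadditive(2)] biadditive.bil_single[OF biadditive(3)]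
  biadditive.bil_single[OF biadditive(4)] biadditive.bil_single[OF biadditive(5)]

lemma lbr_add: "lbr (x + y) z = lbr x z + lbr y z" "lbr x (y + z) = lbr x y + lbr x z"
  by (cases x; cases y; cases z; simp add: plus_prod_def lbr_eq bil_adds algebra_simps)+

lemma lbr_zero: "lbr 0 x = 0" "lbr x 0 = 0"
  using lbr_add(1)[of 0 0 x] lbr_add(2)[of x 0 0] by auto

lemma lbr_minus: "lbr (- x) y = - lbr x y" "lbr x (- y) = - lbr x y"
  using lbr_add(1)[of x "- x" y] lbr_add(2)[of x y "- y"] by (auto simp: lbr_zero eq_neg_iff_add_eq_0 add.commute)

lemma lbr_modes:
  "lbr (am a m) (am b n) = am (scA D (of_int (m - n) / 2) (a * b)) (m + n - 1) + cen (if m + n = 2 then (of_int m gchoose 3) * formA D a b else 0)"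
  "lbr (am a m) (um u n) = um (scU D (of_int (m - 2 * n) / 4) (act D a u)) (m + n - 1)"
  "lbr (um u n) (am a m) = - um (scU D (of_int (m - 2 * n) / 4) (act D a u)) (m + n - 1)"
  "lbr (um u m) (um v n) = am (circ D u v) (m + n) + cen (if m + n = 1 then of_int (m * (m - 1)) / 2 * formU D u v else 0)"
  "lbr (cen k) x = 0" "lbr x (cen k) = 0"
proof -
  show "lbr (cen k) x = 0" "lbr x (cen k) = 0"
    by (cases x; simp add: cen_def lbr_eq bil_zeros zero_prod_def)+
qed (auto simp: am_def um_def cen_def lbr_eq bil_zeros bil_singles plus_prod_def uminus_prod_def bAA_def bUU_def bAU_def cAA_def cUU_def)

abbreviation "lsc \<equiv> loop_scale D"

lemma lsc_add: "lsc c (x + y) = lsc c x + lsc c y" and lsc_diff: "lsc c (x - y) = lsc c x - lsc c y"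
  and lsc_minus1: "lsc (-1) x = - x" and lsc_one: "lsc 1 x = x"
  by (cases x; cases y; auto simp: loop_scale_def plus_prod_def minus_prod_def uminus_prod_def lookup_map_zero lookup_add lookup_minus
    A.scale_right_distrib U.scale_right_distrib A.scale_right_diff_distrib U.scale_right_diff_distrib algebra_simps
    intro!: poly_mapping_eqI)+

lemma lsc_modes: "lsc c (am a n) = am (scA D c a) n" "lsc c (um u n) = um (scU D c u) n" "lsc c (cen k) = cen (c * k)"
  by (auto simp: loop_scale_def am_def um_def cen_def intro!: poly_mapping_eqI simp: lookup_map_zero lookup_single when_def)

lemma um_minus: "- um u n = um (- u) n" and am_minus: "- am a n = am (- a) n" and cen_minus: "- cen k = cen (- k)"
  by (simp_all add: um_def am_def cen_def uminus_prod_def single_uminus)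

lemma lsc_zero: "lsc c 0 = 0" using lsc_diff[of c 0 0] by simp

lemma lbr_scale: "lbr (lsc c x) y = lsc c (lbr x y)" "lbr x (lsc c y) = lsc c (lbr x y)"
proof -
  show "lbr (lsc c x) y = lsc c (lbr x y)"
  proof (induction x rule: loop_induct)
    case (1 x x')
    then show ?case by (simp add: lbr_add lsc_add)
  next
    case (2 a n)
    show ?case by (induction y rule: loop_induct) (simp_all add: lbr_add lsc_add lsc_zero lsc_modes lbr_modes act_rules circ_rules formA_rules formU_rules um_minus mult.commute mult.left_commute mult.assoc mult_scale)
  next
    case (3 u n)
    show ?case by (induction y rule: loop_induct) (simp_all add: lbr_add lsc_add lsc_zero lsc_modes lbr_modes act_rules circ_rules formA_rules formU_rules um_minus mult.commute mult.left_commute mult.assoc mult_scale)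
  next
    case (4 k)
    show ?case by (induction y rule: loop_induct) (simp_all add: lbr_add lsc_add lsc_zero lsc_modes lbr_modes act_rules circ_rules formA_rules formU_rules um_minus mult.commute mult.left_commute mult.assoc mult_scale)
  qed
  show "lbr x (lsc c y) = lsc c (lbr x y)"
  proof (induction x rule: loop_induct)
    case (1 x x')
    then show ?case by (simp add: lbr_add lsc_add)
  next
    case (2 a n)
    show ?case by (induction y rule: loop_induct) (simp_all add: lbr_add lsc_add lsc_zero lsc_modes lbr_modes act_rules circ_rules formA_rules formU_rules um_minus mult.commute mult.left_commute mult.assoc mult_scale)
  next
    case (3 u n)
    show ?case by (induction y rule: loop_induct) (simp_all add: lbr_add lsc_add lsc_zero lsc_modes lbr_modes act_rules circ_rules formA_rules formU_rules um_minus mult.commute mult.left_commute mult.assoc mult_scale)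
  next
    case (4 k)
    show ?case by (induction y rule: loop_induct) (simp_all add: lbr_add lsc_add lsc_zero lsc_modes lbr_modes act_rules circ_rules formA_rules formU_rules um_minus mult.commute mult.left_commute mult.assoc mult_scale)
  qed
qed

lemma lbr_skew_modes:
  "lbr (am a m) (am b n) = - lbr (am b n) (am a m)"
  "lbr (um u m) (um v n) = lbr (um v n) (um u m)"
proof -
  have "(of_int m gchoose 3 :: complex) = - (of_int n gchoose 3)" if "m + n = 2"
  proof -
    have n: "n = 2 - m" using that by simp
    show ?thesis unfolding n gbinomial_three by (simp add: field_simps)
  qed
  then show "lbr (am a m) (am b n) = - lbr (am b n) (am a m)"
    by (auto simp: lbr_modes am_minus cen_minus formA_sym[of b a] mult.commute add.commute simp flip: A.scale_minus_left divide_minus_left)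
  have "of_int (m * (m - 1)) = (of_int (n * (n - 1)) :: complex)" if "m + n = 1"
  proof -
    have n: "n = 1 - m" using that by simp
    show ?thesis unfolding n by (simp add: algebra_simps)
  qed
  then show "lbr (um u m) (um v n) = lbr (um v n) (um u m)"
    by (auto simp: lbr_modes circ_sym[of v u] formU_sym[of v u] add.commute)
qed

lemma lbr_hom: "x \<in> hom_part p \<Longrightarrow> y \<in> hom_part q \<Longrightarrow> lbr x y \<in> hom_part (p \<noteq> q)"
  by (cases p; cases q) (auto simp: hom_part_def lbr_eq bil_zeros)

definition skew_pair :: "complex \<Rightarrow> ('a, 'u) loop \<Rightarrow> ('a, 'u) loop \<Rightarrow> bool" where
  "skew_pair s x y \<longleftrightarrow> lbr x y = lsc s (lbr y x)"

lemma skew_pair_add: "skew_pair s x y \<Longrightarrow> skew_pair s x' y \<Longrightarrow> skew_pair s (x + x') y"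
  "skew_pair s x y \<Longrightarrow> skew_pair s x y' \<Longrightarrow> skew_pair s x (y + y')"
  unfolding skew_pair_def lbr_add lsc_add by (simp_all only:)

lemma skew_pair_cen: "skew_pair s (cen k) y" "skew_pair s x (cen k)"
  unfolding skew_pair_def lbr_modes(5,6) lsc_zero by (rule refl)+

lemma skew_pair_modes: "skew_pair (-1) (am a m) (am b n)" "skew_pair 1 (um u m) (um v n)"
  unfolding skew_pair_def lsc_minus1 lsc_one by (rule lbr_skew_modes)+

lemma lbr_skew:
  assumes "x \<in> hom_part p" "y \<in> hom_part q"
  shows "lbr x y = lsc (- super_sign p q) (lbr y x)"
proof -
  have ee: "skew_pair (-1) (f, 0, k) (f', 0, k')" for f f' k k'
    by (induction f k rule: loop_even_induct; induction f' k' rule: loop_even_induct)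
      (auto intro: skew_pair_add skew_pair_cen skew_pair_modes)
  have eo: "lbr (f, 0, k) (0, g', 0) = - lbr (0, g', 0) (f, 0, k)" for f g' k
    by (simp add: lbr_eq bil_zeros uminus_prod_def)
  have oo: "skew_pair 1 (0, g, 0) (0, g', 0)" for g g'
    by (induction g rule: loop_odd_induct; induction g' rule: loop_odd_induct)
      (auto intro: skew_pair_add skew_pair_modes)
  consider "p = False" "q = False" | "p = False" "q = True" | "p = True" "q = False" | "p = True" "q = True" by blast
  then show ?thesis
  proof cases
    case 1
    then obtain f k f' k' where "x = (f, 0, k)" "y = (f', 0, k')" using assms hom_partD(1) by metis
    then show ?thesis using ee[of f k f' k'] 1 by (simp only: super_sign_simps skew_pair_def)
  next
    case 2
    then obtain f k g where "x = (f, 0, k)" "y = (0, g, 0)" using assms hom_partD by metis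
    then show ?thesis using eo[of f k g] 2 by (simp only: super_sign_simps lsc_minus1)
  next
    case 3
    then obtain f k g where "y = (f, 0, k)" "x = (0, g, 0)" using assms hom_partD by metis
    then show ?thesis using eo[of f k g] 3 by (simp only: super_sign_simps lsc_minus1 minus_minus)
  next
    case 4
    then obtain g g' where "x = (0, g, 0)" "y = (0, g', 0)" using assms hom_partD(2) by metis
    then show ?thesis using oo[of g g'] 4 by (simp only: super_sign_def skew_pair_def if_True simp_thms minus_minus)
  qed
qed

text \<open>The Jacobi identity in the form of a derivation rule, which is additive in each argument and can therefore be
checked on modes.\<close>

definition jac :: "complex \<Rightarrow> ('a, 'u) loop \<Rightarrow> ('a, 'u) loop \<Rightarrow> ('a, 'u) loop \<Rightarrow> bool" where
  "jac s x y z \<longleftrightarrow> lbr x (lbr y z) = lbr (lbr x y) z + lsc s (lbr y (lbr x z))"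

lemma jac_add: "jac s x y z \<Longrightarrow> jac s x' y z \<Longrightarrow> jac s (x + x') y z"
  "jac s x y z \<Longrightarrow> jac s x y' z \<Longrightarrow> jac s x (y + y') z" "jac s x y z \<Longrightarrow> jac s x y z' \<Longrightarrow> jac s x y (z + z')"
  unfolding jac_def lbr_add lsc_add by simp_all

lemma jac_cen: "jac s (cen k) y z" "jac s x (cen k) z" "jac s x y (cen k)"
  unfolding jac_def lbr_modes(5,6) lbr_zero using lsc_add[of s 0 0] by simp_all

lemma am_cen_eqI: "X = Y + Z \<Longrightarrow> c = c1 + c2 \<Longrightarrow> am X k + cen c = (am Y k + cen c1) + (am Z k + cen c2 :: ('a, 'u) loop)"
  by (simp add: am_um_cen_add(1,3)[symmetric] algebra_simps)

lemma um_eqI: "X = Y + Z \<Longrightarrow> um X k = um Y k + (um Z k :: ('a, 'u) loop)"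
  by (simp add: am_um_cen_add)

lemma scA_sum: "x = y + z \<Longrightarrow> scA D x t = scA D y t + scA D z t" by (simp add: A.scale_left_distrib)
lemma scU_sum: "x = y + z \<Longrightarrow> scU D x t = scU D y t + scU D z t" by (simp add: U.scale_left_distrib)

lemma formA_left_commute: "formA D b (a * c) = formA D a (b * c)"
  using formA_assoc formA_sym by (metis mult.commute)

text \<open>The central terms meet only for \<open>m + n + r = 3\<close>, where the associativity of the form reduces the claim to a
polynomial identity in \<open>m\<close> and \<open>n\<close>.\<close>

lemma jac_AAA: "jac 1 (am a m) (am b n) (am c r)"
proof -
  let ?t = "a * (b * c)"
  have N: "m + (n + r - 1) - 1 = m + n + r - 2" "m + n - 1 + r - 1 = m + n + r - 2" "n + (m + r - 1) - 1 = m + n + r - 2"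
    "m + (n + r - 1) = 2 \<longleftrightarrow> m + n + r = 3" "m + n - 1 + r = 2 \<longleftrightarrow> m + n + r = 3" "n + (m + r - 1) = 2 \<longleftrightarrow> m + n + r = 3" by auto
  have p: "a * b * c = ?t" "b * (a * c) = ?t" "formA D (a * b) c = formA D a (b * c)" "formA D b (a * c) = formA D a (b * c)"
    by (auto simp: mult.assoc mult.left_commute formA_assoc formA_left_commute)
  have c: "(of_int m * (of_int m - 1) * (of_int m - 2) / 6) * ((of_int (n - r) / 2) * F)
     = (of_int (m + n - 1) * (of_int (m + n - 1) - 1) * (of_int (m + n - 1) - 2) / 6) * ((of_int (m - n) / 2) * F)
     + (of_int n * (of_int n - 1) * (of_int n - 2) / 6) * ((of_int (m - r) / 2) * (F::complex))" if "m + n + r = 3" for F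
  proof -
    have r: "r = 3 - m - n" using that by simp
    show ?thesis unfolding r by (simp add: field_simps)
  qed
  show ?thesis
    unfolding jac_def lbr_modes lbr_add lbr_modes(5,6) lsc_one add_0_right add_0_left mult_scale formA_rules A.scale_scale p N
    by (rule am_cen_eqI[OF scA_sum], simp add: field_simps, cases "m + n + r = 3", simp only: gbinomial_three if_True simp_thms, erule c, simp)
qed

lemma jac_AAU: "jac 1 (am a m) (am b n) (um u r)"
proof -
  have N: "m + (n + r - 1) - 1 = m + n + r - 2" "m + n - 1 + r - 1 = m + n + r - 2" "n + (m + r - 1) - 1 = m + n + r - 2" by auto
  have p: "act D (a * b) u = act D a (act D b u)" "act D b (act D a u) = act D a (act D b u)"
    by (auto simp flip: act_assoc simp: mult.commute)
  show ?thesis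
    unfolding jac_def lbr_modes lbr_add lbr_modes(5,6) lsc_one add_0_right add_0_left act_rules U.scale_scale p N
    by (rule um_eqI[OF scU_sum]) (simp add: field_simps)
qed

lemma jac_AUA: "jac 1 (am a m) (um u n) (am c r)"
proof -
  have N: "m + (r + n - 1) - 1 = m + n + r - 2" "r + (m + n - 1) - 1 = m + n + r - 2" "m + r - 1 + n - 1 = m + n + r - 2" by auto
  have p: "act D (a * c) u = act D a (act D c u)" "act D c (act D a u) = act D a (act D c u)"
    by (auto simp flip: act_assoc simp: mult.commute)
  show ?thesis
    unfolding jac_def lbr_modes lbr_add lbr_minus lbr_modes(5,6) lsc_one add_0_right add_0_left act_rules U.scale_scale p N um_minus U.scale_minus_left[symmetric]
    by (rule um_eqI[OF scU_sum]) (simp add: field_simps)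
qed

lemma formU_circ': "formU D (act D a u) v = 4/3 * formA D a (circ D u v)" "formU D u (act D a v) = 4/3 * formA D a (circ D u v)"
  using formU_circ formU_act formU_sym circ_sym by metis+

text \<open>The factor \<open>4/3\<close> in the compatibility of the two forms is exactly what makes the central terms cancel.\<close>

lemma jac_AUU: "jac 1 (am a m) (um u n) (um v r)"
proof -
  have N: "m + (n + r) - 1 = m + n + r - 1" "m + n - 1 + r = m + n + r - 1" "n + (m + r - 1) = m + n + r - 1"
    "m + (n + r) = 2 \<longleftrightarrow> m + n + r = 2" "m + n + r - 1 = 1 \<longleftrightarrow> m + n + r = 2" by auto
  have p: "circ D (act D a u) v = a * circ D u v" "circ D u (act D a v) = a * circ D u v"
    using mult_circ1 mult_circ2 circ_sym by metis+
  have c: "(of_int m * (of_int m - 1) * (of_int m - 2) / 6) * F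
     = (of_int ((m + n - 1) * (m + n - 1 - 1)) / 2) * ((of_int (m - 2 * n) / 4) * (4/3 * F))
     + (of_int (n * (n - 1)) / 2) * ((of_int (m - 2 * r) / 4) * (4/3 * (F::complex)))" if "m + n + r = 2" for F
  proof -
    have r: "r = 2 - m - n" using that by simp
    show ?thesis unfolding r by (simp add: field_simps)
  qed
  show ?thesis
    unfolding jac_def lbr_modes lbr_add lbr_modes(5,6) lsc_one add_0_right add_0_left circ_rules formU_rules formU_circ' A.scale_scale p N
    by (rule am_cen_eqI[OF scA_sum], simp add: field_simps, cases "m + n + r = 2", simp only: gbinomial_three if_True simp_thms, erule c, simp)
qed

text \<open>The remaining orders of the first two arguments follow from the antisymmetry of the bracket.\<close>

lemma jac_swap:
  assumes "x \<in> hom_part p" "y \<in> hom_part q" "jac (super_sign p q) x y z"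
  shows "jac (super_sign q p) y x z"
proof -
  let ?s = "super_sign p q"
  have ss: "lsc ?s (lsc ?s w) = w" for w by (auto simp: super_sign_def lsc_minus1 lsc_one)
  have m: "lsc (- ?s) w = - lsc ?s w" for w by (auto simp: super_sign_def lsc_minus1 lsc_one)
  have "lsc ?s (lbr x (lbr y z)) = - lbr (lbr y x) z + lbr y (lbr x z)"
    using assms(3) unfolding jac_def lbr_skew[OF assms(1,2)] m lbr_minus lbr_scale by (simp add: lsc_add ss) (simp add: lsc_diff ss flip: diff_conv_add_uminus)
  then show ?thesis unfolding jac_def super_sign_simps(2)[of q p] by simp
qed

lemma jac_UUA: "jac (-1) (um u m) (um v n) (am a r)"
proof -
  have N: "m + (r + n - 1) = m + n + r - 1" "n + (r + m - 1) = m + n + r - 1"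
    "m + n + r - 1 = 1 \<longleftrightarrow> m + n + r = 2" by auto
  have p: "circ D v (act D a u) = a * circ D u v" "circ D u (act D a v) = a * circ D u v" "circ D u v * a = a * circ D u v"
    using mult_circ1 mult_circ2 circ_sym by (metis, metis, metis mult.commute)
  have f: "formA D (circ D u v) a = formA D a (circ D u v)" "formU D v (act D a u) = 4/3 * formA D a (circ D u v)"
    using formA_sym formU_circ' circ_sym by metis+
  have c: "of_int (m * (m - 1)) / 2 * (- ((of_int (r - 2 * n) / 4) * (4/3 * F)))
    = (of_int (m + n) * (of_int (m + n) - 1) * (of_int (m + n) - 2) / 6) * F + (of_int (n * (n - 1)) / 2) * ((of_int (r - 2 * m) / 4) * (4/3 * (F::complex)))"
    if "m + n + r = 2" for F
  proof -
    have r: "r = 2 - m - n" using that by simp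
    show ?thesis unfolding r by (simp add: field_simps)
  qed
  have "lbr (um u m) (lbr (um v n) (am a r)) = am (scA D (- (of_int (r - 2 * n) / 4)) (a * circ D u v)) (m + n + r - 1)
      + cen (if m + n + r = 2 then of_int (m * (m - 1)) / 2 * (- ((of_int (r - 2 * n) / 4) * (4/3 * formA D a (circ D u v)))) else 0)"
    unfolding lbr_modes lbr_minus circ_rules formU_rules formU_circ' p N by (simp add: am_minus cen_minus)
  moreover have "lsc (-1) (lbr (um v n) (lbr (um u m) (am a r))) = am (scA D (of_int (r - 2 * m) / 4) (a * circ D u v)) (m + n + r - 1)
      + cen (if m + n + r = 2 then of_int (n * (n - 1)) / 2 * ((of_int (r - 2 * m) / 4) * (4/3 * formA D a (circ D u v))) else 0)"
    unfolding lbr_modes lbr_minus lsc_minus1 circ_rules formU_rules f p N by (simp add: ac_simps)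
  moreover have "lbr (lbr (um u m) (um v n)) (am a r) = am (scA D (of_int (m + n - r) / 2) (a * circ D u v)) (m + n + r - 1)
      + cen (if m + n + r = 2 then (of_int (m + n) * (of_int (m + n) - 1) * (of_int (m + n) - 2) / 6) * formA D a (circ D u v) else 0)"
    unfolding lbr_modes lbr_add f p by (simp add: gbinomial_three)
  ultimately show ?thesis
    unfolding jac_def by (simp only:) (rule am_cen_eqI[OF scA_sum], simp add: field_simps, cases "m + n + r = 2", simp only: if_True simp_thms, erule c, simp)
qed

text \<open>The three terms are multiples of one vector by the cyclic symmetry of \<open>(u \<circ> v)w\<close>, and the coefficients add up.\<close>

lemma jac_UUU: "jac (-1) (um u m) (um v n) (um w r)"
proof -
  let ?t = "act D (circ D u v) w"
  have p: "act D (circ D v w) u = ?t" "act D (circ D u w) v = ?t"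
    using circ_act1 circ_act2 circ_sym by metis+
  have "lbr (um u m) (lbr (um v n) (um w r)) = um (scU D (- (of_int (n + r - 2 * m) / 4)) ?t) (m + n + r - 1)"
    unfolding lbr_modes lbr_add p by (simp add: um_minus ac_simps)
  moreover have "lsc (-1) (lbr (um v n) (lbr (um u m) (um w r))) = um (scU D (of_int (m + r - 2 * n) / 4) ?t) (m + n + r - 1)"
    unfolding lbr_modes lbr_add p lsc_minus1 by (simp add: ac_simps)
  moreover have "lbr (lbr (um u m) (um v n)) (um w r) = um (scU D (of_int (m + n - 2 * r) / 4) ?t) (m + n + r - 1)"
    unfolding lbr_modes lbr_add p by simp
  ultimately show ?thesis
    unfolding jac_def by (simp only:) (rule um_eqI[OF scU_sum], simp add: field_simps)
qed

lemma am_hom: "am a n \<in> hom_part False" and um_hom: "um u n \<in> hom_part True" and cen_hom: "cen k \<in> hom_part False"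
  by (simp_all add: am_def um_def cen_def hom_part_def)

lemma jac_homogeneous:
  assumes "x \<in> hom_part p" "y \<in> hom_part q"
  shows "jac (super_sign p q) x y z"
proof (induction z rule: loop_induct)
  case (1 x y)
  then show ?case by (rule jac_add)
next
  have ee: "jac 1 (f, 0, k) (g, 0, k') z" if "\<And>a m b n. jac 1 (am a m) (am b n) z" for f g k k' and z
    by (induction f k rule: loop_even_induct; induction g k' rule: loop_even_induct) (auto intro: jac_add jac_cen that)
  have eo: "jac 1 (f, 0, k) (0, g, 0) z" if "\<And>a m b n. jac 1 (am a m) (um b n) z" for f g k and z
    by (induction f k rule: loop_even_induct; induction g rule: loop_odd_induct) (auto intro: jac_add jac_cen that)
  have oo: "jac (-1) (0, f, 0) (0, g, 0) z" if "\<And>a m b n. jac (-1) (um a m) (um b n) z" for f g and z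
    by (induction f rule: loop_odd_induct; induction g rule: loop_odd_induct) (auto intro: jac_add jac_cen that)
  have *: "jac (super_sign p q) x y z"
    if "\<And>a m b n. jac 1 (am a m) (am b n) z" "\<And>a m b n. jac 1 (am a m) (um b n) z" "\<And>a m b n. jac (-1) (um a m) (um b n) z" for z
  proof (cases "p = q")
    case True
    then show ?thesis using assms ee[OF that(1)] oo[OF that(3)] by (cases p) (auto simp: super_sign_def dest!: hom_partD)
  next
    case False
    have j: "jac (super_sign False True) x y z" if "x \<in> hom_part False" "y \<in> hom_part True" for x y
      using eo[OF \<open>\<And>a m b n. jac 1 (am a m) (um b n) z\<close>] that by (auto simp: super_sign_def dest!: hom_partD)
    show ?thesis
    proof (cases p)
      case True
      then have "x \<in> hom_part True" "y \<in> hom_part False" "p = True" "q = False" using assms False by auto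
      then show ?thesis using jac_swap[OF _ _ j] by blast
    next
      case False
      then have "x \<in> hom_part False" "y \<in> hom_part True" "p = False" "q = True" using assms \<open>p \<noteq> q\<close> by auto
      then show ?thesis using j by blast
    qed
  qed
  {
    case (2 c r)
    show ?case by (rule *) (rule jac_AAA jac_AUA jac_UUA)+
  next
    case (3 w r)
    show ?case by (rule *) (rule jac_AAU jac_AUU jac_UUU)+
  next
    case (4 k)
    show ?case by (rule jac_cen)
  }
qed

lemma loop_pos_br: "loop_pos (lbr (loop_pos x) (loop_pos y)) = lbr (loop_pos x) (loop_pos y)"
  and chi_pos_br: "snd (snd (lbr (loop_pos x) (loop_pos y))) = 0"
proof -
  have g: "of_int m gchoose 3 = (0::complex)" if "0 \<le> m" "0 \<le> n" "m + n = 2" for m n :: int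
  proof -
    have "m = 0 \<or> m = 1 \<or> m = 2" using that by arith
    then show ?thesis by (auto simp: gbinomial_three)
  qed
  have h: "of_int (m * (m - 1)) = (0::complex)" if "0 \<le> m" "0 \<le> n" "m + n = 1" for m n :: int
  proof -
    have "m = 0 \<or> m = 1" using that by arith
    then show ?thesis by auto
  qed
  have s: "loop_pos (am (scA D (of_int (m - n) / 2) a) (m + n - 1)) = (am (scA D (of_int (m - n) / 2) a) (m + n - 1) :: ('a, 'u) loop)"
    "loop_pos (um (scU D (of_int (m - 2 * n) / 4) u) (m + n - 1)) = (um (scU D (of_int (m - 2 * n) / 4) u) (m + n - 1) :: ('a, 'u) loop)"
    if "0 \<le> m" "0 \<le> n" for m n a u
    using that by (cases "m = 0 \<and> n = 0"; force simp: loop_pos_simps am_um_cen_add)+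
  have neg: "loop_pos (- z) = - loop_pos z" for z :: "('a, 'u) loop"
    using loop_pos_simps(1)[of z "- z"] by (simp add: loop_pos_simps(5) eq_neg_iff_add_eq_0 add.commute)
  have "loop_pos (lbr (loop_pos x) (loop_pos y)) = lbr (loop_pos x) (loop_pos y) \<and> snd (snd (lbr (loop_pos x) (loop_pos y))) = 0"
    (is "?Q x y")
  proof (induction x rule: loop_induct)
    case (1 x x')
    then show ?case by (simp add: loop_pos_simps lbr_add)
  next
    case (2 a m)
    show ?case
    proof (induction y rule: loop_induct)
      case (1 y y')
      then show ?case by (simp add: loop_pos_simps lbr_add)
    next
      case (2 b n)
      then show ?case using s(1)[of m n "a * b"] g[of m n]
        by (auto simp: loop_pos_simps(1-5) lbr_zero lbr_modes am_um_cen_add) (auto simp: am_def cen_def)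
    next
      case (3 u n)
      then show ?case using s(2)[of m n "act D a u"] by (auto simp: loop_pos_simps(2-5) lbr_zero lbr_modes) (auto simp: um_def)
    qed (simp add: loop_pos_simps lbr_modes lbr_zero)
  next
    case (3 u m)
    show ?case
    proof (induction y rule: loop_induct)
      case (1 y y')
      then show ?case by (simp add: loop_pos_simps lbr_add)
    next
      case (2 b n)
      then show ?case using s(2)[of n m "act D b u"] by (auto simp: loop_pos_simps(2-5) lbr_zero lbr_modes neg) (auto simp: um_def)
    next
      case (3 v n)
      then show ?case using h[of m n]
        by (auto simp: loop_pos_simps(1-5) lbr_zero lbr_modes am_um_cen_add) (auto simp: am_def cen_def)
    qed (simp add: loop_pos_simps lbr_modes lbr_zero)
  next
    case (4 k)
    then show ?case by (simp add: loop_pos_simps lbr_modes lbr_zero)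
  qed
  then show "loop_pos (lbr (loop_pos x) (loop_pos y)) = lbr (loop_pos x) (loop_pos y)"
    "snd (snd (lbr (loop_pos x) (loop_pos y))) = 0" by auto
qed

text \<open>The modes of negative index form a subalgebra: the central terms of the brackets need \<open>m + n = 2\<close> or \<open>m + n = 1\<close>.\<close>

lemma loop_neg_br: "loop_pos (lbr (x - loop_pos x) (y - loop_pos y)) = 0"
proof -
  have d: "x + x' - loop_pos (x + x') = (x - loop_pos x) + (x' - loop_pos x')" for x x' :: "('a, 'u) loop"
    by (simp add: loop_pos_simps)
  have neg: "loop_pos (- z) = - loop_pos z" for z :: "('a, 'u) loop"
    using loop_pos_simps(1)[of z "- z"] by (simp add: loop_pos_simps(5) eq_neg_iff_add_eq_0 add.commute)
  show ?thesis
  proof (induction x rule: loop_induct)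
    case (1 x x')
    then show ?case by (simp only: d lbr_add) (simp add: loop_pos_simps(1))
  next
    case (2 a m)
    show ?case
    proof (induction y rule: loop_induct)
      case (1 y y')
      then show ?case by (simp only: d lbr_add) (simp add: loop_pos_simps(1))
    qed (auto simp: loop_pos_simps(1-5) lbr_zero lbr_modes am_um_cen_add)
  next
    case (3 u m)
    show ?case
    proof (induction y rule: loop_induct)
      case (1 y y')
      then show ?case by (simp only: d lbr_add) (simp add: loop_pos_simps(1))
    qed (auto simp: loop_pos_simps(1-5) lbr_zero lbr_modes am_um_cen_add neg)
  next
    case (4 k)
    then show ?case by (simp add: loop_pos_simps lbr_modes lbr_zero)
  qed
qed

sublocale LS: split_lie_superalgebra lsc lbr hom_part even_part odd_part loop_pos "\<lambda>x. l * snd (snd x)" for l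
proof
  fix x y z :: "('a, 'u) loop" and p q c
  show "loop_pos (lsc c x) = lsc c (loop_pos x)"
    by (induction x rule: loop_induct) (auto simp: lsc_add lsc_modes loop_pos_simps lsc_zero)
  show "even_part (lsc c x) = lsc c (even_part x)" "odd_part (lsc c x) = lsc c (odd_part x)" 
    by (cases x; auto simp: even_part_def odd_part_def loop_scale_def intro!: poly_mapping_eqI simp: lookup_map_zero)+
  show "x \<in> hom_part p \<Longrightarrow> loop_pos x \<in> hom_part p"
    by (cases p) (auto simp: hom_part_def loop_pos_def nonneg_part_simps)
  show "loop_pos x = 0 \<Longrightarrow> loop_pos y = 0 \<Longrightarrow> loop_pos (lbr x y) = 0" using loop_neg_br[of x y] by simp
  show "loop_pos x = x \<Longrightarrow> loop_pos y = y \<Longrightarrow> loop_pos (lbr x y) = lbr x y" using loop_pos_br[of x y] by simp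
  show "loop_pos x = x \<Longrightarrow> loop_pos y = y \<Longrightarrow> l * snd (snd (lbr x y)) = 0" using chi_pos_br[of x y] by simp
  show "x \<in> hom_part p \<Longrightarrow> y \<in> hom_part q \<Longrightarrow> lbr x (lbr y z) = lbr (lbr x y) z + lsc (super_sign p q) (lbr y (lbr x z))"
    using jac_homogeneous unfolding jac_def .
  show "x \<in> hom_part p \<Longrightarrow> y \<in> hom_part p \<Longrightarrow> x - y \<in> hom_part p"
    by (cases p) (auto simp: hom_part_def)
  show "x \<in> hom_part p \<Longrightarrow> y \<in> hom_part q \<Longrightarrow> lbr x y = lsc (- super_sign p q) (lbr y x)" by (rule lbr_skew)
  show "x \<in> hom_part p \<Longrightarrow> y \<in> hom_part q \<Longrightarrow> lbr x y \<in> hom_part (p \<noteq> q)" by (rule lbr_hom)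
  show "lbr (x + y) z = lbr x z + lbr y z" "lbr x (y + z) = lbr x y + lbr x z" by (rule lbr_add)+
  show "lbr (lsc c x) y = lsc c (lbr x y)" "lbr x (lsc c y) = lsc c (lbr x y)" by (rule lbr_scale)+
  show "lsc (- 1) x = - x" "lsc 1 x = x" "lsc c (x - y) = lsc c x - lsc c y" by (rule lsc_minus1 lsc_one lsc_diff)+
  show "loop_pos (x + y) = loop_pos x + loop_pos y" "loop_pos (loop_pos x) = loop_pos x" by (rule loop_pos_simps)+
  show "l * snd (snd (lsc c x)) = c * (l * snd (snd x))"
    by (simp add: loop_scale_def split: prod.splits)
qed (auto simp: even_part_def odd_part_def hom_part_def plus_prod_def algebra_simps zero_prod_def split: prod.splits)

end

section \<open>Complex vector spaces with carrier sets\<close>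

lemma CC_simps [simp]: "carrier CC = UNIV" "mult CC = (*)" "one CC = 1" "zero CC = 0" "add CC = (+)"
  by (simp_all add: CC_def)

lemma CC_cring: "cring CC"
proof (rule cringI)
  have "\<exists>y. y + x = 0" for x :: complex using add.left_inverse by blast
  then show "abelian_group CC" by (intro abelian_groupI) auto
  show "Group.comm_monoid CC" by (intro comm_monoidI) auto
qed (auto simp: algebra_simps)

text \<open>Subspaces, cosets and quotients of modules over \<open>\<complex>\<close>, with membership in a coset expressed by differences.\<close>

locale cspace = module CC M for M :: "(complex, 'v) module" (structure)
begin

lemma sm_closed: "x \<in> carrier M \<Longrightarrow> c \<odot> x \<in> carrier M"
  using smult_closed by simp

lemma sm_rules:
  "x \<in> carrier M \<Longrightarrow> (a + b) \<odot> x = a \<odot> x \<oplus> b \<odot> x"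
  "x \<in> carrier M \<Longrightarrow> y \<in> carrier M \<Longrightarrow> a \<odot> (x \<oplus> y) = a \<odot> x \<oplus> a \<odot> y"
  "x \<in> carrier M \<Longrightarrow> (a * b) \<odot> x = a \<odot> (b \<odot> x)"
  "x \<in> carrier M \<Longrightarrow> 1 \<odot> x = x" "x \<in> carrier M \<Longrightarrow> 0 \<odot> x = \<zero>" "a \<odot> \<zero> = \<zero>"
  using smult_l_distr[of a b x] smult_r_distr[of a x y] smult_assoc1[of a b x] smult_one[of x] smult_l_null[of x] smult_r_null[of a] by auto

lemma neg_eq: "x \<in> carrier M \<Longrightarrow> \<ominus> x = (-1) \<odot> x"
proof -
  assume x: "x \<in> carrier M"
  have "x \<oplus> (-1) \<odot> x = (1 + -1) \<odot> x" using sm_rules(1)[OF x, of 1 "-1"] sm_rules(4)[OF x] by simp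
  then have "x \<oplus> (-1) \<odot> x = \<zero>" using sm_rules(5)[OF x] by simp
  then show ?thesis using x sm_closed by (metis M.minus_equality M.a_comm)
qed

lemma minus_eq: "x \<ominus> y = x \<oplus> \<ominus> y" by (simp add: a_minus_def)

lemma submoduleI':
  assumes "H \<subseteq> carrier M" "\<zero> \<in> H" "\<And>x y. x \<in> H \<Longrightarrow> y \<in> H \<Longrightarrow> x \<oplus> y \<in> H" "\<And>c x. x \<in> H \<Longrightarrow> c \<odot> x \<in> H"
  shows "submodule H CC M"
  by (rule submoduleI) (use assms neg_eq in \<open>auto simp: subset_iff\<close>)

lemma submoduleD:
  assumes "submodule H CC M"
  shows "H \<subseteq> carrier M" "\<zero> \<in> H" "x \<in> H \<Longrightarrow> y \<in> H \<Longrightarrow> x \<oplus> y \<in> H" "x \<in> H \<Longrightarrow> c \<odot> x \<in> H"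
    "x \<in> H \<Longrightarrow> \<ominus> x \<in> H" "x \<in> H \<Longrightarrow> y \<in> H \<Longrightarrow> x \<ominus> y \<in> H"
proof -
  note e = submoduleE[OF assms]
  show s: "H \<subseteq> carrier M" and "x \<in> H \<Longrightarrow> y \<in> H \<Longrightarrow> x \<oplus> y \<in> H" "x \<in> H \<Longrightarrow> c \<odot> x \<in> H" "x \<in> H \<Longrightarrow> \<ominus> x \<in> H"
    using e by auto
  show "x \<in> H \<Longrightarrow> y \<in> H \<Longrightarrow> x \<ominus> y \<in> H" using e by (auto simp: a_minus_def)
  obtain z where "z \<in> H" using e(2) by blast
  then have "0 \<odot> z \<in> H" using e(4) by simp
  then show "\<zero> \<in> H" using sm_rules(5) \<open>z \<in> H\<close> s by auto
qed

lemma carrier_submodule: "submodule (carrier M) CC M"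
  by (rule submoduleI') (auto simp: sm_closed)

lemma vspan_submodule: assumes "S \<subseteq> carrier M" shows "submodule (vspan M S) CC M"
proof (rule submoduleI')
  show "vspan M S \<subseteq> carrier M" unfolding vspan_def using carrier_submodule assms by auto
qed (auto simp: vspan_def dest: submoduleD)

lemma vspan_superset: "S \<subseteq> vspan M S" unfolding vspan_def by blast
lemma vspan_minimal: "submodule H CC M \<Longrightarrow> S \<subseteq> H \<Longrightarrow> vspan M S \<subseteq> H" unfolding vspan_def by blast
lemma submodule_abelian: "submodule N CC M \<Longrightarrow> abelian_subgroup N M"
  by (intro abelian_subgroupI3 additive_subgroup.intro M.abelian_group_axioms) (rule submodule.axioms(1))

context
  fixes N assumes N: "submodule N CC M"
begin

interpretation N: abelian_subgroup N M by (rule submodule_abelian[OF N])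

lemma cos_mem: "x \<in> carrier M \<Longrightarrow> y \<in> N +> x \<longleftrightarrow> y \<in> carrier M \<and> y \<ominus> x \<in> N"
  unfolding minus_eq using N.a_rcos_module_imp[of x y] N.a_rcos_module_rev[of x y] N.a_elemrcos_carrier[of x y]
  by blast

lemma cos_self: "x \<in> carrier M \<Longrightarrow> x \<in> N +> x"
  using cos_mem submoduleD(2)[OF N] by (simp add: minus_eq M.r_neg)

lemma cos_eq: assumes "x \<in> carrier M" "y \<in> carrier M" shows "N +> x = N +> y \<longleftrightarrow> x \<ominus> y \<in> N"
proof
  assume "N +> x = N +> y"
  then show "x \<ominus> y \<in> N" using cos_self[OF assms(1)] cos_mem[OF assms(2)] by auto
next
  assume "x \<ominus> y \<in> N"
  have *: "z \<ominus> b \<in> N" if "z \<ominus> a \<in> N" "a \<ominus> b \<in> N" "z \<in> carrier M" "a \<in> carrier M" "b \<in> carrier M" for a b z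
  proof -
    have "z \<ominus> b = (z \<ominus> a) \<oplus> (a \<ominus> b)"
      using that(3-5) by (simp add: minus_eq M.a_assoc M.r_neg1 M.r_neg2)
    then show ?thesis using submoduleD(3)[OF N that(1,2)] by simp
  qed
  have "y \<ominus> x = \<ominus> (x \<ominus> y)" using assms by (simp add: minus_eq M.minus_add M.a_comm)
  then have "y \<ominus> x \<in> N" using submoduleD(5)[OF N \<open>x \<ominus> y \<in> N\<close>] by simp
  then show "N +> x = N +> y" using *[OF _ \<open>x \<ominus> y \<in> N\<close>] *[OF _ \<open>y \<ominus> x \<in> N\<close>] assms by (auto simp: cos_mem)
qed

lemma quot_carrier: "carrier (quot_mod M N) = (\<lambda>x. N +> x) ` carrier M"
  by (auto simp: quot_mod_def A_RCOSETS_def')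

lemma quot_zero: "zero (quot_mod M N) = N" "N +> \<zero> = N"
  using submoduleD(1)[OF N] by (auto simp: quot_mod_def)

lemma quot_add: "x \<in> carrier M \<Longrightarrow> y \<in> carrier M \<Longrightarrow> (N +> x) \<oplus>\<^bsub>quot_mod M N\<^esub> (N +> y) = N +> (x \<oplus> y)"
  by (simp add: quot_mod_def N.a_rcos_sum)

lemma quot_smult: assumes "x \<in> carrier M" shows "c \<odot>\<^bsub>quot_mod M N\<^esub> (N +> x) = N +> (c \<odot> x)"
proof -
  have "N +> (c \<odot> y) = N +> (c \<odot> x)" if y: "y \<in> N +> x" for y
  proof -
    have yc: "y \<in> carrier M" "y \<ominus> x \<in> N" using y cos_mem[OF assms] by auto
    have "c \<odot> (y \<ominus> x) \<in> N" using submoduleD(4)[OF N] yc by blast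
    also have "c \<odot> (y \<ominus> x) = c \<odot> y \<ominus> c \<odot> x"
      using yc assms by (simp add: minus_eq neg_eq sm_rules sm_closed flip: sm_rules(3)) 
    finally show ?thesis using cos_eq yc assms sm_closed by simp
  qed
  then have "(\<Union>y\<in>N +> x. N +> (c \<odot> y)) = N +> (c \<odot> x)" using cos_self[OF assms] by blast
  then show ?thesis by (simp add: quot_mod_def)
qed

lemma quot_module: "module CC (quot_mod M N)"
proof (rule moduleI[OF CC_cring])
  show "abelian_group (quot_mod M N)"
  proof (rule abelian_groupI)
    fix x assume "x \<in> carrier (quot_mod M N)"
    then obtain a where a: "a \<in> carrier M" "x = N +> a" unfolding quot_carrier by blast
    then have "(N +> \<ominus> a) \<oplus>\<^bsub>quot_mod M N\<^esub> x = zero (quot_mod M N)" by (simp add: quot_add quot_zero M.l_neg)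
    then show "\<exists>y\<in>carrier (quot_mod M N). y \<oplus>\<^bsub>quot_mod M N\<^esub> x = zero (quot_mod M N)"
      using a by (auto simp: quot_carrier)
  next
    show "zero (quot_mod M N) \<in> carrier (quot_mod M N)"
      unfolding quot_carrier quot_zero(1) using quot_zero(2) M.zero_closed by blast
  next
    fix x assume "x \<in> carrier (quot_mod M N)"
    then obtain a where a: "a \<in> carrier M" "x = N +> a" unfolding quot_carrier by blast
    show "zero (quot_mod M N) \<oplus>\<^bsub>quot_mod M N\<^esub> x = x"
      unfolding quot_zero(1) a(2) using quot_add[OF M.zero_closed a(1)] quot_zero(2) a(1) by simp
  qed (auto simp: quot_carrier quot_add M.a_ac)
qed (auto simp: quot_carrier quot_add quot_smult sm_closed sm_rules)

end

lemma finsum_support: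
  assumes "finite A" "{i. f i \<noteq> \<zero>} \<subseteq> A" "\<And>i. f i \<in> carrier M"
  shows "finsum M f {i. f i \<noteq> \<zero>} = finsum M f A"
  by (rule M.add.finprod_mono_neutral_cong_left) (use assms in auto)

lemma fsum_eq:
  assumes "\<And>i. i \<ge> N \<Longrightarrow> f i = \<zero>" "\<And>i. f i \<in> carrier M"
  shows "fsum M f = finsum M f {..<N}"
  unfolding fsum_def by (rule finsum_support) (use assms in \<open>auto simp: not_le[symmetric]\<close>)

end

lemma cspaceI: "module CC M \<Longrightarrow> cspace M" by (simp add: cspace_def)

section \<open>Vector spaces of finitely supported functions\<close>

lemma lookup_pm_scale: "Poly_Mapping.lookup (pm_scale c f) k = c * Poly_Mapping.lookup f k"
  by (simp add: pm_scale_def lookup_map_zero)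

lemma pm_scale_vector_space: "vector_space pm_scale"
  by unfold_locales (auto intro!: poly_mapping_eqI simp: lookup_pm_scale lookup_add algebra_simps)

interpretation pm: vector_space "pm_scale :: complex \<Rightarrow> ('k \<Rightarrow>\<^sub>0 complex) \<Rightarrow> ('k \<Rightarrow>\<^sub>0 complex)"
  by (rule pm_scale_vector_space)

lemma pm_scale_single: "pm_scale c (Poly_Mapping.single k a) = Poly_Mapping.single k (c * a)"
  by (simp add: pm_scale_def)

lemma keys_pm_scale: "Poly_Mapping.keys (pm_scale c f) \<subseteq> Poly_Mapping.keys f"
  by (auto simp: in_keys_iff lookup_pm_scale)

text \<open>The linear extension of a function on a basis.\<close>

definition lext :: "('k \<Rightarrow> complex) \<Rightarrow> ('k \<Rightarrow>\<^sub>0 complex) \<Rightarrow> complex" where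
  "lext \<phi> f = (\<Sum>k\<in>Poly_Mapping.keys f. Poly_Mapping.lookup f k * \<phi> k)"

lemma lext_superset: "finite K \<Longrightarrow> Poly_Mapping.keys f \<subseteq> K \<Longrightarrow> lext \<phi> f = (\<Sum>k\<in>K. Poly_Mapping.lookup f k * \<phi> k)"
  unfolding lext_def by (rule sum.mono_neutral_left) (auto simp: in_keys_iff)

lemma lext_add: "lext \<phi> (f + g) = lext \<phi> f + lext \<phi> g"
  using Poly_Mapping.keys_add[of f g]
  by (subst (1 2 3) lext_superset[where K = "Poly_Mapping.keys f \<union> Poly_Mapping.keys g"]) (auto simp: lookup_add algebra_simps sum.distrib)

lemma lext_scale: "lext \<phi> (pm_scale c f) = c * lext \<phi> f"
  using keys_pm_scale[of c f]
  by (subst (1 2) lext_superset[where K = "Poly_Mapping.keys f"]) (auto simp: lookup_pm_scale algebra_simps sum_distrib_left)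

lemma lext_diff: "lext \<phi> (f - g) = lext \<phi> f - lext \<phi> g"
  using lext_add[of \<phi> "f - g" g] by simp

lemma lext_single: "lext \<phi> (Poly_Mapping.single k a) = a * \<phi> k"
  by (subst lext_superset[where K = "{k}"]) auto

lemma pm_linear_induct:
  assumes "\<And>f g. Q f \<Longrightarrow> Q g \<Longrightarrow> Q (f + g)" "\<And>c f. Q f \<Longrightarrow> Q (pm_scale c f)" "\<And>k. Q (Poly_Mapping.single k 1)"
  shows "Q (f :: 'k \<Rightarrow>\<^sub>0 complex)"
proof (rule pm_additive_induct[of Q, OF assms(1)])
  fix k a show "Q (Poly_Mapping.single k a)" using assms(2)[OF assms(3), of a k] by (simp add: pm_scale_single)
qed

lemma class_module:
  fixes s :: "complex \<Rightarrow> 'k::ab_group_add \<Rightarrow> 'k" and R :: "(complex, 'k) module"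
  assumes "vector_space s" and "add R = (+)" "zero R = 0" "smult R = s"
    and "0 \<in> carrier R" "\<And>x y. x \<in> carrier R \<Longrightarrow> y \<in> carrier R \<Longrightarrow> x + y \<in> carrier R" "\<And>c x. x \<in> carrier R \<Longrightarrow> s c x \<in> carrier R"
  shows "module CC R"
proof -
  interpret vector_space s by fact
  have "\<exists>y\<in>carrier R. y + x = 0" if "x \<in> carrier R" for x
    using assms(7)[OF that, of "-1"] by (intro bexI[of _ "s (-1) x"]) auto
  then show ?thesis
    by (intro moduleI CC_cring abelian_groupI) (auto simp: assms algebra_simps)
qed

lemma class_module_minus:
  fixes R :: "(complex, 'k::ab_group_add) module"
  assumes "module CC R" "add R = (+)" "zero R = 0" "x \<in> carrier R" "y \<in> carrier R"
  shows "x \<ominus>\<^bsub>R\<^esub> y = x - y"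
proof -
  interpret cspace R using assms(1) by (rule cspaceI)
  have "y \<oplus>\<^bsub>R\<^esub> \<ominus>\<^bsub>R\<^esub> y = \<zero>\<^bsub>R\<^esub>" using assms(5) by (rule M.r_neg)
  then have "\<ominus>\<^bsub>R\<^esub> y = - y" unfolding assms(2,3) by (metis add.inverse_unique)
  then show ?thesis by (simp add: minus_eq assms(2))
qed

section \<open>The induced module as a quotient of the free algebra\<close>

lemma letters_simps [simp]: "letters (v + w) = letters v @ letters w" "letters 0 = []"
  by (simp_all add: plus_word_def zero_word_def)

definition wd :: "'l list \<Rightarrow> ('l word \<Rightarrow>\<^sub>0 complex)" where "wd xs = Poly_Mapping.single (Word xs) 1"

lemma wd_simps: "wd [] = 1" "gen x * wd xs = wd (x # xs)" "wd xs * wd ys = wd (xs @ ys)" "wd [x] = gen x" "wd xs * gen x = wd (xs @ [x])"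
  by (simp_all add: wd_def gen_def mult_single plus_word_def flip: single_one zero_word_def)

lemma word_induct:
  assumes "\<And>f g. Q f \<Longrightarrow> Q g \<Longrightarrow> Q (f + g)" "\<And>c f. Q f \<Longrightarrow> Q (pm_scale c f)" "\<And>xs. Q (wd xs)"
  shows "Q (f :: 'l word \<Rightarrow>\<^sub>0 complex)"
proof (rule pm_linear_induct[of Q, OF assms(1,2)])
  fix k :: "'l word" show "Q (Poly_Mapping.single k 1)" using assms(3)[of "letters k"] by (simp add: wd_def)
qed

lemma pm_scale_mult: "pm_scale c f * g = pm_scale c (f * g)" "f * pm_scale c g = pm_scale c (f * (g :: 'l::monoid_add \<Rightarrow>\<^sub>0 complex))"
proof -
  have l: "pm_scale c f = Poly_Mapping.single 0 c * f" and r: "pm_scale c f = f * Poly_Mapping.single 0 c" for f :: "'l \<Rightarrow>\<^sub>0 complex"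
    by (induction f rule: pm_additive_induct)
      (simp_all add: pm.scale_right_distrib distrib_left distrib_right pm_scale_single mult_single mult.commute)
  show "pm_scale c f * g = pm_scale c (f * g)" unfolding l by (rule mult.assoc)
  show "f * pm_scale c g = pm_scale c (f * g)" unfolding r by (rule mult.assoc[symmetric])
qed

lemma free_alg_simps [simp]: "mult (free_alg S) = (*)" "one (free_alg S) = 1" "zero (free_alg S) = 0" "add (free_alg S) = (+)"
  "smult (free_alg S) = pm_scale" "f \<in> carrier (free_alg S) \<longleftrightarrow> (\<forall>w\<in>Poly_Mapping.keys f. set (letters w) \<subseteq> S)"
  by (simp_all add: free_alg_def)

lemma free_alg_closed:
  "f \<in> carrier (free_alg S) \<Longrightarrow> g \<in> carrier (free_alg S) \<Longrightarrow> f + g \<in> carrier (free_alg S)"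
  "f \<in> carrier (free_alg S) \<Longrightarrow> pm_scale c f \<in> carrier (free_alg S)"
  "f \<in> carrier (free_alg S) \<Longrightarrow> g \<in> carrier (free_alg S) \<Longrightarrow> f * g \<in> carrier (free_alg S)"
  "f \<in> carrier (free_alg S) \<Longrightarrow> g \<in> carrier (free_alg S) \<Longrightarrow> f - g \<in> carrier (free_alg S)"
  "0 \<in> carrier (free_alg S)" "1 \<in> carrier (free_alg S)" "x \<in> S \<Longrightarrow> gen x \<in> carrier (free_alg S)"
proof -
  show "f * g \<in> carrier (free_alg S)" if "f \<in> carrier (free_alg S)" "g \<in> carrier (free_alg S)"
    using that keys_mult[of f g] by fastforce
  show "1 \<in> carrier (free_alg S)" by (simp flip: single_one)
  show "f - g \<in> carrier (free_alg S)" if "f \<in> carrier (free_alg S)" "g \<in> carrier (free_alg S)"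
    using that keys_diff[of f g] by fastforce
qed (use Poly_Mapping.keys_add[of f g] keys_pm_scale[of c f] in \<open>fastforce simp: gen_def\<close>)+

lemma free_alg_module: "module CC (free_alg S)"
  by (rule class_module[OF pm_scale_vector_space]) (use free_alg_closed in \<open>simp_all del: free_alg_simps(6)\<close>)

lemma free_alg_ring: "ring (free_alg S)"
proof (rule ringI)
  show "abelian_group (free_alg S)" using free_alg_module module.axioms(2) by blast
  show "Group.monoid (free_alg S)"
    by (rule monoidI) (use free_alg_closed in \<open>simp_all del: free_alg_simps(6) add: mult.assoc\<close>)
qed (simp_all add: distrib_left distrib_right)

lemma free_alg_ideal_submodule:
  assumes "ideal I (free_alg S)"
  shows "submodule I CC (free_alg S)"
proof -
  interpret ideal I "free_alg S" by fact
  interpret F: cspace "free_alg S" by (rule cspaceI[OF free_alg_module])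
  show ?thesis
  proof (rule F.submoduleI')
    show "c \<odot>\<^bsub>free_alg S\<^esub> x \<in> I" if "x \<in> I" for c x
    proof -
      have "pm_scale c 1 \<in> carrier (free_alg S)" by (intro free_alg_closed)
      from I_l_closed[OF that this] show ?thesis by (simp add: pm_scale_mult)
    qed
  qed (use a_subset additive_subgroup.zero_closed[OF additive_subgroup_axioms] additive_subgroup.a_closed[OF additive_subgroup_axioms] in auto)
qed

lemma idealI':
  assumes "I \<subseteq> carrier (free_alg S)" "0 \<in> I" "\<And>x y. x \<in> I \<Longrightarrow> y \<in> I \<Longrightarrow> x + y \<in> I" "\<And>c x. x \<in> I \<Longrightarrow> pm_scale c x \<in> I"
    "\<And>a x. a \<in> I \<Longrightarrow> x \<in> carrier (free_alg S) \<Longrightarrow> x * a \<in> I" "\<And>a x. a \<in> I \<Longrightarrow> x \<in> carrier (free_alg S) \<Longrightarrow> a * x \<in> I"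
  shows "ideal I (free_alg S)"
proof (rule idealI[OF free_alg_ring])
  interpret F: cspace "free_alg S" by (rule cspaceI[OF free_alg_module])
  have "submodule I CC (free_alg S)" by (rule F.submoduleI') (use assms in \<open>auto simp del: free_alg_simps(6)\<close>)
  then show "subgroup I (add_monoid (free_alg S))" by (rule submodule.axioms)
qed (use assms in \<open>simp_all del: free_alg_simps(6)\<close>)

lemma uea_ideal_ideal:
  assumes "uea_rels L \<subseteq> carrier (free_alg (lcarrier L))"
  shows "ideal (uea_ideal L) (free_alg (lcarrier L))" "uea_rels L \<subseteq> uea_ideal L"
    "\<And>I. ideal I (free_alg (lcarrier L)) \<Longrightarrow> uea_rels L \<subseteq> I \<Longrightarrow> uea_ideal L \<subseteq> I"
  unfolding uea_ideal_def
  by (rule ring.genideal_ideal[OF free_alg_ring assms], rule ring.genideal_self[OF free_alg_ring assms],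
      rule ring.genideal_minimal[OF free_alg_ring])

lemma uea_relsI:
  "x \<in> lcarrier L \<Longrightarrow> y \<in> lcarrier L \<Longrightarrow> gen (x + y) - gen x - gen y \<in> uea_rels L"
  "x \<in> lcarrier L \<Longrightarrow> gen (lscale L c x) - pm_scale c (gen x) \<in> uea_rels L"
  "x \<in> lcarrier L \<inter> lpart L p \<Longrightarrow> y \<in> lcarrier L \<inter> lpart L q \<Longrightarrow>
     gen x * gen y - pm_scale (super_sign p q) (gen y * gen x) - gen (lbracket L x y) \<in> uea_rels L"
  unfolding uea_rels_def super_sign_def by blast+

lemma uea_relsE:
  assumes "r \<in> uea_rels L"
    "\<And>x y. x \<in> lcarrier L \<Longrightarrow> y \<in> lcarrier L \<Longrightarrow> Q (gen (x + y) - gen x - gen y)"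
    "\<And>c x. x \<in> lcarrier L \<Longrightarrow> Q (gen (lscale L c x) - pm_scale c (gen x))"
    "\<And>x y p q. x \<in> lcarrier L \<Longrightarrow> x \<in> lpart L p \<Longrightarrow> y \<in> lcarrier L \<Longrightarrow> y \<in> lpart L q \<Longrightarrow>
     Q (gen x * gen y - pm_scale (super_sign p q) (gen y * gen x) - gen (lbracket L x y))"
  shows "Q r"
  using assms unfolding uea_rels_def super_sign_def by blast

lemma nonneg_part_fixed: "nonneg_part f = f \<longleftrightarrow> Poly_Mapping.keys f \<subseteq> {0..}"
  unfolding poly_mapping_eq_iff fun_eq_iff lookup_nonneg_part by (auto simp: in_keys_iff)

context compatible_pair
begin

abbreviation "FA \<equiv> free_alg (UNIV :: ('a, 'u) loop set)"
abbreviation "FP \<equiv> free_alg (lcarrier (LAU_plus D))"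
abbreviation "ucls \<equiv> uea_class (LAU D)"

lemma LAU_simps: "lcarrier (LAU D) = UNIV" "lscale (LAU D) = loop_scale D" "lbracket (LAU D) = loop_bracket D" "lpart (LAU D) p = hom_part p"
  "lscale (LAU_plus D) = loop_scale D" "lbracket (LAU_plus D) = loop_bracket D" "lpart (LAU_plus D) p = hom_part p"
  by (simp_all add: LAU_def LAU_plus_def hom_part_def)

lemma LAU_plus_pos: "x \<in> lcarrier (LAU_plus D) \<longleftrightarrow> loop_pos x = x"
  by (cases x) (auto simp: LAU_plus_def loop_pos_def nonneg_part_fixed)

lemma LAU_rels: "uea_rels (LAU D) \<subseteq> carrier FA" "uea_rels (LAU_plus D) \<subseteq> carrier FP"
proof -
  show "uea_rels (LAU D) \<subseteq> carrier FA" by (auto simp: free_alg_simps)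
  have p: "x + y \<in> lcarrier (LAU_plus D)" "loop_bracket D x y \<in> lcarrier (LAU_plus D)"
    if "x \<in> lcarrier (LAU_plus D)" "y \<in> lcarrier (LAU_plus D)" for x y
    using that loop_pos_br[of x y] by (simp_all add: LAU_plus_pos loop_pos_simps)
  have p': "loop_scale D c x \<in> lcarrier (LAU_plus D)" if "x \<in> lcarrier (LAU_plus D)" for x c
    using that LS.pos_lin(2)[of c x] by (simp add: LAU_plus_pos)
  show "uea_rels (LAU_plus D) \<subseteq> carrier FP"
  proof
    fix r assume "r \<in> uea_rels (LAU_plus D)"
    then show "r \<in> carrier FP"
    proof (rule uea_relsE)
      fix x y p' q' assume "x \<in> lcarrier (LAU_plus D)" "y \<in> lcarrier (LAU_plus D)"
      then show "gen x * gen y - pm_scale (super_sign p' q') (gen y * gen x) - gen (lbracket (LAU_plus D) x y) \<in> carrier FP"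
        unfolding LAU_simps by (intro free_alg_closed p)
    next
      fix x y assume "x \<in> lcarrier (LAU_plus D)" "y \<in> lcarrier (LAU_plus D)"
      then show "gen (x + y) - gen x - gen y \<in> carrier FP" by (intro free_alg_closed p)
    next
      fix c x assume "x \<in> lcarrier (LAU_plus D)"
      then show "gen (lscale (LAU_plus D) c x) - pm_scale c (gen x) \<in> carrier FP"
        unfolding LAU_simps by (intro free_alg_closed p')
    qed
  qed
qed

lemmas Iall = uea_ideal_ideal[of "LAU D", unfolded LAU_simps(1), OF LAU_rels(1)]
lemmas Ipos = uea_ideal_ideal[of "LAU_plus D", OF LAU_rels(2)]

lemma carrier_FA: "f \<in> carrier FA" by simp

interpretation FA: cspace FA by (rule cspaceI[OF free_alg_module])
interpretation FP: cspace FP by (rule cspaceI[OF free_alg_module])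

lemmas Iall_sub = free_alg_ideal_submodule[OF Iall(1)]
lemmas Ipos_sub = free_alg_ideal_submodule[OF Ipos(1)]

abbreviation "UL \<equiv> uea (LAU D)"
abbreviation "UP \<equiv> uea (LAU_plus D)"

lemma UL_def': "UL = quot_mod FA (uea_ideal (LAU D))" "ucls f = uea_ideal (LAU D) +>\<^bsub>FA\<^esub> f"
  by (simp_all add: uea_def uea_class_def LAU_simps)

lemma UP_def': "UP = quot_mod FP (uea_ideal (LAU_plus D))" "uea_class (LAU_plus D) f = uea_ideal (LAU_plus D) +>\<^bsub>FP\<^esub> f"
  by (simp_all add: uea_def uea_class_def)

lemma FA_minus: "f \<ominus>\<^bsub>FA\<^esub> g = f - g"
  by (rule class_module_minus[OF free_alg_module]) simp_all

lemma FP_minus: "f \<in> carrier FP \<Longrightarrow> g \<in> carrier FP \<Longrightarrow> f \<ominus>\<^bsub>FP\<^esub> g = f - g"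
  by (rule class_module_minus[OF free_alg_module]) simp_all

lemma ucls_eq: "ucls f = ucls g \<longleftrightarrow> f - g \<in> uea_ideal (LAU D)"
  unfolding UL_def' using FA.cos_eq[OF Iall_sub carrier_FA carrier_FA] FA_minus by simp

lemma ucls_mem: "g \<in> ucls f \<longleftrightarrow> g - f \<in> uea_ideal (LAU D)"
  unfolding UL_def' using FA.cos_mem[OF Iall_sub carrier_FA] FA_minus by simp

lemma pcls_mem: "f \<in> carrier FP \<Longrightarrow> g \<in> uea_class (LAU_plus D) f \<longleftrightarrow> g \<in> carrier FP \<and> g - f \<in> uea_ideal (LAU_plus D)"
  unfolding UP_def' using FP.cos_mem[OF Ipos_sub, of f g] FP_minus by auto

lemma UL_ops: "carrier UL = range ucls" "ucls f \<oplus>\<^bsub>UL\<^esub> ucls g = ucls (f + g)" "c \<odot>\<^bsub>UL\<^esub> ucls f = ucls (pm_scale c f)"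
  "ucls f \<otimes>\<^bsub>UL\<^esub> ucls g = ucls (f * g)" "one UL = ucls 1"
proof -
  note FA = FA.quot_carrier[OF Iall_sub] FA.quot_add[OF Iall_sub carrier_FA carrier_FA] FA.quot_smult[OF Iall_sub carrier_FA]
  show "carrier UL = range ucls" using FA(1) unfolding UL_def' by auto
  show "ucls f \<oplus>\<^bsub>UL\<^esub> ucls g = ucls (f + g)" "c \<odot>\<^bsub>UL\<^esub> ucls f = ucls (pm_scale c f)"
    using FA(2)[of f g] FA(3)[of c f] unfolding UL_def' by simp_all
  show "ucls f \<otimes>\<^bsub>UL\<^esub> ucls g = ucls (f * g)"
    using ideal.rcoset_mult_add[OF Iall(1) carrier_FA[of f] carrier_FA[of g]] unfolding UL_def' by (simp add: quot_mod_def)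
  show "one UL = ucls 1" unfolding UL_def' by (simp add: quot_mod_def)
qed

lemma UP_carrier: "carrier UP = uea_class (LAU_plus D) ` carrier FP"
  using FP.quot_carrier[OF Ipos_sub] unfolding UP_def' by auto

lemma Ipos_subset: "uea_ideal (LAU_plus D) \<subseteq> uea_ideal (LAU D)"
proof -
  interpret I: ideal "uea_ideal (LAU D)" FA by (rule Iall)
  note s = FA.submoduleD[OF Iall_sub]
  have "uea_ideal (LAU_plus D) \<subseteq> uea_ideal (LAU D) \<inter> carrier FP"
  proof (rule Ipos(3)[OF idealI'])
    show "uea_rels (LAU_plus D) \<subseteq> uea_ideal (LAU D) \<inter> carrier FP"
    proof
      fix r assume r: "r \<in> uea_rels (LAU_plus D)"
      have "r \<in> uea_ideal (LAU D)" using r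
        by (rule uea_relsE) (rule subsetD[OF Iall(2)], use uea_relsI[where L = "LAU D"] in \<open>simp add: LAU_simps\<close>)+
      then show "r \<in> uea_ideal (LAU D) \<inter> carrier FP" using LAU_rels(2) r by blast
    qed
  qed (use s free_alg_closed[where S = "lcarrier (LAU_plus D)"] I.I_l_closed I.I_r_closed in \<open>auto simp del: free_alg_simps(6) simp: free_alg_simps(6)[of _ UNIV]\<close>)
  then show ?thesis by blast
qed

lemma FA_zero_ideal: "0 \<in> uea_ideal (LAU D)" using FA.submoduleD(2)[OF Iall_sub] by simp

text \<open>The relations of the subalgebra are relations of \<open>\<L>(A, U)\<close>, so that the map of enveloping algebras is well defined on
cosets.\<close>

lemma uea_incl_class: "f \<in> carrier FP \<Longrightarrow> uea_incl (LAU D) (uea_class (LAU_plus D) f) = ucls f"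
proof -
  assume f: "f \<in> carrier FP"
  have "ucls g = ucls f" if "g \<in> uea_class (LAU_plus D) f" for g
    using that pcls_mem[OF f] Ipos_subset ucls_eq by blast
  moreover have "f \<in> uea_class (LAU_plus D) f"
    using pcls_mem[OF f] f FP.submoduleD(2)[OF Ipos_sub] by simp
  ultimately show ?thesis unfolding uea_incl_def by blast
qed

subsection \<open>The functional on the enveloping algebra\<close>

context fixes l :: complex
begin

abbreviation "sg \<equiv> LS.sigma l"

text \<open>The functional \<open>sigma\<close>, extended linearly to the free algebra.\<close>

definition sigF :: "(('a, 'u) loop word \<Rightarrow>\<^sub>0 complex) \<Rightarrow> complex" where
  "sigF = lext (\<lambda>w. sg (letters w))"

lemma sigF_simps: "sigF (f + g) = sigF f + sigF g" "sigF (pm_scale c f) = c * sigF f" "sigF (f - g) = sigF f - sigF g" "sigF (wd xs) = sg xs"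
  by (simp_all add: sigF_def lext_add lext_scale lext_diff lext_single wd_def)

lemma sigF_zero: "sigF 0 = 0"
  using sigF_simps(2)[of 0 0] by simp

text \<open>The kernel of \<open>sigF\<close> is not an ideal; what is an ideal is the set of all \<open>f\<close> that remain in the kernel after
multiplication from both sides.\<close>

lemma sigF_ideal:
  assumes "f \<in> uea_ideal (LAU D)"
  shows "sigF f = 0"
proof -
  let ?K = "{f. \<forall>p q. sigF (p * f * q) = 0}"
  have *: "\<forall>p q. sigF (p * r * q) = 0" if "\<And>us vs. sigF (wd us * r * wd vs) = 0" for r
  proof (intro allI)
    fix p q
    have "sigF (wd us * r * q) = 0" for us
      by (induction q rule: word_induct) (simp_all add: that distrib_left sigF_simps pm_scale_mult)
    then show "sigF (p * r * q) = 0"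
      by (induction p rule: word_induct) (simp_all add: distrib_right sigF_simps pm_scale_mult)
  qed
  note m = LS.multilinearD[OF LS.multilinear_sigma, of l]
  have "uea_ideal (LAU D) \<subseteq> ?K"
  proof (rule Iall(3))
    show "ideal ?K FA"
    proof (rule idealI')
      fix a x assume a: "a \<in> ?K"
      show "x * a \<in> ?K" using a by (auto simp flip: mult.assoc)
      show "a * x \<in> ?K" using a by (auto simp: mult.assoc)
    qed (auto simp: distrib_left distrib_right sigF_simps sigF_zero pm_scale_mult)
    show "uea_rels (LAU D) \<subseteq> ?K"
    proof
      fix r assume "r \<in> uea_rels (LAU D)"
      then have "\<forall>p q. sigF (p * r * q) = 0"
      proof (rule uea_relsE)
        fix x y p q assume "x \<in> lpart (LAU D) p" "y \<in> lpart (LAU D) q"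
        then have xy: "x \<in> hom_part p" "y \<in> hom_part q" by (simp_all add: LAU_simps)
        show "\<forall>p' q'. sigF (p' * (gen x * gen y - pm_scale (super_sign p q) (gen y * gen x) - gen (lbracket (LAU D) x y)) * q') = 0"
        proof (rule *)
          fix us vs :: "('a, 'u) loop list"
          have e: "wd us * (gen x * gen y) * wd vs = wd (us @ x # y # vs)" for x y
            by (simp add: wd_simps flip: wd_simps(4))
          have e': "wd us * gen x * wd vs = wd (us @ x # vs)" for x
            by (simp add: wd_simps flip: wd_simps(4))
          show "sigF (wd us * (gen x * gen y - pm_scale (super_sign p q) (gen y * gen x) - gen (lbracket (LAU D) x y)) * wd vs) = 0"
            unfolding right_diff_distrib left_diff_distrib pm_scale_mult e e' sigF_simps LAU_simps
            using LS.sigma_commutator[OF xy, of l us vs] by simp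
        qed
      next
        fix x y
        show "\<forall>p q. sigF (p * (gen (x + y) - gen x - gen y) * q) = 0"
        proof (rule *)
          fix us vs :: "('a, 'u) loop list"
          have e': "wd us * gen x * wd vs = wd (us @ x # vs)" for x
            by (simp add: wd_simps flip: wd_simps(4))
          show "sigF (wd us * (gen (x + y) - gen x - gen y) * wd vs) = 0"
            unfolding right_diff_distrib left_diff_distrib e' sigF_simps using m(1)[of us x y vs] by simp
        qed
      next
        fix c x
        show "\<forall>p q. sigF (p * (gen (lscale (LAU D) c x) - pm_scale c (gen x)) * q) = 0"
        proof (rule *)
          fix us vs :: "('a, 'u) loop list"
          have e': "wd us * gen x * wd vs = wd (us @ x # vs)" for x
            by (simp add: wd_simps flip: wd_simps(4))
          show "sigF (wd us * (gen (lscale (LAU D) c x) - pm_scale c (gen x)) * wd vs) = 0"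
            unfolding right_diff_distrib left_diff_distrib pm_scale_mult e' sigF_simps LAU_simps using m(2)[of us c x vs] by simp
        qed
      qed
      then show "r \<in> ?K" by blast
    qed
  qed
  then show ?thesis using assms by (metis (mono_tags, lifting) mem_Collect_eq mult_1 mult_1_right subsetD)
qed

lemma foldr_C_ell: "foldr (C_ell l) xs z = prod_list (map (\<lambda>x. l * snd (snd x)) xs) * z"
  by (induction xs) (auto simp: C_ell_def split: prod.splits)

lemma free_act_eq: "free_act (C_ell l) f z = lext (\<lambda>w. prod_list (map (\<lambda>x. l * snd (snd x)) (letters w))) f * z"
  unfolding free_act_def lext_def foldr_C_ell by (simp add: sum_distrib_right mult.assoc)

definition chiF :: "(('a, 'u) loop word \<Rightarrow>\<^sub>0 complex) \<Rightarrow> complex" where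
  "chiF = lext (\<lambda>w. prod_list (map (\<lambda>x. l * snd (snd x)) (letters w)))"

lemma chiF_simps: "chiF (f + g) = chiF f + chiF g" "chiF (pm_scale c f) = c * chiF f" "chiF (f - g) = chiF f - chiF g"
  "chiF (wd xs) = prod_list (map (\<lambda>x. l * snd (snd x)) xs)" "chiF (gen x) = l * snd (snd x)"
  by (simp_all add: chiF_def lext_add lext_scale lext_diff lext_single wd_def gen_def)

lemma chiF_zero: "chiF 0 = 0"
  using chiF_simps(2)[of 0 0] by simp

lemma chiF_mult: "chiF (f * g) = chiF f * chiF g"
proof (induction g rule: word_induct)
  case (3 ys)
  show ?case
    by (induction f rule: word_induct) (simp_all add: distrib_right chiF_simps pm_scale_mult wd_simps)
qed (simp_all add: distrib_left chiF_simps pm_scale_mult)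

lemma chiF_ideal:
  assumes "f \<in> uea_ideal (LAU_plus D)"
  shows "chiF f = 0"
proof -
  have "uea_ideal (LAU_plus D) \<subseteq> {f \<in> carrier FP. chiF f = 0}"
  proof (rule Ipos(3)[OF idealI'])
    show "uea_rels (LAU_plus D) \<subseteq> {f \<in> carrier FP. chiF f = 0}"
    proof
      fix r assume r: "r \<in> uea_rels (LAU_plus D)"
      then have "chiF r = 0"
      proof (rule uea_relsE)
        fix x y p q assume "x \<in> lcarrier (LAU_plus D)" "x \<in> lpart (LAU_plus D) p" "y \<in> lcarrier (LAU_plus D)" "y \<in> lpart (LAU_plus D) q"
        then have xy: "x \<in> hom_part p" "y \<in> hom_part q" "loop_pos x = x" "loop_pos y = y" by (simp_all add: LAU_simps LAU_plus_pos)
        have "snd (snd (loop_bracket D x y)) = 0" using chi_pos_br[of x y] xy by simp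
        then show "chiF (gen x * gen y - pm_scale (super_sign p q) (gen y * gen x) - gen (lbracket (LAU_plus D) x y)) = 0"
          using xy(1,2) by (cases p; cases q) (auto simp: chiF_simps chiF_mult LAU_simps super_sign_def hom_part_def)
      qed (auto simp: chiF_simps LAU_simps algebra_simps loop_scale_def split: prod.splits)
      then show "r \<in> {f \<in> carrier FP. chiF f = 0}" using r LAU_rels(2) by blast
    qed
  qed (use free_alg_closed[where S = "lcarrier (LAU_plus D)"] in
      \<open>simp_all del: free_alg_simps(6) add: chiF_simps chiF_mult chiF_zero subset_iff\<close>)
  then show ?thesis using assms by blast
qed

lemma uea_act_class: "f \<in> carrier FP \<Longrightarrow> uea_act (C_ell l) (uea_class (LAU_plus D) f) z = chiF f * z"
proof -
  assume f: "f \<in> carrier FP"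
  have "free_act (C_ell l) g z = chiF f * z" if "g \<in> uea_class (LAU_plus D) f" for g
    using chiF_ideal[of "g - f"] that pcls_mem[OF f] by (simp add: free_act_eq chiF_simps(3) flip: chiF_def)
  moreover have "f \<in> uea_class (LAU_plus D) f"
    using pcls_mem[OF f] f FP.submoduleD(2)[OF Ipos_sub] by simp
  ultimately have "(\<lambda>g. free_act (C_ell l) g z) ` uea_class (LAU_plus D) f = {chiF f * z}"
    by (intro equalityI subsetI) (auto simp: image_iff intro!: bexI[of _ f])
  then show ?thesis by (simp add: uea_act_def)
qed

lemma sigF_right_word:
  assumes "\<forall>x\<in>set xs. loop_pos x = x"
  shows "sg (us @ xs) = sg us * prod_list (map (\<lambda>x. l * snd (snd x)) xs)"
  using assms
proof (induction xs rule: rev_induct)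
  case (snoc x xs)
  then show ?case using LS.sigma_right[of x l "us @ xs"] by simp
qed simp

text \<open>Right multiplication by the enveloping algebra of the subalgebra is evaluated by the character of \<open>\<complex>\<^sub>\<ell>\<close>; this is the
relation that defines the tensor product.\<close>

lemma sigF_right:
  assumes "g \<in> carrier FP"
  shows "sigF (f * g) = sigF f * chiF g"
proof -
  have g: "set (letters w) \<subseteq> {x. loop_pos x = x}" if "w \<in> Poly_Mapping.keys g" for w
    using assms that by (simp flip: LAU_plus_pos)
  have w: "sigF (f * wd (letters w)) = sigF f * chiF (wd (letters w))" if "w \<in> Poly_Mapping.keys g" for w
  proof -
    have "\<forall>x\<in>set (letters w). loop_pos x = x" using g[OF that] by blast
    note r = sigF_right_word[OF this]
    show ?thesis
      by (induction f rule: word_induct) (simp_all add: distrib_right sigF_simps pm_scale_mult wd_simps chiF_simps r)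
  qed
  have "sigF (f * (\<Sum>w\<in>A. Poly_Mapping.single w (Poly_Mapping.lookup g w))) = sigF f * chiF (\<Sum>w\<in>A. Poly_Mapping.single w (Poly_Mapping.lookup g w))"
    if "finite A" "A \<subseteq> Poly_Mapping.keys g" for A
    using that
  proof (induction A)
    case empty
    then show ?case by (simp add: sigF_def chiF_def lext_def)
  next
    case (insert w A)
    have "Poly_Mapping.single w (Poly_Mapping.lookup g w) = pm_scale (Poly_Mapping.lookup g w) (wd (letters w))"
      by (simp add: wd_def pm_scale_single)
    then show ?case using insert w by (simp add: distrib_left sigF_simps chiF_simps pm_scale_mult algebra_simps)
  qed
  from this[OF finite_keys subset_refl] show ?thesis
    by (simp only: pm_eq_sum_single[OF finite_keys subset_refl, of g, symmetric])
qed

end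

end

lemma tensor_free_simps: "f \<in> carrier (tensor_free M N) \<longleftrightarrow> Poly_Mapping.keys f \<subseteq> carrier M \<times> carrier N" "zero (tensor_free M N) = 0"
  "add (tensor_free M N) = (+)" "smult (tensor_free M N) = pm_scale"
  by (simp_all add: tensor_free_def)

lemma tensor_free_module: "module CC (tensor_free M N)"
proof (rule class_module[OF pm_scale_vector_space])
  show "x + y \<in> carrier (tensor_free M N)" if "x \<in> carrier (tensor_free M N)" "y \<in> carrier (tensor_free M N)" for x y
    using that Poly_Mapping.keys_add[of x y] unfolding tensor_free_simps by blast
  show "pm_scale c x \<in> carrier (tensor_free M N)" if "x \<in> carrier (tensor_free M N)" for c x
    using that keys_pm_scale[of c x] unfolding tensor_free_simps by blast
qed (simp_all add: tensor_free_simps)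

lemma tensor_relsI:
  "p \<in> carrier P \<Longrightarrow> p' \<in> carrier P \<Longrightarrow> x \<in> carrier N \<Longrightarrow> tens (p \<oplus>\<^bsub>P\<^esub> p') x - tens p x - tens p' x \<in> tensor_rels P S ra N la"
  "p \<in> carrier P \<Longrightarrow> x \<in> carrier N \<Longrightarrow> x' \<in> carrier N \<Longrightarrow> tens p (x \<oplus>\<^bsub>N\<^esub> x') - tens p x - tens p x' \<in> tensor_rels P S ra N la"
  "p \<in> carrier P \<Longrightarrow> x \<in> carrier N \<Longrightarrow> tens (c \<odot>\<^bsub>P\<^esub> p) x - pm_scale c (tens p x) \<in> tensor_rels P S ra N la"
  "p \<in> carrier P \<Longrightarrow> x \<in> carrier N \<Longrightarrow> tens p (c \<odot>\<^bsub>N\<^esub> x) - pm_scale c (tens p x) \<in> tensor_rels P S ra N la"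
  "p \<in> carrier P \<Longrightarrow> s \<in> S \<Longrightarrow> x \<in> carrier N \<Longrightarrow> tens (ra p s) x - tens p (la s x) \<in> tensor_rels P S ra N la"
  unfolding tensor_rels_def by blast+

context compatible_pair
begin

context fixes l :: complex
begin

abbreviation "TF \<equiv> V_free D"
abbreviation "VN \<equiv> V_null D l"
abbreviation "VM \<equiv> V_mod D l"

definition "trels = tensor_rels UL (carrier UP) (\<lambda>p s. p \<otimes>\<^bsub>UL\<^esub> uea_incl (LAU D) s) CC (uea_act (C_ell l))"

lemma trelsI:
  "tens (ucls (f + g)) z - tens (ucls f) z - tens (ucls g) z \<in> trels"
  "tens (ucls f) (z + z') - tens (ucls f) z - tens (ucls f) z' \<in> trels"
  "tens (ucls (pm_scale c f)) z - pm_scale c (tens (ucls f) z) \<in> trels"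
  "tens (ucls f) (c * z) - pm_scale c (tens (ucls f) z) \<in> trels"
  "h \<in> carrier FP \<Longrightarrow> tens (ucls (f * h)) z - tens (ucls f) (chiF l h * z) \<in> trels"
proof -
  have c: "ucls f \<in> carrier UL" for f by (simp add: UL_ops)
  have CCs: "smult CC = (*)" by (simp add: CC_def)
  note r = tensor_relsI[where P = UL and N = CC and S = "carrier UP" and ra = "\<lambda>p s. p \<otimes>\<^bsub>UL\<^esub> uea_incl (LAU D) s" and la = "uea_act (C_ell l)",
      folded trels_def]
  show "tens (ucls (f + g)) z - tens (ucls f) z - tens (ucls g) z \<in> trels"
    using r(1)[OF c c, of z f g] by (simp add: UL_ops)
  show "tens (ucls f) (z + z') - tens (ucls f) z - tens (ucls f) z' \<in> trels"
    using r(2)[OF c, of z z' f] by simp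
  show "tens (ucls (pm_scale c f)) z - pm_scale c (tens (ucls f) z) \<in> trels"
    using r(3)[OF c, of z c f] by (simp add: UL_ops)
  show "tens (ucls f) (c * z) - pm_scale c (tens (ucls f) z) \<in> trels"
    using r(4)[OF c, of z f c] by (simp add: CCs)
  assume h: "h \<in> carrier FP"
  have "tens (ucls f \<otimes>\<^bsub>UL\<^esub> uea_incl (LAU D) (uea_class (LAU_plus D) h)) z - tens (ucls f) (uea_act (C_ell l) (uea_class (LAU_plus D) h) z) \<in> trels"
    by (rule r(5)[OF c]) (use UP_carrier h in auto)
  then show "tens (ucls (f * h)) z - tens (ucls f) (chiF l h * z) \<in> trels"
    using uea_incl_class[OF h] uea_act_class[OF h] by (simp add: UL_ops)
qed

lemma trelsE:
  assumes "r \<in> trels"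
    "\<And>f g z. Q (tens (ucls (f + g)) z - tens (ucls f) z - tens (ucls g) z)"
    "\<And>f z z'. Q (tens (ucls f) (z + z') - tens (ucls f) z - tens (ucls f) z')"
    "\<And>c f z. Q (tens (ucls (pm_scale c f)) z - pm_scale c (tens (ucls f) z))"
    "\<And>c f z. Q (tens (ucls f) (c * z) - pm_scale c (tens (ucls f) z))"
    "\<And>f h z. h \<in> carrier FP \<Longrightarrow> Q (tens (ucls (f * h)) z - tens (ucls f) (chiF l h * z))"
  shows "Q r"
proof -
  have CCs: "smult CC = (*)" by (simp add: CC_def)
  from assms(1) consider
    (1) p p' z where "r = tens (p \<oplus>\<^bsub>UL\<^esub> p') z - tens p z - tens p' z" "p \<in> carrier UL" "p' \<in> carrier UL"
  | (2) p z z' where "r = tens p (z + z') - tens p z - tens p z'" "p \<in> carrier UL"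
  | (3) c p z where "r = tens (c \<odot>\<^bsub>UL\<^esub> p) z - pm_scale c (tens p z)" "p \<in> carrier UL"
  | (4) c p z where "r = tens p (c * z) - pm_scale c (tens p z)" "p \<in> carrier UL"
  | (5) p s z where "r = tens (p \<otimes>\<^bsub>UL\<^esub> uea_incl (LAU D) s) z - tens p (uea_act (C_ell l) s z)" "p \<in> carrier UL" "s \<in> carrier UP"
    unfolding trels_def tensor_rels_def CCs CC_simps by blast
  then show ?thesis
  proof cases
    case 1 then show ?thesis using assms(2) by (auto simp: UL_ops)
  next
    case 2 then show ?thesis using assms(3) by (auto simp: UL_ops)
  next
    case 3 then show ?thesis using assms(4) by (auto simp: UL_ops)
  next
    case 4 then show ?thesis using assms(5) by (auto simp: UL_ops)
  next
    case 5
    then obtain f h where f: "p = ucls f" and h: "h \<in> carrier FP" "s = uea_class (LAU_plus D) h" unfolding UL_ops UP_carrier by blast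
    show ?thesis using assms(6)[OF h(1)] uea_incl_class[OF h(1)] uea_act_class[OF h(1)] 5(1) by (simp add: f h(2) UL_ops)
  qed
qed

lemma TF_simps: "carrier TF = {f. Poly_Mapping.keys f \<subseteq> range ucls \<times> UNIV}" "zero TF = 0" "add TF = (+)" "smult TF = pm_scale"
  unfolding V_free_def using tensor_free_simps[where M = UL and N = CC] by (auto simp: UL_ops)

interpretation T: cspace TF unfolding V_free_def by (rule cspaceI[OF tensor_free_module])

lemma TF_closed: "f \<in> carrier TF \<Longrightarrow> g \<in> carrier TF \<Longrightarrow> f + g \<in> carrier TF" "f \<in> carrier TF \<Longrightarrow> pm_scale c f \<in> carrier TF"
  "f \<in> carrier TF \<Longrightarrow> g \<in> carrier TF \<Longrightarrow> f - g \<in> carrier TF" "tens (ucls h) z \<in> carrier TF"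
proof -
  show "f - g \<in> carrier TF" if "f \<in> carrier TF" "g \<in> carrier TF"
    using that keys_diff[of f g] unfolding TF_simps by blast
  show "tens (ucls h) z \<in> carrier TF" by (auto simp: TF_simps tens_def)
qed (use T.M.a_closed[of f g] T.sm_closed[of f c] in \<open>simp_all only: TF_simps(3,4)\<close>)

lemma trels_carrier: "trels \<subseteq> carrier TF"
proof
  fix r assume "r \<in> trels"
  then show "r \<in> carrier TF" by (rule trelsE) (intro TF_closed)+
qed

lemma VN_eq: "VN = vspan TF trels"
  by (simp add: V_null_def tensor_null_def trels_def V_free_def)

lemma VN_sub: "submodule VN CC TF" unfolding VN_eq by (rule T.vspan_submodule[OF trels_carrier])

lemma VN_trels: "r \<in> trels \<Longrightarrow> r \<in> VN" unfolding VN_eq using T.vspan_superset by blast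

lemma VM_eq: "VM = quot_mod TF VN"
  by (simp add: V_mod_def tensor_product_def V_free_def V_null_def)

lemma VM_module: "module CC VM" unfolding VM_eq by (rule T.quot_module[OF VN_sub])

definition vcls :: "(('a, 'u) U_elem \<times> complex \<Rightarrow>\<^sub>0 complex) \<Rightarrow> ('a, 'u) V_elem" where
  "vcls t = VN +>\<^bsub>TF\<^esub> t"

lemma vcls_ops: "carrier VM = vcls ` carrier TF" "s \<in> carrier TF \<Longrightarrow> t \<in> carrier TF \<Longrightarrow> vcls s \<oplus>\<^bsub>VM\<^esub> vcls t = vcls (s + t)"
  "t \<in> carrier TF \<Longrightarrow> c \<odot>\<^bsub>VM\<^esub> vcls t = vcls (pm_scale c t)"
  "s \<in> carrier TF \<Longrightarrow> t \<in> carrier TF \<Longrightarrow> vcls s = vcls t \<longleftrightarrow> s - t \<in> VN" "t \<in> carrier TF \<Longrightarrow> s \<in> vcls t \<longleftrightarrow> s \<in> carrier TF \<and> s - t \<in> VN"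
proof -
  have m: "s \<ominus>\<^bsub>TF\<^esub> t = s - t" if "s \<in> carrier TF" "t \<in> carrier TF" for s t
    by (rule class_module_minus[OF T.module_axioms _ _ that]) (simp_all add: TF_simps)
  show "carrier VM = vcls ` carrier TF" unfolding VM_eq vcls_def by (rule T.quot_carrier[OF VN_sub])
  show "s \<in> carrier TF \<Longrightarrow> t \<in> carrier TF \<Longrightarrow> vcls s \<oplus>\<^bsub>VM\<^esub> vcls t = vcls (s + t)"
    unfolding VM_eq vcls_def using T.quot_add[OF VN_sub, of s t] by (simp only: TF_simps(3))
  show "t \<in> carrier TF \<Longrightarrow> c \<odot>\<^bsub>VM\<^esub> vcls t = vcls (pm_scale c t)"
    unfolding VM_eq vcls_def using T.quot_smult[OF VN_sub, of t c] by (simp only: TF_simps(4))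
  show "s \<in> carrier TF \<Longrightarrow> t \<in> carrier TF \<Longrightarrow> vcls s = vcls t \<longleftrightarrow> s - t \<in> VN"
    unfolding vcls_def using T.cos_eq[OF VN_sub, of s t] m by simp
  show "t \<in> carrier TF \<Longrightarrow> s \<in> vcls t \<longleftrightarrow> s \<in> carrier TF \<and> s - t \<in> VN"
    unfolding vcls_def using T.cos_mem[OF VN_sub, of t s] m by auto
qed

lemma vcls_trel: "s - t \<in> trels \<Longrightarrow> s \<in> carrier TF \<Longrightarrow> t \<in> carrier TF \<Longrightarrow> vcls s = vcls t"
  using vcls_ops(4) VN_trels by blast

text \<open>The map \<open>f \<mapsto> f \<otimes> 1\<close> by which the free algebra covers the induced module.\<close>

definition Psi :: "(('a, 'u) loop word \<Rightarrow>\<^sub>0 complex) \<Rightarrow> ('a, 'u) V_elem" where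
  "Psi f = vcls (tens (ucls f) 1)"

lemma vcls_tens: "vcls (tens (ucls f) z) = Psi (pm_scale z f)"
proof -
  have "vcls (tens (ucls f) z) = vcls (pm_scale z (tens (ucls f) 1))"
    by (rule vcls_trel) (use trelsI(4)[of f z 1] TF_closed in simp_all)
  also have "\<dots> = vcls (tens (ucls (pm_scale z f)) 1)"
    by (rule vcls_trel[symmetric]) (use trelsI(3)[of z f 1] TF_closed in simp_all)
  finally show ?thesis by (simp add: Psi_def)
qed

lemma Psi_add: "Psi (f + g) = Psi f \<oplus>\<^bsub>VM\<^esub> Psi g"
proof -
  have "vcls (tens (ucls (f + g)) 1) = vcls (tens (ucls f) 1 + tens (ucls g) 1)"
    by (rule vcls_trel) (use trelsI(1)[of f g 1] TF_closed in \<open>simp_all add: diff_diff_add\<close>)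
  then show ?thesis by (simp add: Psi_def vcls_ops TF_closed)
qed

lemma Psi_scale: "Psi (pm_scale c f) = c \<odot>\<^bsub>VM\<^esub> Psi f"
proof -
  have "vcls (tens (ucls (pm_scale c f)) 1) = vcls (pm_scale c (tens (ucls f) 1))"
    by (rule vcls_trel) (use trelsI(3)[of c f 1] TF_closed in simp_all)
  then show ?thesis by (simp add: Psi_def vcls_ops TF_closed)
qed

interpretation V: cspace VM by (rule cspaceI[OF VM_module])

lemma Psi_closed: "Psi f \<in> carrier VM" unfolding Psi_def vcls_ops(1) using TF_closed(4) by blast

lemma Psi_zero: "Psi 0 = zero VM"
  using Psi_scale[of 0 0] V.sm_rules(5)[OF Psi_closed] by simp

lemma vcls_zero: "vcls 0 = zero VM"
  using vcls_ops(3)[of "tens (ucls 0) 1" 0] TF_closed(4) V.sm_rules(5)[OF Psi_closed[of 0]] unfolding Psi_def by simp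

text \<open>The second factor of the tensor product is one-dimensional and can be absorbed in the first.\<close>

lemma Psi_surj: "carrier VM = range Psi"
proof
  show "carrier VM \<subseteq> range Psi"
  proof
    fix v assume "v \<in> carrier VM"
    then obtain t where t: "t \<in> carrier TF" "v = vcls t" unfolding vcls_ops by blast
    have "(\<Sum>k\<in>A. Poly_Mapping.single k (Poly_Mapping.lookup t k)) \<in> carrier TF \<and>
        vcls (\<Sum>k\<in>A. Poly_Mapping.single k (Poly_Mapping.lookup t k)) \<in> range Psi" if "finite A" "A \<subseteq> Poly_Mapping.keys t" for A
      using that
    proof (induction A)
      case empty
      have "0 \<in> carrier TF" by (simp add: TF_simps)
      then show ?case using vcls_zero range_eqI[of _ Psi 0, OF Psi_zero[symmetric]] by simp
    next
      case (insert k A)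
      obtain X z where k: "k = (X, z)" by force
      then obtain f where f: "X = ucls f" using insert t(1) by (auto simp: TF_simps)
      have s: "Poly_Mapping.single k (Poly_Mapping.lookup t k) = pm_scale (Poly_Mapping.lookup t k) (tens (ucls f) z)"
        by (simp add: k f tens_def pm_scale_single)
      have c: "Poly_Mapping.single k (Poly_Mapping.lookup t k) \<in> carrier TF" unfolding s by (intro TF_closed)
      have "vcls (Poly_Mapping.single k (Poly_Mapping.lookup t k)) = Psi (pm_scale (Poly_Mapping.lookup t k) (pm_scale z f))"
        unfolding s vcls_ops(3)[OF TF_closed(4), symmetric] vcls_tens Psi_scale ..
      then show ?case
        using insert c TF_closed(1) vcls_ops(2)[OF c, symmetric] Psi_add[symmetric] by auto
    qed
    from this[OF finite_keys subset_refl] show "v \<in> range Psi"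
      unfolding t(2) by (simp only: pm_eq_sum_single[OF finite_keys subset_refl, of t, symmetric])
  qed
qed (use Psi_closed in blast)

lemma Psi_ideal: "f \<in> uea_ideal (LAU D) \<Longrightarrow> Psi f = zero VM"
  using ucls_eq[of f 0] Psi_zero by (simp add: Psi_def)

lemma Psi_right:
  assumes "loop_pos x = x"
  shows "Psi (f * gen x) = (l * snd (snd x)) \<odot>\<^bsub>VM\<^esub> Psi f"
proof -
  have x: "gen x \<in> carrier FP" using assms LAU_plus_pos by (intro free_alg_closed) blast
  have "vcls (tens (ucls (f * gen x)) 1) = vcls (tens (ucls f) (chiF l (gen x) * 1))"
    by (rule vcls_trel[OF trelsI(5)[OF x] TF_closed(4) TF_closed(4)])
  then show ?thesis using vcls_tens[of f "l * snd (snd x)"] by (simp add: Psi_def chiF_simps Psi_scale[unfolded Psi_def])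
qed

definition val :: "('a, 'u) U_elem \<Rightarrow> complex" where "val X = sigF l (SOME f. f \<in> X)"

lemma val: "val (ucls f) = sigF l f"
proof -
  have "f \<in> ucls f" using ucls_mem[of f f] FA_zero_ideal by simp
  then have "(SOME g. g \<in> ucls f) \<in> ucls f" by (rule someI)
  then show ?thesis unfolding val_def using ucls_mem sigF_ideal[of _ l] sigF_simps(3)[of l _ f] by fastforce
qed

text \<open>The functional is well defined on the tensor product: it respects the relations of the enveloping algebra and the
relation over the subalgebra.  This is what keeps the induced module from collapsing.\<close>

lemma Psi_null: assumes "Psi f = zero VM" shows "sigF l f = 0"
proof -
  define tau where "tau = lext (\<lambda>(X, z). val X * z)"
  have tau: "tau (tens (ucls f) z) = sigF l f * z" "tau (s + t) = tau s + tau t" "tau (pm_scale c s) = c * tau s" "tau (s - t) = tau s - tau t" for f z s t c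
    by (simp_all add: tau_def lext_add lext_scale lext_diff tens_def lext_single val)
  have t0: "tau 0 = 0" using tau(3)[of 0 0] by simp
  have "VN \<subseteq> {t \<in> carrier TF. tau t = 0}"
    unfolding VN_eq
  proof (rule T.vspan_minimal)
    show "submodule {t \<in> carrier TF. tau t = 0} CC TF"
      by (rule T.submoduleI') (use TF_closed T.M.zero_closed in \<open>simp_all add: TF_simps(2-4) tau t0 subset_iff\<close>)
    have "tau r = 0" if "r \<in> trels" for r
      using that by (rule trelsE) (simp_all add: tau sigF_simps sigF_right algebra_simps)
    then show "trels \<subseteq> {t \<in> carrier TF. tau t = 0}" using trels_carrier by blast
  qed
  moreover have "tens (ucls f) 1 - 0 \<in> VN"
    using assms vcls_zero vcls_ops(4)[OF TF_closed(4), of 0] T.M.zero_closed unfolding Psi_def TF_simps(2) by simp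
  ultimately show ?thesis using tau(1)[of f 1] by auto
qed

lemma V_vac_eq: "V_vac D l = Psi 1"
  by (simp add: V_vac_def Psi_def vcls_def UL_ops)

text \<open>The representative of \<open>x t\<close> that occurs in the definition of the action.\<close>

definition Lam :: "('a, 'u) loop \<Rightarrow> (('a, 'u) U_elem \<times> complex \<Rightarrow>\<^sub>0 complex) \<Rightarrow> (('a, 'u) U_elem \<times> complex \<Rightarrow>\<^sub>0 complex)" where
  "Lam x t = (\<Sum>(p, z)\<in>Poly_Mapping.keys t. pm_scale (Poly_Mapping.lookup t (p, z)) (tens (ucls (gen x) \<otimes>\<^bsub>UL\<^esub> p) z))"

lemma Lam_superset: "finite K \<Longrightarrow> Poly_Mapping.keys t \<subseteq> K \<Longrightarrow>
    Lam x t = (\<Sum>k\<in>K. pm_scale (Poly_Mapping.lookup t k) (tens (ucls (gen x) \<otimes>\<^bsub>UL\<^esub> fst k) (snd k)))"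
  unfolding Lam_def case_prod_beta prod.collapse by (rule sum.mono_neutral_left) (auto simp: in_keys_iff)

lemma Lam_simps: "Lam x (s + t) = Lam x s + Lam x t" "Lam x (pm_scale c s) = pm_scale c (Lam x s)"
  "Lam x (tens (ucls f) z) = tens (ucls (gen x * f)) z" "Lam x (s - t) = Lam x s - Lam x t"
proof -
  show a: "Lam x (s + t) = Lam x s + Lam x t" for s t
    using Poly_Mapping.keys_add[of s t]
    by (subst (1 2 3) Lam_superset[where K = "Poly_Mapping.keys s \<union> Poly_Mapping.keys t"])
      (auto simp: lookup_add pm.scale_left_distrib sum.distrib)
  show "Lam x (pm_scale c s) = pm_scale c (Lam x s)"
    using keys_pm_scale[of c s]
    by (subst (1 2) Lam_superset[where K = "Poly_Mapping.keys s"]) (auto simp: lookup_pm_scale pm.scale_sum_right)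
  show "Lam x (tens (ucls f) z) = tens (ucls (gen x * f)) z"
    by (subst Lam_superset[where K = "{(ucls f, z)}"]) (auto simp: tens_def UL_ops)
  show "Lam x (s - t) = Lam x s - Lam x t" using a[of "s - t" t] by (simp add: algebra_simps)
qed

lemma Lam_VN: "t \<in> VN \<Longrightarrow> Lam x t \<in> VN \<and> Lam x t \<in> carrier TF"
proof -
  note VNs = T.submoduleD[OF VN_sub, unfolded TF_simps]
  have L0: "Lam x 0 = 0" using Lam_simps(2)[of x 0 0] by simp
  have "VN \<subseteq> {t \<in> carrier TF. Lam x t \<in> VN}"
    unfolding VN_eq
  proof (rule T.vspan_minimal)
    show "submodule {t \<in> carrier TF. Lam x t \<in> vspan TF trels} CC TF"
      by (rule T.submoduleI', unfold VN_eq[symmetric])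
        (use TF_closed T.M.zero_closed VNs in \<open>simp_all add: TF_simps(2-4) Lam_simps L0 subset_iff\<close>)
    have "Lam x r \<in> trels" if "r \<in> trels" for r
      using that by (rule trelsE) (use trelsI in \<open>simp_all add: Lam_simps distrib_left pm_scale_mult flip: mult.assoc\<close>)
    then show "trels \<subseteq> {t \<in> carrier TF. Lam x t \<in> vspan TF trels}" using trels_carrier VN_trels unfolding VN_eq by blast
  qed
  then show "t \<in> VN \<Longrightarrow> Lam x t \<in> VN \<and> Lam x t \<in> carrier TF" using VNs(1) TF_simps(1) by blast
qed

lemma V_act_Psi: "V_act D l x (Psi f) = Psi (gen x * f)"
proof -
  have *: "vcls (Lam x t) = Psi (gen x * f)" if t: "t \<in> Psi f" for t
  proof -
    have n: "t \<in> carrier TF" "t - tens (ucls f) 1 \<in> VN" using t vcls_ops(5)[OF TF_closed(4)] unfolding Psi_def by blast+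
    have L: "Lam x t - tens (ucls (gen x * f)) 1 \<in> VN" "Lam x t - tens (ucls (gen x * f)) 1 \<in> carrier TF"
      using Lam_VN[OF n(2), of x] by (simp_all add: Lam_simps)
    have "Lam x t \<in> carrier TF" using TF_closed(1)[OF L(2) TF_closed(4)[of "gen x * f" 1]] by simp
    then show ?thesis unfolding Psi_def using vcls_ops(4)[OF _ TF_closed(4)] L(1) by blast
  qed
  have "tens (ucls f) 1 \<in> Psi f" unfolding Psi_def
    using vcls_ops(5)[OF TF_closed(4), of "tens (ucls f) 1"] TF_closed(4) T.submoduleD(2)[OF VN_sub] by (simp add: TF_simps)
  then have "(\<Union>t\<in>Psi f. vcls (Lam x t)) = Psi (gen x * f)" using * by blast
  then show ?thesis unfolding V_act_def vcls_def Lam_def by simp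
qed

end

end

section \<open>The generating fields of the induced module\<close>

text \<open>A basis of the subspace is extended to the whole space; the projection kills the former and fixes the additional basis
vectors.\<close>

lemma (in vector_space) exists_projection:
  assumes N: "subspace N"
  shows "\<exists>P. Vector_Spaces.linear scale scale P \<and> (\<forall>v. P (P v) = P v) \<and> (\<forall>v. P v = 0 \<longleftrightarrow> v \<in> N)"
proof -
  interpret VP: vector_space_pair scale scale ..
  obtain B where B: "B \<subseteq> N" "independent B" "N \<subseteq> span B" using maximal_independent_subset[of N] by metis
  have sB: "span B = N" using B N span_minimal by blast
  obtain C where C: "B \<subseteq> C" "independent C" "UNIV \<subseteq> span C"
    using maximal_independent_subset_extend[OF subset_UNIV B(2)] by metis
  obtain g where g: "Vector_Spaces.linear scale scale g" "\<And>x. x \<in> C \<Longrightarrow> g x = (if x \<in> B then 0 else x)"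
    using VP.linear_independent_extend[OF C(2), of "\<lambda>x. if x \<in> B then 0 else x"] by metis
  interpret g: Vector_Spaces.linear scale scale g by (rule g(1))
  have gN: "g v = 0" if "v \<in> N" for v
    using that unfolding sB[symmetric]
  proof (induction rule: span_induct_alt)
    case (step c x y)
    then show ?case using g(2)[of x] C(1) by (auto simp: g.add g.scale)
  qed (simp add: g.zero)
  have gd: "g v - v \<in> N" for v
  proof -
    have "v \<in> span C" using C(3) by blast
    then show ?thesis
    proof (induction rule: span_induct_alt)
      case base
      then show ?case using subspace_0[OF N] by (simp add: g.zero)
    next
      case (step c x y)
      have "g x - x \<in> N" using g(2)[OF step(1)] B(1) subspace_0[OF N] subspace_neg[OF N] by auto
      then have "scale c (g x - x) + (g y - y) \<in> N" using step N subspace_add subspace_scale by blast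
      then show ?case by (simp add: g.add g.scale scale_right_diff_distrib algebra_simps)
    qed
  qed
  have "g (g v) = g v" for v using gN[OF gd[of v]] by (simp add: g.diff)
  moreover have "g v = 0 \<longleftrightarrow> v \<in> N" for v
  proof
    assume "g v = 0"
    then have "- v \<in> N" using gd[of v] by simp
    then show "v \<in> N" using subspace_neg[OF N] by fastforce
  qed (rule gN)
  ultimately show ?thesis using g(1) by blast
qed

type_synonym ('a, 'u) T_alg = "('a, 'u) loop word \<Rightarrow>\<^sub>0 complex"

locale pair_level = compatible_pair D \<omega> for D :: "('a::comm_ring, 'u::ab_group_add) pair_data" and \<omega> :: 'a +
  fixes l :: complex
begin

abbreviation "\<psi> \<equiv> Psi l"

sublocale V: cspace "V_mod D l" by (rule cspaceI[OF VM_module])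

definition N0 :: "(('a, 'u) T_alg) set" where "N0 = {f. \<psi> f = zero (V_mod D l)}"

lemma N0_subspace: "pm.subspace N0"
  by (rule pm.subspaceI) (simp_all add: N0_def Psi_zero Psi_add Psi_scale V.sm_rules)

lemma psi_diff: "\<psi> f = \<psi> g \<longleftrightarrow> f - g \<in> N0"
proof -
  have "\<psi> f = \<psi> (f - g) \<oplus>\<^bsub>V_mod D l\<^esub> \<psi> g" by (simp flip: Psi_add)
  then show ?thesis using Psi_closed V.M.add.r_cancel_one' by (auto simp: N0_def)
qed

lemma N0_gen: "f \<in> N0 \<Longrightarrow> gen x * f \<in> N0"
  using V_act_Psi[of l x f] V_act_Psi[of l x 0] by (simp add: N0_def Psi_zero)

lemma N0_ideal: "r \<in> uea_ideal (LAU D) \<Longrightarrow> r * f \<in> N0"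
  using ideal.I_r_closed[OF Iall(1), of r f] Psi_ideal by (simp add: N0_def)

lemma N0_rels: "r \<in> uea_rels (LAU D) \<Longrightarrow> r * f \<in> N0"
  using N0_ideal Iall(2) by blast

lemma N0_sigma: "f \<in> N0 \<Longrightarrow> sigF l f = 0" by (simp add: N0_def Psi_null)

text \<open>Normal forms for the elements of the induced module: two elements of the free algebra represent the same vector iff
they have the same image under this projection.\<close>

definition PP :: "(('a, 'u) T_alg) \<Rightarrow> (('a, 'u) T_alg)" where
  "PP = (SOME P. Vector_Spaces.linear pm_scale pm_scale P \<and> (\<forall>v. P (P v) = P v) \<and> (\<forall>v. P v = 0 \<longleftrightarrow> v \<in> N0))"

lemma PP: "Vector_Spaces.linear pm_scale pm_scale PP" "PP (PP v) = PP v" "PP v = 0 \<longleftrightarrow> v \<in> N0"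
  using someI_ex[OF pm.exists_projection[OF N0_subspace], folded PP_def] by auto

sublocale F: field_space pm_scale PP
  by (rule field_space.intro[OF pm_scale_vector_space field_space_axioms.intro]) (rule PP)+

lemma PP_eq: "PP v = PP w \<longleftrightarrow> v - w \<in> N0"
  using PP(3)[of "v - w"] F.P_simps by simp

lemma psi_eq_PP: "\<psi> v = \<psi> w \<longleftrightarrow> PP v = PP w" by (simp add: psi_diff PP_eq)

lemma psi_PP: "\<psi> (PP v) = \<psi> v" by (simp add: psi_eq_PP PP(2))

text \<open>The action of the Lie superalgebra on the induced module, lifted to normal forms.\<close>

definition X :: "('a, 'u) loop \<Rightarrow> (('a, 'u) T_alg) \<Rightarrow> (('a, 'u) T_alg)" where
  "X x w = PP (gen x * w)"

lemma X_linear: "F.lin (X x)"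
  by (rule F.linI) (simp_all add: X_def distrib_left F.P_simps pm_scale_mult)

lemmas X_simps = F.lin_simps[OF X_linear]

lemma X_P: "PP (X x w) = X x w" "X x (PP w) = X x w"
proof -
  show "PP (X x w) = X x w" by (simp add: X_def PP(2))
  have "PP w - w \<in> N0" using PP_eq PP(2) by blast
  then show "X x (PP w) = X x w" unfolding X_def PP_eq using N0_gen[of "PP w - w" x] by (simp add: right_diff_distrib)
qed

lemma X_psi: "\<psi> (X x w) = V_act D l x (\<psi> w)"
  by (simp add: X_def psi_PP V_act_Psi)

lemma X_add: "X (x + y) w = X x w + X y w"
proof -
  have "gen (x + y) * w - (gen x * w + gen y * w) \<in> N0"
    using N0_rels[OF uea_relsI(1)[where L = "LAU D" and x = x and y = y], of w] by (simp add: LAU_simps algebra_simps)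
  then show ?thesis using PP_eq by (simp add: X_def F.P_simps(1)[symmetric])
qed

lemma X_scale: "X (lsc c x) w = pm_scale c (X x w)"
proof -
  have "gen (lsc c x) * w - pm_scale c (gen x * w) \<in> N0"
    using N0_rels[OF uea_relsI(2)[where L = "LAU D" and x = x and c = c], of w] by (simp add: LAU_simps left_diff_distrib pm_scale_mult)
  then show ?thesis using PP_eq by (simp add: X_def F.P_simps(3)[symmetric])
qed

lemma X_zero: "X 0 w = 0" using X_add[of 0 0 w] by simp
lemma X_commutator:
  assumes "x \<in> hom_part p" "y \<in> hom_part q"
  shows "X x (X y w) - pm_scale (super_sign p q) (X y (X x w)) = X (lbr x y) w"
proof -
  have "(gen x * (gen y * w) - pm_scale (super_sign p q) (gen y * (gen x * w))) - gen (lbr x y) * w \<in> N0"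
    using N0_rels[OF uea_relsI(3)[where L = "LAU D" and x = x and y = y and p = p and q = q], of w] assms
    by (simp add: LAU_simps left_diff_distrib pm_scale_mult mult.assoc)
  then have "PP (gen x * (gen y * w)) - pm_scale (super_sign p q) (PP (gen y * (gen x * w))) = PP (gen (lbr x y) * w)"
    unfolding F.P_simps(2,3)[symmetric] PP_eq .
  then show ?thesis using X_P(2)[of x "gen y * w"] X_P(2)[of y "gen x * w"] by (simp add: X_def)
qed

definition vac0 :: "('a, 'u) T_alg" where "vac0 = PP 1"

lemma vac0_P: "PP vac0 = vac0" by (simp add: vac0_def PP(2))

lemma psi_vac0: "\<psi> vac0 = V_vac D l" by (simp add: vac0_def psi_PP V_vac_eq)

lemma X_vac: "loop_pos x = x \<Longrightarrow> X x vac0 = pm_scale (l * snd (snd x)) vac0"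
  using Psi_right[of x l 1] unfolding vac0_def X_P(2) unfolding X_def F.P_simps(3)[symmetric] psi_eq_PP[symmetric]
  by (simp add: Psi_scale)

lemma generation_all:
  assumes "pm.subspace H" "\<And>v. PP v = 0 \<Longrightarrow> v \<in> H" "vac0 \<in> H" "\<And>x v. v \<in> H \<Longrightarrow> X x v \<in> H"
  shows "H = UNIV"
proof -
  have step: "v \<in> H" if "PP v \<in> H" for v
  proof -
    have d: "v - PP v \<in> H" by (rule assms(2)) (simp add: F.P_simps PP(2))
    show ?thesis using pm.subspace_add[OF assms(1) d that] by simp
  qed
  have "f \<in> H" for f
  proof (induction f rule: word_induct)
    case (3 xs)
    show ?case
    proof (induction xs)
      case Nil
      then show ?case using step[of 1] assms(3) by (simp add: vac0_def wd_simps)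
    next
      case (Cons x xs)
      then show ?case using step[of "gen x * wd xs"] assms(4)[of "wd xs" x] by (simp add: X_def wd_simps)
    qed
  qed (use assms(1) pm.subspace_add pm.subspace_scale in blast)+
  then show ?thesis by blast
qed

lemma X_cen: "X (cen k) w = pm_scale (l * k) (PP w)"
proof -
  let ?H = "{w. X (cen k) w = pm_scale (l * k) (PP w)}"
  have "?H = UNIV"
  proof (rule generation_all)
    show "pm.subspace ?H"
      by (rule pm.subspaceI) (simp_all add: X_simps F.P_simps pm.scale_right_distrib mult.commute)
    show "v \<in> ?H" if "PP v = 0" for v using X_P(2)[of "cen k" v] that by (simp add: X_simps)
    show "vac0 \<in> ?H" using X_vac[of "cen k"] by (simp add: loop_pos_simps vac0_P) (simp add: cen_def)
    fix x v assume v: "v \<in> ?H"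
    have *: "X (cen k) (X y v) = pm_scale (l * k) (X y v)" if "y \<in> hom_part q" for y q
      using X_commutator[OF cen_hom that, of k v] v
      by (simp add: super_sign_simps lbr_modes X_zero X_simps X_P)
    have "X x v = X (even_part x) v + X (odd_part x) v" by (simp flip: X_add LS.ev_od)
    then show "X x v \<in> ?H"
      using *[OF LS.ev_hom[of x]] *[OF LS.od_hom[of x]] by (simp add: X_simps F.P_simps X_P pm.scale_right_distrib)
  qed
  then show ?thesis by blast
qed

lemma generation_modes:
  assumes "pm.subspace H" "\<And>v. PP v = 0 \<Longrightarrow> v \<in> H" "vac0 \<in> H"
    "\<And>a n v. v \<in> H \<Longrightarrow> X (am a n) v \<in> H" "\<And>u n v. v \<in> H \<Longrightarrow> X (um u n) v \<in> H"
  shows "H = UNIV"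
proof (rule generation_all[OF assms(1-3)])
  fix x v assume v: "v \<in> H"
  show "X x v \<in> H"
  proof (induction x rule: loop_induct)
    case (1 x y)
    then show ?case unfolding X_add by (rule pm.subspace_add[OF assms(1)])
  next
    case (4 k)
    have d: "PP v - v \<in> H" by (rule assms(2)) (simp add: F.P_simps PP(2))
    have "PP v \<in> H" using pm.subspace_add[OF assms(1) d v] by simp
    then show ?case unfolding X_cen by (rule pm.subspace_scale[OF assms(1)])
  qed (use assms v in auto)
qed

lemma X_am_scale: "X (am (scA D c a) n) w = pm_scale c (X (am a n) w)" and X_um_scale: "X (um (scU D c u) n) w = pm_scale c (X (um u n) w)"
  using X_scale[of c "am a n" w] X_scale[of c "um u n" w] by (simp_all add: lsc_modes)

definition fA :: "'a \<Rightarrow> int \<Rightarrow> ('a, 'u) T_alg \<Rightarrow> ('a, 'u) T_alg" where "fA a n = X (am a n)"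
definition fU :: "'u \<Rightarrow> int \<Rightarrow> ('a, 'u) T_alg \<Rightarrow> ('a, 'u) T_alg" where "fU u n = X (um u n)"

lemma f_scale: "fA (scA D c a) n w = pm_scale c (fA a n w)" "fU (scU D c u) n w = pm_scale c (fU u n w)"
  by (simp_all add: fA_def fU_def X_am_scale X_um_scale)

lemma f_commutators:
  "fA a m (fA b n w) - fA b n (fA a m w) = pm_scale (of_int (m - n) / 2) (fA (a * b) (m + n - 1) w)
     + pm_scale (if m + n = 2 then l * (of_int m * (of_int m - 1) * (of_int m - 2) / 6 * formA D a b) else 0) (PP w)"
  "fA a m (fU u n w) - fU u n (fA a m w) = pm_scale (of_int (m - 2 * n) / 4) (fU (act D a u) (m + n - 1) w)"
  "fU u m (fU v n w) + fU v n (fU u m w) = fA (circ D u v) (m + n) w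
     + pm_scale (if m + n = 1 then l * (of_int (m * (m - 1)) / 2 * formU D u v) else 0) (PP w)"
  using X_commutator[OF am_hom am_hom, of a m b n w] X_commutator[OF am_hom um_hom, of a m u n w] X_commutator[OF um_hom um_hom, of u m v n w]
  by (simp_all add: fA_def fU_def super_sign_simps(3,4) lbr_modes X_add X_cen X_am_scale X_um_scale gbinomial_three) (simp add: super_sign_def)

lemma f_vac: "n \<ge> 0 \<Longrightarrow> fA a n vac0 = 0" "n \<ge> 0 \<Longrightarrow> fU u n vac0 = 0"
  using X_vac[of "am a n"] X_vac[of "um u n"] by (simp_all add: loop_pos_simps fA_def fU_def) (simp_all add: am_def um_def)

lemma f_simps: "F.lin (fA a n)" "F.lin (fU u n)" "PP (fA a n w) = fA a n w" "fA a n (PP w) = fA a n w" "PP (fU u n w) = fU u n w" "fU u n (PP w) = fU u n w"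
  by (simp_all add: fA_def fU_def X_linear X_P)

lemmas fA_lin = F.lin_simps[OF f_simps(1)] and fU_lin = F.lin_simps[OF f_simps(2)]

lemma generation_f:
  assumes "pm.subspace H" "\<And>v. PP v = 0 \<Longrightarrow> v \<in> H" "vac0 \<in> H"
    "\<And>a n v. v \<in> H \<Longrightarrow> fA a n v \<in> H" "\<And>u n v. v \<in> H \<Longrightarrow> fU u n v \<in> H"
  shows "H = UNIV"
  using assms unfolding fA_def fU_def by (rule generation_modes)

text \<open>The vectors on which all fields are truncated contain the vacuum, and the commutators show that they are closed
under modes: a commutator with a mode of large index is a mode of large index.\<close>

lemma f_truncation: "\<exists>N. \<forall>n\<ge>N. fA a n w = 0" "\<exists>N. \<forall>n\<ge>N. fU u n w = 0"
proof -
  let ?H = "{w. (\<forall>a. eventually (\<lambda>n. fA a n w = 0) at_top) \<and> (\<forall>u. eventually (\<lambda>n. fU u n w = 0) at_top)}"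
  have shift: "eventually (\<lambda>n. Q (n + k)) at_top" if Q: "eventually Q at_top" for Q and k :: int
  proof -
    obtain N where N: "\<And>n. n \<ge> N \<Longrightarrow> Q n" using Q unfolding eventually_at_top_linorder by blast
    show ?thesis unfolding eventually_at_top_linorder by (intro exI[of _ "N - k"]) (auto intro: N)
  qed
  have ne: "eventually (\<lambda>n. n + k \<noteq> (j::int)) at_top" for k j
    unfolding eventually_at_top_linorder by (intro exI[of _ "j - k + 1"]) auto
  have "?H = UNIV"
  proof (rule generation_f)
    show "pm.subspace ?H"
    proof (rule pm.subspaceI)
      show "x + y \<in> ?H" if "x \<in> ?H" "y \<in> ?H" for x y
      proof -
        have "eventually (\<lambda>n. fA a n (x + y) = 0) at_top" for a
        proof -
          have "eventually (\<lambda>n. fA a n x = 0) at_top" "eventually (\<lambda>n. fA a n y = 0) at_top" using that by auto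
          then show ?thesis by eventually_elim (simp add: fA_lin)
        qed
        moreover have "eventually (\<lambda>n. fU a n (x + y) = 0) at_top" for a
        proof -
          have "eventually (\<lambda>n. fU a n x = 0) at_top" "eventually (\<lambda>n. fU a n y = 0) at_top" using that by auto
          then show ?thesis by eventually_elim (simp add: fU_lin)
        qed
        ultimately show ?thesis by simp
      qed
      show "pm_scale c x \<in> ?H" if "x \<in> ?H" for c x
        using that by (auto simp: fA_lin fU_lin elim: eventually_mono)
    qed (simp add: fA_lin fU_lin)
    show "v \<in> ?H" if "PP v = 0" for v
      using f_simps(4)[of _ _ v] f_simps(6)[of _ _ v] that by (simp add: fA_lin fU_lin)
    show "vac0 \<in> ?H" unfolding eventually_at_top_linorder using f_vac by blast
    fix v assume v: "v \<in> ?H"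
    note va = v[THEN CollectD, THEN conjunct1, rule_format] and vu = v[THEN CollectD, THEN conjunct2, rule_format]
    show "fA b k v \<in> ?H" for b k
    proof (intro CollectI conjI allI)
      fix a
      show "eventually (\<lambda>n. fA a n (fA b k v) = 0) at_top"
        using va[of a] shift[OF va[of "a * b"], of "k - 1"] ne[of k 2]
      proof eventually_elim
        case (elim n)
        then show ?case using f_commutators(1)[of a n b k v] by (simp add: fA_lin add_diff_eq)
      qed
    next
      fix u
      show "eventually (\<lambda>n. fU u n (fA b k v) = 0) at_top"
        using vu[of u] shift[OF vu[of "act D b u"], of "k - 1"]
      proof eventually_elim
        case (elim n)
        then show ?case using f_commutators(2)[of b k u n v] by (simp add: fA_lin add.commute add_diff_eq)
      qed
    qed
    show "fU u k v \<in> ?H" for u k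
    proof (intro CollectI conjI allI)
      fix a
      show "eventually (\<lambda>n. fA a n (fU u k v) = 0) at_top"
        using va[of a] shift[OF vu[of "act D a u"], of "k - 1"]
      proof eventually_elim
        case (elim n)
        then show ?case using f_commutators(2)[of a n u k v] by (simp add: fU_lin add_diff_eq)
      qed
    next
      fix u'
      show "eventually (\<lambda>n. fU u' n (fU u k v) = 0) at_top"
        using vu[of u'] shift[OF va[of "circ D u' u"], of k] ne[of k 1]
      proof eventually_elim
        case (elim n)
        then show ?case using f_commutators(3)[of u' n u k v] by (simp add: fU_lin)
      qed
    qed
  qed
  then show "\<exists>N. \<forall>n\<ge>N. fA a n w = 0" "\<exists>N. \<forall>n\<ge>N. fU u n w = 0"
    unfolding eventually_at_top_linorder by blast+
qed

lemma f_field: "F.field (fA a)" "F.field (fU u)"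
  unfolding F.field_def by (auto simp: f_simps f_truncation)

text \<open>Locality of order four means that the fourth difference of the commutators, taken along indices with a fixed sum,
vanishes; this holds for polynomials of degree at most three.\<close>

lemma cubic_local:
  assumes f: "F.field \<phi>" "F.field \<chi>"
    and c: "\<And>k q w. \<phi> k (\<chi> q w) - pm_scale s (\<chi> q (\<phi> k w)) =
      (\<Sum>j<4. pm_scale (of_int k ^ j) (g j (k + q) w))"
  shows "F.mut_local s \<phi> \<chi>"
proof (rule F.mut_localI[OF f, where N = 4])
  fix k q w
  let ?G = "\<lambda>k q. \<Sum>j<4. pm_scale (of_int k ^ j) (g j (k + q) w)"
  let ?b = "\<lambda>m k q. F.bor s \<phi> \<chi> m k q w"
  have r: "?b (m + 1) k q = ?b m (k + 1) q - ?b m k (q + 1)" for m k q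
    by (rule F.bor_recurrence[OF f, symmetric])
  have b0: "?b 0 k q = ?G k q" for k q by (simp only: F.bor_0 c)
  have "?b 4 k q = ?G (k + 4) q - pm_scale 4 (?G (k + 3) (q + 1)) + pm_scale 6 (?G (k + 2) (q + 2)) - pm_scale 4 (?G (k + 1) (q + 3)) + ?G k (q + 4)"
  proof -
    have p: "pm_scale 4 x = x + x + x + x" "pm_scale 6 x = x + x + x + x + x + x" for x :: "('a, 'u) T_alg"
      using pm.scale_left_distrib[of 3 1 x] pm.scale_left_distrib[of 2 1 x] pm.scale_left_distrib[of 1 1 x]
        pm.scale_left_distrib[of 3 3 x] by simp_all
    show ?thesis
      unfolding b0[symmetric] p
      using r[of 3 k q] r[of 2 "k + 1" q] r[of 2 k "q + 1"] r[of 1 "k + 2" q] r[of 1 "k + 1" "q + 1"] r[of 1 k "q + 2"]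
        r[of 0 "k + 3" q] r[of 0 "k + 2" "q + 1"] r[of 0 "k + 1" "q + 2"] r[of 0 k "q + 3"]
      by (simp add: add.assoc)
  qed
  also have "\<dots> = (\<Sum>j<4. pm_scale (of_int (k + 4) ^ j - 4 * of_int (k + 3) ^ j + 6 * of_int (k + 2) ^ j - 4 * of_int (k + 1) ^ j + of_int k ^ j) (g j (k + q + 4) w))"
  proof -
    have e: "k + 4 + q = k + q + 4" "k + 3 + (q + 1) = k + q + 4" "k + 2 + (q + 2) = k + q + 4" "k + 1 + (q + 3) = k + q + 4" "k + (q + 4) = k + q + 4" by auto
    show ?thesis unfolding e
      by (simp only: pm.scale_left_distrib pm.scale_left_diff_distrib sum.distrib sum_subtractf pm.scale_sum_right pm.scale_scale)
  qed
  also have "\<dots> = 0"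
  proof (rule sum.neutral, rule ballI)
    fix j assume "j \<in> {..<4::nat}"
    then have "j = 0 \<or> j = 1 \<or> j = 2 \<or> j = 3" by auto
    then have z: "complex_of_int (k + 4) ^ j - 4 * of_int (k + 3) ^ j + 6 * of_int (k + 2) ^ j - 4 * of_int (k + 1) ^ j + of_int k ^ j = 0"
      by (auto simp: power2_eq_square power3_eq_cube algebra_simps)
    show "pm_scale (complex_of_int (k + 4) ^ j - 4 * of_int (k + 3) ^ j + 6 * of_int (k + 2) ^ j - 4 * of_int (k + 1) ^ j + of_int k ^ j) (g j (k + q + 4) w) = 0"
      unfolding z by simp
  qed
  finally show "?b 4 k q = 0" .
qed

lemma f_local: "F.mut_local 1 (fA a) (fA b)" "F.mut_local 1 (fA a) (fU u)" "F.mut_local (-1) (fU u) (fU v)"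
proof -
  have s4: "(\<Sum>j<4. f j) = f 0 + f 1 + f 2 + f (3::nat)" for f :: "nat \<Rightarrow> ('a, 'u) T_alg"
    by (simp add: eval_nat_numeral lessThan_Suc add.commute add.left_commute)
  show "F.mut_local 1 (fA a) (fA b)"
  (* The commutator, sorted by powers of k while the sum of the indices is fixed. *)
  proof (rule cubic_local[OF f_field(1) f_field(1), where g = "\<lambda>j r w. if j = 0 then pm_scale (- of_int r / 2) (fA (a * b) (r - 1) w)
      else if j = 1 then fA (a * b) (r - 1) w + pm_scale (if r = 2 then l * formA D a b / 3 else 0) (PP w)
      else if j = 2 then pm_scale (if r = 2 then - l * formA D a b / 2 else 0) (PP w)
      else pm_scale (if r = 2 then l * formA D a b / 6 else 0) (PP w)"])
    fix k q w
    let ?Z = "fA (a * b) (k + q - 1) w"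
    have 1: "pm_scale (of_int (k - q) / 2) ?Z = pm_scale (- of_int (k + q) / 2) ?Z + pm_scale (of_int k) ?Z"
      unfolding pm.scale_left_distrib[symmetric] by (rule arg_cong[of _ _ "\<lambda>c. pm_scale c ?Z"]) (simp add: field_simps)
    have 2: "l * (of_int k * (of_int k - 1) * (of_int k - 2) / 6 * formA D a b) = of_int k * (l * formA D a b / 3) + of_int k ^ 2 * (- l * formA D a b / 2) + of_int k ^ 3 * (l * formA D a b / 6)"
      by (simp add: field_simps power2_eq_square power3_eq_cube)
    show "fA a k (fA b q w) - pm_scale 1 (fA b q (fA a k w)) = (\<Sum>j<4. pm_scale (of_int k ^ j) (if j = 0 then pm_scale (- of_int (k + q) / 2) (fA (a * b) (k + q - 1) w)
      else if j = 1 then fA (a * b) (k + q - 1) w + pm_scale (if k + q = 2 then l * formA D a b / 3 else 0) (PP w)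
      else if j = 2 then pm_scale (if k + q = 2 then - l * formA D a b / 2 else 0) (PP w)
      else pm_scale (if k + q = 2 then l * formA D a b / 6 else 0) (PP w)))"
      unfolding s4 pm.scale_one f_commutators(1) 1
      by (cases "k + q = 2") (simp_all only: if_True if_False 2, simp_all add: pm.scale_left_distrib pm.scale_right_distrib pm.scale_left_diff_distrib)
  qed
  show "F.mut_local 1 (fA a) (fU u)"
  proof (rule cubic_local[OF f_field(1) f_field(2), where g = "\<lambda>j r w. if j = 0 then pm_scale (- of_int r / 2) (fU (act D a u) (r - 1) w)
      else if j = 1 then pm_scale (3/4) (fU (act D a u) (r - 1) w) else 0"])
    fix k q w
    let ?Z = "fU (act D a u) (k + q - 1) w"
    have 1: "pm_scale (of_int (k - 2 * q) / 4) ?Z = pm_scale (- of_int (k + q) / 2) ?Z + pm_scale (of_int k * (3/4)) ?Z"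
      unfolding pm.scale_left_distrib[symmetric] by (rule arg_cong[of _ _ "\<lambda>c. pm_scale c ?Z"]) (simp add: field_simps)
    show "fA a k (fU u q w) - pm_scale 1 (fU u q (fA a k w)) = (\<Sum>j<4. pm_scale (of_int k ^ j) (if j = 0 then pm_scale (- of_int (k + q) / 2) (fU (act D a u) (k + q - 1) w)
      else if j = 1 then pm_scale (3/4) (fU (act D a u) (k + q - 1) w) else 0))"
      unfolding s4 pm.scale_one f_commutators(2) 1 by simp
  qed
  show "F.mut_local (-1) (fU u) (fU v)"
  proof (rule cubic_local[OF f_field(2) f_field(2), where g = "\<lambda>j r w. if j = 0 then fA (circ D u v) r w
      else if j = 1 then pm_scale (if r = 1 then - l * formU D u v / 2 else 0) (PP w)
      else if j = 2 then pm_scale (if r = 1 then l * formU D u v / 2 else 0) (PP w) else 0"])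
    fix k q w
    have 2: "l * (of_int (k * (k - 1)) / 2 * formU D u v) = of_int k * (- l * formU D u v / 2) + of_int k ^ 2 * (l * formU D u v / 2)"
      by (simp add: field_simps power2_eq_square)
    have e: "fU u k (fU v q w) - pm_scale (-1) (fU v q (fU u k w)) = fU u k (fU v q w) + fU v q (fU u k w)" by simp
    show "fU u k (fU v q w) - pm_scale (-1) (fU v q (fU u k w)) = (\<Sum>j<4. pm_scale (of_int k ^ j) (if j = 0 then fA (circ D u v) (k + q) w
      else if j = 1 then pm_scale (if k + q = 1 then - l * formU D u v / 2 else 0) (PP w)
      else if j = 2 then pm_scale (if k + q = 1 then l * formU D u v / 2 else 0) (PP w) else 0))"
      unfolding s4 e f_commutators(3)
      by (cases "k + q = 1") (simp_all only: if_True if_False 2, simp_all add: pm.scale_left_distrib pm.scale_right_distrib pm.scale_left_diff_distrib)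
  qed
qed

lemma omega_mult: "\<omega> * a = scA D 2 a" and omega_act: "act D \<omega> u = scU D 2 u"
proof -
  have "scA D 2 (scA D (1/2) (\<omega> * a)) = scA D 2 a" using identity[of a] by (simp only: mult_scale)
  then show "\<omega> * a = scA D 2 a" by (simp only: A.scale_scale) simp
  have "scU D 2 (scU D (1/2) (act D \<omega> u)) = scU D 2 u" using act_identity[of u] by (simp only: act_rules)
  then show "act D \<omega> u = scU D 2 u" by (simp only: U.scale_scale) simp
qed

text \<open>As \<open>\<omega>\<close> is twice the identity of \<open>A\<close>, its modes \<open>L(n) = \<omega>(n + 1)\<close> satisfy the Virasoro relations; the fields of
\<open>A\<close> and \<open>U\<close> are covariant of weights \<open>2\<close> and \<open>3/2\<close> under \<open>L(-1)\<close> and \<open>L(0)\<close>.\<close>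

lemma omega_commutators:
  "fA \<omega> m (fA a n w) - fA a n (fA \<omega> m w) = pm_scale (of_int (m - n)) (fA a (m + n - 1) w)
     + pm_scale (if m + n = 2 then l * (of_int m * (of_int m - 1) * (of_int m - 2) / 6 * formA D \<omega> a) else 0) (PP w)"
  "fA \<omega> m (fU u n w) - fU u n (fA \<omega> m w) = pm_scale (of_int (m - 2 * n) / 2) (fU u (m + n - 1) w)"
  unfolding f_commutators omega_mult omega_act f_scale by simp_all

end

context pair_level
begin

section \<open>The grading by eigenvalues of \<open>L(0)\<close>\<close>

text \<open>The eigenspaces of \<open>L(0)\<close>; every one of them contains the representatives \<open>N0\<close> of zero.\<close>

definition gr0 :: "rat \<Rightarrow> ('a, 'u) T_alg set" where
  "gr0 q = {v. fA \<omega> 1 v = pm_scale (of_rat q) (PP v)}"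

lemma gr0_subspace: "pm.subspace (gr0 q)"
  by (rule pm.subspaceI) (simp_all add: gr0_def fA_lin F.P_simps pm.scale_right_distrib mult.commute)

lemmas gr0_closed = pm.subspace_add[OF gr0_subspace] pm.subspace_scale[OF gr0_subspace] pm.subspace_diff[OF gr0_subspace]
  pm.subspace_0[OF gr0_subspace] pm.subspace_neg[OF gr0_subspace]

lemma f_null: "PP v = 0 \<Longrightarrow> fA a n v = 0" "PP v = 0 \<Longrightarrow> fU u n v = 0"
  using f_simps(4)[of a n v] f_simps(6)[of u n v] by (simp_all add: fA_lin fU_lin)

lemma gr0_null: "PP v = 0 \<Longrightarrow> v \<in> gr0 q"
  by (simp add: gr0_def f_null)

lemma gr0_vac: "vac0 \<in> gr0 0"
  by (simp add: gr0_def f_vac)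

lemma gr0_fA: "v \<in> gr0 q \<Longrightarrow> fA a n v \<in> gr0 (q + (1 - of_int n))"
  and gr0_fU: "v \<in> gr0 q \<Longrightarrow> fU u n v \<in> gr0 (q + (1/2 - of_int n))"
proof -
  assume v: "v \<in> gr0 q"
  have "fA \<omega> 1 (fA a n v) = pm_scale (of_rat q) (fA a n v) + pm_scale (1 - of_int n) (fA a n v)"
    using omega_commutators(1)[of 1 a n v] v by (simp add: gr0_def fA_lin f_simps algebra_simps)
  then show "fA a n v \<in> gr0 (q + (1 - of_int n))"
    by (simp add: gr0_def f_simps of_rat_add of_rat_diff pm.scale_left_distrib)
  have "fA \<omega> 1 (fU u n v) = pm_scale (of_rat q) (fU u n v) + pm_scale (of_int (1 - 2 * n) / 2) (fU u n v)"
    using omega_commutators(2)[of 1 u n v] v by (simp add: gr0_def fU_lin f_simps algebra_simps)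
  also have "complex_of_int (1 - 2 * n) / 2 = of_rat (1/2 - of_int n)"
  proof -
    have "(1/2 - of_int n :: rat) = of_int (1 - 2 * n) / 2" by (simp add: field_simps)
    then show ?thesis by (simp only: of_rat_divide of_rat_of_int_eq of_rat_numeral_eq)
  qed
  finally show "fU u n v \<in> gr0 (q + (1/2 - of_int n))"
    by (simp add: gr0_def f_simps of_rat_add pm.scale_left_distrib)
qed

text \<open>Induction on the number of components: applying \<open>L(0) - p\<close> removes the component of degree \<open>p\<close> and multiplies the others by
nonzero scalars.\<close>

lemma eigen_components:
  assumes H: "pm.subspace H" "\<And>v. PP v = 0 \<Longrightarrow> v \<in> H" "\<And>v. v \<in> H \<Longrightarrow> fA \<omega> 1 v \<in> H"
    and "finite Q" "\<And>q. q \<in> Q \<Longrightarrow> f q \<in> gr0 q" "(\<Sum>q\<in>Q. f q) \<in> H" "q \<in> Q"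
  shows "f q \<in> H"
  using assms(4-7)
proof (induction Q arbitrary: f q)
  case (insert p Q)
  note Hc = pm.subspace_add[OF H(1)] pm.subspace_scale[OF H(1)] pm.subspace_diff[OF H(1)]
  have PH: "PP v \<in> H \<longleftrightarrow> v \<in> H" for v
  proof -
    have "v - PP v \<in> H" by (rule H(2)) (simp add: F.P_simps PP(2))
    then show ?thesis using Hc(1)[of "PP v" "v - PP v"] Hc(3)[of v "v - PP v"] by auto
  qed
  let ?v = "\<Sum>q\<in>insert p Q. f q"
  let ?g = "\<lambda>q. pm_scale (of_rat q - of_rat p) (PP (f q))"
  have eig: "fA \<omega> 1 (f q) = pm_scale (of_rat q) (PP (f q))" if "q \<in> insert p Q" for q
    using insert(4)[OF that] by (simp add: gr0_def)
  have "fA \<omega> 1 ?v - pm_scale (of_rat p) (PP ?v) \<in> H"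
    by (rule Hc(3)[OF H(3)[OF insert(5)] Hc(2)]) (simp only: PH insert(5))
  also have "fA \<omega> 1 ?v - pm_scale (of_rat p) (PP ?v) = (\<Sum>q\<in>insert p Q. ?g q)"
    unfolding fA_lin F.P_simps pm.scale_sum_right sum_subtractf[symmetric]
    by (rule sum.cong) (simp_all add: eig pm.scale_left_diff_distrib)
  also have "\<dots> = (\<Sum>q\<in>Q. ?g q)" using insert(1,2) by simp
  finally have S: "(\<Sum>q\<in>Q. ?g q) \<in> H" .
  have g: "?g q \<in> H" if "q \<in> Q" for q
  proof (rule insert(3)[OF _ S that])
    fix q assume "q \<in> Q"
    then show "?g q \<in> gr0 q" using eig[of q] by (simp add: gr0_def fA_lin F.P_simps f_simps PP(2) mult.commute)
  qed
  have fQ: "f q \<in> H" if "q \<in> Q" for q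
  proof -
    have "q \<noteq> p" using that insert(2) by blast
    then have "complex_of_rat q - of_rat p \<noteq> 0" by simp
    then have "PP (f q) = pm_scale (inverse (of_rat q - of_rat p)) (?g q)" by simp
    then have "PP (f q) \<in> H" using Hc(2)[OF g[OF that]] by metis
    then show ?thesis by (simp add: PH)
  qed
  have "f p = ?v - (\<Sum>q\<in>Q. f q)" using insert(1,2) by simp
  also have "\<dots> \<in> H" by (rule Hc(3)[OF insert(5) pm.subspace_sum[OF H(1) fQ]])
  finally show ?case using fQ insert(6) by auto
qed simp

text \<open>The span of a family of homogeneous subspaces, with its elements in the form that the arguments about components use.\<close>

definition hom_sums :: "(rat \<Rightarrow> ('a, 'u) T_alg set) \<Rightarrow> rat set \<Rightarrow> ('a, 'u) T_alg set" where
  "hom_sums G I = {v. \<exists>Q f. finite Q \<and> Q \<subseteq> I \<and> (\<forall>q. f q \<in> G q) \<and> v = (\<Sum>q\<in>Q. f q)}"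

lemma hom_sumsI:
  assumes "finite Q" "Q \<subseteq> I" "\<And>q. f q \<in> G q" "v = (\<Sum>q\<in>Q. f q)"
  shows "v \<in> hom_sums G I"
  unfolding hom_sums_def mem_Collect_eq by (rule exI[of _ Q], rule exI[of _ f]) (use assms in simp)

lemma hom_sumsE:
  assumes "v \<in> hom_sums G I"
  obtains Q f where "finite Q" "Q \<subseteq> I" "\<And>q. f q \<in> G q" "v = (\<Sum>q\<in>Q. f q)"
proof -
  from assms obtain Q f where "finite Q \<and> Q \<subseteq> I \<and> (\<forall>q. f q \<in> G q) \<and> v = (\<Sum>q\<in>Q. f q)"
    unfolding hom_sums_def mem_Collect_eq by (elim exE)
  then show ?thesis by (intro that[of Q f]) simp_all
qed

lemma hom_sums_subspace:
  assumes G: "\<And>q. pm.subspace (G q)"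
  shows "pm.subspace (hom_sums G I)"
proof (rule pm.subspaceI)
  show "0 \<in> hom_sums G I"
    by (rule hom_sumsI[of "{}" _ "\<lambda>q. 0"]) (simp_all add: pm.subspace_0[OF G])
  show "pm_scale c x \<in> hom_sums G I" if h: "x \<in> hom_sums G I" for c x
  proof -
    obtain Q f where f: "finite Q" "Q \<subseteq> I" "\<And>q. f q \<in> G q" "x = (\<Sum>q\<in>Q. f q)" by (rule hom_sumsE[OF h]) (rule that)
    show ?thesis
      by (rule hom_sumsI[OF f(1,2), of "\<lambda>q. pm_scale c (f q)"]) (simp_all add: f(3,4) pm.scale_sum_right pm.subspace_scale[OF G])
  qed
  show "x + y \<in> hom_sums G I" if h: "x \<in> hom_sums G I" "y \<in> hom_sums G I" for x y
  proof -
    obtain Q f where f: "finite Q" "Q \<subseteq> I" "\<And>q. f q \<in> G q" "x = (\<Sum>q\<in>Q. f q)" by (rule hom_sumsE[OF h(1)]) (rule that)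
    obtain R g where g: "finite R" "R \<subseteq> I" "\<And>q. g q \<in> G q" "y = (\<Sum>q\<in>R. g q)" by (rule hom_sumsE[OF h(2)]) (rule that)
    let ?f = "\<lambda>q. if q \<in> Q then f q else 0" and ?g = "\<lambda>q. if q \<in> R then g q else 0"
    have "x = (\<Sum>q\<in>Q \<union> R. ?f q)" unfolding f(4) using f(1) g(1) by (intro sum.mono_neutral_cong_left) auto
    moreover have "y = (\<Sum>q\<in>Q \<union> R. ?g q)" unfolding g(4) using f(1) g(1) by (intro sum.mono_neutral_cong_left) auto
    ultimately have "x + y = (\<Sum>q\<in>Q \<union> R. ?f q + ?g q)" by (simp add: sum.distrib)
    moreover have "?f q + ?g q \<in> G q" for q using f(3) g(3) pm.subspace_add[OF G] pm.subspace_0[OF G] by auto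
    ultimately show ?thesis using f(1,2) g(1,2) by (intro hom_sumsI[of "Q \<union> R" I "\<lambda>q. ?f q + ?g q"]) simp_all
  qed
qed

lemma hom_sums_single: "(\<And>q. 0 \<in> G q) \<Longrightarrow> v \<in> G q \<Longrightarrow> q \<in> I \<Longrightarrow> v \<in> hom_sums G I"
  by (rule hom_sumsI[of "{q}" I "\<lambda>r. if r = q then v else 0"]) auto

lemma hom_sums_map:
  assumes h: "pm.subspace H" "\<And>x y. h (x + y) = h x + h y" "\<And>q v. q \<in> I \<Longrightarrow> v \<in> G q \<Longrightarrow> h v \<in> H"
    and v: "v \<in> hom_sums G I"
  shows "h v \<in> H"
proof -
  have "h 0 = 0" using h(2)[of 0 0] by simp
  then have s: "h (sum f Q) = (\<Sum>q\<in>Q. h (f q))" for f :: "rat \<Rightarrow> ('a, 'u) T_alg" and Q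
    by (induction Q rule: infinite_finite_induct) (simp_all add: h(2))
  obtain Q f where f: "finite Q" "Q \<subseteq> I" "\<And>q. f q \<in> G q" "v = (\<Sum>q\<in>Q. f q)" by (rule hom_sumsE[OF v]) (rule that)
  show ?thesis unfolding f(4) s by (rule pm.subspace_sum[OF h(1)]) (use f h(3) in auto)
qed

lemma half_ints_shift: "q \<in> half_ints \<Longrightarrow> q + (1 - of_int n) \<in> half_ints" "q \<in> half_ints \<Longrightarrow> q + (1/2 - of_int n) \<in> half_ints"
  "0 \<in> half_ints" "of_int n + (if p then 1/2 else 0) \<in> half_ints"
proof -
  show "q + (1 - of_int n) \<in> half_ints" if "q \<in> half_ints"
  proof -
    have "2 * (q + (1 - of_int n)) = 2 * q + of_int (2 - 2 * n)" by simp
    then show ?thesis using that unfolding half_ints_def mem_Collect_eq by (metis Ints_add Ints_of_int)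
  qed
  show "q + (1/2 - of_int n) \<in> half_ints" if "q \<in> half_ints"
  proof -
    have "2 * (q + (1/2 - of_int n)) = 2 * q + of_int (1 - 2 * n)" by simp
    then show ?thesis using that unfolding half_ints_def mem_Collect_eq by (metis Ints_add Ints_of_int)
  qed
  show "0 \<in> half_ints" by (simp add: half_ints_def)
  have "2 * (of_int n + (if p then 1/2 else 0)) = (of_int (2 * n + (if p then 1 else 0)) :: rat)" by simp
  then show "of_int n + (if p then 1/2 else 0) \<in> half_ints" unfolding half_ints_def mem_Collect_eq by (metis Ints_of_int)
qed

end

text \<open>Several descriptions of the homogeneous subspaces are compared with the eigenspaces of \<open>L(0)\<close>.  It suffices that a
family lies in the eigenspaces, contains the vacuum and is compatible with the degrees of modes: it then spans
everything, and eigenvectors for different eigenvalues are independent.\<close>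

locale mode_stable_family = pair_level D \<omega> l
  for D :: "('a::comm_ring, 'u::ab_group_add) pair_data" and \<omega> :: 'a and l :: complex +
  fixes G :: "rat \<Rightarrow> ('a, 'u) T_alg set"
  assumes subspace: "pm.subspace (G q)" and sub: "G q \<subseteq> gr0 q" and null: "PP v = 0 \<Longrightarrow> v \<in> G q"
    and vac: "vac0 \<in> G 0"
    and modes: "v \<in> G q \<Longrightarrow> fA a n v \<in> G (q + (1 - of_int n))" "v \<in> G q \<Longrightarrow> fU u n v \<in> G (q + (1/2 - of_int n))"

begin

lemma spans: "hom_sums G half_ints = UNIV"
proof -
  have sub: "pm.subspace (hom_sums G half_ints)" by (rule hom_sums_subspace[OF subspace])
  note single = hom_sums_single[of G, OF pm.subspace_0[OF subspace]]
  show ?thesis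
  proof (rule generation_f[OF sub])
    show "v \<in> hom_sums G half_ints" if "PP v = 0" for v using single[OF null[OF that, of 0] half_ints_shift(3)] .
    show "vac0 \<in> hom_sums G half_ints" using single[OF vac half_ints_shift(3)] .
    fix v assume v: "v \<in> hom_sums G half_ints"
    show "fA a n v \<in> hom_sums G half_ints" for a n
      by (rule hom_sums_map[OF sub fA_lin(1) _ v]) (rule single[OF modes(1) half_ints_shift(1)])
    show "fU u n v \<in> hom_sums G half_ints" for u n
      by (rule hom_sums_map[OF sub fU_lin(1) _ v]) (rule single[OF modes(2) half_ints_shift(2)])
  qed
qed

lemma equals_gr0: "G q = gr0 q"
proof
  show "G q \<subseteq> gr0 q" by (rule sub)
  show "gr0 q \<subseteq> G q"
  proof
    fix v assume v: "v \<in> gr0 q"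
    have "v \<in> hom_sums G half_ints" using spans by blast
    then obtain Q f where f: "finite Q" "\<And>q. f q \<in> G q" "v = (\<Sum>q\<in>Q. f q)" by (rule hom_sumsE) (rule that)
    define h where "h r = (if r \<in> Q then f r else 0) - (if r = q then v else 0)" for r
    have "(\<Sum>r\<in>insert q Q. h r) = 0"
    proof -
      have "(\<Sum>r\<in>insert q Q. if r \<in> Q then f r else 0) = v"
        unfolding f(3) using f(1) by (intro sum.mono_neutral_cong_right) auto
      moreover have "(\<Sum>r\<in>insert q Q. if r = q then v else 0) = v" using f(1) by simp
      ultimately show ?thesis by (simp add: h_def sum_subtractf)
    qed
    moreover have "h r \<in> gr0 r" for r
      unfolding h_def using f(2) sub v by (intro gr0_closed(3)) (auto intro: gr0_closed)
    ultimately have "h q \<in> {v. PP v = 0}"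
      by (intro eigen_components[of "{v. PP v = 0}" "insert q Q" h q])
        (auto simp: F.P_simps f_simps f_null f(1) intro!: pm.subspaceI)
    then have "- h q \<in> G q" by (intro null) (simp add: F.P_simps)
    moreover have "(if q \<in> Q then f q else 0) \<in> G q" using f(2) pm.subspace_0[OF subspace] by auto
    ultimately have "(if q \<in> Q then f q else 0) + - h q \<in> G q" by (intro pm.subspace_add[OF subspace])
    then show "v \<in> G q" by (simp add: h_def)
  qed
qed

end

context pair_level
begin

lemma gr0_family: "mode_stable_family D \<omega> l gr0"
  by unfold_locales (auto simp: gr0_subspace gr0_null gr0_vac gr0_fA gr0_fU)

lemmas gr0_spans = mode_stable_family.spans[OF gr0_family]

definition Sp :: "bool \<Rightarrow> ('a, 'u) T_alg set" where
  "Sp p = hom_sums gr0 (range (\<lambda>n::int. of_int n + (if p then 1/2 else 0)))"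

lemma half_int_ne: "(of_int m :: rat) \<noteq> of_int n + 1/2"
proof
  assume "(of_int m :: rat) = of_int n + 1/2"
  then have "(of_int (2 * m) :: rat) = of_int (2 * n + 1)" by simp
  then have "2 * m = 2 * n + 1" by (simp only: of_int_eq_iff)
  then show False by presburger
qed

lemma Sp_disjoint0: assumes "v \<in> Sp False" "v \<in> Sp True" shows "PP v = 0"
proof -
  obtain Q f where f: "finite Q" "Q \<subseteq> range (\<lambda>n::int. of_int n)" "\<And>q. f q \<in> gr0 q" "v = (\<Sum>q\<in>Q. f q)"
    by (rule hom_sumsE[OF assms(1)[unfolded Sp_def]]) (rule that, simp_all)
  obtain R g where g: "finite R" "R \<subseteq> range (\<lambda>n::int. of_int n + 1/2)" "\<And>q. g q \<in> gr0 q" "v = (\<Sum>q\<in>R. g q)"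
    by (rule hom_sumsE[OF assms(2)[unfolded Sp_def]]) (rule that, simp_all)
  have d: "Q \<inter> R = {}" using f(2) g(2) half_int_ne by blast
  define h where "h q = (if q \<in> Q then f q else - g q)" for q
  have "(\<Sum>q\<in>Q \<union> R. h q) = (\<Sum>q\<in>Q. h q) + (\<Sum>q\<in>R. h q)" by (rule sum.union_disjoint[OF f(1) g(1) d])
  also have "(\<Sum>q\<in>Q. h q) = v" unfolding f(4) by (rule sum.cong) (auto simp: h_def)
  also have "(\<Sum>q\<in>R. h q) = - v" unfolding g(4) sum_negf[symmetric] by (rule sum.cong) (use d in \<open>auto simp: h_def\<close>)
  finally have s: "(\<Sum>q\<in>Q \<union> R. h q) = 0" by simp
  have hN: "h q \<in> {v. PP v = 0}" if "q \<in> Q \<union> R" for q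
    by (rule eigen_components[of "{v. PP v = 0}" "Q \<union> R" h q])
      (use that f g s in \<open>auto simp: F.P_simps f_simps f_null h_def intro!: pm.subspaceI gr0_closed(5)\<close>)
  have "PP (f q) = 0" if "q \<in> Q" for q using hN[of q] that by (simp add: h_def)
  then show ?thesis unfolding f(4) F.P_simps by simp
qed

lemma Sp_subspace0: "pm.subspace (Sp p)" unfolding Sp_def by (rule hom_sums_subspace[OF gr0_subspace])

lemma Sp_gr0: "v \<in> gr0 (of_int n + (if p then 1/2 else 0)) \<Longrightarrow> v \<in> Sp p"
  unfolding Sp_def by (rule hom_sums_single[OF gr0_closed(4)]) auto

definition Gen :: "bool \<Rightarrow> (int \<Rightarrow> ('a, 'u) T_alg \<Rightarrow> ('a, 'u) T_alg) set" where
  "Gen p = (if p then range fU else range fA)"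

lemma Gen_cases:
  assumes "x \<in> Gen p" "\<And>a. p = False \<Longrightarrow> x = fA a \<Longrightarrow> Q" "\<And>u. p = True \<Longrightarrow> x = fU u \<Longrightarrow> Q"
  shows Q
  using assms by (auto simp: Gen_def split: if_splits)

sublocale G: generating_fields pm_scale PP Gen vac0 "fA \<omega> 0" Sp
proof (rule generating_fields.intro[OF F.field_space_axioms], rule generating_fields_axioms.intro)
  fix p q x y n w v
  show "pm.subspace (Sp p)" by (rule Sp_subspace0)
  show "PP v = 0 \<Longrightarrow> v \<in> Sp p" using Sp_gr0[of v 0 p] gr0_null by blast
  show "v \<in> Sp False \<Longrightarrow> v \<in> Sp True \<Longrightarrow> PP v = 0" by (rule Sp_disjoint0)
  show "PP vac0 = vac0" by (rule vac0_P)
  show "vac0 \<in> Sp False" using Sp_gr0[of vac0 0 False] gr0_vac by simp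
  show "PP (fA \<omega> 0 v) = fA \<omega> 0 v" "fA \<omega> 0 (PP v) = fA \<omega> 0 v" by (simp_all add: f_simps)
  show "fA \<omega> 0 vac0 = 0" by (simp add: f_vac)
  show "x \<in> Gen p \<Longrightarrow> F.field x" by (erule Gen_cases) (simp_all add: f_field)
  show "x \<in> Gen p \<Longrightarrow> y \<in> Gen q \<Longrightarrow> F.mut_local (super_sign p q) x y"
    using f_local F.mut_local_sym[OF f_local(2)]
    by (elim Gen_cases) (auto simp: super_sign_def)
  show "x \<in> Gen p \<Longrightarrow> fA \<omega> 0 (x n w) - x n (fA \<omega> 0 w) = pm_scale (- of_int n) (x (n - 1) w)"
  proof (erule Gen_cases)
    fix a assume x: "x = fA a"
    show ?thesis unfolding x omega_commutators(1) by simp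
  next
    fix u assume x: "x = fU u"
    show ?thesis unfolding x omega_commutators(2) by simp
  qed
  show "x \<in> Gen p \<Longrightarrow> 0 \<le> n \<Longrightarrow> x n vac0 = 0" by (elim Gen_cases) (simp_all add: f_vac)
  show "x \<in> Gen p \<Longrightarrow> w \<in> Sp q \<Longrightarrow> x n w \<in> Sp (p \<noteq> q)"
  proof (erule Gen_cases)
    fix a assume w: "w \<in> Sp q" and x: "x = fA a" "p = False"
    show "x n w \<in> Sp (p \<noteq> q)" unfolding x(1)
    proof (rule hom_sums_map[OF Sp_subspace0 fA_lin(1) _ w[unfolded Sp_def]])
      fix r v assume "r \<in> range (\<lambda>n::int. of_int n + (if q then 1/2 else 0 :: rat))" and v: "v \<in> gr0 r"
      then obtain k :: int where k: "r = of_int k + (if q then 1/2 else 0)" by blast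
      show "fA a n v \<in> Sp (p \<noteq> q)"
        by (rule Sp_gr0[of _ "k + 1 - n"]) (use gr0_fA[OF v, of a n] in \<open>simp add: k x(2) algebra_simps\<close>)
    qed
  next
    fix u assume w: "w \<in> Sp q" and x: "x = fU u" "p = True"
    show "x n w \<in> Sp (p \<noteq> q)" unfolding x(1)
    proof (rule hom_sums_map[OF Sp_subspace0 fU_lin(1) _ w[unfolded Sp_def]])
      fix r v assume "r \<in> range (\<lambda>n::int. of_int n + (if q then 1/2 else 0 :: rat))" and v: "v \<in> gr0 r"
      then obtain k :: int where k: "r = of_int k + (if q then 1/2 else 0)" by blast
      show "fU u n v \<in> Sp (p \<noteq> q)"
        by (rule Sp_gr0[of _ "k + (if q then 1 else 0) - n"]) (use gr0_fU[OF v, of u n] in \<open>cases q; simp add: k x(2) algebra_simps\<close>)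
    qed
  qed
next
  show "F.lin (fA \<omega> 0)" by (rule f_simps)
next
  fix H :: "('a, 'u) T_alg set"
  assume H: "pm.subspace H" "\<And>v. PP v = 0 \<Longrightarrow> v \<in> H" "vac0 \<in> H" "\<And>p x n v. x \<in> Gen p \<Longrightarrow> v \<in> H \<Longrightarrow> x n v \<in> H"
  show "H = UNIV"
    by (rule generation_f[OF H(1-3)]) (use H(4)[of _ False] H(4)[of _ True] in \<open>auto simp: Gen_def\<close>)
qed

section \<open>Strong generation\<close>

text \<open>The vacuum and the monomials in modes of negative index, with their degrees.\<close>

inductive negw :: "rat \<Rightarrow> ('a, 'u) T_alg \<Rightarrow> bool" where
  vac: "negw 0 vac0"
| A: "negw q v \<Longrightarrow> n < 0 \<Longrightarrow> negw (q + (1 - of_int n)) (fA a n v)"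
| U: "negw q v \<Longrightarrow> n < 0 \<Longrightarrow> negw (q + (1/2 - of_int n)) (fU u n v)"

definition NW :: "rat \<Rightarrow> ('a, 'u) T_alg set" where
  "NW q = pm.span (Collect (negw q) \<union> N0)"

lemma NW_subspace: "pm.subspace (NW q)" by (simp add: NW_def)
lemmas NW_closed = pm.subspace_add[OF NW_subspace] pm.subspace_scale[OF NW_subspace] pm.subspace_diff[OF NW_subspace] pm.subspace_0[OF NW_subspace]
lemma NW_base: "negw q v \<Longrightarrow> v \<in> NW q" "v \<in> N0 \<Longrightarrow> v \<in> NW q" by (auto simp: NW_def pm.span_base)

lemma NW_map:
  assumes "v \<in> NW q" "F.lin h" "\<And>v. negw q v \<Longrightarrow> h v \<in> NW r" "\<And>v. v \<in> N0 \<Longrightarrow> h v \<in> NW r"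
  shows "h v \<in> NW r"
  using assms(1) unfolding NW_def
proof (induction rule: pm.span_induct_alt)
  case base
  then show ?case using NW_closed(4)[of r] by (simp add: F.lin_simps[OF assms(2)] flip: NW_def)
next
  case (step c x y)
  then show ?case using assms(3,4) NW_closed(1,2)
    by (auto simp: F.lin_simps[OF assms(2)] simp flip: NW_def)
qed

lemma f_N0: "v \<in> N0 \<Longrightarrow> fA a n v = 0" "v \<in> N0 \<Longrightarrow> fU u n v = 0"
  using f_null PP(3) by auto

lemma NW_neg: "v \<in> NW q \<Longrightarrow> n < 0 \<Longrightarrow> fA a n v \<in> NW (q + (1 - of_int n))" "v \<in> NW q \<Longrightarrow> n < 0 \<Longrightarrow> fU u n v \<in> NW (q + (1/2 - of_int n))"
  by (rule NW_map[OF _ f_simps(1)], auto intro: NW_base negw.intros simp: f_N0 NW_closed)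
    (rule NW_map[OF _ f_simps(2)], auto intro: NW_base negw.intros simp: f_N0 NW_closed)

lemma NW_PP: "v \<in> NW q \<Longrightarrow> PP v \<in> NW q"
proof -
  assume v: "v \<in> NW q"
  have "PP v - v \<in> NW q" using PP_eq PP(2) NW_base(2) by blast
  then show "PP v \<in> NW q" using NW_closed(1)[OF _ v] by force
qed

text \<open>A mode of arbitrary index is commuted to the right through a monomial; the commutators are shorter, and a mode of
nonnegative index finally annihilates the vacuum.\<close>

lemma negw_modes: "negw q v \<Longrightarrow> (\<forall>a n. fA a n v \<in> NW (q + (1 - of_int n))) \<and> (\<forall>u n. fU u n v \<in> NW (q + (1/2 - of_int n)))"
proof (induction rule: negw.induct)
  case vac
  have "fA a n vac0 \<in> NW (0 + (1 - of_int n))" for a n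
    using NW_neg(1)[OF NW_base(1)[OF negw.vac]] f_vac NW_closed(4) by (cases "n < 0") auto
  moreover have "fU u n vac0 \<in> NW (0 + (1/2 - of_int n))" for u n
    using NW_neg(2)[OF NW_base(1)[OF negw.vac]] f_vac NW_closed(4) by (cases "n < 0") auto
  ultimately show ?case by blast
next
  case (A q v m b)
  note IH = A(3)[THEN conjunct1, rule_format] A(3)[THEN conjunct2, rule_format]
  have "fA a n (fA b m v) \<in> NW (q + (1 - of_int m) + (1 - of_int n))" for a n
  proof -
    have "fA a n (fA b m v) = fA b m (fA a n v) + (pm_scale (of_int (n - m) / 2) (fA (a * b) (n + m - 1) v)
       + pm_scale (if n + m = 2 then l * (of_int n * (of_int n - 1) * (of_int n - 2) / 6 * formA D a b) else 0) (PP v))"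
      using f_commutators(1)[of a n b m v] by (simp add: algebra_simps)
    moreover have "fA b m (fA a n v) \<in> NW (q + (1 - of_int m) + (1 - of_int n))"
      using NW_neg(1)[OF IH(1)[of a n] A(2), of b] by (simp add: ac_simps)
    moreover have "fA (a * b) (n + m - 1) v \<in> NW (q + (1 - of_int m) + (1 - of_int n))"
      using IH(1)[of "a * b" "n + m - 1"] by (simp add: algebra_simps)
    moreover have "pm_scale (if n + m = 2 then c else 0) (PP v) \<in> NW (q + (1 - of_int m) + (1 - of_int n))" for c
    proof (cases "n + m = 2")
      case True
      have "rat_of_int (n + m) = 2" unfolding True by simp
      then have e: "q + (1 - of_int m) + (1 - of_int n) = q" by simp
      show ?thesis unfolding e using True NW_PP[OF NW_base(1)[OF A(1)]] by (simp add: NW_closed)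
    qed (simp add: NW_closed)
    ultimately show ?thesis by (simp add: NW_closed)
  qed
  moreover have "fU u n (fA b m v) \<in> NW (q + (1 - of_int m) + (1/2 - of_int n))" for u n
  proof -
    have "fU u n (fA b m v) = fA b m (fU u n v) - pm_scale (of_int (m - 2 * n) / 4) (fU (act D b u) (m + n - 1) v)"
      using f_commutators(2)[of b m u n v] by (simp add: algebra_simps)
    moreover have "fA b m (fU u n v) \<in> NW (q + (1 - of_int m) + (1/2 - of_int n))"
      using NW_neg(1)[OF IH(2)[of u n] A(2), of b] by (simp add: ac_simps)
    moreover have "fU (act D b u) (m + n - 1) v \<in> NW (q + (1 - of_int m) + (1/2 - of_int n))"
      using IH(2)[of "act D b u" "m + n - 1"] by (simp add: algebra_simps)
    ultimately show ?thesis by (simp add: NW_closed)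
  qed
  ultimately show ?case by blast
next
  case (U q v m u)
  note IH = U(3)[THEN conjunct1, rule_format] U(3)[THEN conjunct2, rule_format]
  have "fA a n (fU u m v) \<in> NW (q + (1/2 - of_int m) + (1 - of_int n))" for a n
  proof -
    have "fA a n (fU u m v) = fU u m (fA a n v) + pm_scale (of_int (n - 2 * m) / 4) (fU (act D a u) (n + m - 1) v)"
      using f_commutators(2)[of a n u m v] by (simp add: algebra_simps)
    moreover have "fU u m (fA a n v) \<in> NW (q + (1/2 - of_int m) + (1 - of_int n))"
      using NW_neg(2)[OF IH(1)[of a n] U(2), of u] by (simp add: ac_simps)
    moreover have "fU (act D a u) (n + m - 1) v \<in> NW (q + (1/2 - of_int m) + (1 - of_int n))"
      using IH(2)[of "act D a u" "n + m - 1"] by (simp add: algebra_simps)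
    ultimately show ?thesis by (simp add: NW_closed)
  qed
  moreover have "fU w n (fU u m v) \<in> NW (q + (1/2 - of_int m) + (1/2 - of_int n))" for w n
  proof -
    have "fU w n (fU u m v) = (fA (circ D w u) (n + m) v
       + pm_scale (if n + m = 1 then l * (of_int (n * (n - 1)) / 2 * formU D w u) else 0) (PP v)) - fU u m (fU w n v)"
      using f_commutators(3)[of w n u m v] by (simp add: algebra_simps)
    moreover have "fU u m (fU w n v) \<in> NW (q + (1/2 - of_int m) + (1/2 - of_int n))"
      using NW_neg(2)[OF IH(2)[of w n] U(2), of u] by (simp add: ac_simps)
    moreover have "fA (circ D w u) (n + m) v \<in> NW (q + (1/2 - of_int m) + (1/2 - of_int n))"
      using IH(1)[of "circ D w u" "n + m"] by (simp add: algebra_simps)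
    moreover have "pm_scale (if n + m = 1 then c else 0) (PP v) \<in> NW (q + (1/2 - of_int m) + (1/2 - of_int n))" for c
    proof (cases "n + m = 1")
      case True
      have "rat_of_int (n + m) = 1" unfolding True by simp
      then have e: "q + (1/2 - of_int m) + (1/2 - of_int n) = q" by simp
      show ?thesis unfolding e using True NW_PP[OF NW_base(1)[OF U(1)]] by (simp add: NW_closed)
    qed (simp add: NW_closed)
    ultimately show ?thesis by (simp add: NW_closed)
  qed
  ultimately show ?case by blast
qed

lemma negw_gr0: "negw q v \<Longrightarrow> v \<in> gr0 q"
  by (induction rule: negw.induct) (auto intro: gr0_vac gr0_fA gr0_fU)

lemma NW_family: "mode_stable_family D \<omega> l NW"
proof
  show "NW q \<subseteq> gr0 q" for q
    unfolding NW_def by (rule pm.span_minimal) (use negw_gr0 gr0_null PP(3) gr0_subspace in auto)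
  show "v \<in> NW q \<Longrightarrow> fA a n v \<in> NW (q + (1 - of_int n))" for v q a n
    by (rule NW_map[OF _ f_simps(1)]) (use negw_modes NW_closed in \<open>auto simp: f_N0\<close>)
  show "v \<in> NW q \<Longrightarrow> fU u n v \<in> NW (q + (1/2 - of_int n))" for v q u n
    by (rule NW_map[OF _ f_simps(2)]) (use negw_modes NW_closed in \<open>auto simp: f_N0\<close>)
qed (auto simp: NW_subspace PP(3) intro: NW_base negw.vac)

lemmas NW_gr0 = mode_stable_family.equals_gr0[OF NW_family]

text \<open>A mode of negative index has degree at least \<open>3/2\<close>, so that two of them already exceed degree two.\<close>

lemma negw_low_degree:
  "negw q v \<Longrightarrow> q = 0 \<and> v = vac0 \<or> q = 2 \<and> (\<exists>a. v = fA a (-1) vac0) \<or> q = 3/2 \<and> (\<exists>u. v = fU u (-1) vac0) \<or> q > 2"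
proof (induction rule: negw.induct)
  case (A q v n a)
  have n: "rat_of_int n \<le> -1" using A(2) by linarith
  show ?case
  proof (cases "q = 0 \<and> n = -1")
    case False
    then have "n < -1 \<or> q > 0" using A(2,3) by auto
    then have "q + (1 - rat_of_int n) > 2"
    proof
      assume "n < -1"
      then have "rat_of_int n \<le> -2" by linarith
      then show ?thesis using A(3) by auto
    qed (use n in linarith)
    then show ?thesis by blast
  qed (use A(3) in auto)
next
  case (U q v n u)
  have n: "rat_of_int n \<le> -1" using U(2) by linarith
  show ?case
  proof (cases "q = 0 \<and> n = -1")
    case False
    then have "n < -1 \<or> q \<ge> 3/2" using U(2,3) by auto
    then have "q + (1/2 - rat_of_int n) > 2"
    proof
      assume "n < -1"
      then have "rat_of_int n \<le> -2" by linarith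
      then show ?thesis using U(3) by auto
    qed (use n in linarith)
    then show ?thesis by blast
  qed (use U(3) in auto)
qed simp

end

context pair_level
begin

section \<open>The largest proper submodule\<close>

text \<open>The radical of the bilinear form \<open>(f, v) \<mapsto> sigma(f v)\<close>.\<close>

definition J0 :: "('a, 'u) T_alg set" where "J0 = {v. \<forall>f. sigF l (f * v) = 0}"

lemma J0_subspace: "pm.subspace J0"
  by (rule pm.subspaceI) (simp_all add: J0_def distrib_left sigF_simps pm_scale_mult sigF_zero)

lemma N0_left: "v \<in> N0 \<Longrightarrow> f * v \<in> N0"
proof (induction f rule: word_induct)
  case (3 xs)
  then show ?case by (induction xs) (simp_all add: wd_simps N0_gen mult.assoc flip: wd_simps(2))
qed (simp_all add: distrib_right pm_scale_mult pm.subspace_add[OF N0_subspace] pm.subspace_scale[OF N0_subspace])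

lemma N0_J0: "v \<in> N0 \<Longrightarrow> v \<in> J0"
  by (simp add: J0_def N0_left N0_sigma)

lemma J0_null: "PP v = 0 \<Longrightarrow> v \<in> J0" using N0_J0 PP(3) by blast

lemma J0_X: "v \<in> J0 \<Longrightarrow> X x v \<in> J0"
proof -
  assume "v \<in> J0"
  then have 1: "gen x * v \<in> J0" by (simp add: J0_def flip: mult.assoc)
  have "X x v - gen x * v \<in> J0" by (rule J0_null) (simp add: X_def F.P_simps PP(2))
  then show ?thesis using pm.subspace_add[OF J0_subspace 1] by force
qed

lemma J0_f: "v \<in> J0 \<Longrightarrow> fA a n v \<in> J0" "v \<in> J0 \<Longrightarrow> fU u n v \<in> J0"
  by (simp_all add: fA_def fU_def J0_X)

lemma sigF_PP: "sigF l (PP v) = sigF l v"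
proof -
  have "PP v - v \<in> N0" using PP_eq PP(2) by blast
  from N0_sigma[OF this] show ?thesis by (simp add: sigF_simps)
qed

lemma sigF_X: "sigF l (X x v) = sigF l (gen x * v)" by (simp add: X_def sigF_PP)

lemma sigF_one: "sigF l 1 = 1" using sigF_simps(4)[of l "[]"] LS.sigma_Nil by (simp add: wd_simps)

lemma sigF_vac0: "sigF l vac0 = 1" by (simp add: vac0_def sigF_PP sigF_one)

lemma sigF_neg: "loop_pos x = 0 \<Longrightarrow> sigF l (X x v) = 0"
  unfolding sigF_X
  by (induction v rule: word_induct) (simp_all add: distrib_left sigF_simps pm_scale_mult wd_simps LS.sigma_neg)

lemma sigF_f_neg: "n < 0 \<Longrightarrow> sigF l (fA a n v) = 0" "n < 0 \<Longrightarrow> sigF l (fU u n v) = 0"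
  by (simp_all add: fA_def fU_def sigF_neg loop_pos_simps)

lemma vac0_J0: "vac0 \<notin> J0"
proof
  assume "vac0 \<in> J0"
  then have "sigF l (1 * vac0) = 0" unfolding J0_def by blast
  then show False by (simp add: sigF_vac0)
qed

lemma sigF_gr0: assumes "v \<in> gr0 q" "q \<noteq> 0" shows "sigF l v = 0"
proof -
  have *: "sigF l w = 0" if "negw q w" for w
    using that assms(2) by cases (auto simp: sigF_f_neg)
  have "v \<in> pm.span (Collect (negw q) \<union> N0)" using assms(1) NW_gr0 by (simp add: NW_def)
  then show ?thesis
    by (induction rule: pm.span_induct_alt) (auto simp: sigF_zero sigF_simps * N0_sigma)
qed

lemma gr0_zero_degree: assumes "v \<in> gr0 0" shows "\<exists>c. v - pm_scale c vac0 \<in> N0"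
proof -
  have "v \<in> pm.span (Collect (negw 0) \<union> N0)" using assms NW_gr0 by (simp add: NW_def)
  then show ?thesis
  proof (induction rule: pm.span_induct_alt)
    case base
    show ?case by (rule exI[of _ 0]) (simp add: pm.subspace_0[OF N0_subspace])
  next
    case (step c x y)
    then obtain d where d: "y - pm_scale d vac0 \<in> N0" by blast
    have "\<exists>e. x - pm_scale e vac0 \<in> N0"
    proof (cases "x \<in> N0")
      case True
      then show ?thesis by (intro exI[of _ 0]) simp
    next
      case False
      then have "x = vac0" using step(1) negw_low_degree[of 0 x] by auto
      then show ?thesis by (intro exI[of _ 1]) (simp add: pm.subspace_0[OF N0_subspace])
    qed
    then obtain e where e: "x - pm_scale e vac0 \<in> N0" by blast
    have "pm_scale c (x - pm_scale e vac0) + (y - pm_scale d vac0) \<in> N0"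
      using e d N0_subspace pm.subspace_add pm.subspace_scale by blast
    then show ?case by (intro exI[of _ "c * e + d"]) (simp add: pm.scale_right_diff_distrib pm.scale_left_distrib algebra_simps)
  qed
qed

lemma gr0_single_degree:
  assumes "\<And>v. negw q v \<Longrightarrow> \<exists>a. v = h a" "q \<noteq> 0" and lin: "\<And>a b. h (a + b) = h a + h b" "\<And>c a. h (s c a) = pm_scale c (h a)" "h 0 = 0"
    and "v \<in> gr0 q"
  shows "\<exists>a. v - h a \<in> N0"
proof -
  have "v \<in> pm.span (Collect (negw q) \<union> N0)" using assms NW_gr0 by (simp add: NW_def)
  then show ?thesis
  proof (induction rule: pm.span_induct_alt)
    case base
    show ?case by (rule exI[of _ 0]) (simp add: pm.subspace_0[OF N0_subspace] lin)
  next
    case (step c x y)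
    then obtain d where d: "y - h d \<in> N0" by blast
    have "\<exists>e. x - h e \<in> N0"
    proof (cases "x \<in> N0")
      case True
      then show ?thesis by (intro exI[of _ 0]) (simp add: lin)
    next
      case False
      then obtain a where "x = h a" using step(1) assms(1) by blast
      then show ?thesis by (intro exI[of _ a]) (simp add: pm.subspace_0[OF N0_subspace])
    qed
    then obtain e where e: "x - h e \<in> N0" by blast
    have "pm_scale c (x - h e) + (y - h d) \<in> N0"
      using e d N0_subspace pm.subspace_add pm.subspace_scale by blast
    then show ?case by (intro exI[of _ "s c e + d"]) (simp add: pm.scale_right_diff_distrib lin algebra_simps)
  qed
qed

lemma gr0_two: "v \<in> gr0 2 \<Longrightarrow> \<exists>a. v - fA a (-1) vac0 \<in> N0"
proof (rule gr0_single_degree[where s = "scA D"])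
  show "\<And>v. negw 2 v \<Longrightarrow> \<exists>a. v = fA a (-1) vac0" using negw_low_degree[of 2] by auto
qed (simp_all add: fA_def X_add X_am_scale X_zero am_um_cen_add(4) flip: am_um_cen_add(1))

lemma gr0_three_halves: "v \<in> gr0 (3/2) \<Longrightarrow> \<exists>u. v - fU u (-1) vac0 \<in> N0"
proof (rule gr0_single_degree[where s = "scU D"])
  show "\<And>v. negw (3/2) v \<Longrightarrow> \<exists>u. v = fU u (-1) vac0" using negw_low_degree[of "3/2"] by auto
qed (simp_all add: fU_def X_add X_um_scale X_zero am_um_cen_add(5) flip: am_um_cen_add(2))

lemma gr0_low: assumes "q < 0" "v \<in> gr0 q" shows "v \<in> N0"
proof -
  have e: "Collect (negw q) = {}" using negw_low_degree[of q] assms(1) by auto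
  have "v \<in> pm.span N0" using assms(2) unfolding NW_gr0[of q, symmetric] NW_def e by simp
  then show ?thesis using N0_subspace pm.span_eq_iff by blast
qed

text \<open>Submodules of the induced module, by their sets of representatives.\<close>

definition mode_submodule :: "('a, 'u) T_alg set \<Rightarrow> bool" where
  "mode_submodule H \<longleftrightarrow> pm.subspace H \<and> N0 \<subseteq> H \<and> (\<forall>v\<in>H. (\<forall>a n. fA a n v \<in> H) \<and> (\<forall>u n. fU u n v \<in> H))"

lemma mode_submoduleD:
  assumes "mode_submodule H"
  shows "pm.subspace H" "PP v = 0 \<Longrightarrow> v \<in> H" "v \<in> H \<Longrightarrow> fA a n v \<in> H" "v \<in> H \<Longrightarrow> fU u n v \<in> H"
    "PP v \<in> H \<longleftrightarrow> v \<in> H" "v \<in> H \<Longrightarrow> X x v \<in> H" "v \<in> H \<Longrightarrow> wd xs * v \<in> H"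
proof -
  show s: "pm.subspace H" and n: "PP v = 0 \<Longrightarrow> v \<in> H" and "v \<in> H \<Longrightarrow> fA a n v \<in> H" "v \<in> H \<Longrightarrow> fU u n v \<in> H" for v
    using assms PP(3) unfolding mode_submodule_def by auto
  have "PP v - v \<in> H" "v - PP v \<in> H" for v by (rule n, simp add: F.P_simps PP(2))+
  then show P: "PP v \<in> H \<longleftrightarrow> v \<in> H" for v
    using pm.subspace_add[OF s, of "PP v - v" v] pm.subspace_add[OF s, of "v - PP v" "PP v"] by auto
  show X: "X x v \<in> H" if "v \<in> H" for x v
  proof (induction x rule: loop_induct)
    case (1 x y)
    then show ?case unfolding X_add by (rule pm.subspace_add[OF s])
  next
    case (4 k)
    then show ?case unfolding X_cen by (rule pm.subspace_scale[OF s]) (simp add: P that)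
  qed (use assms that in \<open>auto simp: mode_submodule_def fA_def fU_def\<close>)
  show "v \<in> H \<Longrightarrow> wd xs * v \<in> H"
  proof (induction xs)
    case (Cons x xs)
    then have "PP (gen x * (wd xs * v)) \<in> H" using X[of "wd xs * v" x] unfolding X_def by blast
    then show ?case by (simp add: P mult.assoc flip: wd_simps(2))
  qed (simp add: wd_simps)
qed

lemma J0_mode_submodule: "mode_submodule J0"
  unfolding mode_submodule_def using J0_subspace N0_J0 J0_f by blast

lemma mode_submodule_components:
  assumes "mode_submodule H" "finite Q" "\<And>q. q \<in> Q \<Longrightarrow> f q \<in> gr0 q" "(\<Sum>q\<in>Q. f q) \<in> H" "q \<in> Q"
  shows "f q \<in> H"
  by (rule eigen_components[of H Q f q]) (use assms mode_submoduleD[OF assms(1)] in auto)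

text \<open>Only the component of degree zero, a multiple of the vacuum, can have a nonzero value under the functional; if the
vacuum is not in the submodule, this component is zero.  The same holds for all \<open>f v\<close>.\<close>

lemma proper_mode_submodule: assumes H: "mode_submodule H" and "vac0 \<notin> H" shows "H \<subseteq> J0"
proof -
  note Hd = mode_submoduleD[OF H]
  have s: "sigF l v = 0" if v: "v \<in> H" for v
  proof -
    have "v \<in> hom_sums gr0 half_ints" using gr0_spans by blast
    then obtain Q f where f: "finite Q" "\<And>q. f q \<in> gr0 q" "v = (\<Sum>q\<in>Q. f q)" by (rule hom_sumsE) (rule that)
    have "sigF l (f q) = 0" if "q \<in> Q" for q
    proof (cases "q = 0")
      case True
      have "f 0 \<in> H" using mode_submodule_components[OF H f(1), of f q] f v that True by blast
      obtain c where c: "f 0 - pm_scale c vac0 \<in> N0" using gr0_zero_degree f(2) by blast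
      have "f 0 - (f 0 - pm_scale c vac0) \<in> H"
        by (rule pm.subspace_diff[OF Hd(1) \<open>f 0 \<in> H\<close>]) (use c PP(3) Hd(2) in blast)
      then have "pm_scale c vac0 \<in> H" by simp
      then have "pm_scale (inverse c) (pm_scale c vac0) \<in> H" by (rule pm.subspace_scale[OF Hd(1)])
      then have "c = 0" using assms(2) by (cases "c = 0") auto
      then show ?thesis using N0_sigma[OF c] True by simp
    qed (use sigF_gr0 f(2) in blast)
    then have "(\<Sum>q\<in>Q. sigF l (f q)) = 0" by simp
    moreover have "sigF l (\<Sum>q\<in>Q. f q) = (\<Sum>q\<in>Q. sigF l (f q))"
      by (induction Q rule: infinite_finite_induct) (simp_all add: sigF_zero sigF_simps)
    ultimately show ?thesis using f(3) by simp
  qed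
  show ?thesis
  proof
    fix v assume v: "v \<in> H"
    have "sigF l (f * v) = 0" for f
      by (induction f rule: word_induct) (simp_all add: distrib_right pm_scale_mult sigF_simps s Hd(7)[OF v])
    then show "v \<in> J0" by (simp add: J0_def)
  qed
qed

section \<open>Submodules are ideals\<close>

lemma Gen_f: "fA a \<in> Gen False" "fU u \<in> Gen True" by (auto simp: Gen_def)

lemma Y_f: "G.Y (fA a (-1) vac0) = fA a" "G.Y (fU u (-1) vac0) = fU u"
  using G.Y_generator[OF Gen_f(1)] G.Y_generator[OF Gen_f(2)] by auto

lemma hsum_mem:
  assumes "pm.subspace H" "\<And>a b. Z a b \<in> H"
  shows "F.hsum Z m k q \<in> H"
  unfolding F.hsum_def Sum_any.expand_set
  by (intro pm.subspace_sum[OF assms(1)] pm.subspace_scale[OF assms(1)] assms(2))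

lemma bor_mem:
  assumes "pm.subspace H" "\<And>a b. \<phi> a (\<chi> b w) \<in> H" "\<And>a b. \<chi> a (\<phi> b w) \<in> H"
  shows "F.bor s \<phi> \<chi> m k q w \<in> H"
  unfolding F.bor_def by (intro pm.subspace_diff[OF assms(1)] pm.subspace_scale[OF assms(1)] hsum_mem assms)

lemma gen_homogeneous: "x \<in> Gen p \<Longrightarrow> x n vac0 \<in> Sp p" using G.good_state_Sp[OF G.good_Gen] .

text \<open>Words in the generators have a parity, so in an induction over the generation from the vacuum one may assume that
the vector is homogeneous, as the Jacobi identity requires.\<close>

lemma homogeneous_induct:
  assumes "\<And>v. PP v = 0 \<Longrightarrow> Q v" "Q vac0" "\<And>u v. Q u \<Longrightarrow> Q v \<Longrightarrow> Q (u + v)" "\<And>c v. Q v \<Longrightarrow> Q (pm_scale c v)"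
    "\<And>p q x n v. x \<in> Gen p \<Longrightarrow> v \<in> Sp q \<Longrightarrow> Q v \<Longrightarrow> Q (x n v)"
  shows "Q v"
proof -
  (* The claim is carried through the generation for both parities at once. *)
  let ?H = "{v. \<exists>a b. a \<in> Sp False \<and> b \<in> Sp True \<and> Q a \<and> Q b \<and> v = a + b}"
  note S = G.Sp_closed G.Sp_zero
  have Q0: "Q 0" by (rule assms(1)) (simp add: F.P_simps)
  have "?H = UNIV"
  proof (rule G.generation)
    show "pm.subspace ?H"
    proof (rule pm.subspaceI)
      show "0 \<in> ?H" using S(4) Q0 by force
      fix x y assume "x \<in> ?H" "y \<in> ?H"
      then obtain a b a' b' where ab: "a \<in> Sp False" "b \<in> Sp True" "Q a" "Q b" "x = a + b" "a' \<in> Sp False" "b' \<in> Sp True" "Q a'" "Q b'" "y = a' + b'" by blast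
      have "x + y = (a + a') + (b + b')" using ab by (simp add: ac_simps)
      moreover have "a + a' \<in> Sp False" "b + b' \<in> Sp True" by (rule G.Sp_closed(1); fact ab)+
      moreover have "Q (a + a')" "Q (b + b')" by (rule assms(3); fact ab)+
      ultimately show "x + y \<in> ?H" by blast
    next
      fix c x assume "x \<in> ?H"
      then obtain a b where ab: "a \<in> Sp False" "b \<in> Sp True" "Q a" "Q b" "x = a + b" by blast
      have "pm_scale c a \<in> Sp False" "pm_scale c b \<in> Sp True" by (rule G.Sp_closed(2); fact ab)+
      moreover have "Q (pm_scale c a)" "Q (pm_scale c b)" by (rule assms(4); fact ab)+
      moreover have "pm_scale c x = pm_scale c a + pm_scale c b" unfolding ab(5) by (rule pm.scale_right_distrib)
      ultimately show "pm_scale c x \<in> ?H" by blast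
    qed
    show "v \<in> ?H" if "PP v = 0" for v using G.Sp_null[OF that] assms(1)[OF that] S(4) Q0 by force
    show "vac0 \<in> ?H" using G.vac_Sp assms(2) S(4) Q0 by force
    fix p x n v assume x: "x \<in> Gen p" and "v \<in> ?H"
    then obtain a b where ab: "a \<in> Sp False" "b \<in> Sp True" "Q a" "Q b" "v = a + b" by blast
    have Qx: "Q (x n a)" "Q (x n b)" using assms(5)[OF x] ab by blast+
    have P: "x n a \<in> Sp (p \<noteq> False)" "x n b \<in> Sp (p \<noteq> True)" using G.Gen_parity[OF x] ab(1,2) by blast+
    have e: "x n v = x n a + x n b" unfolding ab(5) by (rule F.lin_simps(1)[OF F.fieldD(1)[OF G.Gen_field[OF x]]])
    show "x n v \<in> ?H"
    proof (cases p)
      case True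
      then have "x n v = x n b + x n a" "x n b \<in> Sp False" "x n a \<in> Sp True" using P e by (simp_all add: add.commute)
      then show ?thesis using Qx by blast
    next
      case False
      then show ?thesis using P e Qx by auto
    qed
  qed
  then obtain a b where "Q a" "Q b" "v = a + b" by blast
  then show ?thesis using assms(3) by blast
qed

lemma mode_submodule_gen: "mode_submodule H \<Longrightarrow> x \<in> Gen p \<Longrightarrow> v \<in> H \<Longrightarrow> x n v \<in> H"
  by (erule Gen_cases) (auto dest: mode_submoduleD)

text \<open>The modes of \<open>Y(x\<^sub>n v)\<close> are built from the modes of \<open>x\<close> and of \<open>v\<close>.\<close>

lemma mode_submodule_Y_left:
  assumes H: "mode_submodule H" and w: "w \<in> H"
  shows "G.Y v n w \<in> H"
proof -
  note Hd = mode_submoduleD[OF H]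
  have "\<forall>n. \<forall>w\<in>H. G.Y v n w \<in> H"
  proof (induction v rule: homogeneous_induct)
    case (1 v)
    then show ?case using pm.subspace_0[OF Hd(1)] by (simp add: G.Y_null)
  next
    case 2
    then show ?case using pm.subspace_0[OF Hd(1)] Hd(5) by (simp add: G.Y_vac_left)
  next
    case (5 p q x k v)
    have e: "G.Y (x k v) = F.nprod (super_sign p q) x k (G.Y v)"
    proof -
      have "G.Y (G.Y (x (-1) vac0) k v) = F.nprod (super_sign p q) (G.Y (x (-1) vac0)) k (G.Y v)"
        by (rule G.Y_nprod[OF gen_homogeneous[OF 5(1)] 5(2)])
      then show ?thesis by (simp only: G.Y_generator[OF 5(1)])
    qed
    show ?case unfolding e F.nprod_def
      using 5(3) mode_submodule_gen[OF H 5(1)] by (intro allI ballI bor_mem[OF Hd(1)]) blast+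
  qed (use pm.subspace_add[OF Hd(1)] pm.subspace_scale[OF Hd(1)] in \<open>auto simp: G.Y_add_left G.Y_scale_left\<close>)
  then show ?thesis using w by blast
qed

lemma homogeneous_split:
  assumes H: "mode_submodule H" "w \<in> H"
  shows "\<exists>a b. a \<in> Sp False \<and> b \<in> Sp True \<and> a \<in> H \<and> b \<in> H \<and> w = a + b"
proof -
  note Hd = mode_submoduleD[OF H(1)]
  have "w \<in> hom_sums gr0 half_ints" using gr0_spans by blast
  then obtain Q f where f: "finite Q" "Q \<subseteq> half_ints" "\<And>q. f q \<in> gr0 q" "w = (\<Sum>q\<in>Q. f q)" by (rule hom_sumsE) (rule that)
  have fH: "f q \<in> H" if "q \<in> Q" for q
    using mode_submodule_components[OF H(1) f(1), of f q] f(3,4) H(2) that by blast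
  let ?E = "{q \<in> Q. q \<in> \<int>}" and ?O = "{q \<in> Q. q \<notin> \<int>}"
  have "w = sum f ?E + sum f ?O" unfolding f(4) using f(1) by (subst sum.union_disjoint[symmetric]) (auto intro!: sum.cong)
  moreover have "sum f ?E \<in> Sp False"
  proof (rule pm.subspace_sum[OF Sp_subspace0])
    fix q assume "q \<in> ?E"
    then obtain n where "q = of_int n" by (auto elim: Ints_cases)
    then show "f q \<in> Sp False" using Sp_gr0[of "f q" n False] f(3)[of q] by simp
  qed
  moreover have "sum f ?O \<in> Sp True"
  proof (rule pm.subspace_sum[OF Sp_subspace0])
    fix q assume q: "q \<in> ?O"
    then obtain n where n: "2 * q = of_int n" using f(2) by (auto simp: half_ints_def elim: Ints_cases)
    have "odd n"
    proof
      assume "even n"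
      then obtain m where "n = 2 * m" by blast
      then have "q = of_int m" using n by simp
      then show False using q by auto
    qed
    then obtain m where "n = 2 * m + 1" by (elim oddE)
    then have "q = of_int m + 1/2" using n by simp
    then show "f q \<in> Sp True" using Sp_gr0[of "f q" m True] f(3)[of q] by simp
  qed
  moreover have "sum f ?E \<in> H" "sum f ?O \<in> H" by (rule pm.subspace_sum[OF Hd(1)]; use fH in auto)+
  ultimately show ?thesis by blast
qed

text \<open>On the vacuum, the modes \<open>w\<^sub>n 1\<close> are obtained from \<open>w\<close> by translation.  Further, \<open>x\<^sub>k w\<^sub>n v\<close> and \<open>w\<^sub>n x\<^sub>k v\<close> differ by
modes of the elements \<open>x\<^sub>i w\<close> of the submodule applied to \<open>v\<close>.\<close>

lemma mode_submodule_Y_right: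
  assumes H: "mode_submodule H" and w: "w \<in> H"
  shows "G.Y w n v \<in> H"
proof -
  note Hd = mode_submoduleD[OF H]
  have "\<forall>n r. \<forall>w\<in>H \<inter> Sp r. G.Y w n v \<in> H"
  proof (induction v rule: homogeneous_induct)
    case (1 v)
    have "G.Y w n v = 0" for w n
      unfolding G.Y_P(2)[of w n v, symmetric] 1 by (rule F.lin_simps(4)[OF G.Y_linear_right])
    then show ?case using pm.subspace_0[OF Hd(1)] by simp
  next
    case 2
    show ?case
    proof (intro allI ballI)
      fix n r w assume w: "w \<in> H \<inter> Sp r"
      show "G.Y w n vac0 \<in> H"
      proof (induction n rule: int_downward_induct[where B = "-1"])
        case (bound n)
        then show ?case using w Hd(5) pm.subspace_0[OF Hd(1)] by (cases "n = -1") (auto simp: G.Y_creation G.Y_annihilation)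
      next
        case (step n)
        show ?case
        proof (cases "n \<ge> -1")
          case True
          then show ?thesis using w Hd(5) pm.subspace_0[OF Hd(1)] by (cases "n = -1") (auto simp: G.Y_creation G.Y_annihilation)
        next
          case False
          have nz: "- complex_of_int (n + 1) \<noteq> 0"
          proof -
            have "n + 1 \<noteq> 0" using False by linarith
            then show ?thesis by (simp only: neg_equal_0_iff_equal of_int_eq_0_iff not_False_eq_True)
          qed
          have "fA \<omega> 0 (G.Y w (n + 1) vac0) = pm_scale (- of_int (n + 1)) (G.Y w n vac0)"
            using G.Y_T[of w "n + 1" vac0] by (simp add: G.T_vac F.lin_simps[OF G.Y_linear_right])
          moreover have "fA \<omega> 0 (G.Y w (n + 1) vac0) \<in> H" using step[of "n + 1"] Hd(3) by simp
          ultimately have "pm_scale (- of_int (n + 1)) (G.Y w n vac0) \<in> H" by simp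
          then have "pm_scale (inverse (- of_int (n + 1))) (pm_scale (- of_int (n + 1)) (G.Y w n vac0)) \<in> H" by (rule pm.subspace_scale[OF Hd(1)])
          then show ?thesis unfolding pm.scale_scale left_inverse[OF nz] pm.scale_one .
        qed
      qed
    qed
  next
    case (5 p q x k v)
    show ?case
    proof (intro allI ballI)
      fix n r w assume w: "w \<in> H \<inter> Sp r"
      let ?s = "super_sign p r"
      have xs: "G.Y (x (-1) vac0) = x" by (rule G.Y_generator[OF 5(1)])
      have wS: "w \<in> Sp r" using w by blast
      have J: "Sum_any (\<lambda>i. pm_scale ((-1) ^ i * (of_int 0 gchoose i)) (x (0 + k - int i) (G.Y w (n + int i) v)
         - pm_scale (?s * (-1) powi 0) (G.Y w (0 + n - int i) (x (k + int i) v))))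
       = Sum_any (\<lambda>i. pm_scale (of_int k gchoose i) (G.Y (x (0 + int i) w) (n + k - int i) v))"
        using G.Y_jacobi[OF gen_homogeneous[OF 5(1), of "-1"] wS, of 0 k n v] unfolding xs .
      have L: "Sum_any (\<lambda>i. pm_scale ((-1) ^ i * (of_int 0 gchoose i)) (x (0 + k - int i) (G.Y w (n + int i) v)
         - pm_scale (?s * (-1) powi 0) (G.Y w (0 + n - int i) (x (k + int i) v)))) = x k (G.Y w n v) - pm_scale ?s (G.Y w n (x k v))"
        by (subst Sum_any_eq_sum[where N = 1]) (auto simp: gbinomial_0_left)
      have R: "Sum_any (\<lambda>i. pm_scale (of_int k gchoose i) (G.Y (x (0 + int i) w) (n + k - int i) v)) \<in> H"
        unfolding Sum_any.expand_set
      proof (intro pm.subspace_sum[OF Hd(1)] pm.subspace_scale[OF Hd(1)])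
        fix i
        have "x (0 + int i) w \<in> H \<inter> Sp (p \<noteq> r)" using w mode_submodule_gen[OF H 5(1)] G.Gen_parity[OF 5(1)] by blast
        then show "G.Y (x (0 + int i) w) (n + k - int i) v \<in> H" using 5(3) by blast
      qed
      have "G.Y w n v \<in> H" using 5(3) w by blast
      then have "x k (G.Y w n v) \<in> H" by (rule mode_submodule_gen[OF H 5(1)])
      moreover have "x k (G.Y w n v) - pm_scale ?s (G.Y w n (x k v)) \<in> H" using R unfolding J[symmetric] L .
      ultimately have "x k (G.Y w n v) - (x k (G.Y w n v) - pm_scale ?s (G.Y w n (x k v))) \<in> H"
        by (rule pm.subspace_diff[OF Hd(1)])
      then have "pm_scale ?s (G.Y w n (x k v)) \<in> H" by simp
      from pm.subspace_scale[OF Hd(1) this, of ?s]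
      have "pm_scale (?s * ?s) (G.Y w n (x k v)) \<in> H" by (simp del: super_sign_simps)
      moreover have "?s * ?s = 1" by (simp add: super_sign_def)
      ultimately show "G.Y w n (x k v) \<in> H" by simp
    qed
  next
    case (3 u v)
    show ?case
    proof (intro allI ballI)
      fix n r w assume "w \<in> H \<inter> Sp r"
      then have "G.Y w n u \<in> H" "G.Y w n v \<in> H" using 3 by blast+
      then have "G.Y w n u + G.Y w n v \<in> H" by (rule pm.subspace_add[OF Hd(1)])
      then show "G.Y w n (u + v) \<in> H" by (simp only: F.lin_simps[OF G.Y_linear_right])
    qed
  next
    case (4 c v)
    show ?case
    proof (intro allI ballI)
      fix n r w assume "w \<in> H \<inter> Sp r"
      then have "G.Y w n v \<in> H" using 4 by blast
      then have "pm_scale c (G.Y w n v) \<in> H" by (rule pm.subspace_scale[OF Hd(1)])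
      then show "G.Y w n (pm_scale c v) \<in> H" by (simp only: F.lin_simps[OF G.Y_linear_right])
    qed
  qed
  moreover obtain a b where "a \<in> Sp False" "b \<in> Sp True" "a \<in> H" "b \<in> H" "w = a + b" using homogeneous_split[OF H w] by blast
  ultimately have "G.Y a n v \<in> H" "G.Y b n v \<in> H" "G.Y w n v = G.Y a n v + G.Y b n v" by (blast, blast, simp only: G.Y_add_left)
  then show ?thesis using pm.subspace_add[OF Hd(1)] by simp
qed

section \<open>The form on states of low degree\<close>

text \<open>Of the central term of \<open>[b(3), a(-1)]\<close>, the binomial coefficient is one.\<close>

lemma pairing_A: "sigF l (fA b 3 (fA a (-1) vac0)) = l * formA D b a"
proof -
  have "fA b 3 (fA a (-1) vac0) = pm_scale (l * formA D b a) vac0"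
    using f_commutators(1)[of b 3 a "-1" vac0] by (simp add: f_vac fA_lin vac0_P)
  then show ?thesis by (simp add: sigF_simps sigF_vac0)
qed

lemma pairing_U: "sigF l (fU v 2 (fU u (-1) vac0)) = l * formU D v u"
proof -
  have "fU v 2 (fU u (-1) vac0) = pm_scale (l * formU D v u) vac0"
    using f_commutators(3)[of v 2 u "-1" vac0] by (simp add: f_vac fU_lin vac0_P)
  then show ?thesis by (simp add: sigF_simps sigF_vac0)
qed

lemma J0_A: assumes "l \<noteq> 0" "nondegenerate (formA D)" "fA a (-1) vac0 \<in> J0" shows "a = 0"
proof -
  have "formA D a b = 0" for b
  proof -
    have "fA b 3 (fA a (-1) vac0) \<in> J0" using J0_f assms(3) by blast
    then have "sigF l (1 * fA b 3 (fA a (-1) vac0)) = 0" unfolding J0_def by blast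
    then show ?thesis using assms(1) pairing_A[of b a] by (simp add: formA_sym[of a b])
  qed
  then show ?thesis using assms(2) unfolding nondegenerate_def by blast
qed

lemma J0_U: assumes "l \<noteq> 0" "nondegenerate (formU D)" "fU u (-1) vac0 \<in> J0" shows "u = 0"
proof -
  have "formU D u v = 0" for v
  proof -
    have "fU v 2 (fU u (-1) vac0) \<in> J0" using J0_f assms(3) by blast
    then have "sigF l (1 * fU v 2 (fU u (-1) vac0)) = 0" unfolding J0_def by blast
    then show ?thesis using assms(1) pairing_U[of v u] by (simp add: formU_sym[of u v])
  qed
  then show ?thesis using assms(2) unfolding nondegenerate_def by blast
qed

end

section \<open>Vertex superalgebra structure on quotients\<close>

text \<open>A quotient of the induced module, presented by its covering \<open>\<alpha>\<close> from the free algebra; \<open>K\<close> is the set of the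
representatives of zero.\<close>

locale vsa_quotient = pair_level D \<omega> l + M: cspace M
  for D :: "('a::comm_ring, 'u::ab_group_add) pair_data" and \<omega> :: 'a and l :: complex and M :: "(complex, 'v) module" +
  fixes \<alpha> :: "('a, 'u) T_alg \<Rightarrow> 'v" and K :: "('a, 'u) T_alg set" and YM :: "'v \<Rightarrow> int \<Rightarrow> 'v \<Rightarrow> 'v"
    and gr :: "rat \<Rightarrow> 'v set"
  assumes \<alpha>_add: "\<alpha> (f + g) = \<alpha> f \<oplus>\<^bsub>M\<^esub> \<alpha> g"
    and \<alpha>_scale: "\<alpha> (pm_scale c f) = c \<odot>\<^bsub>M\<^esub> \<alpha> f"
    and \<alpha>_surj: "carrier M = range \<alpha>"
    and K: "mode_submodule K"
    and ker: "\<alpha> v = \<zero>\<^bsub>M\<^esub> \<longleftrightarrow> v \<in> K"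
    and YM: "YM (\<alpha> v) n (\<alpha> w) = \<alpha> (G.Y v n w)"
    and gr: "q \<in> half_ints \<Longrightarrow> gr q = \<alpha> ` gr0 q"
begin

lemmas Kd = mode_submoduleD[OF K]

lemma \<alpha>_carrier: "\<alpha> f \<in> carrier M" using \<alpha>_surj by blast

lemma \<alpha>_zero: "\<alpha> 0 = \<zero>\<^bsub>M\<^esub>" using ker pm.subspace_0[OF Kd(1)] by blast

lemma \<alpha>_minus: "\<alpha> (f - g) = \<alpha> f \<ominus>\<^bsub>M\<^esub> \<alpha> g"
proof -
  have "\<alpha> (f - g) = \<alpha> (f + pm_scale (-1) g)" by simp
  also have "\<dots> = \<alpha> f \<oplus>\<^bsub>M\<^esub> (-1) \<odot>\<^bsub>M\<^esub> \<alpha> g" unfolding \<alpha>_add \<alpha>_scale ..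
  finally show ?thesis by (simp add: M.minus_eq M.neg_eq[OF \<alpha>_carrier])
qed

lemma \<alpha>_eq: "\<alpha> f = \<alpha> g \<longleftrightarrow> f - g \<in> K"
proof -
  have "\<alpha> f = \<alpha> (f - g) \<oplus>\<^bsub>M\<^esub> \<alpha> g" by (simp flip: \<alpha>_add)
  then show ?thesis using \<alpha>_carrier M.M.add.r_cancel_one' ker by metis
qed

lemma \<alpha>_PP: "\<alpha> (PP v) = \<alpha> v"
  unfolding \<alpha>_eq by (rule Kd(2)) (simp add: F.P_simps PP(2))

lemma \<alpha>_sum: "finite A \<Longrightarrow> finsum M (\<lambda>i. \<alpha> (t i)) A = \<alpha> (sum t A)"
proof (induction A rule: finite_induct)
  case (insert x A)
  then show ?case by (subst M.M.finsum_insert) (auto simp: \<alpha>_carrier \<alpha>_add)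
qed (simp add: \<alpha>_zero)

lemma \<alpha>_fsum:
  assumes "\<And>i. i \<ge> N \<Longrightarrow> t i = 0"
  shows "fsum M (\<lambda>i. \<alpha> (t i)) = \<alpha> (Sum_any t)"
proof -
  have "fsum M (\<lambda>i. \<alpha> (t i)) = finsum M (\<lambda>i. \<alpha> (t i)) {..<N}"
    by (rule M.fsum_eq) (simp_all add: assms \<alpha>_zero \<alpha>_carrier)
  also have "\<dots> = \<alpha> (sum t {..<N})" by (rule \<alpha>_sum) simp
  also have "sum t {..<N} = Sum_any t" by (rule Sum_any_eq_sum[symmetric]) (rule assms)
  finally show ?thesis .
qed

lemma \<alpha>_subspace: assumes "pm.subspace H" shows "submodule (\<alpha> ` H) CC M"
proof (rule M.submoduleI')
  show "\<zero>\<^bsub>M\<^esub> \<in> \<alpha> ` H" using \<alpha>_zero pm.subspace_0[OF assms] by (metis imageI)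
  show "x \<oplus>\<^bsub>M\<^esub> y \<in> \<alpha> ` H" if "x \<in> \<alpha> ` H" "y \<in> \<alpha> ` H" for x y
    using that pm.subspace_add[OF assms] \<alpha>_add by (auto simp flip: \<alpha>_add)
  show "c \<odot>\<^bsub>M\<^esub> x \<in> \<alpha> ` H" if "x \<in> \<alpha> ` H" for c x
    using that pm.subspace_scale[OF assms] by (auto simp flip: \<alpha>_scale)
qed (use \<alpha>_carrier in blast)

lemma vimage_subspace: assumes "submodule I CC M" shows "pm.subspace {v. \<alpha> v \<in> I}"
  by (rule pm.subspaceI) (use M.submoduleD[OF assms] in \<open>simp_all add: \<alpha>_zero \<alpha>_add \<alpha>_scale\<close>)

text \<open>Submodules are graded by parity, because they are graded by the eigenvalues of \<open>L(0)\<close>.\<close>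

lemma parity_components:
  assumes "a \<in> Sp False" "b \<in> Sp True" "a + b \<in> K"
  shows "a \<in> K \<and> b \<in> K"
proof -
  obtain c d where c: "c \<in> Sp False" "d \<in> Sp True" "c \<in> K" "d \<in> K" "a + b = c + d"
    using homogeneous_split[OF K assms(3)] by blast
  have e: "a - c = d - b" using c(5) by (simp add: algebra_simps)
  have "a - c \<in> Sp False" "d - b \<in> Sp True" using assms c G.Sp_closed(3) by blast+
  then have "PP (a - c) = 0" using G.Sp_disjoint e by simp
  then have "a - c \<in> K" by (rule Kd(2))
  then have "(a - c) + c \<in> K" using c(3) pm.subspace_add[OF Kd(1)] by blast
  then have a: "a \<in> K" by simp
  then have "(a + b) - a \<in> K" using assms(3) pm.subspace_diff[OF Kd(1)] by blast
  then show ?thesis using a by simp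
qed

lemma finsum_bool: "f False \<in> carrier M \<Longrightarrow> f True \<in> carrier M \<Longrightarrow> finsum M f (UNIV :: bool set) = f False \<oplus>\<^bsub>M\<^esub> f True"
  by (simp add: UNIV_bool)

lemma parity_direct: "direct_sum M UNIV (\<lambda>p. \<alpha> ` Sp p)"
  unfolding direct_sum_def
proof (intro conjI ballI)
  show "submodule (\<alpha> ` Sp p) CC M" for p by (rule \<alpha>_subspace[OF Sp_subspace0])
  fix v assume "v \<in> carrier M"
  then obtain w where w: "v = \<alpha> w" unfolding \<alpha>_surj by blast
  obtain a b where ab: "a \<in> Sp False" "b \<in> Sp True" "w = a + b" using G.parity_decomposition by blast
  have fs: "finsum M f {i. f i \<noteq> \<zero>\<^bsub>M\<^esub>} = f False \<oplus>\<^bsub>M\<^esub> f True" if "\<forall>i\<in>UNIV. f i \<in> \<alpha> ` Sp i" for f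
  proof -
    have c: "f i \<in> carrier M" for i
    proof -
      have "f i \<in> \<alpha> ` Sp i" using that by blast
      then show ?thesis using \<alpha>_carrier by (elim imageE) simp
    qed
    then show ?thesis using M.finsum_support[of "UNIV :: bool set" f] finsum_bool[of f] by simp
  qed
  show "\<exists>!f. (\<forall>i\<in>UNIV. f i \<in> \<alpha> ` Sp i) \<and> (\<forall>i. i \<notin> UNIV \<longrightarrow> f i = \<zero>\<^bsub>M\<^esub>) \<and> finite {i. f i \<noteq> \<zero>\<^bsub>M\<^esub>} \<and>
      v = finsum M f {i. f i \<noteq> \<zero>\<^bsub>M\<^esub>}"
  proof (rule ex1I[of _ "\<lambda>p. if p then \<alpha> b else \<alpha> a"])
    let ?f = "\<lambda>p. if p then \<alpha> b else \<alpha> a"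
    have S: "\<forall>i\<in>UNIV. ?f i \<in> \<alpha> ` Sp i" using ab by auto
    show "(\<forall>i\<in>UNIV. ?f i \<in> \<alpha> ` Sp i) \<and> (\<forall>i. i \<notin> UNIV \<longrightarrow> ?f i = \<zero>\<^bsub>M\<^esub>) \<and> finite {i. ?f i \<noteq> \<zero>\<^bsub>M\<^esub>} \<and>
      v = finsum M ?f {i. ?f i \<noteq> \<zero>\<^bsub>M\<^esub>}"
      unfolding fs[OF S] using S by (simp add: w ab(3) \<alpha>_add)
    fix g assume g: "(\<forall>i\<in>UNIV. g i \<in> \<alpha> ` Sp i) \<and> (\<forall>i. i \<notin> UNIV \<longrightarrow> g i = \<zero>\<^bsub>M\<^esub>) \<and> finite {i. g i \<noteq> \<zero>\<^bsub>M\<^esub>} \<and>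
      v = finsum M g {i. g i \<noteq> \<zero>\<^bsub>M\<^esub>}"
    then have gS: "\<forall>i\<in>UNIV. g i \<in> \<alpha> ` Sp i" by blast
    obtain c d where cd: "c \<in> Sp False" "g False = \<alpha> c" "d \<in> Sp True" "g True = \<alpha> d" using gS by blast
    have "\<alpha> (a + b) = \<alpha> (c + d)" using g unfolding fs[OF gS] by (simp add: w ab(3) cd \<alpha>_add)
    then have "(a + b) - (c + d) \<in> K" unfolding \<alpha>_eq .
    then have "(a - c) + (b - d) \<in> K" by (simp add: algebra_simps)
    then have "a - c \<in> K \<and> b - d \<in> K" by (intro parity_components G.Sp_closed ab cd)
    then have "g False = \<alpha> a" "g True = \<alpha> b" unfolding cd \<alpha>_eq[symmetric] by simp_all
    then show "g = ?f" by (auto simp: fun_eq_iff)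
  qed
qed

theorem vertex_superalgebra_quotient: "vertex_superalgebra M (\<lambda>p. \<alpha> ` Sp p) YM (\<alpha> vac0)"
proof
  note [simp] = \<alpha>_carrier
  have rep: "\<exists>w. v = \<alpha> w" if "v \<in> carrier M" for v using that unfolding \<alpha>_surj by blast
  show "direct_sum M UNIV (\<lambda>p. \<alpha> ` Sp p)" by (rule parity_direct)
  show "\<alpha> vac0 \<in> \<alpha> ` Sp False" using G.vac_Sp by blast
  fix u v w n m k p q c
  show "YM v n w \<in> carrier M" if "v \<in> carrier M" "w \<in> carrier M"
    using rep[OF that(1)] rep[OF that(2)] by (auto simp: YM)
  show "YM (u \<oplus>\<^bsub>M\<^esub> v) n w = YM u n w \<oplus>\<^bsub>M\<^esub> YM v n w" if "u \<in> carrier M" "v \<in> carrier M" "w \<in> carrier M"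
    using rep[OF that(1)] rep[OF that(2)] rep[OF that(3)] by (auto simp: YM G.Y_add_left simp flip: \<alpha>_add)
  show "YM (c \<odot>\<^bsub>M\<^esub> v) n w = c \<odot>\<^bsub>M\<^esub> YM v n w" if "v \<in> carrier M" "w \<in> carrier M"
    using rep[OF that(1)] rep[OF that(2)] by (auto simp: YM G.Y_scale_left simp flip: \<alpha>_scale)
  show "YM u n (v \<oplus>\<^bsub>M\<^esub> w) = YM u n v \<oplus>\<^bsub>M\<^esub> YM u n w" if "u \<in> carrier M" "v \<in> carrier M" "w \<in> carrier M"
    using rep[OF that(1)] rep[OF that(2)] rep[OF that(3)] by (auto simp: YM F.lin_simps[OF G.Y_linear_right] simp flip: \<alpha>_add)
  show "YM v n (c \<odot>\<^bsub>M\<^esub> w) = c \<odot>\<^bsub>M\<^esub> YM v n w" if "v \<in> carrier M" "w \<in> carrier M"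
    using rep[OF that(1)] rep[OF that(2)] by (auto simp: YM F.lin_simps[OF G.Y_linear_right] simp flip: \<alpha>_scale)
  show "YM u n v \<in> \<alpha> ` Sp (p \<noteq> q)" if "u \<in> \<alpha> ` Sp p" "v \<in> \<alpha> ` Sp q"
    using that G.Y_parity by (auto simp: YM)
  show "\<exists>N. \<forall>n\<ge>N. YM u n v = \<zero>\<^bsub>M\<^esub>" if uv: "u \<in> carrier M" "v \<in> carrier M"
  proof -
    obtain a b where "u = \<alpha> a" "v = \<alpha> b" using rep uv by blast
    moreover obtain N where "\<forall>n\<ge>N. G.Y a n b = 0" using G.Y_truncation by blast
    ultimately show ?thesis by (intro exI[of _ N]) (simp add: YM \<alpha>_zero)
  qed
  show "YM (\<alpha> vac0) m v = (if m = - 1 then v else \<zero>\<^bsub>M\<^esub>)" if "v \<in> carrier M"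
    using rep[OF that] by (auto simp: YM G.Y_vac_left \<alpha>_PP \<alpha>_zero)
  show "YM v (- 1) (\<alpha> vac0) = v" if "v \<in> carrier M" using rep[OF that] by (auto simp: YM G.Y_creation \<alpha>_PP)
  show "YM v n (\<alpha> vac0) = \<zero>\<^bsub>M\<^esub>" if "v \<in> carrier M" "0 \<le> n" using rep[OF that(1)] that(2) by (auto simp: YM G.Y_annihilation \<alpha>_zero)
  show "fsum M (\<lambda>i. ((-1) ^ i * (of_int m gchoose i)) \<odot>\<^bsub>M\<^esub>
            (YM u (m + k - int i) (YM v (n + int i) w) \<ominus>\<^bsub>M\<^esub>
             (super_sign p q * (-1) powi m) \<odot>\<^bsub>M\<^esub> YM v (m + n - int i) (YM u (k + int i) w)))
        = fsum M (\<lambda>i. (of_int k gchoose i) \<odot>\<^bsub>M\<^esub> YM (YM u (m + int i) v) (n + k - int i) w)"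
    if u: "u \<in> \<alpha> ` Sp p" and v: "v \<in> \<alpha> ` Sp q" and w: "w \<in> carrier M"
  proof -
    obtain a where a: "a \<in> Sp p" "u = \<alpha> a" using u by blast
    obtain b where b: "b \<in> Sp q" "v = \<alpha> b" using v by blast
    obtain c where c: "w = \<alpha> c" using rep[OF w] by blast
    let ?t = "\<lambda>i. pm_scale ((-1) ^ i * (of_int m gchoose i)) (G.Y a (m + k - int i) (G.Y b (n + int i) c)
       - pm_scale (super_sign p q * (-1) powi m) (G.Y b (m + n - int i) (G.Y a (k + int i) c)))"
    let ?r = "\<lambda>i. pm_scale (of_int k gchoose i) (G.Y (G.Y a (m + int i) b) (n + k - int i) c)"
    obtain B where B: "\<And>i. i \<ge> B \<Longrightarrow> G.Y b i c = 0" using G.Y_truncation by blast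
    obtain B' where B': "\<And>i. i \<ge> B' \<Longrightarrow> G.Y a i c = 0" using G.Y_truncation by blast
    obtain B'' where B'': "\<And>i. i \<ge> B'' \<Longrightarrow> G.Y a i b = 0" using G.Y_truncation by blast
    have t: "?t i = 0" if "i \<ge> nat (max (B - n) (B' - k))" for i
    proof -
      have "n + int i \<ge> B" "k + int i \<ge> B'" using that by linarith+
      then show ?thesis by (simp add: B B' F.lin_simps[OF G.Y_linear_right])
    qed
    have r: "?r i = 0" if "i \<ge> nat (B'' - m)" for i
    proof -
      have "m + int i \<ge> B''" using that by linarith
      then show ?thesis by (simp add: B'' G.Y_null F.P_simps)
    qed
    have "fsum M (\<lambda>i. \<alpha> (?t i)) = \<alpha> (Sum_any ?t)" by (rule \<alpha>_fsum[OF t])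
    also have "Sum_any ?t = Sum_any ?r" by (rule G.Y_jacobi[OF a(1) b(1)])
    also have "\<alpha> (Sum_any ?r) = fsum M (\<lambda>i. \<alpha> (?r i))" by (rule \<alpha>_fsum[OF r, symmetric])
    finally have E: "fsum M (\<lambda>i. \<alpha> (?t i)) = fsum M (\<lambda>i. \<alpha> (?r i))" .
    show ?thesis unfolding a(2) b(2) c YM \<alpha>_scale[symmetric] \<alpha>_minus[symmetric] by (rule E)
  qed
qed

lemma gr_parity_eq: "gr_parity M gr p = \<alpha> ` Sp p"
proof -
  have e: "(\<Union>n::int. gr (of_int n + (if p then 1/2 else 0))) = (\<Union>n::int. \<alpha> ` gr0 (of_int n + (if p then 1/2 else 0)))"
    using gr half_ints_shift(4) by auto
  show ?thesis
  proof
    show "gr_parity M gr p \<subseteq> \<alpha> ` Sp p"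
      unfolding gr_parity_def e
      by (rule M.vspan_minimal[OF \<alpha>_subspace[OF Sp_subspace0]]) (use Sp_gr0 in blast)
    have c: "(\<Union>n::int. \<alpha> ` gr0 (of_int n + (if p then 1/2 else 0))) \<subseteq> carrier M" using \<alpha>_carrier by blast
    show "\<alpha> ` Sp p \<subseteq> gr_parity M gr p"
    proof
      fix v assume "v \<in> \<alpha> ` Sp p"
      then obtain w where w: "w \<in> Sp p" "v = \<alpha> w" by blast
      have "w \<in> {w. \<alpha> w \<in> gr_parity M gr p}"
      proof (rule hom_sums_map[of _ "\<lambda>x. x", OF _ _ _ w(1)[unfolded Sp_def]])
        show "pm.subspace {w. \<alpha> w \<in> gr_parity M gr p}"
          unfolding gr_parity_def e by (rule vimage_subspace[OF M.vspan_submodule[OF c]])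
        show "v \<in> {w. \<alpha> w \<in> gr_parity M gr p}" if "q \<in> range (\<lambda>n::int. of_int n + (if p then 1/2 else 0))" "v \<in> gr0 q" for q v
          unfolding gr_parity_def e mem_Collect_eq by (rule subsetD[OF M.vspan_superset]) (use that in blast)
      qed simp
      then show "v \<in> gr_parity M gr p" using w by simp
    qed
  qed
qed

text \<open>Existence of the decomposition comes from generation; uniqueness holds because the submodule \<open>K\<close> contains the
homogeneous components of its elements.\<close>

lemma gr_direct: "direct_sum M half_ints gr"
  unfolding direct_sum_def
proof (intro conjI ballI)
  show "submodule (gr q) CC M" if "q \<in> half_ints" for q
    unfolding gr[OF that] by (rule \<alpha>_subspace[OF gr0_subspace])
  fix v assume "v \<in> carrier M"
  then obtain w where w: "v = \<alpha> w" unfolding \<alpha>_surj by blast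
  have "w \<in> hom_sums gr0 half_ints" using gr0_spans by blast
  then obtain Q f where f: "finite Q" "Q \<subseteq> half_ints" "\<And>q. f q \<in> gr0 q" "w = (\<Sum>q\<in>Q. f q)" by (rule hom_sumsE) (rule that)
  show "\<exists>!f. (\<forall>i\<in>half_ints. f i \<in> gr i) \<and> (\<forall>i. i \<notin> half_ints \<longrightarrow> f i = \<zero>\<^bsub>M\<^esub>) \<and> finite {i. f i \<noteq> \<zero>\<^bsub>M\<^esub>} \<and>
      v = finsum M f {i. f i \<noteq> \<zero>\<^bsub>M\<^esub>}"
  proof (rule ex1I[of _ "\<lambda>q. \<alpha> (if q \<in> Q then f q else 0)"])
    let ?f = "\<lambda>q. \<alpha> (if q \<in> Q then f q else 0)"
    have s: "{q. ?f q \<noteq> \<zero>\<^bsub>M\<^esub>} \<subseteq> Q" by (auto simp: \<alpha>_zero)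
    have "finsum M ?f {q. ?f q \<noteq> \<zero>\<^bsub>M\<^esub>} = finsum M ?f Q" by (rule M.finsum_support[OF f(1) s \<alpha>_carrier])
    also have "\<dots> = \<alpha> (\<Sum>q\<in>Q. if q \<in> Q then f q else 0)" by (rule \<alpha>_sum[OF f(1)])
    also have "(\<Sum>q\<in>Q. if q \<in> Q then f q else 0) = w" unfolding f(4) by (rule sum.cong) auto
    finally have "v = finsum M ?f {q. ?f q \<noteq> \<zero>\<^bsub>M\<^esub>}" using w by simp
    moreover have "finite {q. ?f q \<noteq> \<zero>\<^bsub>M\<^esub>}" by (rule finite_subset[OF s f(1)])
    ultimately show "(\<forall>i\<in>half_ints. ?f i \<in> gr i) \<and> (\<forall>i. i \<notin> half_ints \<longrightarrow> ?f i = \<zero>\<^bsub>M\<^esub>) \<and> finite {i. ?f i \<noteq> \<zero>\<^bsub>M\<^esub>} \<and>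
      v = finsum M ?f {i. ?f i \<noteq> \<zero>\<^bsub>M\<^esub>}"
      using f(2,3) gr0_closed(4) by (auto simp: gr \<alpha>_zero)
    fix g assume g: "(\<forall>i\<in>half_ints. g i \<in> gr i) \<and> (\<forall>i. i \<notin> half_ints \<longrightarrow> g i = \<zero>\<^bsub>M\<^esub>) \<and> finite {i. g i \<noteq> \<zero>\<^bsub>M\<^esub>} \<and>
      v = finsum M g {i. g i \<noteq> \<zero>\<^bsub>M\<^esub>}"
    have "\<forall>i. \<exists>b. b \<in> gr0 i \<and> g i = \<alpha> b"
    proof
      fix i
      show "\<exists>b. b \<in> gr0 i \<and> g i = \<alpha> b"
      proof (cases "i \<in> half_ints")
        case True
        then show ?thesis using g gr[OF True] by blast
      next
        case False
        then show ?thesis using g \<alpha>_zero gr0_closed(4) by metis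
      qed
    qed
    then obtain b where b: "\<And>i. b i \<in> gr0 i" "\<And>i. g i = \<alpha> (b i)" by metis
    let ?R = "Q \<union> {i. g i \<noteq> \<zero>\<^bsub>M\<^esub>}"
    have R: "finite ?R" using f(1) g by blast
    have "v = finsum M g ?R" using g M.finsum_support[OF R, of g] b(2) \<alpha>_carrier by auto
    also have "\<dots> = finsum M (\<lambda>i. \<alpha> (b i)) ?R" by (rule arg_cong[where f = "\<lambda>h. finsum M h ?R", OF ext[OF b(2)]])
    also have "\<dots> = \<alpha> (\<Sum>i\<in>?R. b i)" by (rule \<alpha>_sum[OF R])
    finally have 1: "\<alpha> w = \<alpha> (\<Sum>i\<in>?R. b i)" using w by simp
    have "w = (\<Sum>i\<in>?R. if i \<in> Q then f i else 0)" unfolding f(4) by (rule sum.mono_neutral_cong_left) (use R in auto)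
    then have "(\<Sum>i\<in>?R. (if i \<in> Q then f i else 0) - b i) \<in> K" using 1 unfolding \<alpha>_eq by (simp add: sum_subtractf)
    then have d: "(if i \<in> Q then f i else 0) - b i \<in> K" if "i \<in> ?R" for i
      using that by (intro mode_submodule_components[OF K R, of "\<lambda>i. (if i \<in> Q then f i else 0) - b i"] gr0_closed(3))
        (use f(3) b(1) gr0_closed(4) in auto)
    show "g = ?f"
    proof
      fix i
      show "g i = ?f i"
      proof (cases "i \<in> ?R")
        case True
        show ?thesis using d[OF True] unfolding \<alpha>_eq[symmetric] b(2) by (rule sym)
      next
        case False
        then show ?thesis by (simp add: \<alpha>_zero)
      qed
    qed
  qed
qed

definition omegaM :: 'v where "omegaM = \<alpha> (fA \<omega> (-1) vac0)"

lemma YM_omega: "YM omegaM n (\<alpha> w) = \<alpha> (fA \<omega> n w)"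
  by (simp add: omegaM_def YM Y_f)

text \<open>An eigenvector in the quotient need not come from an eigenvector; but its homogeneous components of other degrees lie in
\<open>K\<close> and can be dropped.\<close>

lemma eigenspace:
  assumes q: "q \<in> half_ints"
  shows "gr q = {v \<in> carrier M. YM omegaM 1 v = of_rat q \<odot>\<^bsub>M\<^esub> v}"
proof
  show "gr q \<subseteq> {v \<in> carrier M. YM omegaM 1 v = of_rat q \<odot>\<^bsub>M\<^esub> v}"
    unfolding gr[OF q] using \<alpha>_carrier by (auto simp: YM_omega gr0_def \<alpha>_scale \<alpha>_PP)
  show "{v \<in> carrier M. YM omegaM 1 v = of_rat q \<odot>\<^bsub>M\<^esub> v} \<subseteq> gr q"
  proof
    fix v assume "v \<in> {v \<in> carrier M. YM omegaM 1 v = of_rat q \<odot>\<^bsub>M\<^esub> v}"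
    then obtain w where w: "v = \<alpha> w" "\<alpha> (fA \<omega> 1 w) = of_rat q \<odot>\<^bsub>M\<^esub> \<alpha> w" unfolding \<alpha>_surj by (auto simp: YM_omega)
    have wK: "fA \<omega> 1 w - pm_scale (of_rat q) w \<in> K" using w(2) unfolding \<alpha>_scale[symmetric] \<alpha>_eq .
    have "w \<in> hom_sums gr0 half_ints" using gr0_spans by blast
    then obtain Q f where f: "finite Q" "Q \<subseteq> half_ints" "\<And>q. f q \<in> gr0 q" "w = (\<Sum>q\<in>Q. f q)" by (rule hom_sumsE) (rule that)
    have "\<alpha> (fA \<omega> 1 w - pm_scale (of_rat q) w) = \<alpha> (\<Sum>r\<in>Q. pm_scale (of_rat r - of_rat q) (f r))"
    proof -
      have "fA \<omega> 1 w - pm_scale (of_rat q) (PP w) = (\<Sum>r\<in>Q. pm_scale (of_rat r - of_rat q) (PP (f r)))"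
        unfolding f(4) fA_lin F.P_simps pm.scale_sum_right sum_subtractf[symmetric]
        by (rule sum.cong) (use f(3) in \<open>simp_all add: gr0_def pm.scale_left_diff_distrib\<close>)
      also have "\<dots> = PP (\<Sum>r\<in>Q. pm_scale (of_rat r - of_rat q) (f r))" by (simp add: F.P_simps)
      finally have "\<alpha> (fA \<omega> 1 w - pm_scale (of_rat q) (PP w)) = \<alpha> (PP (\<Sum>r\<in>Q. pm_scale (of_rat r - of_rat q) (f r)))"
        by (rule arg_cong)
      then show ?thesis unfolding \<alpha>_minus \<alpha>_scale \<alpha>_PP .
    qed
    then have "\<alpha> (\<Sum>r\<in>Q. pm_scale (of_rat r - of_rat q) (f r)) = \<zero>\<^bsub>M\<^esub>"
      unfolding iffD2[OF ker wK] by (rule sym)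
    then have "(\<Sum>r\<in>Q. pm_scale (of_rat r - of_rat q) (f r)) \<in> K" unfolding ker .
    then have c: "pm_scale (of_rat r - of_rat q) (f r) \<in> K" if "r \<in> Q" for r
      using that by (intro mode_submodule_components[OF K f(1), of "\<lambda>r. pm_scale (of_rat r - of_rat q) (f r)"] gr0_closed(2) f(3))
    have "f r \<in> K" if "r \<in> Q - {q}" for r
    proof -
      have nz: "complex_of_rat r - of_rat q \<noteq> 0" using that by simp
      have "pm_scale (inverse (of_rat r - of_rat q)) (pm_scale (of_rat r - of_rat q) (f r)) \<in> K"
        by (rule pm.subspace_scale[OF Kd(1) c]) (use that in blast)
      then show ?thesis unfolding pm.scale_scale left_inverse[OF nz] pm.scale_one .
    qed
    then have "(\<Sum>r\<in>Q - {q}. f r) \<in> K" by (rule pm.subspace_sum[OF Kd(1)])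
    moreover have "w - (if q \<in> Q then f q else 0) = (\<Sum>r\<in>Q - {q}. f r)" unfolding f(4) using f(1) by (simp add: sum_diff1)
    ultimately have "\<alpha> w = \<alpha> (if q \<in> Q then f q else 0)" unfolding \<alpha>_eq by simp
    then show "v \<in> gr q" unfolding w(1) gr[OF q] using f(3) gr0_closed(4) by auto
  qed
qed

text \<open>The translation axiom is the commutator of \<open>L(-1)\<close> with a vertex operator, combined with the covariance of the
generated fields; the Virasoro relations are those of the modes of \<open>\<omega>\<close>.\<close>

theorem conformal_quotient: "conformal_vertex_superalgebra M gr YM (\<alpha> vac0) omegaM"
proof (rule conformal_vertex_superalgebra.intro, rule vertex_superalgebra_quotient[folded gr_parity_eq], rule conformal_vertex_superalgebra_axioms.intro)
  show "direct_sum M half_ints gr" by (rule gr_direct)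
  show "omegaM \<in> gr_parity M gr False"
    unfolding gr_parity_eq omegaM_def using gen_homogeneous[OF Gen_f(1)] by blast
  show "gr q = {v \<in> carrier M. YM omegaM 1 v = of_rat q \<odot>\<^bsub>M\<^esub> v}" if "q \<in> half_ints" for q by (rule eigenspace[OF that])
  show "YM (YM omegaM 0 v) n w = (- of_int n) \<odot>\<^bsub>M\<^esub> YM v (n - 1) w" if vw: "v \<in> carrier M" "w \<in> carrier M" for v n w
  proof -
    obtain a b where ab: "v = \<alpha> a" "w = \<alpha> b" using vw unfolding \<alpha>_surj by blast
    have "G.Y (fA \<omega> 0 a) n b = fA \<omega> 0 (G.Y a n b) - G.Y a n (fA \<omega> 0 b)"
    proof (induction a rule: homogeneous_induct)
      case (5 p q x k v)
      let ?v = "x k v"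
      have hv: "?v \<in> Sp (p \<noteq> q)" using G.Gen_parity[OF 5(1,2)] .
      have J: "Sum_any (\<lambda>i. pm_scale ((-1) ^ i * (of_int 0 gchoose i)) (fA \<omega> (0 + 0 - int i) (G.Y ?v (n + int i) b)
         - pm_scale (super_sign False (p \<noteq> q) * (-1) powi 0) (G.Y ?v (0 + n - int i) (fA \<omega> (0 + int i) b))))
       = Sum_any (\<lambda>i. pm_scale (of_int 0 gchoose i) (G.Y (fA \<omega> (0 + int i) ?v) (n + 0 - int i) b))"
        using G.Y_jacobi[OF gen_homogeneous[OF Gen_f(1), of \<omega> "-1"] hv, of 0 0 n b] unfolding Y_f .
      have "Sum_any (\<lambda>i. pm_scale ((-1) ^ i * (of_int 0 gchoose i)) (fA \<omega> (0 + 0 - int i) (G.Y ?v (n + int i) b)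
         - pm_scale (super_sign False (p \<noteq> q) * (-1) powi 0) (G.Y ?v (0 + n - int i) (fA \<omega> (0 + int i) b))))
         = fA \<omega> 0 (G.Y ?v n b) - G.Y ?v n (fA \<omega> 0 b)"
        by (subst Sum_any_eq_sum[where N = 1]) (auto simp: gbinomial_0_left super_sign_simps)
      moreover have "Sum_any (\<lambda>i. pm_scale (of_int 0 gchoose i) (G.Y (fA \<omega> (0 + int i) ?v) (n + 0 - int i) b)) = G.Y (fA \<omega> 0 ?v) n b"
        by (subst Sum_any_eq_sum[where N = 1]) (auto simp: gbinomial_0_left)
      ultimately show ?case using J by simp
    next
      case (4 c v)
      then show ?case by (simp add: fA_lin G.Y_scale_left pm.scale_right_diff_distrib)
    qed (auto simp: G.Y_null f_null fA_lin F.P_simps G.Y_add_left G.Y_scale_left G.Y_vac_left f_vac f_simps pm.scale_right_diff_distrib algebra_simps)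
    then have "G.Y (fA \<omega> 0 a) n b = pm_scale (- of_int n) (G.Y a (n - 1) b)" using G.Y_T[of a n b] by simp
    then show ?thesis unfolding ab YM_omega YM \<alpha>_scale[symmetric] by simp
  qed
  show "\<exists>c. \<forall>m n. \<forall>v\<in>carrier M. YM omegaM (m + 1) (YM omegaM (n + 1) v) \<ominus>\<^bsub>M\<^esub> YM omegaM (n + 1) (YM omegaM (m + 1) v) =
        of_int (m - n) \<odot>\<^bsub>M\<^esub> YM omegaM (m + n + 1) v \<oplus>\<^bsub>M\<^esub> (if m + n = 0 then of_int (m ^ 3 - m) / 12 * c else 0) \<odot>\<^bsub>M\<^esub> v"
  (* [L(m), L(n)] has the central term \<ell> \<langle>\<omega>, \<omega>\<rangle> (m + 1) m (m - 1) / 6; comparison with the Virasoro relations gives c. *)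
  proof (intro exI[of _ "2 * l * formA D \<omega> \<omega>"] allI ballI)
    fix m n v assume "v \<in> carrier M"
    then obtain w where w: "v = \<alpha> w" unfolding \<alpha>_surj by blast
    let ?k = "if m + n = 0 then of_int (m ^ 3 - m) / 12 * (2 * l * formA D \<omega> \<omega>) else 0"
    have k: "(if (m + 1) + (n + 1) = 2 then l * (of_int (m + 1) * (of_int (m + 1) - 1) * (of_int (m + 1) - 2) / 6 * formA D \<omega> \<omega>) else 0) = ?k"
      by (simp add: power3_eq_cube field_simps)
    have i: "m + 1 + (n + 1) - 1 = m + n + 1" "(m + 1) - (n + 1) = m - n" by simp_all
    have "fA \<omega> (m + 1) (fA \<omega> (n + 1) w) - fA \<omega> (n + 1) (fA \<omega> (m + 1) w) = pm_scale (of_int (m - n)) (fA \<omega> (m + n + 1) w) + pm_scale ?k (PP w)"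
      unfolding omega_commutators(1) k i ..
    then show "YM omegaM (m + 1) (YM omegaM (n + 1) v) \<ominus>\<^bsub>M\<^esub> YM omegaM (n + 1) (YM omegaM (m + 1) v) =
        of_int (m - n) \<odot>\<^bsub>M\<^esub> YM omegaM (m + n + 1) v \<oplus>\<^bsub>M\<^esub> ?k \<odot>\<^bsub>M\<^esub> v"
      unfolding w YM_omega \<alpha>_minus[symmetric] by (simp only: \<alpha>_add \<alpha>_scale \<alpha>_PP)
  qed
qed

end

section \<open>Ideals, simplicity and generators of quotients\<close>

context pair_level
begin

lemma f_add: "fA (a + b) n w = fA a n w + fA b n w" "fU (u + v) n w = fU u n w + fU v n w"
  unfolding fA_def fU_def by (simp_all flip: X_add am_um_cen_add)

lemma f_zero: "fA 0 n w = 0" "fU 0 n w = 0"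
  using f_add(1)[of 0 0 n w] f_add(2)[of 0 0 n w] by simp_all

end

context vsa_quotient
begin

lemma ideal_preimage:
  assumes I: "va_ideal M YM I"
  shows "mode_submodule {v. \<alpha> v \<in> I}" "I = \<alpha> ` {v. \<alpha> v \<in> I}"
proof -
  have s: "submodule I CC M" and Y: "\<And>v w n. v \<in> carrier M \<Longrightarrow> w \<in> I \<Longrightarrow> YM v n w \<in> I" using I unfolding va_ideal_def by blast+
  have "\<alpha> (fA a n v) \<in> I" "\<alpha> (fU u n v) \<in> I" if "\<alpha> v \<in> I" for a u n v
    using Y[OF \<alpha>_carrier[of "fA a (-1) vac0"] that, of n] Y[OF \<alpha>_carrier[of "fU u (-1) vac0"] that, of n]
    by (simp_all add: YM Y_f)
  moreover have "\<alpha> v \<in> I" if "v \<in> N0" for v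
  proof -
    have "v \<in> K" by (rule Kd(2)) (simp add: PP(3) that)
    then show ?thesis using M.submoduleD(2)[OF s] ker by metis
  qed
  ultimately show "mode_submodule {v. \<alpha> v \<in> I}" unfolding mode_submodule_def using vimage_subspace[OF s] by blast
  show "I = \<alpha> ` {v. \<alpha> v \<in> I}" using M.submoduleD(1)[OF s] unfolding \<alpha>_surj by blast
qed

lemma ideal_image:
  assumes H: "mode_submodule H"
  shows "va_ideal M YM (\<alpha> ` H)"
  unfolding va_ideal_def
proof (intro conjI ballI allI)
  show "submodule (\<alpha> ` H) CC M" by (rule \<alpha>_subspace[OF mode_submoduleD(1)[OF H]])
  fix v w n assume "v \<in> carrier M" "w \<in> \<alpha> ` H"
  then obtain a b where ab: "v = \<alpha> a" "w = \<alpha> b" "b \<in> H" unfolding \<alpha>_surj by blast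
  show "YM v n w \<in> \<alpha> ` H" unfolding ab YM by (rule imageI, rule mode_submodule_Y_left[OF H ab(3)])
  show "YM w n v \<in> \<alpha> ` H" unfolding ab YM by (rule imageI, rule mode_submodule_Y_right[OF H ab(3)])
qed

lemma mode_submodule_vac: "mode_submodule H \<Longrightarrow> vac0 \<in> H \<Longrightarrow> H = UNIV"
  by (rule generation_f) (use mode_submoduleD in blast)+

lemma proper_ideal:
  assumes I: "va_ideal M YM I" and "I \<noteq> carrier M"
  shows "{v. \<alpha> v \<in> I} \<subseteq> J0"
proof (rule proper_mode_submodule[OF ideal_preimage(1)[OF I]])
  show "vac0 \<notin> {v. \<alpha> v \<in> I}"
  proof
    assume "vac0 \<in> {v. \<alpha> v \<in> I}"
    then have "{v. \<alpha> v \<in> I} = UNIV" by (rule mode_submodule_vac[OF ideal_preimage(1)[OF I]])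
    then have "I = carrier M" using ideal_preimage(2)[OF I] \<alpha>_surj by simp
    then show False using assms(2) by simp
  qed
qed

lemma graded_image:
  assumes H: "mode_submodule H"
  shows "graded_ideal M gr YM (\<alpha> ` H)"
  unfolding graded_ideal_def
proof (intro conjI ideal_image[OF H])
  let ?S = "\<Union>q\<in>half_ints. \<alpha> ` H \<inter> gr q"
  have S: "?S \<subseteq> carrier M" using \<alpha>_carrier by blast
  show "\<alpha> ` H = vspan M ?S"
  proof
    show "vspan M ?S \<subseteq> \<alpha> ` H" by (rule M.vspan_minimal[OF \<alpha>_subspace[OF mode_submoduleD(1)[OF H]]]) blast
    show "\<alpha> ` H \<subseteq> vspan M ?S"
    proof
      fix v assume "v \<in> \<alpha> ` H"
      then obtain w where w: "v = \<alpha> w" "w \<in> H" by blast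
      have "w \<in> hom_sums gr0 half_ints" using gr0_spans by blast
      then obtain Q f where f: "finite Q" "Q \<subseteq> half_ints" "\<And>q. f q \<in> gr0 q" "w = (\<Sum>q\<in>Q. f q)" by (rule hom_sumsE) (rule that)
      have fH: "f q \<in> H" if "q \<in> Q" for q
        by (rule mode_submodule_components[OF H f(1) f(3) _ that]) (use w(2) f(4) in simp)
      have "(\<Sum>q\<in>Q. f q) \<in> {w. \<alpha> w \<in> vspan M ?S}"
      proof (rule pm.subspace_sum[OF vimage_subspace[OF M.vspan_submodule[OF S]]])
        fix q assume q: "q \<in> Q"
        have qh: "q \<in> half_ints" using q f(2) by blast
        have "\<alpha> (f q) \<in> gr q" unfolding gr[OF qh] by (rule imageI[OF f(3)])
        then have "\<alpha> (f q) \<in> ?S" using imageI[OF fH[OF q], of \<alpha>] qh by blast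
        then have "\<alpha> (f q) \<in> vspan M ?S" by (rule subsetD[OF M.vspan_superset])
        then show "f q \<in> {w. \<alpha> w \<in> vspan M ?S}" by simp
      qed
      then show "v \<in> vspan M ?S" using w f(4) by simp
    qed
  qed
qed

text \<open>Every ideal that does not contain the vacuum lies in the image of the radical, and the image of the radical is graded.\<close>

lemma maximal_ideal_unique:
  assumes KJ: "K \<subseteq> J0"
  shows "maximal_graded_ideal M gr YM I \<longleftrightarrow> I = \<alpha> ` J0"
proof -
  have J: "graded_ideal M gr YM (\<alpha> ` J0)" by (rule graded_image[OF J0_mode_submodule])
  have ne: "\<alpha> ` J0 \<noteq> carrier M"
  proof
    assume "\<alpha> ` J0 = carrier M"
    then obtain j where j: "\<alpha> vac0 = \<alpha> j" "j \<in> J0" using \<alpha>_carrier[of vac0] by blast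
    then have "vac0 - j \<in> J0" using KJ unfolding \<alpha>_eq by blast
    then have "(vac0 - j) + j \<in> J0" using j(2) by (rule pm.subspace_add[OF J0_subspace])
    then show False using vac0_J0 by simp
  qed
  have sub: "I' \<subseteq> \<alpha> ` J0" if I': "graded_ideal M gr YM I'" "I' \<noteq> carrier M" for I'
  proof -
    have I: "va_ideal M YM I'" using I'(1) unfolding graded_ideal_def by blast
    show ?thesis using proper_ideal[OF I I'(2)] ideal_preimage(2)[OF I] by blast
  qed
  show ?thesis unfolding maximal_graded_ideal_def using J ne sub by blast
qed

lemma image_K: "\<alpha> ` K = {\<zero>\<^bsub>M\<^esub>}"
proof
  show "{\<zero>\<^bsub>M\<^esub>} \<subseteq> \<alpha> ` K" unfolding \<alpha>_zero[symmetric] using pm.subspace_0[OF Kd(1)] by blast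
qed (use ker in blast)

lemma simple_quotient: assumes KJ: "K = J0" shows "va_simple M YM"
  unfolding va_simple_def
proof (intro conjI allI impI)
  show "carrier M \<noteq> {\<zero>\<^bsub>M\<^esub>}" using \<alpha>_carrier[of vac0] ker[of vac0] vac0_J0 KJ by auto
  fix I assume I: "va_ideal M YM I"
  show "I = {\<zero>\<^bsub>M\<^esub>} \<or> I = carrier M"
  proof (rule disjCI)
    assume n: "I \<noteq> carrier M"
    have "I \<subseteq> \<alpha> ` K" using proper_ideal[OF I n] ideal_preimage(2)[OF I] KJ by blast
    moreover have "\<zero>\<^bsub>M\<^esub> \<in> I" using I M.submoduleD(2) unfolding va_ideal_def by blast
    ultimately show "I = {\<zero>\<^bsub>M\<^esub>}" unfolding image_K by blast
  qed
qed

text \<open>The canonical map of \<open>A \<oplus> U\<close> to the quotient.\<close>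

definition emb :: "'a \<times> 'u \<Rightarrow> 'v" where "emb x = \<alpha> (fA (fst x) (-1) vac0 + fU (snd x) (-1) vac0)"

lemma emb_simps: "emb (a, 0) = \<alpha> (fA a (-1) vac0)" "emb (0, u) = \<alpha> (fU u (-1) vac0)"
  by (simp_all add: emb_def f_zero)

lemma YM_emb: "YM (emb (a, 0)) n (\<alpha> w) = \<alpha> (fA a n w)" "YM (emb (0, u)) n (\<alpha> w) = \<alpha> (fU u n w)"
  by (simp_all add: emb_simps YM Y_f)

lemma generation_by_degree:
  assumes H: "pm.subspace H" "N0 \<subseteq> H" "\<And>q v. negw q v \<Longrightarrow> v \<in> H"
  shows "v \<in> H"
proof -
  have "gr0 q \<subseteq> H" for q unfolding NW_gr0[symmetric] NW_def by (rule pm.span_minimal) (use H in auto)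
  then have "v \<in> (\<lambda>x. x) ` H" if "v \<in> hom_sums gr0 half_ints" for v
    using hom_sums_map[OF H(1) _ _ that, of "\<lambda>x. x"] by auto
  then show ?thesis using gr0_spans by blast
qed

text \<open>The monomials in modes of negative index are exactly the vectors in the definition of strong generation.\<close>

theorem strongly_generated_quotient: "strongly_generated M YM (\<alpha> vac0) (range emb)"
  unfolding strongly_generated_def
proof
  let ?F = "\<lambda>xs. foldr (\<lambda>(a, n) v. YM a (- n) v) xs (\<alpha> vac0)"
  let ?S = "{?F xs | xs :: ('v \<times> int) list. \<forall>(a, n)\<in>set xs. a \<in> range emb \<and> n > 0}"
  have "?F xs \<in> carrier M" if "\<forall>(a, n)\<in>set xs. a \<in> range emb \<and> n > 0" for xs
    using that
  proof (induction xs)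
    case (Cons x xs)
    obtain a n where x: "x = (a, n)" by (cases x)
    obtain b where "a = \<alpha> b" using Cons(2) unfolding x by (auto simp: emb_def)
    moreover have "?F xs \<in> carrier M" by (rule Cons(1)) (use Cons(2) in simp)
    then obtain c where "?F xs = \<alpha> c" unfolding \<alpha>_surj by (elim imageE)
    ultimately show ?case by (simp add: x YM \<alpha>_carrier)
  qed (simp add: \<alpha>_carrier)
  then have S: "?S \<subseteq> carrier M" by blast
  show "vspan M ?S \<subseteq> carrier M" by (rule M.vspan_minimal[OF M.carrier_submodule S])
  have sub: "pm.subspace {v. \<alpha> v \<in> vspan M ?S}" by (rule vimage_subspace[OF M.vspan_submodule[OF S]])
  have neg: "\<exists>xs. (\<forall>(a, n)\<in>set xs. a \<in> range emb \<and> n > 0) \<and> \<alpha> v = ?F xs" if "negw q v" for q v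
    using that
  proof (induction rule: negw.induct)
    case vac
    show ?case by (rule exI[of _ "[]"]) simp
  next
    case (A q v n a)
    then obtain xs where "\<forall>(a, n)\<in>set xs. a \<in> range emb \<and> n > 0" "\<alpha> v = ?F xs" by blast
    then show ?case using A(2) YM_emb(1)[of a n v] by (intro exI[of _ "(emb (a, 0), - n) # xs"]) simp
  next
    case (U q v n u)
    then obtain xs where "\<forall>(a, n)\<in>set xs. a \<in> range emb \<and> n > 0" "\<alpha> v = ?F xs" by blast
    then show ?case using U(2) YM_emb(2)[of u n v] by (intro exI[of _ "(emb (0, u), - n) # xs"]) simp
  qed
  show "carrier M \<subseteq> vspan M ?S"
  proof
    fix v assume "v \<in> carrier M"
    then obtain w where w: "v = \<alpha> w" unfolding \<alpha>_surj by blast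
    have "w \<in> {v. \<alpha> v \<in> vspan M ?S}"
    proof (rule generation_by_degree[OF sub])
      show "N0 \<subseteq> {v. \<alpha> v \<in> vspan M ?S}"
      proof
        fix v assume "v \<in> N0"
        then have "v \<in> K" by (intro Kd(2)) (simp add: PP(3))
        then have "\<alpha> v = \<zero>\<^bsub>M\<^esub>" using ker by blast
        then show "v \<in> {v. \<alpha> v \<in> vspan M ?S}" using M.submoduleD(2)[OF M.vspan_submodule[OF S]] by simp
      qed
      show "v \<in> {v. \<alpha> v \<in> vspan M ?S}" if "negw q v" for q v
        using neg[OF that] M.vspan_superset[of ?S] by blast
    qed
    then show "v \<in> vspan M ?S" using w by simp
  qed
qed

lemma N0_K: "v \<in> N0 \<Longrightarrow> v \<in> K"
  by (rule Kd(2)) (simp add: PP(3))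

text \<open>The maps from \<open>A\<close> and from \<open>U\<close> are treated alike; injectivity is the statement that the submodule \<open>K\<close> contains no
nonzero vector of the form \<open>h x\<close>.\<close>

lemma degree_iso:
  assumes h: "\<And>x y. h (x + y) = h x + h y" "\<And>c x. h (s c x) = pm_scale c (h x)"
    and inj: "\<And>x. h x \<in> K \<Longrightarrow> x = 0" and onto: "\<And>v. v \<in> gr0 q \<Longrightarrow> \<exists>x. v - h x \<in> N0"
    and q: "\<And>x. h x \<in> gr0 q" "q \<in> half_ints"
  shows "linear_iso_onto s M (gr q) (\<lambda>x. \<alpha> (h x))"
  unfolding linear_iso_onto_def
proof (intro conjI allI)
  have d: "h (x - y) = h x - h y" for x y using h(1)[of "x - y" y] by (simp add: algebra_simps)
  show "bij_betw (\<lambda>x. \<alpha> (h x)) UNIV (gr q)"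
    unfolding bij_betw_def
  proof
    show "inj (\<lambda>x. \<alpha> (h x))"
    proof (rule injI)
      fix x y assume "\<alpha> (h x) = \<alpha> (h y)"
      then have "h (x - y) \<in> K" unfolding \<alpha>_eq d .
      then show "x = y" using inj by fastforce
    qed
    show "range (\<lambda>x. \<alpha> (h x)) = gr q"
      unfolding gr[OF q(2)]
    proof
      show "\<alpha> ` gr0 q \<subseteq> range (\<lambda>x. \<alpha> (h x))"
      proof
        fix w assume "w \<in> \<alpha> ` gr0 q"
        then obtain v where v: "w = \<alpha> v" "v \<in> gr0 q" by blast
        obtain x where "v - h x \<in> N0" using onto[OF v(2)] by blast
        then have "\<alpha> v = \<alpha> (h x)" unfolding \<alpha>_eq by (rule N0_K)
        then show "w \<in> range (\<lambda>x. \<alpha> (h x))" using v(1) by blast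
      qed
    qed (use q(1) in blast)
  qed
qed (simp_all add: h \<alpha>_add \<alpha>_scale)

lemma f_degree: "fA a (-1) vac0 \<in> gr0 2" "fU u (-1) vac0 \<in> gr0 (3/2)"
  using gr0_fA[OF gr0_vac, of a "-1"] gr0_fU[OF gr0_vac, of u "-1"] by simp_all

theorem degree_two_iso:
  assumes "l \<noteq> 0" "nondegenerate (formA D)" "K \<subseteq> J0"
  shows "linear_iso_onto (scA D) M (gr 2) (\<lambda>a. emb (a, 0))"
  unfolding emb_simps
  by (rule degree_iso) (use assms J0_A gr0_two f_degree in \<open>auto simp: f_add f_scale half_ints_def\<close>)

theorem degree_three_halves_iso:
  assumes "l \<noteq> 0" "nondegenerate (formU D)" "K \<subseteq> J0"
  shows "linear_iso_onto (scU D) M (gr (3/2)) (\<lambda>u. emb (0, u))"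
  unfolding emb_simps
  by (rule degree_iso) (use assms J0_U gr0_three_halves f_degree in \<open>auto simp: f_add f_scale half_ints_def\<close>)

end

section \<open>Finiteness\<close>

context pair_level
begin

text \<open>A monomial of degree \<open>q\<close> begins with a mode of degree at least \<open>3/2\<close> and continues with a monomial of smaller
degree; only finitely many indices of the first mode leave a nonnegative degree, and its vector may be taken from a finite
basis.\<close>

lemma finite_degree:
  assumes "fin_dim_type (scA D)" "fin_dim_type (scU D)"
  shows "\<forall>q. q < of_nat k \<longrightarrow> (\<exists>B. finite B \<and> B \<subseteq> gr0 q \<and> gr0 q \<subseteq> pm.span (B \<union> N0))"
proof (induction k)
  case 0
  have "gr0 q \<subseteq> pm.span ({} \<union> N0)" if "q < 0" for q using gr0_low[OF that] by (auto intro: pm.span_base)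
  then show ?case by (intro allI impI exI[of _ "{}"]) simp
next
  case (Suc k)
  obtain BA BU where BA: "finite BA" "A.span BA = UNIV" and BU: "finite BU" "U.span BU = UNIV"
    using assms unfolding fin_dim_type_def by blast
  show ?case
  proof (intro allI impI)
    fix q :: rat assume q: "q < of_nat (Suc k)"
    have "\<forall>r. \<exists>B. r < of_nat k \<longrightarrow> finite B \<and> B \<subseteq> gr0 r \<and> gr0 r \<subseteq> pm.span (B \<union> N0)" using Suc by blast
    then obtain B where B: "\<And>r. r < of_nat k \<Longrightarrow> finite (B r) \<and> B r \<subseteq> gr0 r \<and> gr0 r \<subseteq> pm.span (B r \<union> N0)"
      using choice[of "\<lambda>r B. r < of_nat k \<longrightarrow> finite B \<and> B \<subseteq> gr0 r \<and> gr0 r \<subseteq> pm.span (B \<union> N0)"] by blast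
    (* For n < -k - 2 the remaining monomial would have negative degree, hence be zero. *)
    let ?R = "{- int k - 2..-1}"
    define C where "C = (if q = 0 then {vac0} else {}) \<union>
      (\<Union>n\<in>?R. \<Union>a\<in>BA. fA a n ` B (q - (1 - of_int n))) \<union> (\<Union>n\<in>?R. \<Union>u\<in>BU. fU u n ` B (q - (1/2 - of_int n)))"
    have sA: "q - (1 - of_int n) < of_nat k" and sU: "q - (1/2 - of_int n) < of_nat k" if "n < 0" for n :: int
    proof -
      have "rat_of_int n \<le> -1" using that by linarith
      then show "q - (1 - of_int n) < of_nat k" "q - (1/2 - of_int n) < of_nat k" using q by simp_all
    qed
    have "finite C" unfolding C_def using BA(1) BU(1) B[OF sA] B[OF sU] by auto
    moreover have "C \<subseteq> gr0 q"
    proof -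
      have gA: "fA a n w \<in> gr0 q" if "n \<in> ?R" "w \<in> B (q - (1 - of_int n))" for a n w
      proof -
        have "n < 0" using that(1) by simp
        then have "w \<in> gr0 (q - (1 - of_int n))" using B[OF sA] that(2) by blast
        from gr0_fA[OF this, of a n] show ?thesis by simp
      qed
      have gU: "fU u n w \<in> gr0 q" if "n \<in> ?R" "w \<in> B (q - (1/2 - of_int n))" for u n w
      proof -
        have "n < 0" using that(1) by simp
        then have "w \<in> gr0 (q - (1/2 - of_int n))" using B[OF sU] that(2) by blast
        from gr0_fU[OF this, of u n] show ?thesis by simp
      qed
      show ?thesis unfolding C_def using gr0_vac by (intro Un_least UN_least image_subsetI gA gU) (auto split: if_splits)
    qed
    moreover have "gr0 q \<subseteq> pm.span (C \<union> N0)"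
    proof -
      let ?T = "pm.span (C \<union> N0)"
      have T: "pm.subspace ?T" by (rule pm.subspace_span)
      have van: "v \<in> N0" if "n \<notin> ?R" "n < 0" "v \<in> gr0 r" "r = q - (1 - of_int n) \<or> r = q - (1/2 - of_int n)" for n v r
      proof (rule gr0_low[OF _ that(3)])
        have "n \<le> - int k - 3" using that by auto
        then have "rat_of_int n \<le> of_int (- int k - 3)" unfolding of_int_le_iff .
        then show "r < 0" using q that(4) by auto
      qed
      have gA: "fA a n v \<in> ?T" if n: "n < 0" and v: "v \<in> gr0 (q - (1 - of_int n))" for a n v
      proof (cases "n \<in> ?R")
        case True
        have "fA b n v \<in> ?T" if b: "b \<in> BA" for b
        proof -
          have "pm.span (B (q - (1 - of_int n)) \<union> N0) \<subseteq> {v. fA b n v \<in> ?T}"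
          proof (rule pm.span_minimal)
            show "pm.subspace {v. fA b n v \<in> ?T}"
              by (rule pm.subspaceI) (auto simp: fA_lin intro: pm.span_zero pm.span_add pm.span_scale)
            have "fA b n w \<in> C" if "w \<in> B (q - (1 - of_int n))" for w unfolding C_def using True b that by blast
            then show "B (q - (1 - of_int n)) \<union> N0 \<subseteq> {v. fA b n v \<in> ?T}" by (auto simp: f_N0 intro: pm.span_zero pm.span_base)
          qed
          then show ?thesis using B[OF sA[OF n]] v by blast
        qed
        moreover have "A.subspace {a. fA a n v \<in> ?T}"
          by (rule A.subspaceI) (auto simp: f_add f_zero f_scale intro: pm.span_zero pm.span_add pm.span_scale)
        ultimately have "A.span BA \<subseteq> {a. fA a n v \<in> ?T}" by (intro A.span_minimal) auto
        then show ?thesis unfolding BA(2) by blast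
      next
        case False
        have "v \<in> N0" by (rule van[OF False n v]) simp
        then show ?thesis by (simp add: f_N0 pm.span_zero)
      qed
      have gU: "fU a n v \<in> ?T" if n: "n < 0" and v: "v \<in> gr0 (q - (1/2 - of_int n))" for a n v
      proof (cases "n \<in> ?R")
        case True
        have "fU b n v \<in> ?T" if b: "b \<in> BU" for b
        proof -
          have "pm.span (B (q - (1/2 - of_int n)) \<union> N0) \<subseteq> {v. fU b n v \<in> ?T}"
          proof (rule pm.span_minimal)
            show "pm.subspace {v. fU b n v \<in> ?T}"
              by (rule pm.subspaceI) (auto simp: fU_lin intro: pm.span_zero pm.span_add pm.span_scale)
            have "fU b n w \<in> C" if "w \<in> B (q - (1/2 - of_int n))" for w unfolding C_def using True b that by blast
            then show "B (q - (1/2 - of_int n)) \<union> N0 \<subseteq> {v. fU b n v \<in> ?T}" by (auto simp: f_N0 intro: pm.span_zero pm.span_base)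
          qed
          then show ?thesis using B[OF sU[OF n]] v by blast
        qed
        moreover have "U.subspace {a. fU a n v \<in> ?T}"
          by (rule U.subspaceI) (auto simp: f_add f_zero f_scale intro: pm.span_zero pm.span_add pm.span_scale)
        ultimately have "U.span BU \<subseteq> {a. fU a n v \<in> ?T}" by (intro U.span_minimal) auto
        then show ?thesis unfolding BU(2) by blast
      next
        case False
        have "v \<in> N0" by (rule van[OF False n v]) simp
        then show ?thesis by (simp add: f_N0 pm.span_zero)
      qed
      have "v \<in> ?T" if v: "negw q v" for v
        using v
      proof (cases rule: negw.cases)
        case vac
        then show ?thesis unfolding C_def by (auto intro: pm.span_base)
      next
        case (A r w n a)
        have "r = q - (1 - of_int n)" using A(1) by simp
        then show ?thesis unfolding A(2) using gA[OF A(4)] negw_gr0[OF A(3)] by simp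
      next
        case (U r w n u)
        have "r = q - (1/2 - of_int n)" using U(1) by simp
        then show ?thesis unfolding U(2) using gU[OF U(4)] negw_gr0[OF U(3)] by simp
      qed
      then show ?thesis unfolding NW_gr0[symmetric] NW_def by (intro pm.span_minimal[OF _ T]) (auto intro: pm.span_base)
    qed
    ultimately show "\<exists>B. finite B \<and> B \<subseteq> gr0 q \<and> gr0 q \<subseteq> pm.span (B \<union> N0)" by blast
  qed
qed

end

context vsa_quotient
begin

theorem finite_quotient:
  assumes "fin_dim_type (scA D)" "fin_dim_type (scU D)"
  shows "vertex_operator_superalgebra M gr YM (\<alpha> vac0) omegaM"
proof (rule vertex_operator_superalgebra.intro[OF conformal_quotient], rule vertex_operator_superalgebra_axioms.intro)
  show "fin_dim M (gr q)" if q: "q \<in> half_ints" for q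
  proof -
    obtain k where k: "q < of_nat k" using reals_Archimedean2[of q] by blast
    obtain B where B: "finite B" "B \<subseteq> gr0 q" "gr0 q \<subseteq> pm.span (B \<union> N0)" using finite_degree[OF assms, of k] k by blast
    have c: "\<alpha> ` B \<subseteq> carrier M" using \<alpha>_carrier by blast
    have sub: "pm.subspace {v. \<alpha> v \<in> vspan M (\<alpha> ` B)}" by (rule vimage_subspace[OF M.vspan_submodule[OF c]])
    have "\<alpha> v \<in> vspan M (\<alpha> ` B)" if "v \<in> N0" for v
    proof -
      have "\<alpha> v = \<zero>\<^bsub>M\<^esub>" using ker N0_K[OF that] by blast
      then show ?thesis using M.submoduleD(2)[OF M.vspan_submodule[OF c]] by simp
    qed
    moreover have "\<alpha> v \<in> vspan M (\<alpha> ` B)" if "v \<in> B" for v using that M.vspan_superset[of "\<alpha> ` B"] by blast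
    ultimately have "pm.span (B \<union> N0) \<subseteq> {v. \<alpha> v \<in> vspan M (\<alpha> ` B)}" by (intro pm.span_minimal[OF _ sub]) blast
    then have "gr q \<subseteq> vspan M (\<alpha> ` B)" unfolding gr[OF q] using B(3) by blast
    moreover have "vspan M (\<alpha> ` B) \<subseteq> gr q"
      unfolding gr[OF q] by (rule M.vspan_minimal[OF \<alpha>_subspace[OF gr0_subspace]]) (use B(2) in blast)
    ultimately show ?thesis unfolding fin_dim_def using B(1) c by blast
  qed
  have "gr q = {\<zero>\<^bsub>M\<^esub>}" if q: "q \<in> half_ints" "q < 0" for q
  proof -
    have "\<alpha> v = \<zero>\<^bsub>M\<^esub>" if "v \<in> gr0 q" for v using ker N0_K[OF gr0_low[OF q(2) that]] by blast
    moreover have "\<zero>\<^bsub>M\<^esub> \<in> \<alpha> ` gr0 q" using gr0_closed(4) \<alpha>_zero by (metis imageI)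
    ultimately show ?thesis unfolding gr[OF q(1)] by blast
  qed
  then show "\<exists>N. \<forall>q\<in>half_ints. q < N \<longrightarrow> gr q = {\<zero>\<^bsub>M\<^esub>}" by blast
qed

end

section \<open>The universal vertex superalgebra\<close>

context pair_level
begin

lemma N0_mode_submodule: "mode_submodule N0"
  unfolding mode_submodule_def using N0_subspace f_N0 pm.subspace_0[OF N0_subspace] by auto

text \<open>The vertex operators of the induced module, with the normalisation outside of the carrier that makes them unique.\<close>

definition YV :: "('a, 'u) V_elem \<Rightarrow> int \<Rightarrow> ('a, 'u) V_elem \<Rightarrow> ('a, 'u) V_elem" where
  "YV v n w = (if v \<in> carrier (V_mod D l) \<and> w \<in> carrier (V_mod D l)
     then \<psi> (G.Y (SOME f. \<psi> f = v) n (SOME f. \<psi> f = w)) else undefined)"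

lemma Y_cong:
  assumes "\<psi> v = \<psi> v'" "\<psi> w = \<psi> w'"
  shows "G.Y v n w = G.Y v' n w'"
proof -
  have "PP (v - v') = 0" using assms(1) unfolding psi_diff PP(3) .
  then have "G.Y (v - v') n w = 0" by (rule G.Y_null)
  then have "G.Y v n w = G.Y v' n w" using G.Y_add_left[of "v - v'" v' n w] by simp
  also have "\<dots> = G.Y v' n (PP w)" by (simp only: G.Y_P)
  also have "PP w = PP w'" using assms(2) unfolding psi_eq_PP .
  also have "G.Y v' n (PP w') = G.Y v' n w'" by (simp only: G.Y_P)
  finally show ?thesis .
qed

lemma YV_psi: "YV (\<psi> v) n (\<psi> w) = \<psi> (G.Y v n w)"
proof -
  have s: "\<psi> (SOME f. \<psi> f = \<psi> v) = \<psi> v" for v by (rule someI_ex) blast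
  have "YV (\<psi> v) n (\<psi> w) = \<psi> (G.Y (SOME f. \<psi> f = \<psi> v) n (SOME f. \<psi> f = \<psi> w))"
    by (simp add: YV_def Psi_closed)
  also have "\<dots> = \<psi> (G.Y v n w)" by (rule arg_cong[OF Y_cong[OF s s]])
  finally show ?thesis .
qed

lemma universal_quotient:
  assumes "\<And>q. q \<in> half_ints \<Longrightarrow> gr q = \<psi> ` gr0 q"
  shows "vsa_quotient D \<omega> l (V_mod D l) \<psi> N0 YV gr"
proof unfold_locales
  show "\<psi> v = \<zero>\<^bsub>V_mod D l\<^esub> \<longleftrightarrow> v \<in> N0" for v unfolding N0_def by simp
qed (fact Psi_add Psi_scale Psi_surj N0_mode_submodule YV_psi assms)+

lemmas psi_subspace = vsa_quotient.\<alpha>_subspace[OF universal_quotient[OF refl]]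
lemmas psi_vimage = vsa_quotient.vimage_subspace[OF universal_quotient[OF refl]]

lemma gr0_PP: "v \<in> gr0 q \<Longrightarrow> PP v \<in> gr0 q"
  by (simp add: gr0_def f_simps F.P_simps PP(2))

text \<open>The modes are homogeneous operators, and \<open>K\<close> acts by a scalar in degree zero.\<close>

lemma X_degree:
  assumes x: "x \<in> LAU_gr d" and v: "v \<in> gr0 q"
  shows "X x v \<in> gr0 (q + d)"
proof -
  obtain f g k where fgk: "x = (f, g, k)" by (cases x) auto
  have f: "X (\<Sum>n\<in>Poly_Mapping.keys f. am (Poly_Mapping.lookup f n) n) v \<in> gr0 (q + d)"
  proof -
    have "X (\<Sum>n\<in>Q. am (Poly_Mapping.lookup f n) n) v \<in> gr0 (q + d)" if "Q \<subseteq> Poly_Mapping.keys f" for Q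
      using finite_subset[OF that finite_keys] that
    proof (induction Q rule: finite_induct)
      case empty
      then show ?case by (simp add: X_zero gr0_closed(4))
    next
      case (insert n Q)
      have "1 - rat_of_int n = d" using x insert(4) unfolding fgk LAU_gr_def by auto
      then have "fA (Poly_Mapping.lookup f n) n v \<in> gr0 (q + d)" using gr0_fA[OF v, of _ n] by simp
      then show ?case using insert gr0_closed(1) by (simp add: X_add fA_def)
    qed
    then show ?thesis by blast
  qed
  have g: "X (\<Sum>n\<in>Poly_Mapping.keys g. um (Poly_Mapping.lookup g n) n) v \<in> gr0 (q + d)"
  proof -
    have "X (\<Sum>n\<in>Q. um (Poly_Mapping.lookup g n) n) v \<in> gr0 (q + d)" if "Q \<subseteq> Poly_Mapping.keys g" for Q
      using finite_subset[OF that finite_keys] that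
    proof (induction Q rule: finite_induct)
      case empty
      then show ?case by (simp add: X_zero gr0_closed(4))
    next
      case (insert n Q)
      have "1/2 - rat_of_int n = d" using x insert(4) unfolding fgk LAU_gr_def by auto
      then have "fU (Poly_Mapping.lookup g n) n v \<in> gr0 (q + d)" using gr0_fU[OF v, of _ n] by simp
      then show ?case using insert gr0_closed(1) by (simp add: X_add fU_def)
    qed
    then show ?thesis by blast
  qed
  have k: "X (cen k) v \<in> gr0 (q + d)"
  proof (cases "k = 0")
    case False
    then have "d = 0" using x unfolding fgk LAU_gr_def by auto
    then show ?thesis unfolding X_cen using gr0_closed(2)[OF gr0_PP[OF v]] by simp
  qed (simp add: X_cen gr0_closed(4))
  have "x = (\<Sum>n\<in>Poly_Mapping.keys f. am (Poly_Mapping.lookup f n) n) + (\<Sum>n\<in>Poly_Mapping.keys g. um (Poly_Mapping.lookup g n) n) + cen k"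
  proof -
    have "(\<Sum>n\<in>Q. am (Poly_Mapping.lookup f n) n) = ((\<Sum>n\<in>Q. Poly_Mapping.single n (Poly_Mapping.lookup f n)), 0 :: int \<Rightarrow>\<^sub>0 'u, 0)"
      "(\<Sum>n\<in>Q. um (Poly_Mapping.lookup g n) n) = (0 :: int \<Rightarrow>\<^sub>0 'a, (\<Sum>n\<in>Q. Poly_Mapping.single n (Poly_Mapping.lookup g n)), 0)" for Q
      by (induction Q rule: infinite_finite_induct) (simp_all add: am_def um_def zero_prod_def plus_prod_def)
    then show ?thesis unfolding fgk by (simp add: cen_def plus_prod_def flip: pm_eq_sum_single[OF finite_keys subset_refl])
  qed
  then show ?thesis using f g k gr0_closed(1) by (simp add: X_add)
qed

lemma V_gr_words:
  assumes "list_all2 (\<lambda>x d. x \<in> LAU_gr d) xs ds"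
  shows "foldr (V_act D l) xs (V_vac D l) \<in> \<psi> ` gr0 (sum_list ds)"
  using assms
proof (induction rule: list_all2_induct)
  case Nil
  show ?case using gr0_vac by (auto simp flip: psi_vac0)
next
  case (Cons x xs d ds)
  then obtain v where v: "foldr (V_act D l) xs (V_vac D l) = \<psi> v" "v \<in> gr0 (sum_list ds)" by blast
  have "X x v \<in> gr0 (sum_list (d # ds))" using X_degree[OF Cons(1) v(2)] by (simp add: add.commute)
  then show ?case by (simp add: v(1) flip: X_psi)
qed

lemma V_gr_generators: "{foldr (V_act D l) xs (V_vac D l) | xs. \<exists>ds. list_all2 (\<lambda>x d. x \<in> LAU_gr d) xs ds \<and> sum_list ds = q} \<subseteq> \<psi> ` gr0 q"
proof (rule subsetI, unfold mem_Collect_eq, elim exE conjE)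
  fix y xs ds assume h: "y = foldr (V_act D l) xs (V_vac D l)" "list_all2 (\<lambda>x d. x \<in> LAU_gr d) xs ds" "sum_list ds = q"
  show "y \<in> \<psi> ` gr0 q" unfolding h(1) h(3)[symmetric] by (rule V_gr_words[OF h(2)])
qed

lemma V_gr_sub: "V_gr D l q \<subseteq> \<psi> ` gr0 q"
  unfolding V_gr_def by (rule V.vspan_minimal[OF psi_subspace[OF gr0_subspace] V_gr_generators])

lemma V_gr_submodule: "submodule (V_gr D l q) CC (V_mod D l)"
proof -
  have "\<psi> ` gr0 q \<subseteq> carrier (V_mod D l)" unfolding Psi_surj by (rule image_mono) simp
  then show ?thesis unfolding V_gr_def by (intro V.vspan_submodule subset_trans[OF V_gr_generators])
qed

lemma V_gr_act:
  assumes x: "x \<in> LAU_gr d" and v: "\<psi> v \<in> V_gr D l q"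
  shows "\<psi> (X x v) \<in> V_gr D l (q + d)"
proof -
  let ?T = "{v. \<psi> (X x v) \<in> V_gr D l (q + d)}"
  have T: "pm.subspace ?T"
    by (rule pm.subspaceI) (use V.submoduleD[OF V_gr_submodule] in \<open>simp_all add: X_simps Psi_add Psi_scale Psi_zero\<close>)
  have "V_gr D l q \<subseteq> \<psi> ` ?T"
    unfolding V_gr_def[of D l q]
  proof (rule V.vspan_minimal[OF psi_subspace[OF T]], rule subsetI)
    fix y assume "y \<in> {foldr (V_act D l) xs (V_vac D l) |xs. \<exists>ds. list_all2 (\<lambda>x d. x \<in> LAU_gr d) xs ds \<and> sum_list ds = q}"
    then obtain xs ds where xs: "y = foldr (V_act D l) xs (V_vac D l)" "list_all2 (\<lambda>x d. x \<in> LAU_gr d) xs ds" "sum_list ds = q" by blast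
    obtain w where w: "y = \<psi> w" using V_gr_words[OF xs(2)] xs(1) by blast
    have "\<psi> (X x w) = foldr (V_act D l) (x # xs) (V_vac D l)" unfolding X_psi by (simp add: xs(1) flip: w)
    moreover have "list_all2 (\<lambda>x d. x \<in> LAU_gr d) (x # xs) (d # ds)" "sum_list (d # ds) = q + d" using x xs by simp_all
    ultimately have "\<psi> (X x w) \<in> {foldr (V_act D l) xs (V_vac D l) |xs. \<exists>ds. list_all2 (\<lambda>x d. x \<in> LAU_gr d) xs ds \<and> sum_list ds = q + d}"
      unfolding mem_Collect_eq by (intro exI conjI)
    then have "\<psi> (X x w) \<in> V_gr D l (q + d)" unfolding V_gr_def by (rule subsetD[OF V.vspan_superset])
    then show "y \<in> \<psi> ` ?T" using w by blast
  qed
  then obtain w where "\<psi> v = \<psi> w" "\<psi> (X x w) \<in> V_gr D l (q + d)" using v by blast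
  then show ?thesis unfolding X_psi by simp
qed

lemma mode_degree: "am a n \<in> LAU_gr (1 - of_int n)" "um u n \<in> LAU_gr (1/2 - of_int n)"
  by (auto simp: LAU_gr_def am_def um_def split: if_splits)

text \<open>The grading by the degrees of words agrees with the one by eigenvalues of \<open>L(0)\<close>, by comparison of families that are
stable under modes.\<close>

lemma V_gr_family: "mode_stable_family D \<omega> l (\<lambda>q. {v \<in> gr0 q. \<psi> v \<in> V_gr D l q})"
proof
  show "pm.subspace {v \<in> gr0 q. \<psi> v \<in> V_gr D l q}" for q
    using pm.subspace_inter[OF gr0_subspace psi_vimage[OF V_gr_submodule], of q q] by (simp add: Int_def)
  show "v \<in> {v \<in> gr0 q. \<psi> v \<in> V_gr D l q}" if "PP v = 0" for v q
    using gr0_null[OF that] that V.submoduleD(2)[OF V_gr_submodule] by (simp add: PP(3) N0_def)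
  have "foldr (V_act D l) [] (V_vac D l) \<in> V_gr D l 0"
    unfolding V_gr_def by (rule subsetD[OF V.vspan_superset]) (use list_all2_Nil in fastforce)
  then show "vac0 \<in> {v \<in> gr0 0. \<psi> v \<in> V_gr D l 0}" using gr0_vac by (simp add: psi_vac0)
  show "fA a n v \<in> {v \<in> gr0 (q + (1 - of_int n)). \<psi> v \<in> V_gr D l (q + (1 - of_int n))}"
    if "v \<in> {v \<in> gr0 q. \<psi> v \<in> V_gr D l q}" for v q a n
    using that gr0_fA V_gr_act[OF mode_degree(1)] by (simp add: fA_def)
  show "fU u n v \<in> {v \<in> gr0 (q + (1/2 - of_int n)). \<psi> v \<in> V_gr D l (q + (1/2 - of_int n))}"
    if "v \<in> {v \<in> gr0 q. \<psi> v \<in> V_gr D l q}" for v q u n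
    using that gr0_fU V_gr_act[OF mode_degree(2)] by (simp add: fU_def)
qed blast

lemma V_gr_eq: "V_gr D l q = \<psi> ` gr0 q"
  using V_gr_sub[of q] mode_stable_family.equals_gr0[OF V_gr_family, of q] by blast

lemmas V_quotient = universal_quotient[OF V_gr_eq]

lemma V_emb_psi: "V_emb D l (a, u) = \<psi> (fA a (-1) vac0 + fU u (-1) vac0)"
  unfolding V_emb_def mode_split psi_vac0[symmetric] X_psi[symmetric] X_add fA_def fU_def ..

lemma V_emb_pure: "V_emb D l (a, 0) = \<psi> (fA a (-1) vac0)" "V_emb D l (0, u) = \<psi> (fU u (-1) vac0)"
  unfolding V_emb_psi by (simp_all add: f_zero)

text \<open>A vertex superalgebra structure is determined by the operators of generators: the Jacobi identity with \<open>k = 0\<close> expresses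
\<open>Y(x\<^sub>m v)\<close> through the modes of \<open>x\<close> and of \<open>v\<close>.\<close>

lemma vertex_operators_unique:
  assumes VSA: "vertex_superalgebra (V_mod D l) (gr_parity (V_mod D l) (V_gr D l)) Y' (V_vac D l)"
    and gen: "\<And>x n w. w \<in> carrier (V_mod D l) \<Longrightarrow> Y' (V_emb D l x) n w = V_act D l (mode x n) w"
  shows "Y' (\<psi> v) n (\<psi> w) = \<psi> (G.Y v n w)"
proof -
  interpret Y': vertex_superalgebra "V_mod D l" "gr_parity (V_mod D l) (V_gr D l)" Y' "V_vac D l" by (rule VSA)
  note c = Psi_closed
  note smult0 = V.sm_rules(5)
  have "\<forall>n w. Y' (\<psi> v) n (\<psi> w) = \<psi> (G.Y v n w)"
  proof (induction v rule: homogeneous_induct)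
    case (1 v)
    have z: "0 \<odot>\<^bsub>V_mod D l\<^esub> \<psi> v = \<psi> v" using 1 smult0[OF c] by (simp add: PP(3) N0_def)
    have "Y' (\<psi> v) n (\<psi> w) = \<zero>\<^bsub>V_mod D l\<^esub>" for n w
    proof -
      have "Y' (0 \<odot>\<^bsub>V_mod D l\<^esub> \<psi> v) n (\<psi> w) = 0 \<odot>\<^bsub>V_mod D l\<^esub> Y' (\<psi> v) n (\<psi> w)" by (rule Y'.Y_smult_left[OF c c])
      then show ?thesis unfolding z smult0[OF Y'.Y_closed[OF c c]] .
    qed
    then show ?case using 1 by (simp add: G.Y_null Psi_zero)
  next
    case 2
    show ?case by (simp add: psi_vac0 Y'.vac_left[OF c] G.Y_vac_left psi_PP Psi_zero)
  next
    case (3 u v)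
    then show ?case by (simp add: Psi_add Y'.Y_add_left[OF c c c] G.Y_add_left)
  next
    case (4 a v)
    then show ?case by (simp add: Psi_scale Y'.Y_smult_left[OF c c] G.Y_scale_left)
  next
    case (5 p q x k v)
    have xs: "G.Y (x (-1) vac0) = x" by (rule G.Y_generator[OF 5(1)])
    have U: "Y' (\<psi> (x (-1) vac0)) n (\<psi> w) = \<psi> (x n w)" for n w
      using 5(1)
    proof (rule Gen_cases)
      fix a assume "x = fA a"
      then show ?thesis using gen[OF c, of "(a, 0)" n w] by (simp add: V_emb_pure mode_eq fA_def X_psi)
    next
      fix u assume "x = fU u"
      then show ?thesis using gen[OF c, of "(0, u)" n w] by (simp add: V_emb_pure mode_eq fU_def X_psi)
    qed
    have par: "\<psi> (x (-1) vac0) \<in> gr_parity (V_mod D l) (V_gr D l) p" "\<psi> v \<in> gr_parity (V_mod D l) (V_gr D l) q"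
      unfolding vsa_quotient.gr_parity_eq[OF V_quotient] using gen_homogeneous[OF 5(1)] 5(2) by blast+
    show ?case
    proof (intro allI)
      fix n w
      let ?t = "\<lambda>i. pm_scale ((-1) ^ i * (of_int k gchoose i)) (x (k + 0 - int i) (G.Y v (n + int i) w)
         - pm_scale (super_sign p q * (-1) powi k) (G.Y v (k + n - int i) (x (0 + int i) w)))"
      let ?r = "\<lambda>i. pm_scale (of_int 0 gchoose i) (G.Y (x (k + int i) v) (n + 0 - int i) w)"
      have J: "Sum_any ?t = Sum_any ?r"
        using G.Y_jacobi[OF gen_homogeneous[OF 5(1), of "-1"] 5(2), of k 0 n w] unfolding xs .
      also have r: "Sum_any ?r = G.Y (x k v) n w"
        by (subst Sum_any_eq_sum[where N = 1]) (auto simp: gbinomial_0_left)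
      finally have J': "Sum_any ?t = G.Y (x k v) n w" .
      obtain B where B: "\<And>i. i \<ge> B \<Longrightarrow> G.Y v i w = 0" using G.Y_truncation by blast
      obtain B' where B': "\<And>i. i \<ge> B' \<Longrightarrow> x i w = 0" using G.Y_truncation[of "x (-1) vac0" w] unfolding xs by blast
      have t: "?t i = 0" if "i \<ge> nat (max (B - n) B')" for i
      proof -
        have "n + int i \<ge> B" "0 + int i \<ge> B'" using that by linarith+
        moreover have "x j 0 = 0" for j using F.lin_simps(4)[OF G.Y_linear_right[of "x (-1) vac0"]] unfolding xs .
        ultimately show ?thesis by (simp add: B B' F.lin_simps(4)[OF G.Y_linear_right])
      qed
      have "fsum (V_mod D l) (\<lambda>i. \<psi> (?t i)) = \<psi> (Sum_any ?t)" by (rule vsa_quotient.\<alpha>_fsum[OF V_quotient t])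
      then have L: "fsum (V_mod D l) (\<lambda>i. \<psi> (?t i)) = \<psi> (G.Y (x k v) n w)" unfolding J' .
      have R: "fsum (V_mod D l) (\<lambda>i. (of_int 0 gchoose i) \<odot>\<^bsub>V_mod D l\<^esub> Y' (\<psi> (x (k + int i) v)) (n + 0 - int i) (\<psi> w)) = Y' (\<psi> (x k v)) n (\<psi> w)"
        (is "fsum _ ?g = _")
      proof -
        have g: "?g i \<in> carrier (V_mod D l)" for i by (rule V.sm_closed[OF Y'.Y_closed[OF c c]])
        have "fsum (V_mod D l) ?g = finsum (V_mod D l) ?g {..<1}"
          by (rule V.fsum_eq[OF _ g]) (simp add: gbinomial_0_left smult0[OF Y'.Y_closed[OF c c]])
        also have "\<dots> = ?g 0" using g[of 0] by (simp add: lessThan_Suc)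
        also have "\<dots> = Y' (\<psi> (x k v)) n (\<psi> w)" using V.sm_rules Y'.Y_closed[OF c c] by simp
        finally show ?thesis .
      qed
      have IH: "Y' (\<psi> v) n (\<psi> w) = \<psi> (G.Y v n w)" for n w using 5(3) by blast
      (* The left side of the Jacobi identity only involves operators that are known by induction; the right side is the new operator. *)
      have "fsum (V_mod D l) (\<lambda>i. \<psi> (?t i)) = Y' (\<psi> (x k v)) n (\<psi> w)"
        using Y'.jacobi[OF par c[where f = w], where m = k and n = n and k = 0]
        unfolding U IH R vsa_quotient.\<alpha>_minus[OF V_quotient, symmetric] Psi_scale[symmetric] .
      then show "Y' (\<psi> (x k v)) n (\<psi> w) = \<psi> (G.Y (x k v) n w)" unfolding L by (rule sym)
    qed
  qed
  then show ?thesis by blast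
qed

lemma V_Y_eq: "V_Y D l = YV"
  unfolding V_Y_def
proof (rule the_equality)
  have e: "gr_parity (V_mod D l) (V_gr D l) = (\<lambda>p. \<psi> ` Sp p)"
    by (rule ext) (rule vsa_quotient.gr_parity_eq[OF V_quotient])
  have 1: "vertex_superalgebra (V_mod D l) (gr_parity (V_mod D l) (V_gr D l)) YV (V_vac D l)"
    unfolding e psi_vac0[symmetric] by (rule vsa_quotient.vertex_superalgebra_quotient[OF V_quotient])
  have 2: "YV (V_emb D l x) n w = V_act D l (mode x n) w" if w: "w \<in> carrier (V_mod D l)" for x n w
  proof -
    obtain a u where x: "x = (a, u)" by (cases x)
    obtain f where f: "w = \<psi> f" using w unfolding Psi_surj by blast
    have "YV (V_emb D l x) n w = \<psi> (fA a n f + fU u n f)"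
      unfolding x f V_emb_psi YV_psi G.Y_add_left Y_f ..
    then show ?thesis unfolding x f mode_split X_psi[symmetric] X_add fA_def fU_def .
  qed
  have 3: "YV v n w = undefined" if "v \<notin> carrier (V_mod D l) \<or> w \<notin> carrier (V_mod D l)" for v n w
    using that by (auto simp: YV_def)
  show "vertex_superalgebra (V_mod D l) (gr_parity (V_mod D l) (V_gr D l)) YV (V_vac D l) \<and>
    (\<forall>x n. \<forall>w\<in>carrier (V_mod D l). YV (V_emb D l x) n w = V_act D l (mode x n) w) \<and>
    (\<forall>v n w. v \<notin> carrier (V_mod D l) \<or> w \<notin> carrier (V_mod D l) \<longrightarrow> YV v n w = undefined)"
    using 1 2 3 by blast
  fix Y' assume Y': "vertex_superalgebra (V_mod D l) (gr_parity (V_mod D l) (V_gr D l)) Y' (V_vac D l) \<and>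
    (\<forall>x n. \<forall>w\<in>carrier (V_mod D l). Y' (V_emb D l x) n w = V_act D l (mode x n) w) \<and>
    (\<forall>v n w. v \<notin> carrier (V_mod D l) \<or> w \<notin> carrier (V_mod D l) \<longrightarrow> Y' v n w = undefined)"
  have u: "Y' (\<psi> f) n (\<psi> g) = YV (\<psi> f) n (\<psi> g)" for f n g
    unfolding YV_psi by (rule vertex_operators_unique) (use Y' in blast)+
  have "Y' v n w = YV v n w" for v n w
  proof (cases "v \<in> carrier (V_mod D l) \<and> w \<in> carrier (V_mod D l)")
    case True
    then obtain f g where "v = \<psi> f" "w = \<psi> g" unfolding Psi_surj by blast
    then show ?thesis using u by simp
  next
    case False
    then show ?thesis using Y' 3 by simp
  qed
  then show "Y' = YV" by blast
qed

section \<open>The simple quotient\<close>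

lemma V_max_ideal_eq: "V_max_ideal D l = \<psi> ` J0"
proof -
  have "N0 \<subseteq> J0" using N0_J0 by blast
  then show ?thesis
    unfolding V_max_ideal_def V_Y_eq vsa_quotient.maximal_ideal_unique[OF V_quotient \<open>N0 \<subseteq> J0\<close>] by simp
qed

lemma J_submodule: "submodule (V_max_ideal D l) CC (V_mod D l)"
  unfolding V_max_ideal_eq by (rule psi_subspace[OF J0_subspace])

lemma psi_J: "\<psi> v \<in> V_max_ideal D l \<longleftrightarrow> v \<in> J0"
proof
  assume "\<psi> v \<in> V_max_ideal D l"
  then obtain j where j: "\<psi> v = \<psi> j" "j \<in> J0" unfolding V_max_ideal_eq by blast
  have "v - j \<in> J0" using j(1) N0_J0 unfolding psi_diff by blast
  then have "(v - j) + j \<in> J0" using j(2) by (rule pm.subspace_add[OF J0_subspace])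
  then show "v \<in> J0" by simp
qed (simp add: V_max_ideal_eq)

text \<open>The covering of the simple quotient by the free algebra.\<close>

definition \<pi> :: "('a, 'u) T_alg \<Rightarrow> ('a, 'u) V_elem set" where "\<pi> v = L_proj D l (\<psi> v)"

lemma pi_eq: "\<pi> v = \<pi> w \<longleftrightarrow> v - w \<in> J0"
  unfolding \<pi>_def L_proj_def V.cos_eq[OF J_submodule Psi_closed Psi_closed]
    vsa_quotient.\<alpha>_minus[OF V_quotient, symmetric] psi_J ..

text \<open>The union over representatives in the definition of the induced operators is a union of equal cosets, because the
radical is an ideal on both sides.\<close>

lemma L_Y_pi: "L_Y D l (\<pi> v) n (\<pi> w) = \<pi> (G.Y v n w)"
proof -
  have m: "x \<in> \<pi> v \<longleftrightarrow> (\<exists>v'. x = \<psi> v' \<and> v' - v \<in> J0)" for x v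
  proof -
    have "x \<in> \<pi> v \<longleftrightarrow> x \<in> carrier (V_mod D l) \<and> x \<ominus>\<^bsub>V_mod D l\<^esub> \<psi> v \<in> V_max_ideal D l"
      unfolding \<pi>_def L_proj_def by (rule V.cos_mem[OF J_submodule Psi_closed])
    also have "\<dots> \<longleftrightarrow> (\<exists>v'. x = \<psi> v' \<and> \<psi> (v' - v) \<in> V_max_ideal D l)"
      unfolding Psi_surj vsa_quotient.\<alpha>_minus[OF V_quotient] by blast
    finally show ?thesis unfolding psi_J .
  qed
  have eq: "L_proj D l (V_Y D l x n y) = \<pi> (G.Y v n w)" if "x \<in> \<pi> v" "y \<in> \<pi> w" for x y
  proof -
    obtain v' where v': "x = \<psi> v'" "v' - v \<in> J0" using \<open>x \<in> \<pi> v\<close> unfolding m by blast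
    obtain w' where w': "y = \<psi> w'" "w' - w \<in> J0" using \<open>y \<in> \<pi> w\<close> unfolding m by blast
    have "G.Y v' n w' = G.Y (v' - v) n w' + (G.Y v n (w' - w) + G.Y v n w)"
      by (simp flip: G.Y_add_left F.lin_simps(1)[OF G.Y_linear_right])
    then have "G.Y v' n w' - G.Y v n w = G.Y (v' - v) n w' + G.Y v n (w' - w)" by simp
    also have "\<dots> \<in> J0"
      by (intro pm.subspace_add[OF J0_subspace] mode_submodule_Y_right[OF J0_mode_submodule] mode_submodule_Y_left[OF J0_mode_submodule] v' w')
    finally have "\<pi> (G.Y v' n w') = \<pi> (G.Y v n w)" unfolding pi_eq .
    then show ?thesis unfolding v' w' V_Y_eq YV_psi \<pi>_def .
  qed
  have ne: "\<psi> v \<in> \<pi> v" for v unfolding m using pm.subspace_0[OF J0_subspace] by (intro exI[of _ v]) simp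
  have "(\<Union>y\<in>\<pi> w. L_proj D l (V_Y D l x n y)) = \<pi> (G.Y v n w)" if "x \<in> \<pi> v" for x
    using eq[OF that] ne[of w] by blast
  then show ?thesis unfolding L_Y_def using ne[of v] by blast
qed

lemma L_quotient: "vsa_quotient D \<omega> l (L_mod D l) \<pi> J0 (L_Y D l) (L_gr D l)"
proof -
  interpret L: cspace "L_mod D l"
    unfolding L_mod_def by (rule cspaceI[OF V.quot_module[OF J_submodule]])
  show ?thesis
  proof unfold_locales
    show "\<pi> (f + g) = \<pi> f \<oplus>\<^bsub>L_mod D l\<^esub> \<pi> g" for f g
      unfolding \<pi>_def L_proj_def L_mod_def Psi_add V.quot_add[OF J_submodule Psi_closed Psi_closed] ..
    show "\<pi> (pm_scale c f) = c \<odot>\<^bsub>L_mod D l\<^esub> \<pi> f" for c f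
      unfolding \<pi>_def L_proj_def L_mod_def Psi_scale V.quot_smult[OF J_submodule Psi_closed] ..
    show "carrier (L_mod D l) = range \<pi>"
      unfolding \<pi>_def L_proj_def L_mod_def V.quot_carrier[OF J_submodule] Psi_surj by blast
    show "(\<pi> v = \<zero>\<^bsub>L_mod D l\<^esub>) = (v \<in> J0)" for v
    proof -
      have "\<zero>\<^bsub>L_mod D l\<^esub> = \<pi> 0"
        unfolding \<pi>_def L_proj_def L_mod_def Psi_zero V.quot_zero[OF J_submodule] ..
      then show ?thesis using pi_eq[of v 0] by simp
    qed
    show "mode_submodule J0" by (rule J0_mode_submodule)
    show "L_Y D l (\<pi> v) n (\<pi> w) = \<pi> (G.Y v n w)" for v n w by (rule L_Y_pi)
    show "L_gr D l q = \<pi> ` gr0 q" for q unfolding L_gr_def V_gr_eq \<pi>_def by blast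
  qed
qed

lemma L_vac_eq: "L_vac D l = \<pi> vac0"
  unfolding L_vac_def \<pi>_def psi_vac0 ..

end

theorem theorem5p7:
  fixes D :: "('a::comm_ring, 'u::ab_group_add) pair_data"
    and \<omega> :: 'a and l :: complex
  assumes "compatible_pair D \<omega>"
    and "formA D \<omega> \<omega> = 1/2"
    and "l \<noteq> 0"
    and "nondegenerate (formA D)"
    and "nondegenerate (formU D)"
  shows "conformal_vertex_superalgebra (L_mod D l) (L_gr D l) (L_Y D l) (L_vac D l) (L_emb D l (\<omega>, 0))
    \<and> va_simple (L_mod D l) (L_Y D l)
    \<and> linear_iso_onto (scA D) (L_mod D l) (L_gr D l 2) (\<lambda>a. L_emb D l (a, 0))
    \<and> linear_iso_onto (scU D) (L_mod D l) (L_gr D l (3/2)) (\<lambda>u. L_emb D l (0, u))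
    \<and> strongly_generated (L_mod D l) (L_Y D l) (L_vac D l) (range (L_emb D l))
    \<and> (fin_dim_type (scA D) \<and> fin_dim_type (scU D) \<longrightarrow>
        vertex_operator_superalgebra (L_mod D l) (L_gr D l) (L_Y D l) (L_vac D l) (L_emb D l (\<omega>, 0)))"
proof -
  interpret pair_level D \<omega> l by (rule pair_level.intro[OF assms(1)])
  interpret L: vsa_quotient D \<omega> l "L_mod D l" \<pi> J0 "L_Y D l" "L_gr D l" by (rule L_quotient)
  have e: "L_emb D l = L.emb"
  proof
    fix x :: "'a \<times> 'u"
    obtain a u where "x = (a, u)" by (cases x)
    then show "L_emb D l x = L.emb x" by (simp add: L_emb_def V_emb_psi L.emb_def \<pi>_def)
  qed
  have o: "L.omegaM = L.emb (\<omega>, 0)" unfolding L.emb_simps L.omegaM_def ..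
  show ?thesis
    unfolding e L_vac_eq o[symmetric]
    using L.conformal_quotient L.simple_quotient[OF refl] L.degree_two_iso[OF assms(3,4) subset_refl]
      L.degree_three_halves_iso[OF assms(3,5) subset_refl] L.strongly_generated_quotient L.finite_quotient
    by blast
qed

end
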